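(* Let $f$ and $g$ be distributions on $\mathbb{R}^n$, let $\alpha_f,\alpha_g\in\mathbb{R}$ with $\alpha_f+\alpha_g\ge 0$, let $1\le p,q,r\le\infty$ satisfy $$\frac1p+\frac1q=\frac1r+1,$$ and let $\mathbf{x}_0\in\mathbb{R}^n$, $\xi_0\in\mathbb{R}^n\setminus\{0\}$. Then: 1. If $f\in H^{\alpha_f,p}(\mathbb{R}^n)$ and $g\in H^{\alpha_g,q}(\mathbb{R}^n)$, then $fg$ is a well defined element of $H^{\min\{\alpha_f,\alpha_g\},r}(\mathbb{R}^n)$. 2. If $\xi_0\notin \mathrm{WF}_{\mathbf{x}_0}(f)\cup \mathrm{WF}_{\mathbf{x}_0}(g)$, and $f\in H^{\alpha_f,p}$ and $g\in H^{\alpha_g,q}$ locally near $\mathbf{x}_0$, then $fg\in H^{\alpha_f+\alpha_g+\min\{\alpha_f,\alpha_g,0\},r}$ microlocally near $(\mathbf{x}_0,\xi_0)$. 3. If $\xi_0\notin \mathrm{WF}_{\mathbf{x}_0}(f)$, $\alpha_g\ge 0$, and $f\in H^{\alpha_f,p}$ and $g\in H^{\alpha_g,q}$ locally near $\mathbf{x}_0$, then $fg\in H^{\alpha_g+\min\{0,\alpha_f\},r}$ microlocally near $(\mathbf{x}_0,\xi_0)$.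
   Context: Fourier transform: $\hat f(\xi)=\mathcal{F}f(\xi)=\int e^{-i\mathbf{x}\cdot\xi}f(\mathbf{x})\,d\mathbf{x}$. For $\alpha\in\mathbb{R}$, $1\le p\le\infty$, $H^{\alpha,p}(\mathbb{R}^n)$ is the space of tempered distributions $f$ whose Fourier transform is a measurable function with $\|f\|_{H^{\alpha,p}(\mathbb{R}^n)}=\|(1+|\xi|^2)^{\alpha/2}\hat f\|_{L^p(\mathbb{R}^n)}<\infty$. A distribution $g$ is in $H^{\alpha,p}$ locally near $\mathbf{x}_0$ if there is $\eta\in C_c^\infty(\mathbb{R}^n)$ with $\eta(\mathbf{x}_0)\ne0$ and $\eta g\in H^{\alpha,p}(\mathbb{R}^n)$. It is in $H^{\alpha,p}$ microlocally near $(\mathbf{x}_0,\xi_0)$ if there are $\eta\in C_c^\infty(\mathbb{R}^n)$ with $\eta(\mathbf{x}_0)\ne 0$ and a function $u$, smooth on $\mathbb{R}^n\setminus\{0\}$ and homogeneous of degree zero, with $u(\xi_0)\neq0$, such that $(1+|\xi|^2)^{\alpha/2}u(\xi)\mathcal{F}(\eta g)(\xi)\in L^p(\mathbb{R}^n)$. $\mathrm{WF}_{\mathbf{x}_0}(f)=\{\xi:(\mathbf{x}_0,\xi)\in\mathrm{WF}(f)\}$, with $\mathrm{WF}$ the $C^\infty$ wavefront set. The product $fg$ is the extension of the pointwise product of test functions determined by $\widehat{fg}=(2\pi)^{-n}\hat f*\hat g$ (in parts 2 and 3, near $\mathbf{x}_0$, applied after multiplying $f$ and $g$ by cutoff functions).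 *)

theory Defs
  imports "HOL-Analysis.Analysis" "HOL-Probability.Essential_Supremum"
begin

subsection \<open>Test functions and Schwartz functions\<close>

text \<open>Iterated partial derivatives; a list of basis vectors of length \<open>k\<close> plays the role of a
  multi-index of order \<open>k\<close>.\<close>

fun pderivs :: "'a::euclidean_space list \<Rightarrow> ('a \<Rightarrow> complex) \<Rightarrow> 'a \<Rightarrow> complex" where
  "pderivs [] f = f"
| "pderivs (b # bs) f = (\<lambda>x. frechet_derivative (pderivs bs f) (at x) b)"

definition multi_indices :: "nat \<Rightarrow> 'a::euclidean_space list set" where
  "multi_indices N = {bs. set bs \<subseteq> Basis \<and> length bs \<le> N}"

text \<open>\<open>C\<^sup>\<infinity>\<close> on an open set \<open>S\<close>: all iterated partial derivatives exist and are differentiable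
  (hence continuous) on \<open>S\<close>.\<close>

definition smooth_fun_on :: "'a::euclidean_space set \<Rightarrow> ('a \<Rightarrow> complex) \<Rightarrow> bool" where
  "smooth_fun_on S f \<longleftrightarrow>
     (\<forall>bs. set bs \<subseteq> Basis \<longrightarrow> (\<forall>x\<in>S. pderivs bs f differentiable (at x)))"

definition supp :: "('a::euclidean_space \<Rightarrow> complex) \<Rightarrow> 'a set" where
  "supp \<phi> = closure {x. \<phi> x \<noteq> 0}"

definition test_fun :: "('a::euclidean_space \<Rightarrow> complex) \<Rightarrow> bool" where
  "test_fun \<phi> \<longleftrightarrow> smooth_fun_on UNIV \<phi> \<and> compact (supp \<phi>)"

definition schwartz_fun :: "('a::euclidean_space \<Rightarrow> complex) \<Rightarrow> bool" where
  "schwartz_fun \<phi> \<longleftrightarrow> smooth_fun_on UNIV \<phi> \<and>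
     (\<forall>k bs. set bs \<subseteq> Basis \<longrightarrow> bounded (range (\<lambda>x. (1 + norm x) ^ k * cmod (pderivs bs \<phi> x))))"

subsection \<open>Distributions and tempered distributions\<close>

text \<open>Distributions are represented by functionals on all functions; only the values on test
  functions (for tempered distributions: on Schwartz functions) are meaningful, so equality of
  distributions is agreement on test functions.\<close>

definition linear_functional_on ::
    "('a \<Rightarrow> complex) set \<Rightarrow> (('a \<Rightarrow> complex) \<Rightarrow> complex) \<Rightarrow> bool" where
  "linear_functional_on V u \<longleftrightarrow>
     (\<forall>\<phi>\<in>V. \<forall>\<psi>\<in>V. \<forall>a b. u (\<lambda>x. a * \<phi> x + b * \<psi> x) = a * u \<phi> + b * u \<psi>)"

definition distribution :: "(('a::euclidean_space \<Rightarrow> complex) \<Rightarrow> complex) \<Rightarrow> bool" where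
  "distribution u \<longleftrightarrow> linear_functional_on {\<phi>. test_fun \<phi>} u \<and>
     (\<forall>K. compact K \<longrightarrow> (\<exists>C N. \<forall>\<phi>. test_fun \<phi> \<and> supp \<phi> \<subseteq> K \<longrightarrow>
        cmod (u \<phi>) \<le> C * (\<Sum>bs\<in>multi_indices N. SUP x. cmod (pderivs bs \<phi> x))))"

definition tempered_distribution :: "(('a::euclidean_space \<Rightarrow> complex) \<Rightarrow> complex) \<Rightarrow> bool" where
  "tempered_distribution u \<longleftrightarrow> linear_functional_on {\<phi>. schwartz_fun \<phi>} u \<and>
     (\<exists>C N. \<forall>\<phi>. schwartz_fun \<phi> \<longrightarrow>
        cmod (u \<phi>) \<le> C * (\<Sum>bs\<in>multi_indices N. SUP x. (1 + norm x) ^ N * cmod (pderivs bs \<phi> x)))"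

definition distr_eq ::
    "(('a::euclidean_space \<Rightarrow> complex) \<Rightarrow> complex) \<Rightarrow> (('a \<Rightarrow> complex) \<Rightarrow> complex) \<Rightarrow> bool" where
  "distr_eq u v \<longleftrightarrow> (\<forall>\<phi>. test_fun \<phi> \<longrightarrow> u \<phi> = v \<phi>)"

definition distr_eq_near ::
    "'a::euclidean_space \<Rightarrow> (('a \<Rightarrow> complex) \<Rightarrow> complex) \<Rightarrow> (('a \<Rightarrow> complex) \<Rightarrow> complex) \<Rightarrow> bool" where
  "distr_eq_near x u v \<longleftrightarrow>
     (\<exists>U. open U \<and> x \<in> U \<and> (\<forall>\<phi>. test_fun \<phi> \<and> supp \<phi> \<subseteq> U \<longrightarrow> u \<phi> = v \<phi>))"

definition mult_distr ::
    "('a \<Rightarrow> complex) \<Rightarrow> (('a \<Rightarrow> complex) \<Rightarrow> complex) \<Rightarrow> (('a \<Rightarrow> complex) \<Rightarrow> complex)" where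
  "mult_distr \<eta> u = (\<lambda>\<phi>. u (\<lambda>x. \<eta> x * \<phi> x))"

text \<open>The distribution \<open>u\<close> is given by the locally integrable function \<open>F\<close>.\<close>

definition distr_is_fun ::
    "(('a::euclidean_space \<Rightarrow> complex) \<Rightarrow> complex) \<Rightarrow> ('a \<Rightarrow> complex) \<Rightarrow> bool" where
  "distr_is_fun u F \<longleftrightarrow> F \<in> borel_measurable lborel \<and>
     (\<forall>K. compact K \<longrightarrow> set_integrable lborel K F) \<and>
     (\<forall>\<phi>. test_fun \<phi> \<longrightarrow> u \<phi> = (\<integral>x. F x * \<phi> x \<partial>lborel))"

subsection \<open>Fourier transform and the spaces \<open>H\<^sup>\<alpha>\<^sup>,\<^sup>p\<close>\<close>

definition fourier :: "('a::euclidean_space \<Rightarrow> complex) \<Rightarrow> 'a \<Rightarrow> complex" where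
  "fourier f \<xi> = (\<integral>x. exp (- \<i> * complex_of_real (x \<bullet> \<xi>)) * f x \<partial>lborel)"

definition fourier_distr ::
    "(('a::euclidean_space \<Rightarrow> complex) \<Rightarrow> complex) \<Rightarrow> (('a \<Rightarrow> complex) \<Rightarrow> complex)" where
  "fourier_distr T = (\<lambda>\<phi>. T (fourier \<phi>))"

text \<open>The distribution \<open>f\<close> is tempered, i.e. it extends to a (necessarily unique) tempered
  distribution \<open>T\<close>, and its Fourier transform is the function \<open>F\<close>, which is thus determined up to
  null sets.\<close>

definition has_fourier_fun ::
    "(('a::euclidean_space \<Rightarrow> complex) \<Rightarrow> complex) \<Rightarrow> ('a \<Rightarrow> complex) \<Rightarrow> bool" where
  "has_fourier_fun f F \<longleftrightarrow>
     (\<exists>T. tempered_distribution T \<and> distr_eq f T \<and> distr_is_fun (fourier_distr T) F)"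

definition in_Lp :: "ennreal \<Rightarrow> ('a::euclidean_space \<Rightarrow> complex) \<Rightarrow> bool" where
  "in_Lp p F \<longleftrightarrow> F \<in> borel_measurable lborel \<and>
     (if p = \<infinity> then esssup lborel (\<lambda>x. ennreal (cmod (F x))) < \<infinity>
      else (\<integral>\<^sup>+x. ennreal (cmod (F x) powr enn2real p) \<partial>lborel) < \<infinity>)"

definition weight :: "real \<Rightarrow> 'a::euclidean_space \<Rightarrow> complex" where
  "weight \<alpha> \<xi> = complex_of_real ((1 + (norm \<xi>)\<^sup>2) powr (\<alpha> / 2))"

definition in_H :: "real \<Rightarrow> ennreal \<Rightarrow> (('a::euclidean_space \<Rightarrow> complex) \<Rightarrow> complex) \<Rightarrow> bool" where
  "in_H \<alpha> p f \<longleftrightarrow> (\<exists>F. has_fourier_fun f F \<and> in_Lp p (\<lambda>\<xi>. weight \<alpha> \<xi> * F \<xi>))"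

definition locally_in_H ::
    "real \<Rightarrow> ennreal \<Rightarrow> 'a::euclidean_space \<Rightarrow> (('a \<Rightarrow> complex) \<Rightarrow> complex) \<Rightarrow> bool" where
  "locally_in_H \<alpha> p x\<^sub>0 g \<longleftrightarrow>
     (\<exists>\<eta>. test_fun \<eta> \<and> \<eta> x\<^sub>0 \<noteq> 0 \<and> in_H \<alpha> p (mult_distr \<eta> g))"

definition microlocally_in_H ::
    "real \<Rightarrow> ennreal \<Rightarrow> 'a::euclidean_space \<Rightarrow> 'a \<Rightarrow> (('a \<Rightarrow> complex) \<Rightarrow> complex) \<Rightarrow> bool" where
  "microlocally_in_H \<alpha> p x\<^sub>0 \<xi>\<^sub>0 g \<longleftrightarrow>
     (\<exists>\<eta> u F. test_fun \<eta> \<and> \<eta> x\<^sub>0 \<noteq> 0 \<and>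
        smooth_fun_on (- {0}) u \<and> (\<forall>\<xi> t. \<xi> \<noteq> 0 \<and> t > 0 \<longrightarrow> u (t *\<^sub>R \<xi>) = u \<xi>) \<and> u \<xi>\<^sub>0 \<noteq> 0 \<and>
        has_fourier_fun (mult_distr \<eta> g) F \<and> in_Lp p (\<lambda>\<xi>. weight \<alpha> \<xi> * u \<xi> * F \<xi>))"

subsection \<open>The wavefront set\<close>

text \<open>The Fourier transform of the compactly supported distribution \<open>\<eta>f\<close> is a smooth function; as \<open>\<Gamma>\<close>
  is open, bounds on \<open>\<Gamma>\<close> for any representative \<open>F\<close> also hold for this smooth one.\<close>

definition WF :: "(('a::euclidean_space \<Rightarrow> complex) \<Rightarrow> complex) \<Rightarrow> ('a \<times> 'a) set" where
  "WF f = {(x, \<xi>). \<xi> \<noteq> 0 \<and>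
     \<not> (\<exists>\<eta> F \<Gamma>. test_fun \<eta> \<and> \<eta> x \<noteq> 0 \<and> has_fourier_fun (mult_distr \<eta> f) F \<and>
          open \<Gamma> \<and> \<xi> \<in> \<Gamma> \<and> (\<forall>\<zeta>\<in>\<Gamma>. \<forall>t>0. t *\<^sub>R \<zeta> \<in> \<Gamma>) \<and>
          (\<forall>N::nat. \<exists>C. \<forall>\<zeta>\<in>\<Gamma>. cmod (F \<zeta>) \<le> C / (1 + norm \<zeta>) ^ N))}"

definition WF_at :: "'a::euclidean_space \<Rightarrow> (('a \<Rightarrow> complex) \<Rightarrow> complex) \<Rightarrow> 'a set" where
  "WF_at x\<^sub>0 f = {\<xi>. (x\<^sub>0, \<xi>) \<in> WF f}"

subsection \<open>Products of distributions\<close>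

text \<open>\<open>h\<close> is the product of \<open>f\<close> and \<open>g\<close>: the convolution integral of the Fourier transforms
  converges absolutely almost everywhere, and \<open>(2\<pi>)\<^sup>-\<^sup>n\<close> times it is the Fourier transform of \<open>h\<close>.\<close>

definition is_product ::
    "(('a::euclidean_space \<Rightarrow> complex) \<Rightarrow> complex) \<Rightarrow> (('a \<Rightarrow> complex) \<Rightarrow> complex) \<Rightarrow>
     (('a \<Rightarrow> complex) \<Rightarrow> complex) \<Rightarrow> bool" where
  "is_product f g h \<longleftrightarrow> distribution h \<and>
     (\<exists>F G. has_fourier_fun f F \<and> has_fourier_fun g G \<and>
        (AE \<xi> in lborel. integrable lborel (\<lambda>\<zeta>. F (\<xi> - \<zeta>) * G \<zeta>)) \<and>
        has_fourier_fun h (\<lambda>\<xi>. complex_of_real (1 / (2 * pi) ^ DIM('a)) *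
                                 (\<integral>\<zeta>. F (\<xi> - \<zeta>) * G \<zeta> \<partial>lborel)))"

definition cutoff_near :: "'a::euclidean_space \<Rightarrow> ('a \<Rightarrow> complex) \<Rightarrow> bool" where
  "cutoff_near x\<^sub>0 \<theta> \<longleftrightarrow> test_fun \<theta> \<and> (\<forall>\<^sub>F x in nhds x\<^sub>0. \<theta> x = 1)"

text \<open>\<open>h\<close> is the product of \<open>f\<close> and \<open>g\<close> near \<open>x\<^sub>0\<close>, where \<open>f\<close> is locally in \<open>H\<^sup>\<alpha>\<^sup>,\<^sup>p\<close> and \<open>g\<close> locally
  in \<open>H\<^sup>\<beta>\<^sup>,\<^sup>q\<close>: there are cutoffs \<open>\<theta>\<close>, \<open>\<psi>\<close> that equal \<open>1\<close> near \<open>x\<^sub>0\<close> and bring \<open>f\<close> and \<open>g\<close> into these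
  spaces, and for any such choice the product of \<open>\<theta>f\<close> and \<open>\<psi>g\<close> exists and is \<open>h\<close> near \<open>x\<^sub>0\<close>.\<close>

definition is_product_near ::
    "real \<Rightarrow> ennreal \<Rightarrow> real \<Rightarrow> ennreal \<Rightarrow> 'a::euclidean_space \<Rightarrow>
     (('a \<Rightarrow> complex) \<Rightarrow> complex) \<Rightarrow> (('a \<Rightarrow> complex) \<Rightarrow> complex) \<Rightarrow>
     (('a \<Rightarrow> complex) \<Rightarrow> complex) \<Rightarrow> bool" where
  "is_product_near \<alpha> p \<beta> q x\<^sub>0 f g h \<longleftrightarrow> distribution h \<and>
     (\<exists>\<theta> \<psi>. cutoff_near x\<^sub>0 \<theta> \<and> cutoff_near x\<^sub>0 \<psi> \<and>
        in_H \<alpha> p (mult_distr \<theta> f) \<and> in_H \<beta> q (mult_distr \<psi> g)) \<and>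
     (\<forall>\<theta> \<psi>. cutoff_near x\<^sub>0 \<theta> \<and> cutoff_near x\<^sub>0 \<psi> \<and>
        in_H \<alpha> p (mult_distr \<theta> f) \<and> in_H \<beta> q (mult_distr \<psi> g) \<longrightarrow>
        (\<exists>k. is_product (mult_distr \<theta> f) (mult_distr \<psi> g) k \<and> distr_eq_near x\<^sub>0 h k))"

end

theory Submission
  imports Defs "HOL-Probability.Characteristic_Functions" "HOL-Probability.Sinc_Integral"
begin

text \<open>On the Fourier side the product is the convolution of \<open>F\<close> and \<open>G\<close>. Everything reduces to
  pointwise bounds of the weight at \<open>\<xi>\<close> by the product of the weights at \<open>\<xi> - \<zeta>\<close> and \<open>\<zeta>\<close>, after
  which Young's inequality gives the \<open>L\<^sup>r\<close> estimate. For the first part the bound is Peetre's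
  inequality. For the microlocal parts, let \<open>\<xi>\<close> lie in a cone strictly inside one where the localized
  transforms decay rapidly: if \<open>\<xi> - \<zeta>\<close> or \<open>\<zeta>\<close> lies in the larger cone, rapid decay absorbs all
  weights, and otherwise \<open>\<xi>\<close> is dominated by both, which are then of comparable size.

  Multiplication by a test function \<open>\<eta>\<close> is convolution with its rapidly decreasing Fourier transform.
  It preserves the spaces, shrinks cones of rapid decay, and can be moved onto either factor of a
  product, which makes the product local. Rapid decay survives localization because the transform of
  a compactly supported distribution has polynomial growth; this follows by duality from
  \<open>\<bar>f (\<eta> fourier \<phi>)\<bar> \<le> C \<integral> (1 + \<bar>\<xi>\<bar>)\<^sup>N \<bar>\<phi> \<xi>\<bar> d\<xi>\<close>, where \<open>fourier \<phi>\<close> is the Fourier transform of \<open>\<phi>\<close>.\<close>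

section \<open>Smooth functions\<close>

text \<open>A Fourier transform is only determined almost everywhere, while the wavefront condition
  bounds one representative of one localization pointwise, and local membership may come with
  another cutoff. Both are brought to a common localization: a small cutoff preserves membership and
  decay, and the two resulting representatives, equal almost everywhere, are spliced along a cone.
  Only membership is claimed, never a norm estimate, so constants may be crude; this is why Young's
  inequality can rest on a single pointwise inequality. If both wavefront conditions hold, the case
  analysis in frequency gives the exponent \<open>\<alpha>\<^sub>f + \<alpha>\<^sub>g\<close>, and
  the exponent claimed is at most this. If only \<open>f\<close> is controlled, then off its cone
  \<open>\<zeta>\<close> dominates \<open>\<xi> - \<zeta>\<close> but not conversely: a positive
  \<open>\<alpha>\<^sub>f\<close> gains nothing in this argument, and a negative one is paid in
  full. This is the term \<open>min 0 \<alpha>\<^sub>f\<close>.\<close>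

lemma frechet_derivative_cong_open:
  assumes "open S" "x \<in> S" "\<And>y. y \<in> S \<Longrightarrow> f y = g y"
  shows "frechet_derivative f (at x) = frechet_derivative g (at x)"
proof -
  have "(f has_derivative D) (at x) \<longleftrightarrow> (g has_derivative D) (at x)" for D
    using has_derivative_transform_within_open[of f D x UNIV S g]
      has_derivative_transform_within_open[of g D x UNIV S f] assms by auto
  thus ?thesis unfolding frechet_derivative_def by presburger
qed

lemma differentiable_cong_open:
  assumes "open S" "x \<in> S" "\<And>y. y \<in> S \<Longrightarrow> f y = g y" "f differentiable (at x)"
  shows "g differentiable (at x)"
  using assms has_derivative_transform_within_open[of f _ x UNIV S g]
  unfolding differentiable_def by blast

lemma pderivs_append: "pderivs (as @ bs) f = pderivs as (pderivs bs f)"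
  by (induction as) auto

lemma pderivs_cong_open:
  assumes "open S" "\<And>y. y \<in> S \<Longrightarrow> f y = g y" "x \<in> S"
  shows "pderivs bs f x = pderivs bs g x"
  using assms(3)
proof (induction bs arbitrary: x)
  case (Cons b bs)
  show ?case using frechet_derivative_cong_open[OF assms(1) Cons.prems Cons.IH] by simp
qed (use assms in auto)

lemma smooth_cong_open:
  assumes "open S" "\<And>y. y \<in> S \<Longrightarrow> f y = g y" "smooth_fun_on S f"
  shows "smooth_fun_on S g"
  unfolding smooth_fun_on_def
proof (intro allI impI ballI)
  fix bs :: "'a list" and x assume "set bs \<subseteq> Basis" "x \<in> S"
  hence "pderivs bs f differentiable (at x)" using assms(3) by (auto simp: smooth_fun_on_def)
  thus "pderivs bs g differentiable (at x)"
    by (rule differentiable_cong_open[OF assms(1) \<open>x \<in> S\<close>, rotated])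
       (use pderivs_cong_open[OF assms(1,2)] in auto)
qed

lemma smooth_local:
  assumes "\<And>x. x \<in> S \<Longrightarrow> \<exists>U. open U \<and> x \<in> U \<and> smooth_fun_on U f"
  shows "smooth_fun_on S f"
  using assms unfolding smooth_fun_on_def by blast

text \<open>Iterated derivatives at points of an open set depend only on values there, so by
  induction every \<open>pderivs bs f\<close> agrees on \<open>S\<close> with a member of
  \<open>P\<close>. Asking for the partial derivatives only up to their values on \<open>S\<close>
  leaves the members of \<open>P\<close> arbitrary outside \<open>S\<close>.\<close>

lemma smooth_coinduct:
  assumes "open S" "P f"
    and step: "\<And>f. P f \<Longrightarrow> \<exists>D. (\<forall>x\<in>S. (f has_derivative D x) (at x)) \<and>
                  (\<forall>b\<in>Basis. \<exists>g. P g \<and> (\<forall>x\<in>S. D x b = g x))"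
  shows "smooth_fun_on S f"
proof -
  have *: "\<exists>g. P g \<and> (\<forall>x\<in>S. pderivs bs f x = g x)" if "set bs \<subseteq> Basis" for bs
    using that
  proof (induction bs)
    case Nil thus ?case using assms(2) by auto
  next
    case (Cons b bs)
    then obtain g where g: "P g" "\<forall>x\<in>S. pderivs bs f x = g x" by auto
    from step[OF g(1)] Cons.prems obtain D h where
      D: "\<forall>x\<in>S. (g has_derivative D x) (at x)" and h: "P h" "\<forall>x\<in>S. D x b = h x" by auto
    have "pderivs (b # bs) f x = h x" if "x \<in> S" for x
      using frechet_derivative_cong_open[OF assms(1) that, of "pderivs bs f" g] g(2)
        frechet_derivative_at[of g "D x" x] D h that by auto
    thus ?case using h(1) by blast
  qed
  show ?thesis unfolding smooth_fun_on_def
  proof (intro allI impI ballI)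
    fix bs :: "'a list" and x assume bs: "set bs \<subseteq> Basis" "x \<in> S"
    obtain g where g: "P g" "\<forall>x\<in>S. pderivs bs f x = g x" using *[OF bs(1)] by auto
    have "g differentiable (at x)" using step[OF g(1)] bs(2) by (auto simp: differentiable_def)
    thus "pderivs bs f differentiable (at x)"
      by (rule differentiable_cong_open[OF assms(1) bs(2), rotated]) (use g in auto)
  qed
qed

lemma smooth_has_derivative:
  "smooth_fun_on S f \<Longrightarrow> x \<in> S \<Longrightarrow> (f has_derivative frechet_derivative f (at x)) (at x)"
  unfolding smooth_fun_on_def using frechet_derivative_works
  by (metis empty_set empty_subsetI pderivs.simps(1))

lemma smooth_pderivs:
  "smooth_fun_on S f \<Longrightarrow> set bs \<subseteq> Basis \<Longrightarrow> smooth_fun_on S (pderivs bs f)"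
  unfolding smooth_fun_on_def by (metis le_sup_iff pderivs_append set_append)

lemma smooth_pd:
  "smooth_fun_on S f \<Longrightarrow> b \<in> Basis \<Longrightarrow> smooth_fun_on S (\<lambda>x. frechet_derivative f (at x) b)"
  using smooth_pderivs[of S f "[b]"] by simp

lemma smooth_subset: "smooth_fun_on S f \<Longrightarrow> T \<subseteq> S \<Longrightarrow> smooth_fun_on T f"
  unfolding smooth_fun_on_def by blast

lemma smooth_continuous: "smooth_fun_on S f \<Longrightarrow> continuous_on S f"
  by (meson continuous_at_imp_continuous_on has_derivative_continuous smooth_has_derivative)

lemma smooth_affine:
  fixes a :: "'a::euclidean_space"
  assumes "open S" shows "smooth_fun_on S (\<lambda>x::'a. of_real (x \<bullet> a) + c)"
proof (rule smooth_coinduct[where P = "\<lambda>f. \<exists>a c. f = (\<lambda>x::'a. of_real (x \<bullet> a) + c)"])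
  fix f :: "'a \<Rightarrow> complex" assume "\<exists>a c. f = (\<lambda>x::'a. of_real (x \<bullet> a) + c)"
  then obtain a c where f: "f = (\<lambda>x::'a. of_real (x \<bullet> a) + c)" by auto
  have "(f has_derivative (\<lambda>h. of_real (h \<bullet> a))) (at x)" for x
    unfolding f by (auto intro!: derivative_eq_intros)
  moreover have "\<exists>g. (\<exists>a c. g = (\<lambda>x::'a. of_real (x \<bullet> a) + c)) \<and> (\<forall>x\<in>S. of_real (b \<bullet> a) = g x)" for b
    by (intro exI[of _ "\<lambda>x. of_real (x \<bullet> 0) + of_real (b \<bullet> a)"] conjI exI[of _ 0]
        exI[of _ "of_real (b \<bullet> a)"]) auto
  ultimately show "\<exists>D. (\<forall>x\<in>S. (f has_derivative D x) (at x)) \<and>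
       (\<forall>b\<in>Basis. \<exists>g. (\<exists>a c. g = (\<lambda>x. complex_of_real (x \<bullet> a) + c)) \<and> (\<forall>x\<in>S. D x b = g x))"
    by (intro exI[of _ "\<lambda>_ h. of_real (h \<bullet> a)"]) auto
qed (use assms in auto)

lemma smooth_const: "open S \<Longrightarrow> smooth_fun_on S (\<lambda>x. c)"
  using smooth_affine[of S 0 c] by simp

text \<open>The algebra generated by the smooth functions is closed under partial derivatives, so it
  consists of smooth functions; this gives all closure properties at once.\<close>

inductive smooth_gen :: "'a::euclidean_space set \<Rightarrow> ('a \<Rightarrow> complex) \<Rightarrow> bool" for S where
  base: "smooth_fun_on S f \<Longrightarrow> smooth_gen S f"
| add: "smooth_gen S f \<Longrightarrow> smooth_gen S g \<Longrightarrow> smooth_gen S (\<lambda>x. f x + g x)"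
| mult: "smooth_gen S f \<Longrightarrow> smooth_gen S g \<Longrightarrow> smooth_gen S (\<lambda>x. f x * g x)"
| inverse: "smooth_gen S f \<Longrightarrow> (\<forall>x\<in>S. f x \<noteq> 0) \<Longrightarrow> smooth_gen S (\<lambda>x. inverse (f x))"
| comp: "smooth_gen S (\<lambda>x. complex_of_real (g x)) \<Longrightarrow> (\<forall>x\<in>S. g x \<in> I) \<Longrightarrow>
     (\<forall>k. \<forall>t\<in>I. (h k has_real_derivative h (Suc k) t) (at t)) \<Longrightarrow>
     smooth_gen S (\<lambda>x. complex_of_real (h k (g x)))"

text \<open>Each generating rule has its differentiation rule, and the derivative is assembled by
  the same rules from the old functions and their partial derivatives. Only its values at basis
  vectors have to lie in the algebra, which is what \<open>smooth_coinduct\<close> asks for.\<close>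

lemma smooth_gen_derivative:
  assumes "open S" "smooth_gen S f"
  shows "\<exists>D. (\<forall>x\<in>S. (f has_derivative D x) (at x)) \<and>
             (\<forall>b\<in>Basis. \<exists>g. smooth_gen S g \<and> (\<forall>x\<in>S. D x b = g x))"
  using assms(2)
proof (induction rule: smooth_gen.induct)
  case (base f)
  thus ?case using smooth_has_derivative[OF base] smooth_pd[OF base]
    by (intro exI[of _ "\<lambda>x. frechet_derivative f (at x)"]) (auto intro: smooth_gen.base)
next
  case (add f g)
  then obtain Df Dg where
    D: "\<forall>x\<in>S. (f has_derivative Df x) (at x)" "\<forall>b\<in>Basis. \<exists>g. smooth_gen S g \<and> (\<forall>x\<in>S. Df x b = g x)"
    "\<forall>x\<in>S. (g has_derivative Dg x) (at x)" "\<forall>b\<in>Basis. \<exists>g. smooth_gen S g \<and> (\<forall>x\<in>S. Dg x b = g x)"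
    by auto
  have "\<exists>k. smooth_gen S k \<and> (\<forall>x\<in>S. Df x b + Dg x b = k x)" if b: "b \<in> Basis" for b
  proof -
    obtain f' g' where "smooth_gen S f'" "\<forall>x\<in>S. Df x b = f' x" "smooth_gen S g'" "\<forall>x\<in>S. Dg x b = g' x"
      using D b by meson
    thus ?thesis by (intro exI[of _ "\<lambda>x. f' x + g' x"]) (auto intro!: smooth_gen.add)
  qed
  thus ?case using D
    by (intro exI[of _ "\<lambda>x h. Df x h + Dg x h"]) (auto intro!: has_derivative_add)
next
  case (mult f g)
  then obtain Df Dg where
    D: "\<forall>x\<in>S. (f has_derivative Df x) (at x)" "\<forall>b\<in>Basis. \<exists>g. smooth_gen S g \<and> (\<forall>x\<in>S. Df x b = g x)"
    "\<forall>x\<in>S. (g has_derivative Dg x) (at x)" "\<forall>b\<in>Basis. \<exists>g. smooth_gen S g \<and> (\<forall>x\<in>S. Dg x b = g x)"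
    by auto
  have "\<exists>k. smooth_gen S k \<and> (\<forall>x\<in>S. f x * Dg x b + Df x b * g x = k x)" if b: "b \<in> Basis" for b
  proof -
    obtain f' g' where "smooth_gen S f'" "\<forall>x\<in>S. Df x b = f' x" "smooth_gen S g'" "\<forall>x\<in>S. Dg x b = g' x"
      using D b by meson
    thus ?thesis using mult.hyps
      by (intro exI[of _ "\<lambda>x. f x * g' x + f' x * g x"]) (auto intro!: smooth_gen.intros(2,3))
  qed
  thus ?case using D
    by (intro exI[of _ "\<lambda>x h. f x * Dg x h + Df x h * g x"]) (auto intro!: has_derivative_mult)
next
  case (inverse f)
  then obtain Df where
    D: "\<forall>x\<in>S. (f has_derivative Df x) (at x)" "\<forall>b\<in>Basis. \<exists>g. smooth_gen S g \<and> (\<forall>x\<in>S. Df x b = g x)"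
    by auto
  have "\<exists>k. smooth_gen S k \<and> (\<forall>x\<in>S. - (inverse (f x) * Df x b * inverse (f x)) = k x)"
    if b: "b \<in> Basis" for b
  proof -
    obtain f' where f': "smooth_gen S f'" "\<forall>x\<in>S. Df x b = f' x" using D b by meson
    have "smooth_gen S (\<lambda>x. (-1) * (inverse (f x) * f' x * inverse (f x)))"
      by (intro smooth_gen.mult smooth_gen.inverse inverse.hyps f'(1))
         (use inverse in \<open>auto intro!: smooth_gen.base smooth_const assms(1)\<close>)
    thus ?thesis using f'(2) by (intro exI[of _ "\<lambda>x. (-1) * (inverse (f x) * f' x * inverse (f x))"]) auto
  qed
  thus ?case using D inverse
    by (intro exI[of _ "\<lambda>x h. - (inverse (f x) * Df x h * inverse (f x))"]) (auto intro!: has_derivative_inverse)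
next
  case (comp g I h k)
  then obtain D where
    D: "\<forall>x\<in>S. ((\<lambda>x. complex_of_real (g x)) has_derivative D x) (at x)"
       "\<forall>b\<in>Basis. \<exists>g. smooth_gen S g \<and> (\<forall>x\<in>S. D x b = g x)"
    by auto
  have g: "(g has_derivative (\<lambda>h. Re (D x h))) (at x)" if "x \<in> S" for x
    using bounded_linear.has_derivative[OF bounded_linear_Re D(1)[rule_format, OF that]] by simp
  \<comment> \<open>\<open>g\<close> is real but enters as a complex-valued function; uniqueness of
    derivatives shows that its derivative takes real values, so passing to \<open>Re\<close> for the
    real chain rule loses nothing.\<close>
  have Dr: "D x = (\<lambda>h. complex_of_real (Re (D x h)))" if "x \<in> S" for x
    using has_derivative_unique[OF D(1)[rule_format, OF that] has_derivative_of_real[OF g[OF that]]] .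
  have "((\<lambda>x. complex_of_real (h k (g x))) has_derivative
      (\<lambda>v. complex_of_real (Re (D x v) * h (Suc k) (g x)))) (at x)" if "x \<in> S" for x
    using comp.hyps(2,3) that
    by (intro has_derivative_of_real DERIV_compose_FDERIV[OF _ g]) auto
  moreover have "\<exists>l. smooth_gen S l \<and> (\<forall>x\<in>S. complex_of_real (Re (D x b) * h (Suc k) (g x)) = l x)"
    if b: "b \<in> Basis" for b
  proof -
    obtain g' where g': "smooth_gen S g'" "\<forall>x\<in>S. D x b = g' x" using D b by meson
    have "smooth_gen S (\<lambda>x. g' x * complex_of_real (h (Suc k) (g x)))"
      by (rule smooth_gen.mult[OF g'(1) smooth_gen.comp[OF comp.hyps]])
    moreover have "complex_of_real (Re (D x b) * h (Suc k) (g x)) = g' x * complex_of_real (h (Suc k) (g x))"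
      if "x \<in> S" for x using fun_cong[OF Dr[OF that], of b] g'(2) that by simp
    ultimately show ?thesis by blast
  qed
  ultimately show ?case
    by (intro exI[of _ "\<lambda>x v. complex_of_real (Re (D x v) * h (Suc k) (g x))"]) auto
qed

lemma smooth_gen_smooth: "open S \<Longrightarrow> smooth_gen S f \<Longrightarrow> smooth_fun_on S f"
  by (rule smooth_coinduct[where P = "smooth_gen S"]) (auto dest: smooth_gen_derivative)

lemma
  assumes "open S" "smooth_fun_on S f" "smooth_fun_on S g"
  shows smooth_add: "smooth_fun_on S (\<lambda>x. f x + g x)"
    and smooth_mult: "smooth_fun_on S (\<lambda>x. f x * g x)"
  using smooth_gen_smooth[OF assms(1) smooth_gen.add[OF smooth_gen.base[OF assms(2)] smooth_gen.base[OF assms(3)]]]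
    smooth_gen_smooth[OF assms(1) smooth_gen.mult[OF smooth_gen.base[OF assms(2)] smooth_gen.base[OF assms(3)]]]
  by blast+

lemma smooth_inverse:
  "open S \<Longrightarrow> smooth_fun_on S f \<Longrightarrow> (\<And>x. x \<in> S \<Longrightarrow> f x \<noteq> 0) \<Longrightarrow> smooth_fun_on S (\<lambda>x. inverse (f x))"
  by (rule smooth_gen_smooth[OF _ smooth_gen.inverse[OF smooth_gen.base]]) auto

text \<open>\<open>h\<close> lists a real function on \<open>I\<close> together with all its
  derivatives; carrying the whole list keeps the chain rule inside the algebra. It is used for the
  flat function and for real powers.\<close>

lemma smooth_comp:
  assumes "open S" "smooth_fun_on S (\<lambda>x. complex_of_real (g x))" "\<And>x. x \<in> S \<Longrightarrow> g x \<in> I"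
    "\<And>k t. t \<in> I \<Longrightarrow> (h k has_real_derivative h (Suc k) t) (at t)"
  shows "smooth_fun_on S (\<lambda>x. complex_of_real (h k (g x)))"
  by (rule smooth_gen_smooth[OF assms(1) smooth_gen.comp[OF smooth_gen.base[OF assms(2)], of I]])
     (use assms(3,4) in auto)

lemma smooth_minus: "open S \<Longrightarrow> smooth_fun_on S f \<Longrightarrow> smooth_fun_on S (\<lambda>x. - f x)"
  using smooth_mult[of S "\<lambda>_. -1" f] smooth_const[of S "-1"] by simp

lemma smooth_diff:
  "open S \<Longrightarrow> smooth_fun_on S f \<Longrightarrow> smooth_fun_on S g \<Longrightarrow> smooth_fun_on S (\<lambda>x. f x - g x)"
  using smooth_add[of S f "\<lambda>x. - g x"] smooth_minus[of S g] by simp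

lemma smooth_inner: "open S \<Longrightarrow> smooth_fun_on S (\<lambda>x. complex_of_real (x \<bullet> a))"
  using smooth_affine[of S a 0] by simp

lemma smooth_sum:
  "open S \<Longrightarrow> (\<And>i. i \<in> A \<Longrightarrow> smooth_fun_on S (f i)) \<Longrightarrow> smooth_fun_on S (\<lambda>x. \<Sum>i\<in>A. f i x)"
  by (induction A rule: infinite_finite_induct) (auto intro: smooth_const smooth_add)

lemma smooth_norm_sq:
  fixes a :: "'a::euclidean_space"
  assumes "open S" shows "smooth_fun_on S (\<lambda>x. complex_of_real ((norm (x - a))\<^sup>2))"
proof -
  have "(\<lambda>x. complex_of_real ((norm (x - a))\<^sup>2)) =
      (\<lambda>x. \<Sum>b\<in>Basis. (of_real (x \<bullet> b) + of_real (- a \<bullet> b)) * (of_real (x \<bullet> b) + of_real (- a \<bullet> b)))"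
    by (intro ext, subst power2_norm_eq_inner, subst euclidean_inner) (simp add: inner_diff_left)
  thus ?thesis using assms by (simp only:) (intro smooth_sum smooth_mult smooth_affine)
qed

section \<open>Cutoff functions\<close>

text \<open>With \<open>e t = exp (-1/t)\<close>, the derivative of \<open>P (1/t) e t\<close> is \<open>Q (1/t) e t\<close>, where
  \<open>Q = X\<^sup>2 (P - P')\<close>.\<close>

primrec flat_poly :: "nat \<Rightarrow> real poly" where
  "flat_poly 0 = 1"
| "flat_poly (Suc k) = monom 1 2 * (flat_poly k - pderiv (flat_poly k))"

definition flat :: "nat \<Rightarrow> real \<Rightarrow> real" where
  "flat k t = (if t > 0 then poly (flat_poly k) (1 / t) * exp (- (1 / t)) else 0)"

lemma poly_div_exp_tendsto_0: "((\<lambda>x. poly p x / exp x) \<longlongrightarrow> (0::real)) at_top"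
proof -
  have "((\<lambda>x. \<Sum>i\<le>degree p. coeff p i * (x ^ i / exp x)) \<longlongrightarrow> (\<Sum>i\<le>degree p. coeff p i * 0)) at_top"
    by (intro tendsto_intros tendsto_power_div_exp_0)
  thus ?thesis by (simp add: poly_altdef sum_divide_distrib)
qed

text \<open>Away from 0 this is calculus. At 0 the difference quotient vanishes from the left, and
  from the right it is a polynomial in \<open>1 / h\<close> times \<open>exp (- (1 / h))\<close>,
  which tends to 0 because the exponential wins.\<close>

lemma flat_derivative: "(flat k has_real_derivative flat (Suc k) t) (at t)"
proof -
  consider "t > 0" | "t < 0" | "t = 0" by linarith
  thus ?thesis
  proof cases
    case 1
    have "((\<lambda>t. poly (flat_poly k) (1 / t) * exp (- (1 / t))) has_real_derivative
        flat (Suc k) t) (at t)"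
      using 1 by (auto intro!: derivative_eq_intros poly_DERIV[THEN DERIV_chain2]
          simp: flat_def poly_monom field_simps power2_eq_square)
    thus ?thesis
      by (rule has_field_derivative_transform_within_open[where S = "{0<..}"])
         (use 1 in \<open>auto simp: flat_def\<close>)
  next
    case 2
    have "((\<lambda>_. 0) has_real_derivative flat (Suc k) t) (at t)"
      using 2 by (auto simp: flat_def)
    thus ?thesis
      by (rule has_field_derivative_transform_within_open[where S = "{..<0}"])
         (use 2 in \<open>auto simp: flat_def\<close>)
  next
    case 3
    have "((\<lambda>h. flat k h / h) \<longlongrightarrow> 0) (at_left 0)"
      by (rule tendsto_eventually) (auto simp: flat_def eventually_at_filter)
    moreover have "((\<lambda>h. flat k h / h) \<longlongrightarrow> 0) (at_right 0)"
    proof -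
      \<comment> \<open>The extra factor \<open>monom 1 1\<close> is the division by
        \<open>h\<close>, expressed in the variable \<open>inverse h\<close>.\<close>
      have "((\<lambda>h. poly (flat_poly k * monom 1 1) (inverse h) / exp (inverse h)) \<longlongrightarrow> 0) (at_right 0)"
        by (rule filterlim_compose[OF poly_div_exp_tendsto_0 filterlim_inverse_at_top_right])
      thus ?thesis
        by (rule Lim_transform_eventually)
           (auto simp: flat_def eventually_at_filter poly_monom exp_minus field_simps)
    qed
    ultimately have "((\<lambda>h. flat k h / h) \<longlongrightarrow> 0) (at 0)" by (simp add: filterlim_split_at)
    thus ?thesis using 3 by (simp add: DERIV_def flat_def)
  qed
qed

lemma flat_0: "flat 0 t = (if t > 0 then exp (- (1 / t)) else 0)"
  by (simp add: flat_def)

lemma smooth_flat: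
  "open S \<Longrightarrow> smooth_fun_on S (\<lambda>x. complex_of_real (g x)) \<Longrightarrow>
   smooth_fun_on S (\<lambda>x. complex_of_real (flat 0 (g x)))"
  by (rule smooth_comp[where I = UNIV]) (auto intro: flat_derivative)

lemma supp_compactI:
  assumes "compact K" "\<And>x. x \<notin> K \<Longrightarrow> \<phi> x = 0"
  shows "supp \<phi> \<subseteq> K" "compact (supp \<phi>)"
proof -
  show "supp \<phi> \<subseteq> K"
    unfolding supp_def by (rule closure_minimal) (use assms compact_imp_closed in auto)
  thus "compact (supp \<phi>)"
    using compact_Int_closed[OF assms(1), of "supp \<phi>"] by (simp add: supp_def Int_absorb1)
qed

text \<open>The quotient \<open>A / (A + B)\<close> of flat functions: \<open>A\<close> is positive
  where \<open>n x < 4 * r\<^sup>2\<close> and \<open>B\<close> where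
  \<open>n x > r\<^sup>2\<close>, so the denominator never vanishes. \<open>B\<close> vanishes on
  the inner ball, which makes the quotient 1, and \<open>A\<close> vanishes outside the outer
  one.\<close>

lemma exists_cutoff:
  fixes x\<^sub>0 :: "'a::euclidean_space"
  assumes "r > 0"
  obtains \<kappa> where "test_fun \<kappa>" "\<And>x. x \<in> cball x\<^sub>0 r \<Longrightarrow> \<kappa> x = 1"
    "\<And>x. x \<notin> ball x\<^sub>0 (2 * r) \<Longrightarrow> \<kappa> x = 0" "supp \<kappa> \<subseteq> cball x\<^sub>0 (2 * r)" "\<And>x. cmod (\<kappa> x) \<le> 1"
proof -
  define n where "n x = (norm (x - x\<^sub>0))\<^sup>2" for x
  define A where "A x = flat 0 (4 * r\<^sup>2 - n x)" for x
  define B where "B x = flat 0 (n x - r\<^sup>2)" for x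
  define \<kappa> where "\<kappa> x = complex_of_real (A x) * inverse (complex_of_real (A x) + complex_of_real (B x))" for x
  have nn: "A x \<ge> 0" "B x \<ge> 0" for x by (auto simp: A_def B_def flat_0)
  have r2: "r\<^sup>2 > 0" using assms by simp
  have pos: "A x + B x > 0" for x
  proof (cases "n x < 4 * r\<^sup>2")
    case True thus ?thesis using nn[of x] by (auto simp: A_def flat_0 intro: add_pos_nonneg)
  next
    case False
    hence "n x > r\<^sup>2" using r2 by linarith
    thus ?thesis using nn[of x] by (auto simp: B_def flat_0 intro: add_nonneg_pos)
  qed
  have *: "smooth_fun_on UNIV (\<lambda>x. complex_of_real (A x))" "smooth_fun_on UNIV (\<lambda>x. complex_of_real (B x))"
    unfolding A_def B_def n_def
    by (intro smooth_flat open_UNIV; simp del: of_real_power;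
        intro smooth_diff smooth_const smooth_norm_sq open_UNIV)+
  have sm: "smooth_fun_on UNIV \<kappa>"
    unfolding \<kappa>_def
    by (intro smooth_mult smooth_inverse smooth_add * open_UNIV)
       (metis of_real_add of_real_eq_0_iff pos less_irrefl)
  have 1: "\<kappa> x = 1" if "x \<in> cball x\<^sub>0 r" for x
  proof -
    have "n x \<le> r\<^sup>2" using that by (auto simp: n_def dist_norm norm_minus_commute intro!: power_mono)
    hence "B x = 0" by (simp add: B_def flat_0)
    thus ?thesis using pos[of x] by (simp add: \<kappa>_def)
  qed
  have 0: "\<kappa> x = 0" if "x \<notin> ball x\<^sub>0 (2 * r)" for x
  proof -
    have "(2 * r)\<^sup>2 \<le> n x" using that assms
      unfolding n_def by (intro power_mono) (auto simp: dist_norm norm_minus_commute)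
    hence "A x = 0" by (simp add: A_def flat_0 power2_eq_square)
    thus ?thesis by (simp add: \<kappa>_def)
  qed
  have s: "supp \<kappa> \<subseteq> cball x\<^sub>0 (2 * r)" and "compact (supp \<kappa>)"
    by (rule supp_compactI[OF compact_cball[of x\<^sub>0 "2 * r"]]; use 0 in force)+
  moreover have "cmod (\<kappa> x) \<le> 1" for x
  proof -
    have "\<kappa> x = of_real (A x / (A x + B x))" by (simp add: \<kappa>_def divide_inverse)
    thus ?thesis using nn[of x] pos[of x] by (simp del: of_real_divide of_real_add)
  qed
  ultimately show ?thesis using that[of \<kappa>] sm 1 0 s by (auto simp: test_fun_def)
qed

section \<open>Homogeneous cutoffs of degree zero\<close>

lemma powr_derivative_sequence:
  fixes a t :: real
  assumes "t > 0"
  shows "((\<lambda>t. (\<Prod>j<k. a - real j) * t powr (a - real k)) has_real_derivative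
     (\<Prod>j<Suc k. a - real j) * t powr (a - real (Suc k))) (at t)"
  using assms by (auto intro!: derivative_eq_intros simp: algebra_simps)

text \<open>The flat function is applied to the cosine of the angle between \<open>\<xi>\<close> and
  \<open>e\<close>, reduced by \<open>c\<close>; the cosine does not change under dilations. The
  norm is written as a power of the squared norm, which is smooth and is positive off the origin. At
  the origin the value is 0 because \<open>c\<close> is nonnegative, so the last two properties hold
  there as well.\<close>

lemma exists_conic_cutoff:
  fixes e :: "'a::euclidean_space"
  assumes "norm e = 1" "0 \<le> c" "c < 1"
  obtains u where "smooth_fun_on (- {0}) u" "\<And>\<xi> t. t > 0 \<Longrightarrow> u (t *\<^sub>R \<xi>) = u \<xi>" "u e \<noteq> 0"
    "\<And>\<xi>. u \<xi> \<noteq> 0 \<Longrightarrow> \<xi> \<bullet> e > c * norm \<xi>" "\<And>\<xi>. cmod (u \<xi>) \<le> 1"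
proof
  let ?u = "\<lambda>\<xi>. complex_of_real (flat 0 ((\<xi> \<bullet> e) * ((norm (\<xi> - 0))\<^sup>2) powr (-1/2) - c))"
  \<comment> \<open>At the origin both sides are 0, by the conventions for \<open>powr\<close> and
    \<open>inverse\<close>.\<close>
  have nrm: "((norm (\<xi> - 0))\<^sup>2) powr (-1/2) = inverse (norm \<xi>)" for \<xi> :: 'a
  proof (cases "\<xi> = 0")
    case False
    hence "norm \<xi> > 0" by simp
    hence "((norm \<xi>)\<^sup>2) powr (-1/2) = norm \<xi> powr (-1)"
      by (simp add: powr_powr flip: powr_numeral)
    thus ?thesis using False by (simp add: powr_minus)
  qed simp
  have op: "open (- {0::'a})" by auto
  have p: "smooth_fun_on (- {0}) (\<lambda>\<xi>::'a. complex_of_real ((\<lambda>k t. (\<Prod>j<k. -1/2 - real j) * t powr (-1/2 - real k)) 0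
              ((norm (\<xi> - 0))\<^sup>2)))"
    by (rule smooth_comp[where I = "{0<..}" and h = "\<lambda>k t. (\<Prod>j<k. -1/2 - real j) * t powr (-1/2 - real k)"
            and g = "\<lambda>\<xi>. (norm (\<xi> - 0))\<^sup>2"])
       (use op smooth_norm_sq[OF op, of 0] powr_derivative_sequence[where a = "-1/2"] in
          \<open>simp_all del: prod.lessThan_Suc of_real_power\<close>)
  show "smooth_fun_on (- {0}) ?u"
    using smooth_flat[OF op, of "\<lambda>\<xi>. (\<xi> \<bullet> e) * ((norm (\<xi> - 0))\<^sup>2) powr (-1/2) - c"]
      smooth_diff[OF op smooth_mult[OF op smooth_inner[OF op, of e] p] smooth_const[OF op, of "of_real c"]]
    by simp
  show "?u (t *\<^sub>R \<xi>) = ?u \<xi>" if "t > 0" for t \<xi>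
  proof -
    have "((t *\<^sub>R \<xi>) \<bullet> e) * inverse (norm (t *\<^sub>R \<xi>)) = (\<xi> \<bullet> e) * inverse (norm \<xi>)"
      using that by (simp add: divide_simps)
    thus ?thesis unfolding nrm by (simp only:)
  qed
  show "?u e \<noteq> 0" unfolding nrm using assms by (simp add: dot_square_norm flat_0)
  show "\<xi> \<bullet> e > c * norm \<xi>" if "?u \<xi> \<noteq> 0" for \<xi>
  proof -
    have *: "\<xi> \<bullet> e * inverse (norm \<xi>) > c" using that unfolding nrm by (simp add: flat_0 split: if_splits)
    hence "\<xi> \<noteq> 0" using assms by auto
    thus ?thesis using * by (simp add: field_simps)
  qed
  show "cmod (?u \<xi>) \<le> 1" for \<xi> by (simp add: flat_0)
qed

section \<open>Seminorms\<close>

lemma pd_eq: "(f has_derivative D) (at x) \<Longrightarrow> frechet_derivative f (at x) b = D b"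
  using frechet_derivative_at by metis

lemma pderivs_has_derivative:
  "smooth_fun_on S f \<Longrightarrow> set bs \<subseteq> Basis \<Longrightarrow> x \<in> S \<Longrightarrow>
   (pderivs bs f has_derivative frechet_derivative (pderivs bs f) (at x)) (at x)"
  by (rule smooth_has_derivative[OF smooth_pderivs])

lemma pderivs_continuous:
  "smooth_fun_on S f \<Longrightarrow> set bs \<subseteq> Basis \<Longrightarrow> continuous_on S (pderivs bs f)"
  by (rule smooth_continuous[OF smooth_pderivs])

lemma pderivs_linear:
  assumes "smooth_fun_on UNIV f" "smooth_fun_on UNIV g" "set bs \<subseteq> Basis"
  shows "pderivs bs (\<lambda>x. a * f x + b * g x) = (\<lambda>x. a * pderivs bs f x + b * pderivs bs g x)"
  using assms(3)
proof (induction bs)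
  case (Cons c bs)
  hence bs: "set bs \<subseteq> Basis" by auto
  show ?case
    unfolding pderivs.simps Cons.IH[OF bs]
    by (intro ext pd_eq) (auto intro!: derivative_eq_intros pderivs_has_derivative[OF assms(1)]
      pderivs_has_derivative[OF assms(2)] bs)
qed auto

lemma pderivs_const: "pderivs bs (\<lambda>x. c) = (\<lambda>x. if bs = [] then c else 0)"
proof (induction bs)
  case (Cons b bs)
  have "frechet_derivative (\<lambda>x. if bs = [] then c else 0) (at x) b = 0" for x
    by (rule pd_eq) (rule has_derivative_const)
  thus ?case using Cons by simp
qed simp

lemma pderivs_scale:
  assumes "smooth_fun_on UNIV f" "set bs \<subseteq> Basis"
  shows "pderivs bs (\<lambda>x. f (c *\<^sub>R x)) = (\<lambda>x. of_real c ^ length bs * pderivs bs f (c *\<^sub>R x))"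
  using assms(2)
proof (induction bs)
  case (Cons b bs)
  hence bs: "set bs \<subseteq> Basis" by auto
  show ?case
  proof
    fix x
    let ?D = "frechet_derivative (pderivs bs f) (at (c *\<^sub>R x))"
    have D: "(pderivs bs f has_derivative ?D) (at (c *\<^sub>R x))"
      by (rule pderivs_has_derivative[OF assms(1) bs UNIV_I])
    have *: "((\<lambda>x. of_real c ^ length bs * pderivs bs f (c *\<^sub>R x)) has_derivative
        (\<lambda>h. of_real c ^ length bs * ?D (c *\<^sub>R h))) (at x)"
      by (rule has_derivative_mult_right,
          rule has_derivative_compose[of "\<lambda>x. c *\<^sub>R x" "\<lambda>h. c *\<^sub>R h" x UNIV, OF _ D])
         (auto intro!: derivative_eq_intros)
    have "?D (c *\<^sub>R b) = of_real c * ?D b"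
      using linear_scale[OF has_derivative_linear[OF D]] by (simp add: scaleR_conv_of_real)
    thus "pderivs (b # bs) (\<lambda>x. f (c *\<^sub>R x)) x = of_real c ^ length (b # bs) * pderivs (b # bs) f (c *\<^sub>R x)"
      using pd_eq[OF *, of b] Cons.IH[OF bs] by simp
  qed
qed auto

lemma smooth_scale:
  assumes "smooth_fun_on UNIV f"
  shows "smooth_fun_on UNIV (\<lambda>x. f (c *\<^sub>R x))"
  unfolding smooth_fun_on_def
proof (intro allI impI ballI)
  fix bs :: "'a list" and x :: 'a assume bs: "set bs \<subseteq> Basis"
  have D: "(pderivs bs f has_derivative frechet_derivative (pderivs bs f) (at (c *\<^sub>R x))) (at (c *\<^sub>R x))"
    by (rule pderivs_has_derivative[OF assms bs UNIV_I])
  have *: "((\<lambda>x. of_real c ^ length bs * pderivs bs f (c *\<^sub>R x)) has_derivative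
      (\<lambda>h. of_real c ^ length bs * frechet_derivative (pderivs bs f) (at (c *\<^sub>R x)) (c *\<^sub>R h))) (at x)"
    by (rule has_derivative_mult_right,
        rule has_derivative_compose[of "\<lambda>x. c *\<^sub>R x" "\<lambda>h. c *\<^sub>R h" x UNIV, OF _ D])
       (auto intro!: derivative_eq_intros)
  thus "pderivs bs (\<lambda>x. f (c *\<^sub>R x)) differentiable at x"
    unfolding pderivs_scale[OF assms bs] differentiable_def by blast
qed

section \<open>Leibniz rule\<close>

fun splits :: "'a list \<Rightarrow> ('a list \<times> 'a list) list" where
  "splits [] = [([], [])]"
| "splits (b # bs) = map (\<lambda>(u, v). (b # u, v)) (splits bs) @ map (\<lambda>(u, v). (u, b # v)) (splits bs)"

lemma length_splits: "length (splits bs) = 2 ^ length bs"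
  by (induction bs) auto

lemma splits_memD:
  "(u, v) \<in> set (splits bs) \<Longrightarrow>
     set u \<subseteq> set bs \<and> set v \<subseteq> set bs \<and> length u \<le> length bs \<and> length v \<le> length bs"
  by (induction bs arbitrary: u v) (auto, (fastforce)+)

lemma has_derivative_sum_list:
  "(\<And>p. p \<in> set ps \<Longrightarrow> (F p has_derivative D p) (at x)) \<Longrightarrow>
   ((\<lambda>x. \<Sum>p\<leftarrow>ps. F p x) has_derivative (\<lambda>h. \<Sum>p\<leftarrow>ps. D p h)) (at x)"
  by (induction ps) (auto intro!: has_derivative_add)

text \<open>\<open>splits\<close> distributes the entries of the list over two lists in all
  \<open>2 ^ length bs\<close> ways. Repeated pairs take the place of binomial coefficients, and
  later estimates use only the number of terms and the lengths.\<close>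

lemma pderivs_mult:
  assumes "smooth_fun_on UNIV f" "smooth_fun_on UNIV g" "set bs \<subseteq> Basis"
  shows "pderivs bs (\<lambda>x. f x * g x) = (\<lambda>x. \<Sum>(u, v)\<leftarrow>splits bs. pderivs u f x * pderivs v g x)"
  using assms(3)
proof (induction bs)
  case (Cons b bs)
  hence bs: "set bs \<subseteq> Basis" by auto
  let ?F = "\<lambda>p x. pderivs (fst p) f x * pderivs (snd p) g x"
  let ?D = "\<lambda>x p h. pderivs (fst p) f x * frechet_derivative (pderivs (snd p) g) (at x) h +
               frechet_derivative (pderivs (fst p) f) (at x) h * pderivs (snd p) g x"
  have "((\<lambda>x. \<Sum>p\<leftarrow>splits bs. ?F p x) has_derivative (\<lambda>h. \<Sum>p\<leftarrow>splits bs. ?D x p h)) (at x)" for x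
  proof (rule has_derivative_sum_list)
    fix p assume "p \<in> set (splits bs)"
    hence "set (fst p) \<subseteq> Basis" "set (snd p) \<subseteq> Basis" using splits_memD[of "fst p" "snd p" bs] bs by auto
    thus "(?F p has_derivative ?D x p) (at x)"
      by (intro has_derivative_mult pderivs_has_derivative[of UNIV] assms) auto
  qed
  hence *: "frechet_derivative (\<lambda>x. \<Sum>p\<leftarrow>splits bs. ?F p x) (at x) b = (\<Sum>p\<leftarrow>splits bs. ?D x p b)" for x
    by (rule pd_eq)
  have "pderivs bs (\<lambda>x. f x * g x) = (\<lambda>x. \<Sum>p\<leftarrow>splits bs. ?F p x)"
    using Cons.IH[OF bs] by (simp add: case_prod_unfold)
  hence "pderivs (b # bs) (\<lambda>x. f x * g x) = (\<lambda>x. \<Sum>p\<leftarrow>splits bs. ?D x p b)"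
    using * by simp
  also have "\<dots> = (\<lambda>x. \<Sum>(u, v)\<leftarrow>splits (b # bs). pderivs u f x * pderivs v g x)"
    by (auto simp: case_prod_unfold o_def sum_list_addf add.commute)
  finally show ?case .
qed auto

section \<open>Bounds for Schwartz seminorms\<close>

lemma finite_multi_indices: "finite (multi_indices N)"
  unfolding multi_indices_def by (rule finite_lists_length_le) simp

lemma multi_indices_mono: "N \<le> M \<Longrightarrow> multi_indices N \<subseteq> multi_indices M"
  by (auto simp: multi_indices_def)

text \<open>A relation instead of a supremum: bounds pass through sums, products and transforms
  without first knowing that suprema are finite. The single index \<open>N\<close> limits both the
  order of the derivatives and the power of the weight, as in
  \<open>tempered_distribution\<close>.\<close>

definition schwartz_bound :: "nat \<Rightarrow> ('a::euclidean_space \<Rightarrow> complex) \<Rightarrow> real \<Rightarrow> bool" where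
  "schwartz_bound N \<phi> B \<longleftrightarrow> (\<forall>bs\<in>multi_indices N. \<forall>x. (1 + norm x) ^ N * cmod (pderivs bs \<phi> x) \<le> B)"

lemma schwartz_boundD:
  "schwartz_bound N \<phi> B \<Longrightarrow> set bs \<subseteq> Basis \<Longrightarrow> length bs \<le> N \<Longrightarrow>
    (1 + norm x) ^ N * cmod (pderivs bs \<phi> x) \<le> B"
  by (auto simp: schwartz_bound_def multi_indices_def)

lemma schwartz_bound_nonneg: "schwartz_bound N \<phi> B \<Longrightarrow> 0 \<le> B"
  using schwartz_boundD[of N \<phi> B "[]" 0] by (auto intro: order_trans[rotated])

lemma schwartz_bound_mono:
  assumes "schwartz_bound M \<phi> B" "N \<le> M" shows "schwartz_bound N \<phi> B"
  unfolding schwartz_bound_def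
proof (intro ballI allI)
  fix bs :: "'a list" and x assume "bs \<in> multi_indices N"
  hence "bs \<in> multi_indices M" using multi_indices_mono[OF assms(2)] by auto
  have "(1 + norm x) ^ N * cmod (pderivs bs \<phi> x) \<le> (1 + norm x) ^ M * cmod (pderivs bs \<phi> x)"
    by (intro mult_right_mono power_increasing assms(2)) auto
  also have "\<dots> \<le> B" using assms(1) \<open>bs \<in> multi_indices M\<close> by (auto simp: schwartz_bound_def)
  finally show "(1 + norm x) ^ N * cmod (pderivs bs \<phi> x) \<le> B" .
qed

text \<open>Only finitely many multi-indices have order at most \<open>N\<close>, so a common bound
  exists; conversely the index \<open>max k (length bs)\<close> covers weight \<open>k\<close> and
  derivative \<open>bs\<close>.\<close>

lemma schwartz_fun_iff:
  "schwartz_fun \<phi> \<longleftrightarrow> smooth_fun_on UNIV \<phi> \<and> (\<forall>N. \<exists>B. schwartz_bound N \<phi> B)"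
proof (intro iffI conjI allI)
  assume *: "schwartz_fun \<phi>"
  show "smooth_fun_on UNIV \<phi>" using * by (simp add: schwartz_fun_def)
  fix N
  have "\<forall>bs\<in>multi_indices N. \<exists>B. \<forall>x. (1 + norm x) ^ N * cmod (pderivs bs \<phi> x) \<le> B"
  proof
    fix bs :: "'a list" assume "bs \<in> multi_indices N"
    hence "bounded (range (\<lambda>x. (1 + norm x) ^ N * cmod (pderivs bs \<phi> x)))"
      using * by (auto simp: schwartz_fun_def multi_indices_def)
    then obtain B where "\<And>x. \<bar>(1 + norm x) ^ N * cmod (pderivs bs \<phi> x)\<bar> \<le> B"
      by (auto simp: bounded_real)
    thus "\<exists>B. \<forall>x. (1 + norm x) ^ N * cmod (pderivs bs \<phi> x) \<le> B" by (meson abs_le_D1)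
  qed
  then obtain B where B: "\<And>bs x. bs \<in> multi_indices N \<Longrightarrow> (1 + norm x) ^ N * cmod (pderivs bs \<phi> x) \<le> B bs"
    by metis
  show "\<exists>B. schwartz_bound N \<phi> B"
    unfolding schwartz_bound_def
    by (intro exI[of _ "Max (B ` multi_indices N)"] ballI allI order_trans[OF B] Max_ge)
       (auto intro: finite_multi_indices)
next
  assume *: "smooth_fun_on UNIV \<phi> \<and> (\<forall>N. \<exists>B. schwartz_bound N \<phi> B)"
  show "schwartz_fun \<phi>"
    unfolding schwartz_fun_def
  proof (intro conjI allI impI)
    fix k and bs :: "'a list" assume bs: "set bs \<subseteq> Basis"
    obtain B where B: "schwartz_bound (max k (length bs)) \<phi> B" using * by blast
    have "(1 + norm x) ^ k * cmod (pderivs bs \<phi> x) \<le> B" for x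
    proof -
      have "(1 + norm x) ^ k * cmod (pderivs bs \<phi> x) \<le> (1 + norm x) ^ max k (length bs) * cmod (pderivs bs \<phi> x)"
        by (intro mult_right_mono power_increasing) auto
      thus ?thesis using schwartz_boundD[OF B bs, of x] by simp
    qed
    thus "bounded (range (\<lambda>x. (1 + norm x) ^ k * cmod (pderivs bs \<phi> x)))"
      by (auto simp: bounded_real intro!: exI[of _ B])
  qed (use * in auto)
qed

lemma schwartz_smooth: "schwartz_fun \<phi> \<Longrightarrow> smooth_fun_on UNIV \<phi>"
  by (simp add: schwartz_fun_def)

lemma schwartz_bound_linear:
  assumes "smooth_fun_on UNIV \<phi>" "smooth_fun_on UNIV \<psi>" "schwartz_bound N \<phi> A" "schwartz_bound N \<psi> B"
  shows "schwartz_bound N (\<lambda>x. a * \<phi> x + b * \<psi> x) (cmod a * A + cmod b * B)"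
  unfolding schwartz_bound_def
proof (intro ballI allI)
  fix bs :: "'a list" and x assume "bs \<in> multi_indices N"
  hence bs: "set bs \<subseteq> Basis" "length bs \<le> N" by (auto simp: multi_indices_def)
  have "(1 + norm x) ^ N * cmod (pderivs bs (\<lambda>x. a * \<phi> x + b * \<psi> x) x) \<le>
     (1 + norm x) ^ N * (cmod a * cmod (pderivs bs \<phi> x) + cmod b * cmod (pderivs bs \<psi> x))"
    unfolding pderivs_linear[OF assms(1,2) bs(1)]
    by (intro mult_left_mono norm_triangle_le) (auto simp: norm_mult)
  also have "\<dots> = cmod a * ((1 + norm x) ^ N * cmod (pderivs bs \<phi> x)) +
      cmod b * ((1 + norm x) ^ N * cmod (pderivs bs \<psi> x))" by (simp add: algebra_simps)
  also have "\<dots> \<le> cmod a * A + cmod b * B"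
    by (intro add_mono mult_left_mono schwartz_boundD[OF assms(3) bs] schwartz_boundD[OF assms(4) bs]) auto
  finally show "(1 + norm x) ^ N * cmod (pderivs bs (\<lambda>x. a * \<phi> x + b * \<psi> x) x) \<le> cmod a * A + cmod b * B" .
qed

lemma cmod_sum_list_le: "cmod (\<Sum>p\<leftarrow>ps. f p) \<le> (\<Sum>p\<leftarrow>ps. cmod (f p))"
  by (induction ps) (auto intro: norm_triangle_le)

text \<open>The Leibniz rule has at most \<open>2 ^ N\<close> terms. The growth of order
  \<open>k\<close> allowed for the derivatives of \<open>m\<close> is paid by using the bound of
  order \<open>N + k\<close> for \<open>\<phi>\<close>.\<close>

lemma schwartz_bound_mult:
  assumes "smooth_fun_on UNIV m" "smooth_fun_on UNIV \<phi>" "schwartz_bound (N + k) \<phi> B"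
    and m: "\<And>bs x. set bs \<subseteq> Basis \<Longrightarrow> length bs \<le> N \<Longrightarrow> cmod (pderivs bs m x) \<le> C * (1 + norm x) ^ k"
  shows "schwartz_bound N (\<lambda>x. m x * \<phi> x) (2 ^ N * (C * B))"
  unfolding schwartz_bound_def
proof (intro ballI allI)
  fix bs :: "'a list" and x assume "bs \<in> multi_indices N"
  hence bs: "set bs \<subseteq> Basis" "length bs \<le> N" by (auto simp: multi_indices_def)
  have C: "C \<ge> 0" using m[of "[]" 0] by simp (meson norm_ge_zero order_trans)
  have B: "B \<ge> 0" using assms(3) by (rule schwartz_bound_nonneg)
  have *: "(1 + norm x) ^ N * cmod (pderivs u m x * pderivs v \<phi> x) \<le> C * B"
    if "(u, v) \<in> set (splits bs)" for u v
  proof -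
    have uv: "set u \<subseteq> Basis" "set v \<subseteq> Basis" "length u \<le> N" "length v \<le> N"
      using splits_memD[OF that] bs by auto
    have "(1 + norm x) ^ N * cmod (pderivs u m x * pderivs v \<phi> x) \<le>
        (1 + norm x) ^ N * (C * (1 + norm x) ^ k * cmod (pderivs v \<phi> x))"
      unfolding norm_mult by (intro mult_left_mono mult_right_mono m uv) auto
    also have "\<dots> = C * ((1 + norm x) ^ (N + k) * cmod (pderivs v \<phi> x))" by (simp add: power_add)
    also have "\<dots> \<le> C * B" by (intro mult_left_mono schwartz_boundD[OF assms(3)] uv C) (use uv in auto)
    finally show ?thesis .
  qed
  have "(1 + norm x) ^ N * cmod (pderivs bs (\<lambda>x. m x * \<phi> x) x) \<le>
      (1 + norm x) ^ N * (\<Sum>(u, v)\<leftarrow>splits bs. cmod (pderivs u m x * pderivs v \<phi> x))"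
    unfolding pderivs_mult[OF assms(1,2) bs(1)]
    by (intro mult_left_mono order_trans[OF cmod_sum_list_le]) (auto simp: case_prod_unfold)
  also have "\<dots> = (\<Sum>(u, v)\<leftarrow>splits bs. (1 + norm x) ^ N * cmod (pderivs u m x * pderivs v \<phi> x))"
    by (simp add: sum_list_const_mult case_prod_unfold)
  also have "\<dots> \<le> (\<Sum>(u, v)\<leftarrow>splits bs. C * B)"
    by (rule sum_list_mono) (use * in auto)
  also have "\<dots> = 2 ^ length bs * (C * B)"
    by (simp add: case_prod_unfold sum_list_triv length_splits)
  also have "\<dots> \<le> 2 ^ N * (C * B)"
    using bs(2) B C by (intro mult_right_mono power_increasing) auto
  finally show "(1 + norm x) ^ N * cmod (pderivs bs (\<lambda>x. m x * \<phi> x) x) \<le> 2 ^ N * (C * B)" .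
qed

lemma smooth_linear:
  assumes "smooth_fun_on UNIV \<phi>" "smooth_fun_on UNIV \<psi>"
  shows "smooth_fun_on UNIV (\<lambda>x. a * \<phi> x + b * \<psi> x)"
  by (rule smooth_add[OF open_UNIV smooth_mult[OF open_UNIV smooth_const[OF open_UNIV] assms(1)]
        smooth_mult[OF open_UNIV smooth_const[OF open_UNIV] assms(2)]])

lemma schwartz_linear:
  assumes "schwartz_fun \<phi>" "schwartz_fun \<psi>" shows "schwartz_fun (\<lambda>x. a * \<phi> x + b * \<psi> x)"
proof -
  have sm: "smooth_fun_on UNIV \<phi>" "smooth_fun_on UNIV \<psi>" using assms by (simp_all add: schwartz_fun_def)
  have "\<exists>B. schwartz_bound N (\<lambda>x. a * \<phi> x + b * \<psi> x) B" for N
  proof -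
    obtain A B where "schwartz_bound N \<phi> A" "schwartz_bound N \<psi> B" using assms schwartz_fun_iff by blast
    from schwartz_bound_linear[OF sm this] show ?thesis by blast
  qed
  thus ?thesis using smooth_linear[OF sm] by (simp add: schwartz_fun_iff)
qed

lemma schwartz_mult:
  assumes "smooth_fun_on UNIV m" "schwartz_fun \<phi>"
    "\<And>N. \<exists>C k. \<forall>bs x. set bs \<subseteq> Basis \<longrightarrow> length bs \<le> N \<longrightarrow> cmod (pderivs bs m x) \<le> C * (1 + norm x) ^ k"
  shows "schwartz_fun (\<lambda>x. m x * \<phi> x)"
  unfolding schwartz_fun_iff
proof (intro conjI allI)
  show "smooth_fun_on UNIV (\<lambda>x. m x * \<phi> x)"
    by (intro smooth_mult assms schwartz_smooth open_UNIV)
  fix N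
  obtain C k where C: "\<forall>bs x. set bs \<subseteq> Basis \<longrightarrow> length bs \<le> N \<longrightarrow> cmod (pderivs bs m x) \<le> C * (1 + norm x) ^ k"
    using assms(3) by blast
  obtain B where "schwartz_bound (N + k) \<phi> B" using assms(2) schwartz_fun_iff by blast
  thus "\<exists>B. schwartz_bound N (\<lambda>x. m x * \<phi> x) B"
    using schwartz_bound_mult[OF assms(1) schwartz_smooth[OF assms(2)]] C by meson
qed

lemma schwartz_bound_pderivs:
  assumes "schwartz_bound (N + length bs) \<phi> B" "set bs \<subseteq> Basis"
  shows "schwartz_bound N (pderivs bs \<phi>) B"
  unfolding schwartz_bound_def
proof (intro ballI allI)
  fix cs :: "'a list" and x assume "cs \<in> multi_indices N"
  hence "set (cs @ bs) \<subseteq> Basis" "length (cs @ bs) \<le> N + length bs" using assms(2) by (auto simp: multi_indices_def)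
  from schwartz_boundD[OF assms(1) this, of x]
  have "(1 + norm x) ^ (N + length bs) * cmod (pderivs cs (pderivs bs \<phi>) x) \<le> B" by (simp add: pderivs_append)
  moreover have "(1 + norm x) ^ N * cmod (pderivs cs (pderivs bs \<phi>) x) \<le>
      (1 + norm x) ^ (N + length bs) * cmod (pderivs cs (pderivs bs \<phi>) x)"
    by (intro mult_right_mono power_increasing) auto
  ultimately show "(1 + norm x) ^ N * cmod (pderivs cs (pderivs bs \<phi>) x) \<le> B" by linarith
qed

lemma schwartz_pderivs: "schwartz_fun \<phi> \<Longrightarrow> set bs \<subseteq> Basis \<Longrightarrow> schwartz_fun (pderivs bs \<phi>)"
  unfolding schwartz_fun_iff using schwartz_bound_pderivs smooth_pderivs by blast

lemma pderivs_inner_le: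
  assumes "set bs \<subseteq> Basis" "b \<in> Basis"
  shows "cmod (pderivs bs (\<lambda>x. complex_of_real (x \<bullet> b)) x) \<le> 1 * (1 + norm x) ^ 1"
\<comment> \<open>The last entry of the list is the derivative taken first, so the list is split at
  its end: one derivative leaves a constant of modulus at most 1, whose further derivatives
  vanish.\<close>
proof (cases bs rule: rev_cases)
  case Nil
  thus ?thesis using Basis_le_norm[OF assms(2), of x] by simp
next
  case (snoc cs c)
  have "frechet_derivative (\<lambda>x. complex_of_real (x \<bullet> b)) (at x) c = of_real (c \<bullet> b)" for x
    by (rule pd_eq) (auto intro!: derivative_eq_intros)
  hence "pderivs bs (\<lambda>x. complex_of_real (x \<bullet> b)) = pderivs cs (\<lambda>x. of_real (c \<bullet> b))"
    unfolding snoc pderivs_append by simp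
  moreover have "\<bar>c \<bullet> b\<bar> \<le> 1" using assms snoc by (auto simp: inner_Basis)
  ultimately show ?thesis using norm_ge_zero[of x]
    by (auto simp: pderivs_const intro: order_trans)
qed

lemma schwartz_bound_inner_mult:
  assumes "smooth_fun_on UNIV \<phi>" "b \<in> Basis" "schwartz_bound (N + 1) \<phi> B"
  shows "schwartz_bound N (\<lambda>x. of_real (x \<bullet> b) * \<phi> x) (2 ^ N * B)"
proof -
  have "schwartz_bound N (\<lambda>x. of_real (x \<bullet> b) * \<phi> x) (2 ^ N * (1 * B))"
    by (rule schwartz_bound_mult[OF smooth_inner[OF open_UNIV] assms(1,3)])
       (rule pderivs_inner_le[OF _ assms(2)])
  thus ?thesis by simp
qed

lemma schwartz_inner_mult:
  "schwartz_fun \<phi> \<Longrightarrow> b \<in> Basis \<Longrightarrow> schwartz_fun (\<lambda>x. of_real (x \<bullet> b) * \<phi> x)"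
  by (rule schwartz_mult[OF smooth_inner]) (auto intro!: exI[of _ 1] dest: pderivs_inner_le[of _ b])

lemma schwartz_reflect:
  assumes "schwartz_fun \<phi>" shows "schwartz_fun (\<lambda>x. \<phi> (- x))"
proof -
  have e: "(\<lambda>x. \<phi> (- x)) = (\<lambda>x. \<phi> ((-1) *\<^sub>R x))" by simp
  have "\<exists>B. schwartz_bound N (\<lambda>x. \<phi> (- x)) B" for N
  proof -
    obtain B where B: "schwartz_bound N \<phi> B" using assms schwartz_fun_iff by blast
    have "schwartz_bound N (\<lambda>x. \<phi> (- x)) B"
      unfolding schwartz_bound_def
    proof (intro ballI allI)
      fix bs :: "'a list" and x assume "bs \<in> multi_indices N"
      hence bs: "set bs \<subseteq> Basis" "length bs \<le> N" by (auto simp: multi_indices_def)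
      show "(1 + norm x) ^ N * cmod (pderivs bs (\<lambda>x. \<phi> (- x)) x) \<le> B"
        using schwartz_boundD[OF B bs, of "- x"]
        unfolding e pderivs_scale[OF schwartz_smooth[OF assms] bs(1)] by (simp add: norm_mult norm_power)
    qed
    thus ?thesis ..
  qed
  thus ?thesis unfolding schwartz_fun_iff e using smooth_scale[OF schwartz_smooth[OF assms], of "-1"] by simp
qed

lemma schwartz_cmult: "schwartz_fun \<phi> \<Longrightarrow> schwartz_fun (\<lambda>x. c * \<phi> x)"
  using schwartz_linear[of \<phi> \<phi> c 0] by simp

lemma schwartz_diff: "schwartz_fun \<phi> \<Longrightarrow> schwartz_fun \<psi> \<Longrightarrow> schwartz_fun (\<lambda>x. \<phi> x - \<psi> x)"
  using schwartz_linear[of \<phi> \<psi> 1 "-1"] by simp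

section \<open>Test functions\<close>

lemma test_smooth: "test_fun \<phi> \<Longrightarrow> smooth_fun_on UNIV \<phi>"
  by (simp add: test_fun_def)

lemma outside_supp: "x \<notin> supp \<phi> \<Longrightarrow> \<phi> x = 0"
  using closure_subset[of "{x. \<phi> x \<noteq> 0}"] by (auto simp: supp_def)

lemma pderivs_outside_supp:
  assumes "x \<notin> supp \<phi>" shows "pderivs bs \<phi> x = 0"
proof -
  have "pderivs bs \<phi> x = pderivs bs (\<lambda>_. 0) x"
    by (rule pderivs_cong_open[of "- supp \<phi>"]) (use assms in \<open>auto simp: supp_def dest: outside_supp[unfolded supp_def]\<close>)
  thus ?thesis by (simp add: pderivs_const)
qed

lemma test_schwartz:
  assumes "test_fun \<phi>" shows "schwartz_fun \<phi>"
  unfolding schwartz_fun_def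
proof (intro conjI allI impI)
  show sm: "smooth_fun_on UNIV \<phi>" using assms by (rule test_smooth)
  fix k and bs :: "'a list" assume bs: "set bs \<subseteq> Basis"
  let ?h = "\<lambda>x. (1 + norm x) ^ k * cmod (pderivs bs \<phi> x)"
  have "continuous_on (supp \<phi>) ?h"
    by (intro continuous_intros continuous_on_subset[OF pderivs_continuous[OF sm bs]]) auto
  hence "bounded (?h ` supp \<phi>)"
    using assms by (auto intro!: compact_imp_bounded compact_continuous_image simp: test_fun_def)
  then obtain B where B: "\<And>x. x \<in> supp \<phi> \<Longrightarrow> \<bar>?h x\<bar> \<le> B" by (auto simp: bounded_real)
  have "\<bar>?h x\<bar> \<le> max B 0" for x
    by (cases "x \<in> supp \<phi>") (use B[of x] in \<open>auto simp: pderivs_outside_supp\<close>)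
  thus "bounded (range ?h)" unfolding bounded_real by blast
qed

lemma test_bound:
  assumes "test_fun \<phi>"
  obtains C where "C \<ge> 0" "\<And>bs x. set bs \<subseteq> Basis \<Longrightarrow> length bs \<le> N \<Longrightarrow> cmod (pderivs bs \<phi> x) \<le> C"
proof -
  obtain C where C: "schwartz_bound N \<phi> C" using test_schwartz[OF assms] schwartz_fun_iff by blast
  have "cmod (pderivs bs \<phi> x) \<le> C" if "set bs \<subseteq> Basis" "length bs \<le> N" for bs x
  proof -
    have "1 * cmod (pderivs bs \<phi> x) \<le> (1 + norm x) ^ N * cmod (pderivs bs \<phi> x)"
      by (intro mult_right_mono one_le_power) auto
    thus ?thesis using schwartz_boundD[OF C that, of x] by simp
  qed
  thus ?thesis using that schwartz_bound_nonneg[OF C] by blast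
qed

lemma test_mult:
  assumes "test_fun \<eta>" "smooth_fun_on UNIV \<phi>"
  shows "test_fun (\<lambda>x. \<eta> x * \<phi> x)" "supp (\<lambda>x. \<eta> x * \<phi> x) \<subseteq> supp \<eta>"
proof -
  have *: "compact (supp \<eta>)" using assms(1) by (simp add: test_fun_def)
  have 0: "\<eta> x * \<phi> x = 0" if "x \<notin> supp \<eta>" for x using outside_supp[OF that] by simp
  show "test_fun (\<lambda>x. \<eta> x * \<phi> x)"
    unfolding test_fun_def
    using supp_compactI(2)[OF * 0] smooth_mult[OF open_UNIV test_smooth[OF assms(1)] assms(2)] by auto
  show "supp (\<lambda>x. \<eta> x * \<phi> x) \<subseteq> supp \<eta>" by (rule supp_compactI(1)[OF * 0])
qed

lemma schwartz_bound_test_mult: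
  assumes "test_fun \<eta>"
  obtains C where "C \<ge> 0" "\<And>\<phi> B. smooth_fun_on UNIV \<phi> \<Longrightarrow> schwartz_bound N \<phi> B \<Longrightarrow>
    schwartz_bound N (\<lambda>x. \<eta> x * \<phi> x) (C * B)"
proof -
  obtain C where C: "C \<ge> 0" "\<And>bs x. set bs \<subseteq> Basis \<Longrightarrow> length bs \<le> N \<Longrightarrow> cmod (pderivs bs \<eta> x) \<le> C"
    using test_bound[OF assms, of N] by auto
  show ?thesis
    by (rule that[of "2 ^ N * C"])
       (use C schwartz_bound_mult[OF test_smooth[OF assms], of _ N 0 _ C] in \<open>auto simp: mult.assoc\<close>)
qed

lemma schwartz_test_mult: "test_fun \<eta> \<Longrightarrow> schwartz_fun \<phi> \<Longrightarrow> schwartz_fun (\<lambda>x. \<eta> x * \<phi> x)"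
  using test_schwartz test_mult(1) schwartz_smooth by blast

section \<open>Tempered distributions\<close>

lemma tempered_linear:
  "tempered_distribution T \<Longrightarrow> schwartz_fun \<phi> \<Longrightarrow> schwartz_fun \<psi> \<Longrightarrow>
   T (\<lambda>x. a * \<phi> x + b * \<psi> x) = a * T \<phi> + b * T \<psi>"
  by (auto simp: tempered_distribution_def linear_functional_on_def)

text \<open>Each supremum is at most \<open>B\<close>, so the sum of seminorms is at most the number
  of multi-indices times \<open>B\<close>. The constant of the definition may be negative and is
  replaced by its absolute value, which is why the sum has to be shown nonnegative.\<close>

lemma tempered_bound:
  assumes "tempered_distribution T"
  obtains C N where "C \<ge> 0" "\<And>\<phi> B. schwartz_fun \<phi> \<Longrightarrow> schwartz_bound N \<phi> B \<Longrightarrow> cmod (T \<phi>) \<le> C * B"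
proof -
  obtain C N where CN: "\<And>\<phi>. schwartz_fun \<phi> \<Longrightarrow>
        cmod (T \<phi>) \<le> C * (\<Sum>bs\<in>multi_indices N. SUP x. (1 + norm x) ^ N * cmod (pderivs bs \<phi> x))"
    using assms unfolding tempered_distribution_def by blast
  show ?thesis
  proof (rule that[of "\<bar>C\<bar> * real (card (multi_indices N :: 'a list set))" N])
    fix \<phi> :: "'a \<Rightarrow> complex" and B assume \<phi>: "schwartz_fun \<phi>" "schwartz_bound N \<phi> B"
    let ?S = "\<Sum>bs\<in>multi_indices N. SUP x. (1 + norm x) ^ N * cmod (pderivs bs \<phi> x)"
    have S: "?S \<le> (\<Sum>bs\<in>(multi_indices N :: 'a list set). B)"
      by (intro sum_mono cSUP_least) (use \<phi>(2) in \<open>auto simp: schwartz_bound_def\<close>)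
    have "0 \<le> ?S"
    proof (intro sum_nonneg)
      fix bs :: "'a list" assume bs: "bs \<in> multi_indices N"
      have "0 \<le> (1 + norm (0::'a)) ^ N * cmod (pderivs bs \<phi> 0)" by simp
      also have "\<dots> \<le> (SUP x. (1 + norm x) ^ N * cmod (pderivs bs \<phi> x))"
        by (rule cSUP_upper) (use \<phi>(2) bs in \<open>auto simp: schwartz_bound_def intro!: bdd_aboveI\<close>)
      finally show "0 \<le> (SUP x. (1 + norm x) ^ N * cmod (pderivs bs \<phi> x))" .
    qed
    have "cmod (T \<phi>) \<le> \<bar>C\<bar> * ?S"
      using CN[OF \<phi>(1)] \<open>0 \<le> ?S\<close> by (meson abs_ge_self mult_right_mono order_trans)
    also have "\<dots> \<le> \<bar>C\<bar> * (\<Sum>bs\<in>(multi_indices N :: 'a list set). B)" using S by (intro mult_left_mono) auto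
    finally show "cmod (T \<phi>) \<le> \<bar>C\<bar> * real (card (multi_indices N :: 'a list set)) * B" by simp
  qed simp
qed

text \<open>The sum of the suprema is itself a \<open>schwartz_bound\<close>, since all summands are
  nonnegative; hence an estimate for arbitrary bounds implies the one in the definition.\<close>

lemma temperedI:
  assumes "\<And>\<phi> \<psi> a b. schwartz_fun \<phi> \<Longrightarrow> schwartz_fun \<psi> \<Longrightarrow> T (\<lambda>x. a * \<phi> x + b * \<psi> x) = a * T \<phi> + b * T \<psi>"
    and "\<And>\<phi> B. schwartz_fun \<phi> \<Longrightarrow> schwartz_bound N \<phi> B \<Longrightarrow> cmod (T \<phi>) \<le> C * B"
  shows "tempered_distribution T"
  unfolding tempered_distribution_def
proof (intro conjI exI allI impI)
  show "linear_functional_on {\<phi>. schwartz_fun \<phi>} T"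
    using assms(1) by (auto simp: linear_functional_on_def)
  fix \<phi> :: "'a \<Rightarrow> complex" assume \<phi>: "schwartz_fun \<phi>"
  obtain B where B: "schwartz_bound N \<phi> B" using \<phi> schwartz_fun_iff by blast
  let ?s = "\<lambda>bs. SUP x. (1 + norm x) ^ N * cmod (pderivs bs \<phi> x)"
  have up: "(1 + norm x) ^ N * cmod (pderivs bs \<phi> x) \<le> ?s bs" if "bs \<in> multi_indices N" for bs x
    by (rule cSUP_upper) (use B that in \<open>auto simp: schwartz_bound_def intro!: bdd_aboveI\<close>)
  have nn: "0 \<le> ?s bs" if "bs \<in> multi_indices N" for bs
    using up[OF that, of 0] by (meson norm_ge_zero mult_nonneg_nonneg zero_le_power add_nonneg_nonneg zero_le_one order_trans)
  have "schwartz_bound N \<phi> (\<Sum>bs\<in>multi_indices N. ?s bs)"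
    unfolding schwartz_bound_def
    by (intro ballI allI, rule order_trans[OF up], assumption, rule member_le_sum[where f = ?s])
       (use nn finite_multi_indices in auto)
  thus "cmod (T \<phi>) \<le> C * (\<Sum>bs\<in>multi_indices N. ?s bs)" using assms(2)[OF \<phi>] by blast
qed

lemma distribution_bound:
  assumes "distribution u" "compact K"
  obtains C N where "C \<ge> 0" "\<And>\<phi> B. test_fun \<phi> \<Longrightarrow> supp \<phi> \<subseteq> K \<Longrightarrow>
     (\<And>bs x. set bs \<subseteq> Basis \<Longrightarrow> length bs \<le> N \<Longrightarrow> cmod (pderivs bs \<phi> x) \<le> B) \<Longrightarrow> cmod (u \<phi>) \<le> C * B"
proof -
  obtain C N where CN: "\<And>\<phi>. test_fun \<phi> \<Longrightarrow> supp \<phi> \<subseteq> K \<Longrightarrow>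
        cmod (u \<phi>) \<le> C * (\<Sum>bs\<in>multi_indices N. SUP x. cmod (pderivs bs \<phi> x))"
    using assms unfolding distribution_def by meson
  show ?thesis
  proof (rule that[of "\<bar>C\<bar> * real (card (multi_indices N :: 'a list set))" N])
    fix \<phi> :: "'a \<Rightarrow> complex" and B assume \<phi>: "test_fun \<phi>" "supp \<phi> \<subseteq> K"
      "\<And>bs x. set bs \<subseteq> Basis \<Longrightarrow> length bs \<le> N \<Longrightarrow> cmod (pderivs bs \<phi> x) \<le> B"
    let ?S = "\<Sum>bs\<in>multi_indices N. SUP x. cmod (pderivs bs \<phi> x)"
    have S: "?S \<le> (\<Sum>bs\<in>(multi_indices N :: 'a list set). B)"
      by (intro sum_mono cSUP_least) (use \<phi>(3) in \<open>auto simp: multi_indices_def\<close>)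
    have "0 \<le> ?S"
    proof (intro sum_nonneg)
      fix bs :: "'a list" assume bs: "bs \<in> multi_indices N"
      have "0 \<le> cmod (pderivs bs \<phi> 0)" by simp
      also have "\<dots> \<le> (SUP x. cmod (pderivs bs \<phi> x))"
        by (rule cSUP_upper) (use \<phi>(3) bs in \<open>auto simp: multi_indices_def intro!: bdd_aboveI\<close>)
      finally show "0 \<le> (SUP x. cmod (pderivs bs \<phi> x))" .
    qed
    have "cmod (u \<phi>) \<le> \<bar>C\<bar> * ?S"
      using CN[OF \<phi>(1,2)] \<open>0 \<le> ?S\<close> by (meson abs_ge_self mult_right_mono order_trans)
    also have "\<dots> \<le> \<bar>C\<bar> * (\<Sum>bs\<in>(multi_indices N :: 'a list set). B)" using S by (intro mult_left_mono) auto
    finally show "cmod (u \<phi>) \<le> \<bar>C\<bar> * real (card (multi_indices N :: 'a list set)) * B" by simp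
  qed simp
qed

text \<open>On a compact set the weight \<open>(1 + norm x) ^ N\<close> is bounded, so weighted and
  unweighted suprema are comparable for functions supported there.\<close>

lemma tempered_imp_distribution:
  assumes "tempered_distribution T" shows "distribution T"
  unfolding distribution_def
proof (intro conjI allI impI)
  show "linear_functional_on {\<phi>. test_fun \<phi>} T"
    unfolding linear_functional_on_def using tempered_linear[OF assms] test_schwartz by blast
  fix K :: "'a set" assume "compact K"
  then obtain R where R: "\<And>x. x \<in> K \<Longrightarrow> norm x \<le> R" using compact_imp_bounded bounded_iff by metis
  obtain C N where CN: "C \<ge> 0" "\<And>\<phi> B. schwartz_fun \<phi> \<Longrightarrow> schwartz_bound N \<phi> B \<Longrightarrow> cmod (T \<phi>) \<le> C * B"
    using tempered_bound[OF assms] by blast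
  show "\<exists>C N. \<forall>\<phi>. test_fun \<phi> \<and> supp \<phi> \<subseteq> K \<longrightarrow>
      cmod (T \<phi>) \<le> C * (\<Sum>bs\<in>multi_indices N. SUP x. cmod (pderivs bs \<phi> x))"
  proof (intro exI allI impI)
    fix \<phi> :: "'a \<Rightarrow> complex" assume \<phi>: "test_fun \<phi> \<and> supp \<phi> \<subseteq> K"
    let ?s = "\<lambda>bs. SUP x. cmod (pderivs bs \<phi> x)"
    obtain B where B: "\<And>bs x. set bs \<subseteq> Basis \<Longrightarrow> length bs \<le> N \<Longrightarrow> cmod (pderivs bs \<phi> x) \<le> B"
      using test_bound[OF conjunct1[OF \<phi>], of N] by blast
    have up: "cmod (pderivs bs \<phi> x) \<le> ?s bs" if "bs \<in> multi_indices N" for bs x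
      by (rule cSUP_upper) (use B that in \<open>auto simp: multi_indices_def intro!: bdd_aboveI\<close>)
    have nn: "0 \<le> ?s bs" if "bs \<in> multi_indices N" for bs
      using up[OF that, of 0] by (meson norm_ge_zero order_trans)
    have "schwartz_bound N \<phi> ((1 + max R 0) ^ N * (\<Sum>bs\<in>multi_indices N. ?s bs))"
      unfolding schwartz_bound_def
    proof (intro ballI allI)
      fix bs :: "'a list" and x assume bs: "bs \<in> multi_indices N"
      have S: "cmod (pderivs bs \<phi> x) \<le> (\<Sum>bs\<in>multi_indices N. ?s bs)"
        by (rule order_trans[OF up[OF bs]], rule member_le_sum[where f = ?s])
           (use bs nn finite_multi_indices in auto)
      show "(1 + norm x) ^ N * cmod (pderivs bs \<phi> x) \<le> (1 + max R 0) ^ N * (\<Sum>bs\<in>multi_indices N. ?s bs)"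
      proof (cases "x \<in> supp \<phi>")
        case True
        hence "norm x \<le> max R 0" using R \<phi> by (meson max.coboundedI1 subset_iff)
        thus ?thesis by (intro mult_mono power_mono S) auto
      next
        case False
        thus ?thesis using order_trans[OF norm_ge_zero S] by (simp add: pderivs_outside_supp)
      qed
    qed
    from CN(2)[OF test_schwartz this] \<phi>
    show "cmod (T \<phi>) \<le> C * (1 + max R 0) ^ N * (\<Sum>bs\<in>multi_indices N. ?s bs)" by (simp add: mult.assoc)
  qed
qed

lemma tempered_mult_distr:
  assumes "tempered_distribution T" "test_fun \<eta>"
  shows "tempered_distribution (mult_distr \<eta> T)"
proof -
  obtain C N where CN: "C \<ge> 0" "\<And>\<phi> B. schwartz_fun \<phi> \<Longrightarrow> schwartz_bound N \<phi> B \<Longrightarrow> cmod (T \<phi>) \<le> C * B"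
    using tempered_bound[OF assms(1)] by blast
  obtain D where D: "D \<ge> 0" "\<And>\<phi> B. smooth_fun_on UNIV \<phi> \<Longrightarrow> schwartz_bound N \<phi> B \<Longrightarrow>
    schwartz_bound N (\<lambda>x. \<eta> x * \<phi> x) (D * B)" using schwartz_bound_test_mult[OF assms(2)] by blast
  show ?thesis
  proof (rule temperedI)
    fix \<phi> \<psi> :: "'a \<Rightarrow> complex" and a b assume \<phi>: "schwartz_fun \<phi>" "schwartz_fun \<psi>"
    have "(\<lambda>x. \<eta> x * (a * \<phi> x + b * \<psi> x)) = (\<lambda>x. a * (\<eta> x * \<phi> x) + b * (\<eta> x * \<psi> x))"
      by (simp add: algebra_simps)
    thus "mult_distr \<eta> T (\<lambda>x. a * \<phi> x + b * \<psi> x) = a * mult_distr \<eta> T \<phi> + b * mult_distr \<eta> T \<psi>"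
      using tempered_linear[OF assms(1)] schwartz_test_mult[OF assms(2)] \<phi> by (simp add: mult_distr_def)
  next
    fix \<phi> :: "'a \<Rightarrow> complex" and B assume \<phi>: "schwartz_fun \<phi>" "schwartz_bound N \<phi> B"
    show "cmod (mult_distr \<eta> T \<phi>) \<le> (C * D) * B"
      using CN(2)[OF schwartz_test_mult[OF assms(2) \<phi>(1)] D(2)[OF schwartz_smooth[OF \<phi>(1)] \<phi>(2)]]
      by (simp add: mult_distr_def mult.assoc)
  qed
qed

text \<open>The cutoffs are \<open>\<kappa> (c j *\<^sub>R x)\<close>. The part of
  \<open>\<phi>\<close> that they remove vanishes for \<open>norm x < real j + 1\<close>, and
  elsewhere \<open>(1 + norm x) / (real j + 1)\<close> is at least 1, so one more power of the
  weight on \<open>\<phi>\<close> buys the rate \<open>1 / (real j + 1)\<close>. The explicit rate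
  expresses convergence in all seminorms without a topology on the Schwartz space.\<close>

lemma schwartz_approx:
  assumes "schwartz_fun \<phi>"
  obtains \<phi>s where "\<And>j::nat. test_fun (\<phi>s j)" "\<And>j x. cmod (\<phi>s j x) \<le> cmod (\<phi> x)"
    "\<And>x. (\<lambda>j. \<phi>s j x) \<longlonglongrightarrow> \<phi> x"
    "\<And>N. \<exists>B. \<forall>j. schwartz_bound N (\<lambda>x. \<phi> x - \<phi>s j x) (B / (real j + 1))"
proof -
  obtain \<kappa> :: "'a \<Rightarrow> complex" where \<kappa>: "test_fun \<kappa>" "\<And>x. x \<in> cball 0 1 \<Longrightarrow> \<kappa> x = 1" "\<And>x. cmod (\<kappa> x) \<le> 1"
    using exists_cutoff[of 1 0] by (metis zero_less_one)
  have sm: "smooth_fun_on UNIV \<kappa>" by (rule test_smooth[OF \<kappa>(1)])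
  define c where "c j = inverse (real j + 1)" for j
  have c: "0 < c j" "c j \<le> 1" for j by (auto simp: c_def field_simps)
  define \<kappa>s where "\<kappa>s j x = \<kappa> (c j *\<^sub>R x)" for j x
  have sms: "smooth_fun_on UNIV (\<kappa>s j)" for j unfolding \<kappa>s_def by (rule smooth_scale[OF sm])
  have t: "test_fun (\<kappa>s j)" for j
  proof -
    have K: "compact ((\<lambda>x. inverse (c j) *\<^sub>R x) ` supp \<kappa>)"
      using \<kappa>(1) by (intro compact_scaling) (simp add: test_fun_def)
    have "\<kappa>s j x = 0" if "x \<notin> (\<lambda>x. inverse (c j) *\<^sub>R x) ` supp \<kappa>" for x
    proof -
      have "c j *\<^sub>R x \<notin> supp \<kappa>"
      proof
        assume "c j *\<^sub>R x \<in> supp \<kappa>"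
        hence "inverse (c j) *\<^sub>R (c j *\<^sub>R x) \<in> (\<lambda>x. inverse (c j) *\<^sub>R x) ` supp \<kappa>" by (rule imageI)
        thus False using that c(1)[of j] by simp
      qed
      thus ?thesis unfolding \<kappa>s_def by (rule outside_supp)
    qed
    from supp_compactI(2)[OF K this] show ?thesis using sms by (simp add: test_fun_def)
  qed
  define m where "m j x = 1 * 1 + (-1) * \<kappa>s j x" for j and x
  have smm: "smooth_fun_on UNIV (m j)" for j
    unfolding m_def by (intro smooth_add smooth_mult smooth_const sms open_UNIV)
  have m0: "m j x = 0" if "norm x < real j + 1" for j x
  proof -
    have "norm (c j *\<^sub>R x) \<le> 1" using that by (simp add: c_def field_simps)
    thus ?thesis using \<kappa>(2)[of "c j *\<^sub>R x"] by (simp add: m_def \<kappa>s_def)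
  qed
  show ?thesis
  proof (rule that[of "\<lambda>j x. \<kappa>s j x * \<phi> x"])
    show "test_fun (\<lambda>x. \<kappa>s j x * \<phi> x)" for j by (rule test_mult(1)[OF t schwartz_smooth[OF assms]])
    show "cmod (\<kappa>s j x * \<phi> x) \<le> cmod (\<phi> x)" for j x
      using \<kappa>(3)[of "c j *\<^sub>R x"] by (simp add: \<kappa>s_def norm_mult mult_left_le_one_le)
    show "(\<lambda>j. \<kappa>s j x * \<phi> x) \<longlonglongrightarrow> \<phi> x" for x
    proof (rule tendsto_eventually)
      obtain j0 :: nat where "norm x < real j0" using reals_Archimedean2 by blast
      hence "\<kappa>s j x = 1" if "j \<ge> j0" for j using m0[of x j] that by (simp add: m_def)
      thus "\<forall>\<^sub>F j in sequentially. \<kappa>s j x * \<phi> x = \<phi> x" unfolding eventually_sequentially by auto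
    qed
    fix N
    obtain C where C: "C \<ge> 0" "\<And>bs x. set bs \<subseteq> Basis \<Longrightarrow> length bs \<le> N \<Longrightarrow> cmod (pderivs bs \<kappa> x) \<le> C"
      using test_bound[OF \<kappa>(1), of N] by auto
    obtain B where B: "schwartz_bound (N + 1) \<phi> B" using assms schwartz_fun_iff by blast
    have "schwartz_bound N (\<lambda>x. m j x * \<phi> x) (2 ^ N * ((1 + C) / (real j + 1) * B))" for j
    proof (rule schwartz_bound_mult[OF smm schwartz_smooth[OF assms] B])
      fix bs :: "'a list" and x assume bs: "set bs \<subseteq> Basis" "length bs \<le> N"
      show "cmod (pderivs bs (m j) x) \<le> (1 + C) / (real j + 1) * (1 + norm x) ^ 1"
      proof (cases "norm x < real j + 1")
        case True
        have "pderivs bs (m j) x = pderivs bs (\<lambda>_. 0) x"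
          by (rule pderivs_cong_open[of "ball 0 (real j + 1)"]) (use True m0 in auto)
        thus ?thesis using C(1) by (simp add: pderivs_const)
      next
        case False
        have "pderivs bs (m j) x = 1 * pderivs bs (\<lambda>_. 1) x + (-1) * pderivs bs (\<kappa>s j) x"
          unfolding m_def by (simp only: pderivs_linear[OF smooth_const[OF open_UNIV] sms bs(1)])
        hence "cmod (pderivs bs (m j) x) \<le> cmod (pderivs bs (\<lambda>_. 1) x) + cmod (pderivs bs (\<kappa>s j) x)"
          by (simp add: norm_triangle_ineq4)
        also have "\<dots> \<le> 1 + C"
        proof (rule add_mono)
          show "cmod (pderivs bs (\<lambda>_. 1) x) \<le> 1" by (simp add: pderivs_const)
          \<comment> \<open>Each derivative of the dilated cutoff produces a factor
            \<open>c j \<le> 1\<close>, so the bound is uniform in \<open>j\<close>.\<close>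
          have "cmod (pderivs bs (\<kappa>s j) x) = c j ^ length bs * cmod (pderivs bs \<kappa> (c j *\<^sub>R x))"
            unfolding \<kappa>s_def pderivs_scale[OF sm bs(1)] using c(1)[of j] by (simp add: norm_mult norm_power)
          also have "\<dots> \<le> 1 * C"
            using c[of j] C bs by (intro mult_mono power_le_one) auto
          finally show "cmod (pderivs bs (\<kappa>s j) x) \<le> C" by simp
        qed
        also have "\<dots> \<le> (1 + C) / (real j + 1) * (1 + norm x) ^ 1"
        proof -
          have "(1 + C) * (real j + 1) \<le> (1 + C) * (1 + norm x)" using False C(1) by (intro mult_left_mono) auto
          thus ?thesis by (simp add: field_simps)
        qed
        finally show ?thesis .
      qed
    qed
    moreover have "(\<lambda>x. m j x * \<phi> x) = (\<lambda>x. \<phi> x - \<kappa>s j x * \<phi> x)" for j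
      by (auto simp: m_def algebra_simps)
    ultimately show "\<exists>B. \<forall>j. schwartz_bound N (\<lambda>x. \<phi> x - \<kappa>s j x * \<phi> x) (B / (real j + 1))"
      by (intro exI[of _ "2 ^ N * (1 + C) * B"]) (simp add: mult.assoc)
  qed
qed

lemma tempered_tendsto:
  assumes "tempered_distribution T" "schwartz_fun \<phi>" "\<And>j. schwartz_fun (\<phi>s j)"
    "\<And>N. \<exists>B. \<forall>j::nat. schwartz_bound N (\<lambda>x. \<phi> x - \<phi>s j x) (B / (real j + 1))"
  shows "(\<lambda>j. T (\<phi>s j)) \<longlonglongrightarrow> T \<phi>"
proof -
  obtain C N where CN: "C \<ge> 0" "\<And>\<phi> B. schwartz_fun \<phi> \<Longrightarrow> schwartz_bound N \<phi> B \<Longrightarrow> cmod (T \<phi>) \<le> C * B"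
    using tempered_bound[OF assms(1)] by blast
  obtain B where B: "\<And>j. schwartz_bound N (\<lambda>x. \<phi> x - \<phi>s j x) (B / (real j + 1))" using assms(4) by blast
  have lin: "T (\<lambda>x. \<phi> x - \<phi>s j x) = T \<phi> - T (\<phi>s j)" for j
    using tempered_linear[OF assms(1,2) assms(3), of 1 "-1" j] by simp
  have "cmod (T (\<phi>s j) - T \<phi>) \<le> C * B / (real j + 1)" for j
    using CN(2)[OF schwartz_diff[OF assms(2,3)] B, of j] unfolding lin by (simp add: norm_minus_commute)
  moreover have "(\<lambda>j. C * B / (real j + 1)) \<longlonglongrightarrow> 0"
    using tendsto_mult[OF tendsto_const[of "C * B"] LIMSEQ_inverse_real_of_nat]
    by (simp add: divide_inverse add.commute)
  ultimately have "(\<lambda>j. T (\<phi>s j) - T \<phi>) \<longlonglongrightarrow> 0"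
    by (rule Lim_null_comparison[OF always_eventually[OF allI]])
  thus ?thesis by (simp add: LIM_zero_iff)
qed

text \<open>Test functions are dense in the Schwartz space, and tempered distributions are
  continuous along the approximating sequences.\<close>

lemma tempered_eqI:
  assumes "tempered_distribution T" "tempered_distribution T'" "\<And>\<phi>. test_fun \<phi> \<Longrightarrow> T \<phi> = T' \<phi>" "schwartz_fun \<phi>"
  shows "T \<phi> = T' \<phi>"
proof -
  obtain \<phi>s where \<phi>s: "\<And>j::nat. test_fun (\<phi>s j)"
    "\<And>N. \<exists>B. \<forall>j. schwartz_bound N (\<lambda>x. \<phi> x - \<phi>s j x) (B / (real j + 1))"
    using schwartz_approx[OF assms(4)] by metis
  show ?thesis
    using tempered_tendsto[OF assms(1,4) test_schwartz[OF \<phi>s(1)] \<phi>s(2)]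
      tempered_tendsto[OF assms(2,4) test_schwartz[OF \<phi>s(1)] \<phi>s(2)] assms(3)[OF \<phi>s(1)]
    by (auto intro: LIMSEQ_unique)
qed

section \<open>Integration on Euclidean space\<close>

text \<open>\<open>lborel\<close> is the image of a product of one-dimensional Lebesgue measures
  under the coordinate map, so Fubini for product measures applies.\<close>

lemma integrable_prod_Basis:
  fixes f :: "'a::euclidean_space \<Rightarrow> real \<Rightarrow> 'b::{real_normed_field,banach,second_countable_topology}"
  assumes "\<And>b. b \<in> Basis \<Longrightarrow> integrable lborel (f b)"
  shows "integrable lborel (\<lambda>x::'a. \<Prod>b\<in>Basis. f b (x \<bullet> b))"
    and "(\<integral>x. (\<Prod>b\<in>Basis. f b ((x::'a) \<bullet> b)) \<partial>lborel) = (\<Prod>b\<in>Basis. \<integral>t. f b t \<partial>lborel)"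
proof -
  interpret product_sigma_finite "\<lambda>_::'a. lborel :: real measure" by standard
  let ?h = "\<lambda>g::'a \<Rightarrow> real. \<Sum>b\<in>Basis. g b *\<^sub>R b"
  have [measurable]: "?h \<in> (\<Pi>\<^sub>M b\<in>Basis. lborel) \<rightarrow>\<^sub>M borel" by measurable
  have [measurable]: "f b \<in> borel_measurable borel" if "b \<in> Basis" for b
    using borel_measurable_integrable[OF assms[OF that]] by simp
  have [measurable]: "(\<lambda>x::'a. \<Prod>b\<in>Basis. f b (x \<bullet> b)) \<in> borel_measurable borel" by measurable
  have eq: "(\<Prod>b\<in>Basis. f b (?h g \<bullet> b)) = (\<Prod>b\<in>Basis. f b (g b))" for g
    by (intro prod.cong refl) simp
  show "integrable lborel (\<lambda>x::'a. \<Prod>b\<in>Basis. f b (x \<bullet> b))"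
    by (subst lborel_eq, subst integrable_distr_eq)
       (auto simp: eq intro!: product_integrable_prod assms simp del: inner_sum_left_Basis)
  show "(\<integral>x. (\<Prod>b\<in>Basis. f b ((x::'a) \<bullet> b)) \<partial>lborel) = (\<Prod>b\<in>Basis. \<integral>t. f b t \<partial>lborel)"
    by (subst lborel_eq, subst integral_distr)
       (auto simp: eq intro!: product_integral_prod assms simp del: inner_sum_left_Basis)
qed

text \<open>Each factor \<open>1 + (x \<bullet> b)\<^sup>2\<close> is at most
  \<open>(1 + norm x)\<^sup>2\<close>, so decay of order twice the dimension is dominated by a
  product of integrable functions of one variable. This is the source of the exponents
  \<open>2 * DIM('a)\<close> below.\<close>

lemma integrable_decay:
  assumes "k \<ge> 2 * DIM('a::euclidean_space)"
  shows "integrable lborel (\<lambda>x::'a. inverse ((1 + norm x) ^ k))"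
proof (rule Bochner_Integration.integrable_bound)
  have "integrable lborel (\<lambda>x::real. inverse (1 + x\<^sup>2))"
    using integrable_inverse_1_plus_square by (simp add: set_integrable_def einterval_def)
  thus "integrable lborel (\<lambda>x::'a. \<Prod>b\<in>Basis. inverse (1 + (x \<bullet> b)\<^sup>2))"
    by (rule integrable_prod_Basis(1)[of "\<lambda>b x. inverse (1 + x\<^sup>2)"])
  show "AE x::'a in lborel. norm (inverse ((1 + norm x) ^ k)) \<le> norm (\<Prod>b\<in>Basis. inverse (1 + (x \<bullet> b)\<^sup>2))"
  proof (intro AE_I2)
    fix x :: 'a
    have *: "1 + (x \<bullet> b)\<^sup>2 \<le> (1 + norm x)\<^sup>2" if "b \<in> Basis" for b
    proof -
      have "(x \<bullet> b)\<^sup>2 \<le> (norm x)\<^sup>2" using power_mono[OF Basis_le_norm[OF that, of x], of 2] by simp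
      moreover have "(1 + norm x)\<^sup>2 = 1 + 2 * norm x + (norm x)\<^sup>2" by (simp add: power2_eq_square algebra_simps)
      ultimately show ?thesis using norm_ge_zero[of x] by linarith
    qed
    have "(\<Prod>b\<in>Basis. 1 + (x \<bullet> b)\<^sup>2) \<le> (\<Prod>b\<in>(Basis :: 'a set). (1 + norm x)\<^sup>2)"
      by (intro prod_mono) (use * in auto)
    also have "\<dots> = (1 + norm x) ^ (2 * DIM('a))" by (simp add: power_mult)
    also have "\<dots> \<le> (1 + norm x) ^ k" using assms by (intro power_increasing) auto
    finally have "(\<Prod>b\<in>Basis. 1 + (x \<bullet> b)\<^sup>2) \<le> (1 + norm x) ^ k" .
    moreover have "(\<Prod>b\<in>Basis. 1 + (x \<bullet> b)\<^sup>2) > 0" by (intro prod_pos) (auto simp: add_pos_nonneg)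
    ultimately have "inverse ((1 + norm x) ^ k) \<le> inverse (\<Prod>b\<in>Basis. 1 + (x \<bullet> b)\<^sup>2)"
      by (rule le_imp_inverse_le)
    thus "norm (inverse ((1 + norm x) ^ k)) \<le> norm (\<Prod>b\<in>Basis. inverse (1 + (x \<bullet> b)\<^sup>2))"
      by (simp add: prod_inversef[symmetric] o_def)
  qed
qed simp

lemma nn_integral_affine:
  fixes f :: "'a::euclidean_space \<Rightarrow> ennreal"
  assumes [measurable]: "f \<in> borel_measurable borel" and "c \<noteq> 0"
  shows "(\<integral>\<^sup>+x. f x \<partial>lborel) = ennreal (\<bar>c\<bar> ^ DIM('a)) * (\<integral>\<^sup>+x. f (t + c *\<^sub>R x) \<partial>lborel)"
  by (subst (1) lborel_affine[OF assms(2), of t], subst nn_integral_density,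
      simp_all add: assms(2) nn_integral_distr nn_integral_cmult)

lemma integrable_affine_iff:
  fixes f :: "'a::euclidean_space \<Rightarrow> complex"
  assumes [measurable]: "f \<in> borel_measurable borel" and "c \<noteq> 0"
  shows "integrable lborel (\<lambda>x. f (t + c *\<^sub>R x)) \<longleftrightarrow> integrable lborel f"
  unfolding integrable_iff_bounded
  using assms(2) by (subst nn_integral_affine[of _ c t]) (auto simp: ennreal_mult_less_top)

lemma lborel_integral_affine:
  fixes f :: "'a::euclidean_space \<Rightarrow> complex"
  assumes [measurable]: "f \<in> borel_measurable borel" and "c \<noteq> 0"
  shows "(\<integral>x. f x \<partial>lborel) = of_real (\<bar>c\<bar> ^ DIM('a)) * (\<integral>x. f (t + c *\<^sub>R x) \<partial>lborel)"
  by (subst (1) lborel_affine[OF assms(2), of t], subst integral_density,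
      simp_all add: assms(2) integral_distr scaleR_conv_of_real)

lemma AE_affine:
  fixes t :: "'a::euclidean_space"
  assumes "c \<noteq> 0" "AE x in lborel. P x" shows "AE x in lborel. P (t + c *\<^sub>R x)"
proof -
  obtain N where N: "{x. \<not> P x} \<subseteq> N" "N \<in> null_sets lborel" using assms(2) by (auto elim!: AE_E simp: null_sets_def)
  hence [measurable]: "N \<in> sets borel" by auto
  have "0 = (\<integral>\<^sup>+x. indicator N x \<partial>lborel)" using N by (simp add: null_setsD1)
  also have "\<dots> = ennreal (\<bar>c\<bar> ^ DIM('a)) * (\<integral>\<^sup>+x. indicator N (t + c *\<^sub>R x) \<partial>lborel)"
    by (rule nn_integral_affine) (use assms in auto)
  finally have "(\<integral>\<^sup>+x. indicator N (t + c *\<^sub>R x) \<partial>lborel) = 0" using assms(1) by auto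
  hence "AE x in lborel. indicator N (t + c *\<^sub>R x) = (0::ennreal)"
    by (subst (asm) nn_integral_0_iff_AE) auto
  thus ?thesis by (rule AE_mp) (use N in \<open>auto simp: indicator_def split: if_splits\<close>)
qed

lemma integrable_pairI:
  fixes H :: "'a::euclidean_space \<Rightarrow> 'b::euclidean_space \<Rightarrow> complex"
  assumes [measurable]: "case_prod H \<in> borel_measurable (lborel \<Otimes>\<^sub>M lborel)"
    and "(\<integral>\<^sup>+x. \<integral>\<^sup>+y. ennreal (cmod (H x y)) \<partial>lborel \<partial>lborel) < \<infinity>"
  shows "integrable (lborel \<Otimes>\<^sub>M lborel) (case_prod H)"
proof (rule integrableI_bounded)
  have "(\<integral>\<^sup>+z. ennreal (cmod (case_prod H z)) \<partial>(lborel \<Otimes>\<^sub>M lborel)) =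
      (\<integral>\<^sup>+x. \<integral>\<^sup>+y. ennreal (cmod (H x y)) \<partial>lborel \<partial>lborel)"
    by (subst lborel.nn_integral_fst[symmetric]) auto
  thus "(\<integral>\<^sup>+z. ennreal (norm (case_prod H z)) \<partial>(lborel \<Otimes>\<^sub>M lborel)) < \<infinity>" using assms(2) by simp
qed fact

lemma nn_integral_less_top: "integrable M f \<Longrightarrow> (\<integral>\<^sup>+x. ennreal (cmod (f x)) \<partial>M) < \<infinity>"
  by (simp add: integrable_iff_bounded)

section \<open>The Fourier transform of Schwartz functions\<close>

lemma schwartz_measurable: "schwartz_fun \<phi> \<Longrightarrow> \<phi> \<in> borel_measurable borel"
  by (intro borel_measurable_continuous_onI smooth_continuous schwartz_smooth)

lemma schwartz_decay:
  assumes "schwartz_fun \<phi>" obtains B where "B \<ge> 0" "\<And>x. cmod (\<phi> x) \<le> B * inverse ((1 + norm x) ^ k)"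
proof -
  obtain B where B: "schwartz_bound k \<phi> B" using assms schwartz_fun_iff by blast
  have "cmod (\<phi> x) \<le> B * inverse ((1 + norm x) ^ k)" for x
    using schwartz_boundD[OF B, of "[]" x] by (simp add: field_simps add_pos_nonneg)
  thus ?thesis using that schwartz_bound_nonneg[OF B] by blast
qed

lemma schwartz_weight_integrable:
  fixes \<phi> :: "'a::euclidean_space \<Rightarrow> complex"
  assumes "schwartz_fun \<phi>" shows "integrable lborel (\<lambda>x. (1 + norm x) ^ k * cmod (\<phi> x))"
proof -
  note [measurable] = schwartz_measurable[OF assms]
  obtain B where B: "B \<ge> 0" "\<And>x. cmod (\<phi> x) \<le> B * inverse ((1 + norm x) ^ (k + 2 * DIM('a)))"
    using schwartz_decay[OF assms, of "k + 2 * DIM('a)"] by blast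
  show ?thesis
  proof (rule Bochner_Integration.integrable_bound)
    show "integrable lborel (\<lambda>x::'a. B * inverse ((1 + norm x) ^ (2 * DIM('a))))"
      by (intro integrable_mult_right integrable_decay) simp
    have "(1 + norm x) ^ k * cmod (\<phi> x) \<le> B * inverse ((1 + norm x) ^ (2 * DIM('a)))" for x
    proof -
      have p: "1 + norm x > 0" by (simp add: add_pos_nonneg)
      have "(1 + norm x) ^ k * cmod (\<phi> x) \<le> (1 + norm x) ^ k * (B * inverse ((1 + norm x) ^ (k + 2 * DIM('a))))"
        by (intro mult_left_mono B) auto
      also have "\<dots> = B * inverse ((1 + norm x) ^ (2 * DIM('a)))" using p by (simp add: power_add field_simps)
      finally show ?thesis .
    qed
    thus "AE x in lborel. norm ((1 + norm x) ^ k * cmod (\<phi> x)) \<le> norm (B * inverse ((1 + norm x) ^ (2 * DIM('a))))"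
      using B(1) by (intro AE_I2) simp
  qed simp
qed

lemma schwartz_integrable: "schwartz_fun \<phi> \<Longrightarrow> integrable lborel \<phi>"
  using schwartz_weight_integrable[of \<phi> 0] schwartz_measurable[of \<phi>]
  by (simp add: integrable_norm_iff)

lemma schwartz_bounded:
  assumes "schwartz_fun \<phi>" obtains B where "B \<ge> 0" "\<And>x. cmod (\<phi> x) \<le> B"
  using schwartz_decay[OF assms, of 0] by auto

lemma integral_bound_schwartz:
  fixes \<phi> :: "'a::euclidean_space \<Rightarrow> complex"
  assumes "schwartz_fun \<phi>" "schwartz_bound (2 * DIM('a)) \<phi> B"
  shows "(\<integral>x. cmod (\<phi> x) \<partial>lborel) \<le> (\<integral>x. inverse ((1 + norm (x::'a)) ^ (2 * DIM('a))) \<partial>lborel) * B"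
proof -
  have "(\<integral>x. cmod (\<phi> x) \<partial>lborel) \<le> (\<integral>x. inverse ((1 + norm (x::'a)) ^ (2 * DIM('a))) * B \<partial>lborel)"
  proof (rule integral_mono)
    show "integrable lborel (\<lambda>x. cmod (\<phi> x))" using schwartz_integrable[OF assms(1)] by simp
    show "integrable lborel (\<lambda>x::'a. inverse ((1 + norm x) ^ (2 * DIM('a))) * B)"
      by (intro integrable_mult_left integrable_decay) simp
    show "cmod (\<phi> x) \<le> inverse ((1 + norm x) ^ (2 * DIM('a))) * B" for x
      using schwartz_boundD[OF assms(2), of "[]" x] by (simp add: field_simps add_pos_nonneg)
  qed
  thus ?thesis by simp
qed

lemma cmod_exp_i: "cmod (exp (- \<i> * complex_of_real t)) = 1" "cmod (exp (\<i> * complex_of_real t)) = 1"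
  using norm_exp_i_times[of "-t"] norm_exp_i_times[of t] by simp_all

lemma fourier_kernel_integrable:
  assumes "integrable lborel (f :: 'a::euclidean_space \<Rightarrow> complex)"
  shows "integrable lborel (\<lambda>x. exp (- \<i> * complex_of_real (x \<bullet> \<xi>)) * f x)"
  by (rule Bochner_Integration.integrable_bound[OF assms])
     (use borel_measurable_integrable[OF assms] in \<open>auto simp: norm_mult cmod_exp_i\<close>)

lemma fourier_norm_le: "cmod (fourier f \<xi>) \<le> (\<integral>x. cmod (f x) \<partial>lborel)"
  unfolding fourier_def
  by (rule order_trans[OF integral_norm_bound]) (simp add: norm_mult cmod_exp_i)

lemma fourier_linear:
  assumes "integrable lborel f" "integrable lborel g"
  shows "fourier (\<lambda>x. a * f x + b * g x) \<xi> = a * fourier f \<xi> + b * fourier g \<xi>"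
proof -
  let ?e = "\<lambda>x. exp (- \<i> * complex_of_real (x \<bullet> \<xi>))"
  have "fourier (\<lambda>x. a * f x + b * g x) \<xi> = (\<integral>x. a * (?e x * f x) + b * (?e x * g x) \<partial>lborel)"
    unfolding fourier_def by (simp add: algebra_simps)
  also have "\<dots> = (\<integral>x. a * (?e x * f x) \<partial>lborel) + (\<integral>x. b * (?e x * g x) \<partial>lborel)"
    by (intro Bochner_Integration.integral_add integrable_mult_right fourier_kernel_integrable assms)
  finally show ?thesis unfolding fourier_def by (simp only: integral_mult_right_zero)
qed

lemma fourier_cmult: "fourier (\<lambda>x. c * f x) \<xi> = c * fourier f \<xi>"
  unfolding fourier_def by (subst Bochner_Integration.integral_mult_right_zero[symmetric]) (simp add: algebra_simps)

section \<open>Derivatives of Fourier transforms\<close>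

lemma exp_i_approx: "cmod (exp (- \<i> * complex_of_real t) - 1 + \<i> * complex_of_real t) \<le> t\<^sup>2"
proof -
  have "cmod (iexp (- t) - (\<Sum>k\<le>1. (\<i> * complex_of_real (- t)) ^ k / fact k)) \<le> \<bar>- t\<bar> ^ Suc 1 / fact (Suc 1)"
    by (rule iexp_approx1)
  also have "(\<Sum>k\<le>1. (\<i> * complex_of_real (- t)) ^ k / fact k) = 1 - \<i> * complex_of_real t" by simp
  also have "\<bar>- t\<bar> ^ Suc 1 / fact (Suc 1) \<le> t\<^sup>2" by (simp add: power2_eq_square)
  finally show ?thesis by (simp add: algebra_simps)
qed

text \<open>Differentiation under the integral sign with an explicit remainder: the second-order
  error of the exponential is at most \<open>(x \<bullet> h)\<^sup>2\<close>, so the total error is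
  at most \<open>(norm h)\<^sup>2\<close> times a weighted integral of
  \<open>\<phi>\<close>.\<close>

lemma fourier_has_derivative:
  fixes \<phi> :: "'a::euclidean_space \<Rightarrow> complex"
  assumes "schwartz_fun \<phi>"
  shows "(fourier \<phi> has_derivative
     (\<lambda>h. \<Sum>b\<in>Basis. of_real (h \<bullet> b) * fourier (\<lambda>x. - \<i> * (of_real (x \<bullet> b) * \<phi> x)) \<xi>)) (at \<xi>)"
proof -
  note [measurable] = schwartz_measurable[OF assms]
  let ?D = "\<lambda>h. \<Sum>b\<in>Basis. of_real (h \<bullet> b) * fourier (\<lambda>x. - \<i> * (of_real (x \<bullet> b) * \<phi> x)) \<xi>"
  define C where "C = (\<integral>x. (1 + norm x) ^ 2 * cmod (\<phi> x) \<partial>lborel)"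
  have ib: "integrable lborel (\<lambda>x. - \<i> * (of_real (x \<bullet> b) * \<phi> x))" if "b \<in> Basis" for b
    by (intro integrable_mult_right schwartz_integrable schwartz_inner_mult assms that)
  have D: "?D h = (\<integral>x. exp (- \<i> * complex_of_real (x \<bullet> \<xi>)) * (- \<i> * of_real (x \<bullet> h) * \<phi> x) \<partial>lborel)"
    and Di: "integrable lborel (\<lambda>x. exp (- \<i> * complex_of_real (x \<bullet> \<xi>)) * (- \<i> * of_real (x \<bullet> h) * \<phi> x))" for h
  proof -
    have e: "exp (- \<i> * complex_of_real (x \<bullet> \<xi>)) * (- \<i> * of_real (x \<bullet> h) * \<phi> x) =
       (\<Sum>b\<in>Basis. of_real (h \<bullet> b) * (exp (- \<i> * complex_of_real (x \<bullet> \<xi>)) * (- \<i> * (of_real (x \<bullet> b) * \<phi> x))))" for x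
      unfolding euclidean_inner[of x h] by (simp add: sum_distrib_left sum_distrib_right algebra_simps)
    show "integrable lborel (\<lambda>x. exp (- \<i> * complex_of_real (x \<bullet> \<xi>)) * (- \<i> * of_real (x \<bullet> h) * \<phi> x))"
      unfolding e by (intro Bochner_Integration.integrable_sum integrable_mult_right fourier_kernel_integrable ib)
    show "?D h = (\<integral>x. exp (- \<i> * complex_of_real (x \<bullet> \<xi>)) * (- \<i> * of_real (x \<bullet> h) * \<phi> x) \<partial>lborel)"
      unfolding e fourier_def
      by (subst Bochner_Integration.integral_sum)
         (auto intro!: integrable_mult_right fourier_kernel_integrable[OF ib, simplified])
  qed
  have "cmod (fourier \<phi> (\<xi> + h) - fourier \<phi> \<xi> - ?D h) \<le> C * (norm h)\<^sup>2" for h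
  proof -
    have "fourier \<phi> (\<xi> + h) - fourier \<phi> \<xi> - ?D h =
       (\<integral>x. exp (- \<i> * complex_of_real (x \<bullet> (\<xi> + h))) * \<phi> x - exp (- \<i> * complex_of_real (x \<bullet> \<xi>)) * \<phi> x -
          exp (- \<i> * complex_of_real (x \<bullet> \<xi>)) * (- \<i> * of_real (x \<bullet> h) * \<phi> x) \<partial>lborel)"
      unfolding D unfolding fourier_def
      by (simp add: Di[simplified] fourier_kernel_integrable[OF schwartz_integrable[OF assms], simplified])
    also have "\<dots> = (\<integral>x. exp (- \<i> * complex_of_real (x \<bullet> \<xi>)) *
        (exp (- \<i> * complex_of_real (x \<bullet> h)) - 1 + \<i> * complex_of_real (x \<bullet> h)) * \<phi> x \<partial>lborel)"
      by (intro Bochner_Integration.integral_cong refl)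
         (simp add: inner_add_right algebra_simps exp_diff exp_add exp_minus divide_inverse)
    also have "cmod \<dots> \<le> (\<integral>x. (norm h)\<^sup>2 * ((1 + norm x) ^ 2 * cmod (\<phi> x)) \<partial>lborel)"
    proof (rule Bochner_Integration.integral_norm_bound_integral)
      fix x :: 'a
      have "\<bar>x \<bullet> h\<bar> \<le> (1 + norm x) * norm h"
        by (rule order_trans[OF Cauchy_Schwarz_ineq2]) (simp add: distrib_right)
      hence "(x \<bullet> h)\<^sup>2 \<le> ((1 + norm x) * norm h)\<^sup>2" by (rule power2_le_iff_abs_le[THEN iffD2, rotated]) auto
      hence "cmod (exp (- \<i> * complex_of_real (x \<bullet> h)) - 1 + \<i> * complex_of_real (x \<bullet> h)) \<le> ((1 + norm x) * norm h)\<^sup>2"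
        using exp_i_approx order_trans by blast
      from mult_right_mono[OF this norm_ge_zero[of "\<phi> x"]]
      show "cmod (exp (- \<i> * complex_of_real (x \<bullet> \<xi>)) *
        (exp (- \<i> * complex_of_real (x \<bullet> h)) - 1 + \<i> * complex_of_real (x \<bullet> h)) * \<phi> x) \<le> (norm h)\<^sup>2 * ((1 + norm x) ^ 2 * cmod (\<phi> x))"
        unfolding norm_mult[of _ "\<phi> x"] norm_mult[of "exp (- \<i> * complex_of_real (x \<bullet> \<xi>))"] cmod_exp_i
        by (simp add: power_mult_distrib mult_ac)
    next
      have i2: "integrable lborel (\<lambda>x. (norm h)\<^sup>2 * ((1 + norm x) ^ 2 * cmod (\<phi> x)))"
        by (intro integrable_mult_right schwartz_weight_integrable assms)
      thus "integrable lborel (\<lambda>x. (norm h)\<^sup>2 * ((1 + norm x) ^ 2 * cmod (\<phi> x)))" .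
      have "exp (- \<i> * complex_of_real (x \<bullet> \<xi>)) *
        (exp (- \<i> * complex_of_real (x \<bullet> h)) - 1 + \<i> * complex_of_real (x \<bullet> h)) * \<phi> x =
        exp (- \<i> * complex_of_real (x \<bullet> (\<xi> + h))) * \<phi> x - exp (- \<i> * complex_of_real (x \<bullet> \<xi>)) * \<phi> x -
          exp (- \<i> * complex_of_real (x \<bullet> \<xi>)) * (- \<i> * of_real (x \<bullet> h) * \<phi> x)" for x
        by (simp add: inner_add_right algebra_simps exp_diff exp_add exp_minus divide_inverse)
      thus "integrable lborel (\<lambda>x. exp (- \<i> * complex_of_real (x \<bullet> \<xi>)) *
        (exp (- \<i> * complex_of_real (x \<bullet> h)) - 1 + \<i> * complex_of_real (x \<bullet> h)) * \<phi> x)"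
        by (simp only:) (intro Bochner_Integration.integrable_diff fourier_kernel_integrable
            schwartz_integrable assms Di)
    qed
    finally show ?thesis by (simp add: C_def mult.commute)
  qed note bound = this
  show ?thesis
  proof (rule has_derivativeI_sandwich[where e = 1 and H = "\<lambda>y. C * norm (y - \<xi>)"])
    show "bounded_linear ?D"
      by (intro bounded_linear_sum bounded_linear_mult_const
          bounded_linear_compose[OF bounded_linear_of_real bounded_linear_inner_left])
    show "norm (fourier \<phi> y - fourier \<phi> \<xi> - ?D (y - \<xi>)) / norm (y - \<xi>) \<le> C * norm (y - \<xi>)" if "y \<noteq> \<xi>" for y
      using bound[of "y - \<xi>"] that by (simp add: divide_le_eq power2_eq_square mult.assoc)
    have "((\<lambda>y. C * norm (y - \<xi>)) \<longlongrightarrow> C * norm (\<xi> - \<xi>)) (at \<xi>)" by (intro tendsto_intros)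
    thus "((\<lambda>y. C * norm (y - \<xi>)) \<longlongrightarrow> 0) (at \<xi>)" by simp
  qed simp
qed

text \<open>The factors are those that differentiation in \<open>\<xi>\<close> brings down from the
  exponential kernel; see \<open>pderivs_fourier\<close>.\<close>

fun moment :: "'a::euclidean_space list \<Rightarrow> ('a \<Rightarrow> complex) \<Rightarrow> 'a \<Rightarrow> complex" where
  "moment [] \<phi> = \<phi>"
| "moment (b # bs) \<phi> = (\<lambda>x. - \<i> * (of_real (x \<bullet> b) * moment bs \<phi> x))"

lemma schwartz_moment: "schwartz_fun \<phi> \<Longrightarrow> set bs \<subseteq> Basis \<Longrightarrow> schwartz_fun (moment bs \<phi>)"
  by (induction bs) (auto intro!: schwartz_cmult[of _ "-\<i>", simplified] schwartz_inner_mult)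

lemma moment_le:
  "set bs \<subseteq> Basis \<Longrightarrow> cmod (moment bs \<phi> x) \<le> (1 + norm x) ^ length bs * cmod (\<phi> x)"
proof (induction bs)
  case (Cons b bs)
  have "\<bar>x \<bullet> b\<bar> \<le> 1 + norm x" using Basis_le_norm[of b x] Cons.prems by simp
  hence "\<bar>x \<bullet> b\<bar> * cmod (moment bs \<phi> x) \<le> (1 + norm x) * ((1 + norm x) ^ length bs * cmod (\<phi> x))"
    by (intro mult_mono) (use Cons in auto)
  thus ?case by (simp add: norm_mult mult.assoc)
qed simp

lemma pd_fourier:
  assumes "schwartz_fun \<phi>" "b \<in> Basis"
  shows "frechet_derivative (fourier \<phi>) (at \<xi>) b = fourier (\<lambda>x. - \<i> * (of_real (x \<bullet> b) * \<phi> x)) \<xi>"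
proof -
  have "(\<Sum>c\<in>Basis. of_real (b \<bullet> c) * fourier (\<lambda>x. - \<i> * (of_real (x \<bullet> c) * \<phi> x)) \<xi>) =
     (\<Sum>c\<in>Basis. if c = b then fourier (\<lambda>x. - \<i> * (of_real (x \<bullet> c) * \<phi> x)) \<xi> else 0)"
    by (intro sum.cong refl) (use assms(2) in \<open>auto simp: inner_Basis\<close>)
  thus ?thesis using pd_eq[OF fourier_has_derivative[OF assms(1)], of \<xi> b] assms(2) by simp
qed

lemma pderivs_fourier:
  "schwartz_fun \<phi> \<Longrightarrow> set bs \<subseteq> Basis \<Longrightarrow> pderivs bs (fourier \<phi>) = fourier (moment bs \<phi>)"
proof (induction bs)
  case (Cons b bs)
  hence "pderivs bs (fourier \<phi>) = fourier (moment bs \<phi>)" "schwartz_fun (moment bs \<phi>)" "b \<in> Basis"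
    by (auto intro: schwartz_moment)
  thus ?case by (auto simp: pd_fourier)
qed simp

lemma smooth_fourier:
  assumes "schwartz_fun \<phi>" shows "smooth_fun_on UNIV (fourier \<phi>)"
  unfolding smooth_fun_on_def
proof (intro allI impI ballI)
  fix bs :: "'a list" and \<xi> assume bs: "set bs \<subseteq> Basis"
  show "pderivs bs (fourier \<phi>) differentiable at \<xi>"
    unfolding pderivs_fourier[OF assms bs] differentiable_def
    using fourier_has_derivative[OF schwartz_moment[OF assms bs]] by blast
qed

text \<open>Only a weighted \<open>L\<^sup>1\<close> norm of \<open>\<phi>\<close> enters and no
  derivative of \<open>\<phi>\<close>. Combined with duality this yields the polynomial growth of
  localized transforms.\<close>

lemma pderivs_fourier_le:
  assumes "schwartz_fun \<phi>" "set bs \<subseteq> Basis"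
  shows "cmod (pderivs bs (fourier \<phi>) \<xi>) \<le> (\<integral>x. (1 + norm x) ^ length bs * cmod (\<phi> x) \<partial>lborel)"
  unfolding pderivs_fourier[OF assms]
  by (intro order_trans[OF fourier_norm_le] integral_mono moment_le assms
      schwartz_weight_integrable integrable_norm schwartz_integrable schwartz_moment)

section \<open>Transforms of derivatives and continuity on the Schwartz space\<close>

lemma schwartz_translate_le:
  assumes "schwartz_bound N \<phi> B" "b \<in> Basis" "\<bar>t\<bar> \<le> 1" "set bs \<subseteq> Basis" "length bs \<le> N"
  shows "cmod (pderivs bs \<phi> (x + t *\<^sub>R b)) \<le> 2 ^ N * B * inverse ((1 + norm x) ^ N)"
proof -
  have tb: "norm (t *\<^sub>R b) \<le> 1" using assms by (simp add: norm_Basis)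
  have "norm x \<le> norm (x + t *\<^sub>R b) + norm (t *\<^sub>R b)" using norm_triangle_ineq4[of "x + t *\<^sub>R b" "t *\<^sub>R b"] by simp
  moreover have "1 + u \<le> 2 * (1 + v)" if "u \<le> v + w" "w \<le> 1" "0 \<le> v" for u v w :: real using that by simp
  ultimately have "1 + norm x \<le> 2 * (1 + norm (x + t *\<^sub>R b))" using tb norm_ge_zero by blast
  hence "(1 + norm x) ^ N \<le> (2 * (1 + norm (x + t *\<^sub>R b))) ^ N" by (intro power_mono) auto
  hence "(1 + norm x) ^ N * cmod (pderivs bs \<phi> (x + t *\<^sub>R b)) \<le>
      (2 * (1 + norm (x + t *\<^sub>R b))) ^ N * cmod (pderivs bs \<phi> (x + t *\<^sub>R b))" by (intro mult_right_mono) auto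
  also have "\<dots> = 2 ^ N * ((1 + norm (x + t *\<^sub>R b)) ^ N * cmod (pderivs bs \<phi> (x + t *\<^sub>R b)))"
    by (simp only: power_mult_distrib mult.assoc)
  also have "\<dots> \<le> 2 ^ N * B" by (intro mult_left_mono schwartz_boundD[OF assms(1)] assms) auto
  finally show ?thesis by (simp add: field_simps add_pos_nonneg)
qed

text \<open>Translation becomes modulation: the difference quotient of \<open>\<phi>\<close> with
  step \<open>s\<close> in direction \<open>b\<close> has as its transform that of
  \<open>\<phi>\<close> times a difference quotient of
  \<open>exp (\<i> * s * (\<xi> \<bullet> b))\<close> at 0. Letting the step tend to 0 on both sides
  replaces integration by parts.\<close>

lemma fourier_pd:
  fixes \<phi> :: "'a::euclidean_space \<Rightarrow> complex"
  assumes "schwartz_fun \<phi>" "b \<in> Basis"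
  shows "fourier (\<lambda>x. frechet_derivative \<phi> (at x) b) \<xi> = \<i> * of_real (\<xi> \<bullet> b) * fourier \<phi> \<xi>"
proof -
  note [measurable] = schwartz_measurable[OF assms(1)]
  have pb: "(\<lambda>x. frechet_derivative \<phi> (at x) b) = pderivs [b] \<phi>" by simp
  have [measurable]: "(\<lambda>x. frechet_derivative \<phi> (at x) b) \<in> borel_measurable borel"
    unfolding pb by (intro schwartz_measurable schwartz_pderivs assms) (use assms in auto)
  let ?N = "2 * DIM('a)"
  obtain B where B: "schwartz_bound ?N \<phi> B" using assms schwartz_fun_iff by blast
  have N1: "1 \<le> ?N" using DIM_positive[where 'a = 'a] by linarith
  define s where "s j = inverse (real (Suc j))" for j
  have s: "0 < s j" "s j \<le> 1" for j by (auto simp: s_def field_simps)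
  have s_ne: "s j \<noteq> 0" for j using s(1)[of j] by simp
  have s0: "s \<longlonglongrightarrow> 0" unfolding s_def by (rule LIMSEQ_inverse_real_of_nat)
  have line: "((\<lambda>t. \<phi> (x + t *\<^sub>R b)) has_vector_derivative frechet_derivative \<phi> (at (x + t *\<^sub>R b)) b) (at t within A)" for x t A
  proof -
    have d: "(\<phi> has_derivative frechet_derivative \<phi> (at (x + t *\<^sub>R b))) (at (x + t *\<^sub>R b))"
      by (rule smooth_has_derivative[OF schwartz_smooth[OF assms(1)] UNIV_I])
    have "((\<lambda>t. \<phi> (x + t *\<^sub>R b)) has_derivative (\<lambda>h. frechet_derivative \<phi> (at (x + t *\<^sub>R b)) (h *\<^sub>R b))) (at t within A)"
      by (rule has_derivative_compose[of "\<lambda>t. x + t *\<^sub>R b" "\<lambda>h. h *\<^sub>R b", OF _ d]) (auto intro!: derivative_eq_intros)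
    thus ?thesis unfolding has_vector_derivative_def
      by (simp add: linear_scale[OF has_derivative_linear[OF d]])
  qed
  define q where "q j x = (\<phi> (x + s j *\<^sub>R b) - \<phi> x) / of_real (s j)" for j x
  have q: "(\<lambda>j. q j x) \<longlonglongrightarrow> frechet_derivative \<phi> (at x) b" for x
  proof -
    let ?d = "frechet_derivative \<phi> (at x) b"
    have "(\<lambda>h. norm (\<phi> (x + h *\<^sub>R b) - \<phi> x - h *\<^sub>R ?d) / norm h) \<midarrow>0\<rightarrow> 0"
      using line[of x 0 UNIV] unfolding has_vector_derivative_def has_derivative_at by simp
    moreover have "filterlim s (at 0) sequentially"
      using s0 s_ne by (auto simp: filterlim_at intro!: always_eventually)
    ultimately have "(\<lambda>j. norm (\<phi> (x + s j *\<^sub>R b) - \<phi> x - s j *\<^sub>R ?d) / norm (s j)) \<longlonglongrightarrow> 0"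
      by (rule filterlim_compose)
    moreover have "norm (\<phi> (x + s j *\<^sub>R b) - \<phi> x - s j *\<^sub>R ?d) / norm (s j) = norm (q j x - ?d)" for j
    proof -
      have "q j x - ?d = (\<phi> (x + s j *\<^sub>R b) - \<phi> x - s j *\<^sub>R ?d) / of_real (s j)"
        using s(1)[of j] by (simp add: q_def scaleR_conv_of_real field_simps)
      thus ?thesis by (simp add: norm_divide)
    qed
    ultimately have "(\<lambda>j. norm (q j x - ?d)) \<longlonglongrightarrow> 0" by simp
    thus ?thesis by (simp add: tendsto_norm_zero_iff LIM_zero_iff)
  qed
  \<comment> \<open>The mean value inequality bounds the quotients by derivatives at points within
    distance 1 of \<open>x\<close>, where \<open>1 + norm\<close> changes at most by a factor 2;
    this gives one integrable majorant for all \<open>j\<close>.\<close>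
  have qb: "cmod (q j x) \<le> 2 ^ ?N * B * inverse ((1 + norm x) ^ ?N)" for j x
  proof -
    let ?M = "2 ^ ?N * B * inverse ((1 + norm x) ^ ?N)"
    have "norm (\<phi> (x + s j *\<^sub>R b) - \<phi> (x + 0 *\<^sub>R b)) \<le> ?M * norm (s j - 0)"
    proof (rule differentiable_bound[of "{0..s j}" "\<lambda>t. \<phi> (x + t *\<^sub>R b)"])
      show "((\<lambda>t. \<phi> (x + t *\<^sub>R b)) has_derivative (\<lambda>h. h *\<^sub>R frechet_derivative \<phi> (at (x + t *\<^sub>R b)) b)) (at t within {0..s j})" for t
        using line unfolding has_vector_derivative_def .
      fix t assume t: "t \<in> {0..s j}"
      have "cmod (pderivs [b] \<phi> (x + t *\<^sub>R b)) \<le> ?M"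
        by (rule schwartz_translate_le[OF B assms(2)]) (use t s[of j] assms N1 in auto)
      thus "onorm (\<lambda>h. h *\<^sub>R frechet_derivative \<phi> (at (x + t *\<^sub>R b)) b) \<le> ?M"
        by (intro onorm_le) (auto intro!: mult_left_mono simp: mult.commute)
    qed (use s[of j] in auto)
    thus ?thesis using s[of j] by (simp add: q_def norm_divide divide_le_eq)
  qed
  have [measurable]: "q j \<in> borel_measurable borel" for j unfolding q_def by measurable
  have "(\<lambda>j. fourier (q j) \<xi>) \<longlonglongrightarrow> fourier (\<lambda>x. frechet_derivative \<phi> (at x) b) \<xi>"
    unfolding fourier_def
  proof (rule integral_dominated_convergence[where w = "\<lambda>x::'a. 2 ^ ?N * B * inverse ((1 + norm x) ^ ?N)"])
    show "integrable lborel (\<lambda>x::'a. 2 ^ ?N * B * inverse ((1 + norm x) ^ ?N))"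
      by (intro integrable_mult_right integrable_decay) simp
    show "AE x in lborel. (\<lambda>j. exp (- \<i> * complex_of_real (x \<bullet> \<xi>)) * q j x) \<longlonglongrightarrow>
        exp (- \<i> * complex_of_real (x \<bullet> \<xi>)) * frechet_derivative \<phi> (at x) b"
      by (intro AE_I2 tendsto_intros q)
    show "AE x in lborel. cmod (exp (- \<i> * complex_of_real (x \<bullet> \<xi>)) * q j x) \<le> 2 ^ ?N * B * inverse ((1 + norm x) ^ ?N)" for j
      unfolding norm_mult cmod_exp_i using qb by simp
  qed (measurable)
  moreover have fq: "fourier (q j) \<xi> = (exp (\<i> * of_real (s j * (\<xi> \<bullet> b))) - 1) / of_real (s j) * fourier \<phi> \<xi>" for j
  proof -
    let ?e = "\<lambda>x. exp (- \<i> * complex_of_real (x \<bullet> \<xi>))"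
    have m: "(\<lambda>x. ?e (x - s j *\<^sub>R b) * \<phi> x) \<in> borel_measurable borel" by measurable
    have e: "?e (x - s j *\<^sub>R b) = exp (\<i> * of_real (s j * (\<xi> \<bullet> b))) * ?e x" for x
      by (simp add: inner_diff_left algebra_simps exp_add[symmetric] inner_commute)
    have i: "integrable lborel (\<lambda>x. ?e (x - s j *\<^sub>R b) * \<phi> x)"
      unfolding e mult.assoc by (intro integrable_mult_right fourier_kernel_integrable schwartz_integrable assms)
    have eq: "?e x * \<phi> (x + s j *\<^sub>R b) = (\<lambda>x. ?e (x - s j *\<^sub>R b) * \<phi> x) (s j *\<^sub>R b + 1 *\<^sub>R x)" for x
      by (simp add: add.commute)
    have "(\<integral>x. ?e x * \<phi> (x + s j *\<^sub>R b) \<partial>lborel) = (\<integral>x. ?e (x - s j *\<^sub>R b) * \<phi> x \<partial>lborel)"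
      unfolding eq using lborel_integral_affine[OF m, of 1 "s j *\<^sub>R b"] by simp
    also have "\<dots> = exp (\<i> * of_real (s j * (\<xi> \<bullet> b))) * fourier \<phi> \<xi>"
      unfolding e fourier_def mult.assoc by simp
    finally have 1: "(\<integral>x. ?e x * \<phi> (x + s j *\<^sub>R b) \<partial>lborel) = exp (\<i> * of_real (s j * (\<xi> \<bullet> b))) * fourier \<phi> \<xi>" .
    have i2: "integrable lborel (\<lambda>x. ?e x * \<phi> (x + s j *\<^sub>R b))"
      unfolding eq using integrable_affine_iff[OF m, of 1 "s j *\<^sub>R b"] i by simp
    have "fourier (q j) \<xi> = (\<integral>x. (?e x * \<phi> (x + s j *\<^sub>R b) - ?e x * \<phi> x) / of_real (s j) \<partial>lborel)"
      unfolding fourier_def q_def by (simp add: diff_divide_distrib algebra_simps)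
    also have "\<dots> = ((\<integral>x. ?e x * \<phi> (x + s j *\<^sub>R b) \<partial>lborel) - fourier \<phi> \<xi>) / of_real (s j)"
      unfolding fourier_def using i2 fourier_kernel_integrable[OF schwartz_integrable[OF assms(1)], of \<xi>]
      by (simp add: Bochner_Integration.integral_diff)
    finally show ?thesis unfolding 1 by (simp add: algebra_simps diff_divide_distrib)
  qed
  moreover have "(\<lambda>j. (exp (\<i> * of_real (s j * (\<xi> \<bullet> b))) - 1) / of_real (s j)) \<longlonglongrightarrow> \<i> * of_real (\<xi> \<bullet> b)"
  proof -
    have "((\<lambda>z. exp (\<i> * of_real (\<xi> \<bullet> b) * z)) has_field_derivative \<i> * of_real (\<xi> \<bullet> b)) (at 0)"
      by (auto intro!: derivative_eq_intros)
    hence "((\<lambda>h. (exp (\<i> * of_real (\<xi> \<bullet> b) * h) - 1) / h) \<longlongrightarrow> \<i> * of_real (\<xi> \<bullet> b)) (at 0)"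
      by (simp add: DERIV_def)
    moreover have "filterlim (\<lambda>j. complex_of_real (s j)) (at 0) sequentially"
      using s_ne tendsto_of_real[OF s0, where 'a = complex]
      by (auto simp: filterlim_at intro!: always_eventually)
    ultimately have "(\<lambda>j. (exp (\<i> * of_real (\<xi> \<bullet> b) * of_real (s j)) - 1) / of_real (s j)) \<longlonglongrightarrow> \<i> * of_real (\<xi> \<bullet> b)"
      by (rule filterlim_compose)
    thus ?thesis by (simp add: mult_ac)
  qed
  hence "(\<lambda>j. (exp (\<i> * of_real (s j * (\<xi> \<bullet> b))) - 1) / of_real (s j) * fourier \<phi> \<xi>) \<longlonglongrightarrow> \<i> * of_real (\<xi> \<bullet> b) * fourier \<phi> \<xi>"
    by (intro tendsto_intros)
  ultimately show ?thesis by (simp add: LIMSEQ_unique)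
qed

lemma schwartz_bound_le: "schwartz_bound N \<phi> A \<Longrightarrow> A \<le> B \<Longrightarrow> schwartz_bound N \<phi> B"
  unfolding schwartz_bound_def using order_trans by blast

lemma schwartz_bound_cmult:
  "smooth_fun_on UNIV \<phi> \<Longrightarrow> schwartz_bound N \<phi> A \<Longrightarrow> schwartz_bound N (\<lambda>x. c * \<phi> x) (cmod c * A)"
  using schwartz_bound_linear[of \<phi> \<phi> N A A c 0] by simp

text \<open>Induction on \<open>k\<close>: the norm in one more factor is at most the sum of the
  coordinates in modulus, and each coordinate is turned into a derivative of \<open>\<phi>\<close>
  at the cost of one order. The surplus \<open>2 * DIM('a)\<close> is what integrability needs in
  the base case. The constant is chosen before \<open>\<phi>\<close>, which makes this a continuity
  statement.\<close>

lemma fourier_decay: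
  "\<exists>C\<ge>0. \<forall>\<phi> B. \<forall>\<xi>::'a::euclidean_space. schwartz_fun \<phi> \<longrightarrow> schwartz_bound (k + 2 * DIM('a)) \<phi> B \<longrightarrow>
     (1 + norm \<xi>) ^ k * cmod (fourier \<phi> \<xi>) \<le> C * B"
proof (induction k)
  case 0
  have "0 \<le> (\<integral>x. inverse ((1 + norm (x::'a)) ^ (2 * DIM('a))) \<partial>lborel)" by simp
  moreover have "cmod (fourier \<phi> \<xi>) \<le> (\<integral>x. inverse ((1 + norm (x::'a)) ^ (2 * DIM('a))) \<partial>lborel) * B"
    if "schwartz_fun \<phi>" "schwartz_bound (2 * DIM('a)) \<phi> B" for \<phi> B and \<xi> :: 'a
    by (rule order_trans[OF fourier_norm_le integral_bound_schwartz[OF that]])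
  ultimately show ?case
    by (intro exI[of _ "\<integral>x. inverse ((1 + norm (x::'a)) ^ (2 * DIM('a))) \<partial>lborel"] conjI allI impI) auto
next
  case (Suc k)
  then obtain C where C: "C \<ge> 0" "\<And>\<phi> B (\<xi>::'a). schwartz_fun \<phi> \<Longrightarrow> schwartz_bound (k + 2 * DIM('a)) \<phi> B \<Longrightarrow>
     (1 + norm \<xi>) ^ k * cmod (fourier \<phi> \<xi>) \<le> C * B" by blast
  show ?case
  proof (intro exI conjI allI impI)
    show "0 \<le> C * (1 + real DIM('a))" using C by simp
    fix \<phi> :: "'a \<Rightarrow> complex" and B and \<xi> :: 'a
    assume \<phi>: "schwartz_fun \<phi>" "schwartz_bound (Suc k + 2 * DIM('a)) \<phi> B"
    have 1: "(1 + norm \<xi>) ^ k * cmod (fourier \<phi> \<xi>) \<le> C * B"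
      by (rule C(2)[OF \<phi>(1) schwartz_bound_mono[OF \<phi>(2)]]) simp
    have 2: "(1 + norm \<xi>) ^ k * (\<bar>\<xi> \<bullet> b\<bar> * cmod (fourier \<phi> \<xi>)) \<le> C * B" if b: "b \<in> Basis" for b
    proof -
      have bb: "set [b] \<subseteq> Basis" using b by simp
      have "schwartz_bound (k + 2 * DIM('a)) (pderivs [b] \<phi>) B"
        by (rule schwartz_bound_pderivs[OF _ bb]) (use \<phi>(2) in simp)
      from C(2)[OF schwartz_pderivs[OF \<phi>(1) bb] this, of \<xi>]
      show ?thesis by (simp add: fourier_pd[OF \<phi>(1) b] norm_mult)
    qed
    have "(1 + norm \<xi>) ^ Suc k * cmod (fourier \<phi> \<xi>) =
        (1 + norm \<xi>) ^ k * cmod (fourier \<phi> \<xi>) + norm \<xi> * ((1 + norm \<xi>) ^ k * cmod (fourier \<phi> \<xi>))"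
      by (simp add: algebra_simps)
    also have "\<dots> \<le> (1 + norm \<xi>) ^ k * cmod (fourier \<phi> \<xi>) + (\<Sum>b\<in>Basis. \<bar>\<xi> \<bullet> b\<bar>) * ((1 + norm \<xi>) ^ k * cmod (fourier \<phi> \<xi>))"
      by (intro add_left_mono mult_right_mono norm_le_l1) auto
    also have "\<dots> = (1 + norm \<xi>) ^ k * cmod (fourier \<phi> \<xi>) + (\<Sum>b\<in>Basis. (1 + norm \<xi>) ^ k * (\<bar>\<xi> \<bullet> b\<bar> * cmod (fourier \<phi> \<xi>)))"
      by (simp add: sum_distrib_left sum_distrib_right mult_ac)
    also have "\<dots> \<le> C * B + (\<Sum>b\<in>(Basis :: 'a set). C * B)"
      by (intro add_mono 1 sum_mono 2)
    also have "\<dots> = C * (1 + real DIM('a)) * B" by (simp add: algebra_simps)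
    finally show "(1 + norm \<xi>) ^ Suc k * cmod (fourier \<phi> \<xi>) \<le> C * (1 + real DIM('a)) * B" .
  qed
qed

text \<open>Every coordinate factor costs one order and a power of 2. It matters only that the
  constant does not depend on \<open>\<phi>\<close>.\<close>

lemma schwartz_bound_moment:
  assumes "schwartz_fun \<phi>" "set bs \<subseteq> Basis" "schwartz_bound (K + length bs) \<phi> B"
  shows "schwartz_bound K (moment bs \<phi>) ((2 ^ (K + length bs)) ^ length bs * B)"
  using assms(2,3)
proof (induction bs arbitrary: K)
  case (Cons b bs)
  let ?l = "length bs"
  have B: "B \<ge> 0" by (rule schwartz_bound_nonneg[OF Cons.prems(2)])
  have m: "schwartz_fun (moment bs \<phi>)" using Cons.prems by (intro schwartz_moment assms) auto
  have "schwartz_bound (K + 1) (moment bs \<phi>) ((2 ^ (K + 1 + ?l)) ^ ?l * B)"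
    using Cons.IH[of "K + 1"] Cons.prems by simp
  hence "schwartz_bound K (\<lambda>x. of_real (x \<bullet> b) * moment bs \<phi> x) (2 ^ K * ((2 ^ (K + 1 + ?l)) ^ ?l * B))"
    using Cons.prems by (intro schwartz_bound_inner_mult schwartz_smooth m) auto
  hence "schwartz_bound K (\<lambda>x. - \<i> * (of_real (x \<bullet> b) * moment bs \<phi> x)) (cmod (- \<i>) * (2 ^ K * ((2 ^ (K + 1 + ?l)) ^ ?l * B)))"
    using Cons.prems by (intro schwartz_bound_cmult schwartz_smooth schwartz_inner_mult m) auto
  moreover have "cmod (- \<i>) * (2 ^ K * ((2 ^ (K + 1 + ?l)) ^ ?l * B)) \<le> (2 ^ (K + length (b # bs))) ^ length (b # bs) * B"
  proof -
    have "(2::real) ^ K * (2 ^ (K + 1 + ?l)) ^ ?l \<le> 2 ^ (K + 1 + ?l) * (2 ^ (K + 1 + ?l)) ^ ?l"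
      by (intro mult_right_mono power_increasing) auto
    from mult_right_mono[OF this B] show ?thesis by (simp add: mult_ac)
  qed
  ultimately have "schwartz_bound K (\<lambda>x. - \<i> * (of_real (x \<bullet> b) * moment bs \<phi> x))
      ((2 ^ (K + length (b # bs))) ^ length (b # bs) * B)" by (rule schwartz_bound_le)
  thus ?case by (simp only: moment.simps)
qed simp

text \<open>Continuity of the Fourier transform on the Schwartz space: derivatives of a transform
  are transforms of moments, to which \<open>fourier_decay\<close> and
  \<open>schwartz_bound_moment\<close> apply.\<close>

lemma schwartz_bound_fourier:
  obtains C M where "C \<ge> 0" "\<And>(\<phi>::'a::euclidean_space \<Rightarrow> complex) B. schwartz_fun \<phi> \<Longrightarrow> schwartz_bound M \<phi> B \<Longrightarrow>
    schwartz_bound N (fourier \<phi>) (C * B)"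
proof -
  obtain C where C: "C \<ge> 0" "\<And>\<phi> B (\<xi>::'a). schwartz_fun \<phi> \<Longrightarrow> schwartz_bound (N + 2 * DIM('a)) \<phi> B \<Longrightarrow>
     (1 + norm \<xi>) ^ N * cmod (fourier \<phi> \<xi>) \<le> C * B" using fourier_decay[of N] by metis
  let ?K = "N + 2 * DIM('a)"
  show ?thesis
  proof (rule that[of "C * (2 ^ (?K + N)) ^ N" "?K + N"])
    fix \<phi> :: "'a \<Rightarrow> complex" and B assume \<phi>: "schwartz_fun \<phi>" "schwartz_bound (?K + N) \<phi> B"
    have B: "B \<ge> 0" by (rule schwartz_bound_nonneg[OF \<phi>(2)])
    show "schwartz_bound N (fourier \<phi>) (C * (2 ^ (?K + N)) ^ N * B)"
      unfolding schwartz_bound_def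
    proof (intro ballI allI)
      fix bs :: "'a list" and \<xi> assume "bs \<in> multi_indices N"
      hence bs: "set bs \<subseteq> Basis" "length bs \<le> N" by (auto simp: multi_indices_def)
      have "schwartz_bound ?K (moment bs \<phi>) ((2 ^ (?K + length bs)) ^ length bs * B)"
        by (rule schwartz_bound_moment[OF \<phi>(1) bs(1) schwartz_bound_mono[OF \<phi>(2)]]) (use bs in simp)
      moreover have "((2::real) ^ (?K + length bs)) ^ length bs * B \<le> (2 ^ (?K + N)) ^ N * B"
      proof (intro mult_right_mono B)
        have "((2::real) ^ (?K + length bs)) ^ length bs \<le> (2 ^ (?K + N)) ^ length bs"
          by (intro power_mono power_increasing) (use bs in auto)
        also have "\<dots> \<le> (2 ^ (?K + N)) ^ N" by (intro power_increasing bs) (simp add: one_le_power)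
        finally show "((2::real) ^ (?K + length bs)) ^ length bs \<le> (2 ^ (?K + N)) ^ N" .
      qed
      ultimately have "schwartz_bound ?K (moment bs \<phi>) ((2 ^ (?K + N)) ^ N * B)" by (rule schwartz_bound_le)
      from C(2)[OF schwartz_moment[OF \<phi>(1) bs(1)] this]
      show "(1 + norm \<xi>) ^ N * cmod (pderivs bs (fourier \<phi>) \<xi>) \<le> C * (2 ^ (?K + N)) ^ N * B"
        unfolding pderivs_fourier[OF \<phi>(1) bs(1)] by (simp only: mult.assoc)
    qed
  qed (use C in simp)
qed

lemma schwartz_fourier:
  fixes \<phi> :: "'a::euclidean_space \<Rightarrow> complex"
  assumes "schwartz_fun \<phi>" shows "schwartz_fun (fourier \<phi>)"
  unfolding schwartz_fun_iff
proof (intro conjI allI smooth_fourier assms)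
  fix N
  obtain C M where CM: "\<And>(\<phi>::'a \<Rightarrow> complex) B. schwartz_fun \<phi> \<Longrightarrow> schwartz_bound M \<phi> B \<Longrightarrow>
    schwartz_bound N (fourier \<phi>) (C * B)" using schwartz_bound_fourier[of N, where 'a = 'a] by metis
  obtain B where "schwartz_bound M \<phi> B" using assms schwartz_fun_iff by blast
  thus "\<exists>B. schwartz_bound N (fourier \<phi>) B" using CM[OF assms] by blast
qed

lemma fourier_tendsto:
  fixes \<phi> :: "'a::euclidean_space \<Rightarrow> complex"
  assumes "schwartz_fun \<phi>" "\<And>j. schwartz_fun (\<phi>s j)"
    "\<And>N. \<exists>B. \<forall>j::nat. schwartz_bound N (\<lambda>x. \<phi> x - \<phi>s j x) (B / (real j + 1))"
  shows "\<exists>B. \<forall>j::nat. schwartz_bound N (\<lambda>x. fourier \<phi> x - fourier (\<phi>s j) x) (B / (real j + 1))"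
proof -
  obtain C M where CM: "\<And>(\<phi>::'a \<Rightarrow> complex) B. schwartz_fun \<phi> \<Longrightarrow> schwartz_bound M \<phi> B \<Longrightarrow>
    schwartz_bound N (fourier \<phi>) (C * B)" using schwartz_bound_fourier[of N, where 'a = 'a] by metis
  obtain B where B: "\<And>j. schwartz_bound M (\<lambda>x. \<phi> x - \<phi>s j x) (B / (real j + 1))" using assms(3) by blast
  have e: "(\<lambda>x. fourier \<phi> x - fourier (\<phi>s j) x) = fourier (\<lambda>x. \<phi> x - \<phi>s j x)" for j
    using fourier_linear[OF schwartz_integrable[OF assms(1)] schwartz_integrable[OF assms(2)], of 1 "-1" j] by auto
  show ?thesis
    unfolding e using CM[OF schwartz_diff[OF assms(1,2)] B] by (intro exI[of _ "C * B"]) simp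
qed

section \<open>Fourier inversion\<close>

text \<open>Read off from the characteristic function of the standard normal distribution; the
  argument \<open>- s\<close> matches the sign in the kernel.\<close>

lemma gauss_real:
  shows "integrable lborel (\<lambda>t::real. exp (- \<i> * complex_of_real (t * s)) * of_real (exp (- t\<^sup>2 / 2)))" (is ?I)
    and "(\<integral>t. exp (- \<i> * complex_of_real (t * s)) * of_real (exp (- t\<^sup>2 / 2)) \<partial>lborel) =
       of_real (sqrt (2 * pi) * exp (- s\<^sup>2 / 2))"
proof -
  have sd: "sqrt (2 * pi) * std_normal_density t = exp (- t\<^sup>2 / 2)" for t
    by (simp add: std_normal_density_def)
  have "integrable lborel std_normal_density"
    using integrable_std_normal_moment[of 0] by simp
  hence "integrable lborel (\<lambda>t. sqrt (2 * pi) * std_normal_density t)" by (rule integrable_mult_right)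
  hence i: "integrable lborel (\<lambda>t::real. exp (- t\<^sup>2 / 2))" unfolding sd .
  show ?I by (rule Bochner_Integration.integrable_bound[OF i]) (auto simp: norm_mult cmod_exp_i simp del: of_real_mult)
  have "of_real (exp (- s\<^sup>2 / 2)) = char std_normal_distribution (- s)"
    by (simp add: char_std_normal_distribution)
  also have "\<dots> = (\<integral>t. std_normal_density t *\<^sub>R exp (- \<i> * complex_of_real (t * s)) \<partial>lborel)"
    unfolding char_def by (subst integral_density) (auto simp: mult_ac)
  finally have "of_real (sqrt (2 * pi)) * of_real (exp (- s\<^sup>2 / 2)) =
      (\<integral>t. of_real (sqrt (2 * pi)) * (std_normal_density t *\<^sub>R exp (- \<i> * complex_of_real (t * s))) \<partial>lborel)"
    by (simp only: integral_mult_right_zero)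
  also have "\<dots> = (\<integral>t. exp (- \<i> * complex_of_real (t * s)) * of_real (exp (- t\<^sup>2 / 2)) \<partial>lborel)"
    unfolding sd[symmetric] by (simp add: scaleR_conv_of_real mult_ac)
  finally show "(\<integral>t. exp (- \<i> * complex_of_real (t * s)) * of_real (exp (- t\<^sup>2 / 2)) \<partial>lborel) =
       of_real (sqrt (2 * pi) * exp (- s\<^sup>2 / 2))" by simp
qed

definition gauss :: "'a::euclidean_space \<Rightarrow> complex" where
  "gauss x = of_real (exp (- (norm x)\<^sup>2 / 2))"

lemma gauss_prod:
  fixes x \<xi> :: "'a::euclidean_space"
  shows "exp (- \<i> * complex_of_real (x \<bullet> \<xi>)) * gauss x =
    (\<Prod>b\<in>Basis. exp (- \<i> * complex_of_real ((x \<bullet> b) * (\<xi> \<bullet> b))) * of_real (exp (- (x \<bullet> b)\<^sup>2 / 2)))"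
proof -
  have "exp (- \<i> * complex_of_real (x \<bullet> \<xi>)) = (\<Prod>b\<in>Basis. exp (- \<i> * complex_of_real ((x \<bullet> b) * (\<xi> \<bullet> b))))"
    unfolding euclidean_inner[of x \<xi>] by (simp add: exp_sum[symmetric] sum_distrib_left sum_negf)
  moreover have "exp (- (norm x)\<^sup>2 / 2) = (\<Prod>b\<in>Basis. exp (- (x \<bullet> b)\<^sup>2 / 2))"
    unfolding power2_norm_eq_inner euclidean_inner[of x x]
    by (simp add: exp_sum[symmetric] sum_divide_distrib sum_negf power2_eq_square)
  ultimately show ?thesis by (simp add: gauss_def prod.distrib del: of_real_exp)
qed

lemma fourier_gauss:
  fixes \<xi> :: "'a::euclidean_space"
  shows "fourier gauss \<xi> = of_real (sqrt (2 * pi) ^ DIM('a)) * gauss \<xi>"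
proof -
  have "fourier gauss \<xi> = (\<Prod>b\<in>Basis. of_real (sqrt (2 * pi) * exp (- (\<xi> \<bullet> b)\<^sup>2 / 2)))"
    unfolding fourier_def gauss_prod
    by (subst integrable_prod_Basis(2)[OF gauss_real(1)]) (simp only: gauss_real(2))
  also have "\<dots> = of_real (sqrt (2 * pi) ^ DIM('a)) * (\<Prod>b\<in>Basis. of_real (exp (- (\<xi> \<bullet> b)\<^sup>2 / 2)))"
    by (simp add: prod.distrib del: of_real_exp)
  also have "(\<Prod>b\<in>Basis. of_real (exp (- (\<xi> \<bullet> b)\<^sup>2 / 2))) = gauss \<xi>"
    using gauss_prod[of \<xi> 0] by simp
  finally show ?thesis .
qed

lemma gauss_integrable: "integrable lborel (gauss :: 'a::euclidean_space \<Rightarrow> complex)"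
proof -
  have "integrable lborel (\<lambda>x::'a. exp (- \<i> * complex_of_real (x \<bullet> 0)) * gauss x)"
    unfolding gauss_prod by (rule integrable_prod_Basis(1)[OF gauss_real(1)])
  thus ?thesis by simp
qed

lemma gauss_measurable [measurable]: "gauss \<in> borel_measurable borel"
  unfolding gauss_def by measurable

lemma gauss_integral: "(\<integral>x. gauss (x::'a::euclidean_space) \<partial>lborel) = of_real (sqrt (2 * pi) ^ DIM('a))"
  using fourier_gauss[of "0::'a"] by (simp add: fourier_def gauss_def)

lemma fourier_multiplication:
  fixes f g :: "'a::euclidean_space \<Rightarrow> complex"
  assumes "integrable lborel f" "integrable lborel g"
  shows "(\<integral>\<xi>. fourier f \<xi> * g \<xi> \<partial>lborel) = (\<integral>x. f x * fourier g x \<partial>lborel)"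
proof -
  have [measurable]: "f \<in> borel_measurable borel" "g \<in> borel_measurable borel"
    using assms by (auto dest: borel_measurable_integrable)
  let ?H = "\<lambda>x \<xi>. exp (- \<i> * complex_of_real (x \<bullet> \<xi>)) * f x * g \<xi>"
  have i: "integrable (lborel \<Otimes>\<^sub>M lborel) (case_prod ?H)"
  proof (rule integrable_pairI)
    have "(\<integral>\<^sup>+x. \<integral>\<^sup>+\<xi>. ennreal (cmod (?H x \<xi>)) \<partial>lborel \<partial>lborel) =
       (\<integral>\<^sup>+x. ennreal (cmod (f x)) \<partial>lborel) * (\<integral>\<^sup>+\<xi>. ennreal (cmod (g \<xi>)) \<partial>lborel)"
      unfolding norm_mult cmod_exp_i by (simp add: ennreal_mult nn_integral_cmult nn_integral_multc)
    thus "(\<integral>\<^sup>+x. \<integral>\<^sup>+\<xi>. ennreal (cmod (?H x \<xi>)) \<partial>lborel \<partial>lborel) < \<infinity>"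
      using nn_integral_less_top[OF assms(1)] nn_integral_less_top[OF assms(2)] by (simp add: ennreal_mult_less_top)
  qed measurable
  have "(\<integral>\<xi>. fourier f \<xi> * g \<xi> \<partial>lborel) = (\<integral>\<xi>. (\<integral>x. ?H x \<xi> \<partial>lborel) \<partial>lborel)"
    unfolding fourier_def by (simp only: integral_mult_left_zero)
  also have "\<dots> = (\<integral>x. (\<integral>\<xi>. ?H x \<xi> \<partial>lborel) \<partial>lborel)" by (rule lborel_pair.Fubini_integral[OF i])
  also have "\<dots> = (\<integral>x. (\<integral>\<xi>. f x * (exp (- \<i> * complex_of_real (\<xi> \<bullet> x)) * g \<xi>) \<partial>lborel) \<partial>lborel)"
    by (simp add: mult_ac inner_commute)
  also have "\<dots> = (\<integral>x. f x * fourier g x \<partial>lborel)"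
    unfolding fourier_def by (simp only: integral_mult_right_zero)
  finally show ?thesis .
qed

text \<open>Apply the multiplication formula to \<open>z \<mapsto> \<phi> (x + s z)\<close> and the Gaussian, and let \<open>s \<longlongrightarrow> 0\<close>.\<close>

theorem fourier_inversion:
  fixes \<phi> :: "'a::euclidean_space \<Rightarrow> complex"
  assumes "schwartz_fun \<phi>"
  shows "fourier (fourier \<phi>) (- x) = of_real ((2 * pi) ^ DIM('a)) * \<phi> x"
proof -
  note [measurable] = schwartz_measurable[OF assms] schwartz_measurable[OF schwartz_fourier[OF assms]]
  define s where "s j = inverse (real (Suc j))" for j
  have s: "0 < s j" "s j \<noteq> 0" for j by (auto simp: s_def)
  have s0: "s \<longlonglongrightarrow> 0" unfolding s_def by (rule LIMSEQ_inverse_real_of_nat)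
  let ?c = "sqrt (2 * pi) ^ DIM('a)"
  obtain B where B: "B \<ge> 0" "\<And>x. cmod (\<phi> x) \<le> B" using schwartz_bounded[OF assms] by blast
  \<comment> \<open>After the substitution \<open>\<xi> = \<eta> / s j\<close> the dilation sits on
    the Gaussian on the left and on \<open>\<phi>\<close> on the right, so both sides have a
    limit.\<close>
  have eq: "(\<integral>\<xi>. exp (\<i> * complex_of_real (x \<bullet> \<xi>)) * fourier \<phi> \<xi> * gauss (s j *\<^sub>R \<xi>) \<partial>lborel) =
        (\<integral>z. \<phi> (x + s j *\<^sub>R z) * fourier gauss z \<partial>lborel)" for j
  proof -
    let ?\<phi> = "\<lambda>z. \<phi> (x + s j *\<^sub>R z)"
    have i: "integrable lborel ?\<phi>" using integrable_affine_iff[of \<phi> "s j" x] s schwartz_integrable[OF assms] by simp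
    have f: "fourier ?\<phi> \<eta> = of_real (inverse (s j) ^ DIM('a)) * (exp (\<i> * complex_of_real (x \<bullet> (inverse (s j) *\<^sub>R \<eta>))) * fourier \<phi> (inverse (s j) *\<^sub>R \<eta>))" for \<eta>
    proof -
      have "fourier \<phi> (inverse (s j) *\<^sub>R \<eta>) = of_real (s j ^ DIM('a)) *
         (\<integral>z. exp (- \<i> * complex_of_real ((x + s j *\<^sub>R z) \<bullet> (inverse (s j) *\<^sub>R \<eta>))) * \<phi> (x + s j *\<^sub>R z) \<partial>lborel)"
        unfolding fourier_def
        by (subst lborel_integral_affine[of _ "s j" x]) (use s[of j] in auto)
      also have "(\<lambda>z. exp (- \<i> * complex_of_real ((x + s j *\<^sub>R z) \<bullet> (inverse (s j) *\<^sub>R \<eta>))) * \<phi> (x + s j *\<^sub>R z)) =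
         (\<lambda>z. exp (- \<i> * complex_of_real (x \<bullet> (inverse (s j) *\<^sub>R \<eta>))) * (exp (- \<i> * complex_of_real (z \<bullet> \<eta>)) * ?\<phi> z))"
      proof
        fix z
        have "(x + s j *\<^sub>R z) \<bullet> (inverse (s j) *\<^sub>R \<eta>) = x \<bullet> (inverse (s j) *\<^sub>R \<eta>) + z \<bullet> \<eta>"
          using s(2)[of j] by (simp add: inner_add_left field_simps)
        hence "exp (- \<i> * complex_of_real ((x + s j *\<^sub>R z) \<bullet> (inverse (s j) *\<^sub>R \<eta>))) =
            exp (- \<i> * complex_of_real (x \<bullet> (inverse (s j) *\<^sub>R \<eta>))) * exp (- \<i> * complex_of_real (z \<bullet> \<eta>))"
          by (simp only: of_real_add distrib_left exp_add)
        thus "exp (- \<i> * complex_of_real ((x + s j *\<^sub>R z) \<bullet> (inverse (s j) *\<^sub>R \<eta>))) * ?\<phi> z =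
            exp (- \<i> * complex_of_real (x \<bullet> (inverse (s j) *\<^sub>R \<eta>))) * (exp (- \<i> * complex_of_real (z \<bullet> \<eta>)) * ?\<phi> z)"
          by (simp only: mult.assoc)
      qed
      also have "(\<integral>z. exp (- \<i> * complex_of_real (x \<bullet> (inverse (s j) *\<^sub>R \<eta>))) * (exp (- \<i> * complex_of_real (z \<bullet> \<eta>)) * ?\<phi> z) \<partial>lborel) =
         exp (- \<i> * complex_of_real (x \<bullet> (inverse (s j) *\<^sub>R \<eta>))) * fourier ?\<phi> \<eta>"
        unfolding fourier_def by (simp only: integral_mult_right_zero)
      finally show ?thesis using s(2)[of j] by (simp add: exp_minus field_simps)
    qed
    have "(\<integral>\<xi>. exp (\<i> * complex_of_real (x \<bullet> \<xi>)) * fourier \<phi> \<xi> * gauss (s j *\<^sub>R \<xi>) \<partial>lborel) =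
       of_real (inverse (s j) ^ DIM('a)) * (\<integral>\<eta>. exp (\<i> * complex_of_real (x \<bullet> (0 + inverse (s j) *\<^sub>R \<eta>))) *
           fourier \<phi> (0 + inverse (s j) *\<^sub>R \<eta>) * gauss (s j *\<^sub>R (0 + inverse (s j) *\<^sub>R \<eta>)) \<partial>lborel)"
      by (subst lborel_integral_affine[of _ "inverse (s j)" 0]) (use s[of j] in auto)
    also have "\<dots> = (\<integral>\<eta>. fourier ?\<phi> \<eta> * gauss \<eta> \<partial>lborel)"
      unfolding f using s(2)[of j] by (simp only: integral_mult_right_zero[symmetric]) (simp add: mult_ac)
    also have "\<dots> = (\<integral>z. ?\<phi> z * fourier gauss z \<partial>lborel)"
      by (rule fourier_multiplication[OF i gauss_integrable])
    finally show ?thesis .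
  qed
  have cont: "isCont \<phi> y" for y
    using has_derivative_continuous[OF smooth_has_derivative[OF schwartz_smooth[OF assms] UNIV_I]] by simp
  have g1: "cmod (gauss y) \<le> 1" for y :: 'a by (simp add: gauss_def)
  have cg: "isCont gauss y" for y :: 'a unfolding gauss_def by (intro continuous_intros) auto
  have sx: "(\<lambda>j. s j *\<^sub>R z) \<longlonglongrightarrow> 0" for z :: 'a using tendsto_scaleR[OF s0 tendsto_const[of z]] by simp
  have L: "(\<lambda>j. \<integral>\<xi>. exp (\<i> * complex_of_real (x \<bullet> \<xi>)) * fourier \<phi> \<xi> * gauss (s j *\<^sub>R \<xi>) \<partial>lborel) \<longlonglongrightarrow>
      (\<integral>\<xi>. exp (\<i> * complex_of_real (x \<bullet> \<xi>)) * fourier \<phi> \<xi> * gauss (0::'a) \<partial>lborel)"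
  proof (rule integral_dominated_convergence[where w = "\<lambda>\<xi>. cmod (fourier \<phi> \<xi>)"])
    show "integrable lborel (\<lambda>\<xi>. cmod (fourier \<phi> \<xi>))"
      by (intro integrable_norm schwartz_integrable schwartz_fourier assms)
    show "AE \<xi> in lborel. (\<lambda>j. exp (\<i> * complex_of_real (x \<bullet> \<xi>)) * fourier \<phi> \<xi> * gauss (s j *\<^sub>R \<xi>)) \<longlonglongrightarrow>
        exp (\<i> * complex_of_real (x \<bullet> \<xi>)) * fourier \<phi> \<xi> * gauss (0::'a)"
      by (intro AE_I2 tendsto_mult tendsto_const isCont_tendsto_compose[OF cg sx])
    show "AE \<xi> in lborel. cmod (exp (\<i> * complex_of_real (x \<bullet> \<xi>)) * fourier \<phi> \<xi> * gauss (s j *\<^sub>R \<xi>)) \<le> cmod (fourier \<phi> \<xi>)" for j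
      unfolding norm_mult cmod_exp_i using g1 by (auto intro!: mult_left_le)
  qed measurable
  have R: "(\<lambda>j. \<integral>z. \<phi> (x + s j *\<^sub>R z) * fourier gauss z \<partial>lborel) \<longlonglongrightarrow> (\<integral>z. \<phi> (x + 0) * fourier gauss (z::'a) \<partial>lborel)"
    unfolding fourier_gauss
  proof (rule integral_dominated_convergence[where w = "\<lambda>z. B * cmod (of_real ?c * gauss z)"])
    show "integrable lborel (\<lambda>z::'a. B * cmod (of_real ?c * gauss z))"
      by (intro integrable_mult_right integrable_norm gauss_integrable)
    show "AE z in lborel. (\<lambda>j. \<phi> (x + s j *\<^sub>R z) * (of_real ?c * gauss z)) \<longlonglongrightarrow> \<phi> (x + 0) * (of_real ?c * gauss z)"
      by (intro AE_I2 tendsto_mult tendsto_const isCont_tendsto_compose[OF cont] tendsto_add sx)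
    show "AE z in lborel. cmod (\<phi> (x + s j *\<^sub>R z) * (of_real ?c * gauss z)) \<le> B * cmod (of_real ?c * gauss z)" for j
      unfolding norm_mult[of "\<phi> _"] by (intro AE_I2 mult_right_mono B) auto
  qed measurable
  have "(\<integral>\<xi>. exp (\<i> * complex_of_real (x \<bullet> \<xi>)) * fourier \<phi> \<xi> * gauss (0::'a) \<partial>lborel) = (\<integral>z. \<phi> (x + 0) * fourier gauss (z::'a) \<partial>lborel)"
    using L R unfolding eq by (rule LIMSEQ_unique)
  also have "(\<integral>\<xi>. exp (\<i> * complex_of_real (x \<bullet> \<xi>)) * fourier \<phi> \<xi> * gauss (0::'a) \<partial>lborel) = fourier (fourier \<phi>) (- x)"
    unfolding fourier_def[of "fourier \<phi>"] by (simp add: gauss_def inner_commute)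
  also have "(\<integral>z. \<phi> (x + 0) * fourier gauss (z::'a) \<partial>lborel) = \<phi> x * (of_real ?c * of_real ?c)"
    unfolding fourier_gauss integral_mult_right_zero gauss_integral by simp
  \<comment> \<open>One factor \<open>?c\<close> comes from the transform of the Gaussian, the other
    from its total mass.\<close>
  also have "of_real ?c * of_real ?c = complex_of_real ((2 * pi) ^ DIM('a))"
    unfolding of_real_mult[symmetric] power_mult_distrib[symmetric] by simp
  finally show ?thesis by (simp add: mult.commute)
qed

lemma fourier_reflect:
  assumes "f \<in> borel_measurable borel"
  shows "fourier (\<lambda>x. f (- x)) \<xi> = fourier f (- \<xi>)"
proof -
  note [measurable] = assms
  show ?thesis unfolding fourier_def by (subst (2) lborel_integral_affine[of _ "-1" 0]) auto
qed

definition ifourier :: "('a::euclidean_space \<Rightarrow> complex) \<Rightarrow> 'a \<Rightarrow> complex" where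
  "ifourier \<psi> x = of_real (1 / (2 * pi) ^ DIM('a)) * fourier \<psi> (- x)"

lemma schwartz_ifourier: "schwartz_fun \<psi> \<Longrightarrow> schwartz_fun (ifourier \<psi>)"
  unfolding ifourier_def by (intro schwartz_cmult schwartz_reflect schwartz_fourier)

lemma ifourier_fourier: "schwartz_fun \<phi> \<Longrightarrow> ifourier (fourier \<phi>) = \<phi>"
  by (rule ext) (simp add: ifourier_def fourier_inversion)

lemma fourier_ifourier:
  assumes "schwartz_fun \<psi>" shows "fourier (ifourier \<psi>) = \<psi>"
proof
  fix x
  have "fourier (ifourier \<psi>) x = of_real (1 / (2 * pi) ^ DIM('a)) * fourier (fourier \<psi>) (- x)"
    unfolding ifourier_def fourier_cmult
    by (subst fourier_reflect) (auto intro: schwartz_measurable schwartz_fourier assms)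
  thus "fourier (ifourier \<psi>) x = \<psi> x" by (simp add: fourier_inversion assms)
qed

section \<open>Pointwise bounds by duality\<close>

text \<open>Prepares the use of Stone-Weierstrass: a polynomial times a cutoff is a test function. A
  linear form is the inner product with its coefficient vector, which is already known to be
  smooth.\<close>

lemma smooth_real_polynomial:
  fixes P :: "'a::euclidean_space \<Rightarrow> real"
  assumes "real_polynomial_function P" shows "smooth_fun_on UNIV (\<lambda>x. complex_of_real (P x))"
  using assms
proof (induction rule: real_polynomial_function.induct)
  case (linear f)
  have "f x = x \<bullet> (\<Sum>b\<in>Basis. f b *\<^sub>R b)" for x
  proof -
    have "f x = f (\<Sum>b\<in>Basis. (x \<bullet> b) *\<^sub>R b)" by (simp add: euclidean_representation)
    also have "\<dots> = (\<Sum>b\<in>Basis. (x \<bullet> b) *\<^sub>R f b)"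
      unfolding linear_sum[OF bounded_linear.linear[OF linear], of "\<lambda>b. (x \<bullet> b) *\<^sub>R b"]
        linear_scale[OF bounded_linear.linear[OF linear]] ..
    finally show ?thesis by (simp add: inner_sum_right mult.commute)
  qed
  hence "f = (\<lambda>x. x \<bullet> (\<Sum>b\<in>Basis. f b *\<^sub>R b))" by (rule ext)
  thus ?case using smooth_inner[OF open_UNIV, of "\<Sum>b\<in>Basis. f b *\<^sub>R b"] by metis
next
  case (add f g)
  thus ?case using smooth_add[OF open_UNIV add.IH] by simp
next
  case (mult f g)
  thus ?case using smooth_mult[OF open_UNIV mult.IH] by simp
qed (rule smooth_const[OF open_UNIV])

lemma indicator_scaleR_integrable:
  "set_integrable lborel K F \<Longrightarrow> integrable lborel (\<lambda>x. cmod (indicator K x *\<^sub>R F x))"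
  unfolding set_integrable_def by (rule integrable_norm)

text \<open>The hypothesis passes from test functions to continuous functions without mollifiers:
  polynomials approximating \<open>g\<close> uniformly on a larger ball are multiplied by a cutoff,
  and dominated convergence applies on that ball.\<close>

lemma duality_continuous:
  fixes F :: "'a::euclidean_space \<Rightarrow> complex" and B g :: "'a \<Rightarrow> real"
  assumes F: "F \<in> borel_measurable borel" "\<And>K. compact K \<Longrightarrow> set_integrable lborel K F"
    and B: "continuous_on UNIV B"
    and le: "\<And>\<phi>. test_fun \<phi> \<Longrightarrow> cmod (\<integral>x. F x * \<phi> x \<partial>lborel) \<le> (\<integral>x. B x * cmod (\<phi> x) \<partial>lborel)"
    and g: "continuous_on UNIV g" "R > 0" "\<And>x. x \<notin> cball 0 R \<Longrightarrow> g x = 0"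
  shows "cmod (\<integral>x. F x * of_real (g x) \<partial>lborel) \<le> (\<integral>x. B x * \<bar>g x\<bar> \<partial>lborel)"
proof -
  let ?K = "cball (0::'a) (2 * R)"
  note [measurable] = F(1) borel_measurable_continuous_onI[OF B] borel_measurable_continuous_onI[OF g(1)]
  obtain \<kappa> :: "'a \<Rightarrow> complex" where \<kappa>: "test_fun \<kappa>" "\<And>x. x \<in> cball 0 R \<Longrightarrow> \<kappa> x = 1"
    "\<And>x. x \<notin> ball 0 (2 * R) \<Longrightarrow> \<kappa> x = 0" "supp \<kappa> \<subseteq> cball 0 (2 * R)" "\<And>x. cmod (\<kappa> x) \<le> 1"
    by (rule exists_cutoff[OF g(2), of "0::'a"], rule that)
  have "\<forall>j::nat. \<exists>P. real_polynomial_function P \<and> (\<forall>x\<in>?K. \<bar>g x - P x\<bar> < inverse (real (Suc j)))"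
  proof
    fix j
    obtain P where "real_polynomial_function P" "\<And>x. x \<in> ?K \<Longrightarrow> \<bar>g x - P x\<bar> < inverse (real (Suc j))"
      by (rule Stone_Weierstrass_real_polynomial_function[of ?K g "inverse (real (Suc j))"])
         (use continuous_on_subset[OF g(1) subset_UNIV] in auto)
    thus "\<exists>P. real_polynomial_function P \<and> (\<forall>x\<in>?K. \<bar>g x - P x\<bar> < inverse (real (Suc j)))" by blast
  qed
  then obtain P where P: "\<And>j. real_polynomial_function (P j)"
    "\<And>j x. x \<in> ?K \<Longrightarrow> \<bar>g x - P j x\<bar> < inverse (real (Suc j))" by metis
  define \<phi> where "\<phi> j x = \<kappa> x * complex_of_real (P j x)" for j x
  have t: "test_fun (\<phi> j)" for j
    unfolding \<phi>_def by (rule test_mult(1)[OF \<kappa>(1) smooth_real_polynomial[OF P(1)]])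
  have [measurable]: "\<phi> j \<in> borel_measurable borel" for j by (rule schwartz_measurable[OF test_schwartz[OF t]])
  have out: "\<phi> j x = 0" "g x = 0" if "x \<notin> ?K" for j x
    using \<kappa>(3)[of x] that g(2) g(3)[of x] by (auto simp: \<phi>_def)
  \<comment> \<open>Where the cutoff may differ from 1, \<open>g\<close> vanishes and the cutoff is
    bounded by 1, so the truncation does not spoil the approximation.\<close>
  have near: "cmod (\<phi> j x - of_real (g x)) \<le> inverse (real (Suc j))" for j x
  proof (cases "x \<in> ?K")
    case K: True
    show ?thesis
    proof (cases "x \<in> cball 0 R")
      case True
      have "\<phi> j x - of_real (g x) = of_real (P j x - g x)" using \<kappa>(2)[OF True] by (simp add: \<phi>_def)
      thus ?thesis using P(2)[OF K, of j] by (simp del: of_real_diff)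
    next
      case False
      hence "g x = 0" by (rule g(3))
      hence "cmod (\<phi> j x - of_real (g x)) \<le> 1 * \<bar>P j x\<bar>"
        using \<kappa>(5)[of x] by (simp add: \<phi>_def norm_mult mult_left_le_one_le)
      thus ?thesis using P(2)[OF K, of j] \<open>g x = 0\<close> by simp
    qed
  qed (simp add: out)
  have lim: "(\<lambda>j. \<phi> j x) \<longlonglongrightarrow> of_real (g x)" for x
  proof -
    have "(\<lambda>j. \<phi> j x - of_real (g x)) \<longlonglongrightarrow> 0"
      by (rule Lim_null_comparison[OF always_eventually[OF allI[OF near]] LIMSEQ_inverse_real_of_nat])
    thus ?thesis by (simp add: LIM_zero_iff)
  qed
  obtain M where M: "M \<ge> 0" "\<And>x. x \<in> ?K \<Longrightarrow> \<bar>g x\<bar> \<le> M"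
  proof -
    have "bounded (g ` ?K)" by (intro compact_imp_bounded compact_continuous_image continuous_on_subset[OF g(1)]) auto
    then obtain M where "\<forall>x\<in>?K. \<bar>g x\<bar> \<le> M" by (auto simp: bounded_iff)
    moreover have "0 \<in> ?K" using g(2) by simp
    ultimately show ?thesis using that[of M] by (meson abs_ge_zero order_trans)
  qed
  have bd: "cmod (\<phi> j x) \<le> (M + 1) * indicator ?K x" for j x
  proof (cases "x \<in> ?K")
    case True
    have "cmod (\<phi> j x) \<le> cmod (\<phi> j x - of_real (g x)) + \<bar>g x\<bar>"
      using norm_triangle_ineq[of "\<phi> j x - of_real (g x)" "of_real (g x)"] by simp
    also have "\<dots> \<le> 1 + M"
    proof (intro add_mono M(2)[OF True])
      have "inverse (real (Suc j)) \<le> 1" by (simp add: field_simps)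
      thus "cmod (\<phi> j x - of_real (g x)) \<le> 1" using near[of j x] by (rule order_trans[rotated])
    qed
    finally show ?thesis using True by simp
  qed (simp add: out)
  have "(\<lambda>j. \<integral>x. F x * \<phi> j x \<partial>lborel) \<longlonglongrightarrow> (\<integral>x. F x * of_real (g x) \<partial>lborel)"
  proof (rule integral_dominated_convergence[where w = "\<lambda>x. (M + 1) * cmod (indicator ?K x *\<^sub>R F x)"])
    show "integrable lborel (\<lambda>x. (M + 1) * cmod (indicator ?K x *\<^sub>R F x))"
      by (intro integrable_mult_right indicator_scaleR_integrable F) auto
    show "AE x in lborel. (\<lambda>j. F x * \<phi> j x) \<longlonglongrightarrow> F x * of_real (g x)" by (intro AE_I2 tendsto_intros lim)
    show "AE x in lborel. cmod (F x * \<phi> j x) \<le> (M + 1) * cmod (indicator ?K x *\<^sub>R F x)" for j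
      unfolding norm_mult
    proof (intro AE_I2)
      fix x show "cmod (F x) * cmod (\<phi> j x) \<le> (M + 1) * cmod (indicator ?K x *\<^sub>R F x)"
        using mult_left_mono[OF bd[of j x] norm_ge_zero[of "F x"]] by (simp add: mult_ac)
    qed
  qed measurable
  moreover have "(\<lambda>j. \<integral>x. B x * cmod (\<phi> j x) \<partial>lborel) \<longlonglongrightarrow> (\<integral>x. B x * cmod (of_real (g x)) \<partial>lborel)"
  proof (rule integral_dominated_convergence[where w = "\<lambda>x. (M + 1) * norm (indicator ?K x *\<^sub>R B x)"])
    have "set_integrable lborel ?K B"
      by (intro borel_integrable_compact[unfolded set_integrable_def[symmetric]] continuous_on_subset[OF B]) auto
    thus "integrable lborel (\<lambda>x. (M + 1) * norm (indicator ?K x *\<^sub>R B x))"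
      unfolding set_integrable_def by (intro integrable_mult_right integrable_norm)
    show "AE x in lborel. (\<lambda>j. B x * cmod (\<phi> j x)) \<longlonglongrightarrow> B x * cmod (of_real (g x))"
      by (intro AE_I2 tendsto_intros lim)
    show "AE x in lborel. norm (B x * cmod (\<phi> j x)) \<le> (M + 1) * norm (indicator ?K x *\<^sub>R B x)" for j
    proof (intro AE_I2)
      fix x show "norm (B x * cmod (\<phi> j x)) \<le> (M + 1) * norm (indicator ?K x *\<^sub>R B x)"
        using mult_left_mono[OF bd[of j x] abs_ge_zero[of "B x"]] by (simp add: abs_mult mult_ac)
    qed
  qed measurable
  ultimately show ?thesis
    by (intro LIMSEQ_le[OF tendsto_norm]) (use le[OF t] in auto)
qed

text \<open>The functions \<open>g j\<close> decrease to the indicator of \<open>K\<close> and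
  vanish at distance 1 or more from \<open>K\<close>, hence outside one fixed ball, so dominated
  convergence passes from continuous functions to the indicator.\<close>

lemma duality_compact:
  fixes F :: "'a::euclidean_space \<Rightarrow> complex" and B :: "'a \<Rightarrow> real"
  assumes F: "F \<in> borel_measurable borel" "\<And>K. compact K \<Longrightarrow> set_integrable lborel K F"
    and B: "continuous_on UNIV B"
    and le: "\<And>\<phi>. test_fun \<phi> \<Longrightarrow> cmod (\<integral>x. F x * \<phi> x \<partial>lborel) \<le> (\<integral>x. B x * cmod (\<phi> x) \<partial>lborel)"
    and K: "compact K" "K \<noteq> {}"
  shows "cmod (\<integral>x. F x * of_real (indicator K x) \<partial>lborel) \<le> (\<integral>x. B x * \<bar>indicator K x\<bar> \<partial>lborel)"
proof -
  note [measurable] = F(1) borel_measurable_continuous_onI[OF B]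
  have [measurable]: "K \<in> sets borel" using K by (simp add: borel_compact)
  obtain R0 where R0: "R0 > 0" "\<And>x. x \<in> K \<Longrightarrow> norm x \<le> R0" using compact_imp_bounded[OF K(1)] bounded_pos by metis
  define R where "R = R0 + 1"
  let ?C = "cball (0::'a) R"
  define g where "g j x = max 0 (1 - real (Suc j) * infdist x K)" for j :: nat and x
  have gc: "continuous_on UNIV (g j)" for j unfolding g_def by (intro continuous_intros)
  note [measurable] = borel_measurable_continuous_onI[OF gc]
  have out: "g j x = 0" if "x \<notin> ?C" for j x
  proof -
    have "1 \<le> infdist x K"
      unfolding infdist_notempty[OF K(2)]
    proof (rule cINF_greatest[OF K(2)])
      fix a assume "a \<in> K"
      thus "1 \<le> dist x a" using R0(2)[of a] that norm_triangle_ineq2[of x a] by (auto simp: R_def dist_norm)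
    qed
    hence "1 * 1 \<le> real (Suc j) * infdist x K" by (intro mult_mono) auto
    thus ?thesis by (simp add: g_def)
  qed
  have g01: "0 \<le> g j x" "g j x \<le> 1" for j x by (auto simp: g_def infdist_nonneg)
  have bd: "\<bar>g j x\<bar> \<le> indicator ?C x" for j x using g01[of j x] out[of x j] by (auto simp: indicator_def)
  have lim: "(\<lambda>j. g j x) \<longlonglongrightarrow> indicator K x" for x
  proof (cases "x \<in> K")
    case True thus ?thesis by (simp add: g_def)
  next
    case False
    hence "0 < infdist x K" using K compact_imp_closed in_closed_iff_infdist_zero infdist_nonneg less_eq_real_def by metis
    then obtain j0 :: nat where "1 < real j0 * infdist x K" using reals_Archimedean3 by blast
    hence "g j x = 0" if "j \<ge> j0" for j
    proof -
      have "real j0 * infdist x K \<le> real (Suc j) * infdist x K" using that by (intro mult_right_mono) (auto simp: infdist_nonneg)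
      thus ?thesis using \<open>1 < real j0 * infdist x K\<close> by (simp add: g_def)
    qed
    hence "\<forall>\<^sub>F j in sequentially. g j x = indicator K x" using False by (auto simp: eventually_sequentially)
    thus ?thesis by (rule tendsto_eventually)
  qed
  have le2: "cmod (\<integral>x. F x * of_real (g j x) \<partial>lborel) \<le> (\<integral>x. B x * \<bar>g j x\<bar> \<partial>lborel)" for j
    by (rule duality_continuous[OF F B le gc, of R]) (use out R0(1) in \<open>auto simp: R_def\<close>)
  have "(\<lambda>j. \<integral>x. F x * of_real (g j x) \<partial>lborel) \<longlonglongrightarrow> (\<integral>x. F x * of_real (indicator K x) \<partial>lborel)"
  proof (rule integral_dominated_convergence[where w = "\<lambda>x. cmod (indicator ?C x *\<^sub>R F x)"])
    show "integrable lborel (\<lambda>x. cmod (indicator ?C x *\<^sub>R F x))"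
      by (intro indicator_scaleR_integrable F) auto
    show "AE x in lborel. (\<lambda>j. F x * of_real (g j x)) \<longlonglongrightarrow> F x * of_real (indicator K x)" by (intro AE_I2 tendsto_intros lim)
    show "AE x in lborel. cmod (F x * of_real (g j x)) \<le> cmod (indicator ?C x *\<^sub>R F x)" for j
      unfolding norm_mult
    proof (intro AE_I2)
      fix x show "cmod (F x) * cmod (of_real (g j x)) \<le> cmod (indicator ?C x *\<^sub>R F x)"
        using mult_left_mono[OF bd[of j x] norm_ge_zero[of "F x"]] by (simp add: mult_ac)
    qed
  qed measurable
  moreover have "(\<lambda>j. \<integral>x. B x * \<bar>g j x\<bar> \<partial>lborel) \<longlonglongrightarrow> (\<integral>x. B x * \<bar>indicator K x\<bar> \<partial>lborel)"
  proof (rule integral_dominated_convergence[where w = "\<lambda>x. norm (indicator ?C x *\<^sub>R B x)"])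
    have "set_integrable lborel ?C B"
      by (intro borel_integrable_compact[unfolded set_integrable_def[symmetric]] continuous_on_subset[OF B]) auto
    thus "integrable lborel (\<lambda>x. norm (indicator ?C x *\<^sub>R B x))"
      unfolding set_integrable_def by (intro integrable_norm)
    show "AE x in lborel. (\<lambda>j. B x * \<bar>g j x\<bar>) \<longlonglongrightarrow> B x * \<bar>indicator K x\<bar>"
      by (intro AE_I2 tendsto_intros lim)
    show "AE x in lborel. norm (B x * \<bar>g j x\<bar>) \<le> norm (indicator ?C x *\<^sub>R B x)" for j
    proof (intro AE_I2)
      fix x show "norm (B x * \<bar>g j x\<bar>) \<le> norm (indicator ?C x *\<^sub>R B x)"
        using mult_left_mono[OF bd[of j x] abs_ge_zero[of "B x"]] by (simp add: abs_mult mult_ac)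
    qed
  qed measurable
  ultimately show ?thesis
    by (intro LIMSEQ_le[OF tendsto_norm]) (use le2 in auto)
qed

text \<open>Inner regularity by closed sets, which are compact when bounded. The tolerance is the
  measure of \<open>A\<close> itself, so the compact part cannot be null.\<close>

lemma positive_compact_subset:
  fixes A :: "'a::euclidean_space set"
  assumes "A \<in> sets borel" "bounded A" "emeasure lborel A \<noteq> 0"
  obtains K where "compact K" "K \<subseteq> A" "measure lborel K > 0"
proof -
  have A: "A \<in> sets lebesgue" "emeasure lebesgue A = emeasure lborel A" using assms(1) by simp_all
  have fin: "emeasure lborel A < \<infinity>" using emeasure_bounded_finite[OF assms(2)] .
  then obtain e where e: "emeasure lborel A = ennreal e" "e > 0"
    using assms(3) by (metis ennreal_cases ennreal_eq_0_iff infinity_ennreal_def less_irrefl not_le)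
  obtain K where K: "closed K" "K \<subseteq> A" "A - K \<in> lmeasurable" "emeasure lebesgue (A - K) < ennreal e"
    using sets_lebesgue_inner_closed[OF A(1) e(2)] by metis
  have kb [measurable]: "K \<in> sets borel" using K by simp
  have "emeasure lborel A \<le> emeasure lborel K + emeasure lborel (A - K)"
    using K(2) assms(1) kb by (subst plus_emeasure) (auto simp: Un_absorb1)
  moreover have "emeasure lborel (A - K) < ennreal e" using K(4) assms(1) kb by simp
  ultimately have "emeasure lborel K \<noteq> 0" using e(1) by auto
  moreover have "emeasure lborel K < \<infinity>" using emeasure_mono[OF K(2), of lborel] assms(1) fin by (simp add: le_less_trans)
  ultimately have "measure lborel K > 0"
    by (metis emeasure_eq_ennreal_measure ennreal_0 infinity_ennreal_def less_irrefl measure_nonneg less_eq_real_def)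
  thus ?thesis using that[of K] K bounded_subset[OF assms(2) K(2)] compact_eq_bounded_closed by blast
qed

text \<open>If \<open>cmod (F x) > B x\<close> on a set of positive measure, then for some
  \<open>c\<close> from a countable dense set in the unit disc and some \<open>n\<close> the real
  part of \<open>c * F x\<close> exceeds \<open>B x\<close> by \<open>inverse (real (Suc n))\<close>
  on a bounded set of positive measure, hence on a compact set \<open>K\<close>. Integrating over
  \<open>K\<close> contradicts the duality bound. Countability merges the exceptional sets into one
  null set.\<close>

theorem AE_le_by_duality:
  fixes F :: "'a::euclidean_space \<Rightarrow> complex" and B :: "'a \<Rightarrow> real"
  assumes F: "F \<in> borel_measurable borel" "\<And>K. compact K \<Longrightarrow> set_integrable lborel K F"
    and B: "continuous_on UNIV B" "\<And>x. B x \<ge> 0"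
    and le: "\<And>\<phi>. test_fun \<phi> \<Longrightarrow> cmod (\<integral>x. F x * \<phi> x \<partial>lborel) \<le> (\<integral>x. B x * cmod (\<phi> x) \<partial>lborel)"
  shows "AE x in lborel. cmod (F x) \<le> B x"
proof -
  note [measurable] = F(1) borel_measurable_continuous_onI[OF B(1)]
  have *: "AE x in lborel. \<not> (norm x \<le> real n \<and> Re (c * F x) \<ge> B x + inverse (real (Suc n)))" if c: "cmod c \<le> 1" for c n
  proof -
    let ?A = "{x::'a. norm x \<le> real n \<and> Re (c * F x) \<ge> B x + inverse (real (Suc n))}"
    have Am: "?A \<in> sets borel" by measurable
    have "emeasure lborel ?A = 0"
    proof (rule ccontr)
      assume "emeasure lborel ?A \<noteq> 0"
      moreover have "bounded ?A" by (auto simp: bounded_iff)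
      ultimately obtain K where K: "compact K" "K \<subseteq> ?A" "measure lborel K > 0"
        using positive_compact_subset[OF Am, of thesis] by blast
      have [measurable]: "K \<in> sets borel" using K by (simp add: borel_compact)
      have fK: "emeasure lborel K < \<infinity>" using emeasure_bounded_finite compact_imp_bounded K(1) by blast
      have iF: "integrable lborel (\<lambda>x. F x * of_real (indicator K x))"
        using F(2)[OF K(1)] by (simp add: set_integrable_def scaleR_conv_of_real mult.commute)
      have iB: "integrable lborel (\<lambda>x. B x * \<bar>indicator K x\<bar>)"
        using borel_integrable_compact[OF K(1) continuous_on_subset[OF B(1)]] by (simp add: mult.commute)
      have iK: "integrable lborel (\<lambda>x. inverse (real (Suc n)) * indicator K x)"
        using fK by (intro integrable_mult_right integrable_real_indicator) auto
      have "K \<noteq> {}" using K(3) by auto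
      have "(\<integral>x. B x * \<bar>indicator K x\<bar> + inverse (real (Suc n)) * indicator K x \<partial>lborel) \<le>
          (\<integral>x. Re (c * (F x * of_real (indicator K x))) \<partial>lborel)"
      proof (rule integral_mono)
        show "integrable lborel (\<lambda>x. B x * \<bar>indicator K x\<bar> + inverse (real (Suc n)) * indicator K x)"
          using iB iK by (rule Bochner_Integration.integrable_add)
        show "integrable lborel (\<lambda>x. Re (c * (F x * of_real (indicator K x))))"
          by (intro integrable_Re integrable_mult_right iF)
        show "B x * \<bar>indicator K x\<bar> + inverse (real (Suc n)) * indicator K x \<le> Re (c * (F x * of_real (indicator K x)))" for x
          using K(2) by (cases "x \<in> K") auto
      qed
      also have "\<dots> = Re (c * (\<integral>x. F x * of_real (indicator K x) \<partial>lborel))"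
        by (subst integral_Re) (auto intro!: integrable_mult_right iF)
      also have "\<dots> \<le> cmod c * cmod (\<integral>x. F x * of_real (indicator K x) \<partial>lborel)"
        using complex_Re_le_cmod norm_mult by metis
      also have "\<dots> \<le> 1 * (\<integral>x. B x * \<bar>indicator K x\<bar> \<partial>lborel)"
        by (intro mult_mono c duality_compact[OF F B(1) le K(1) \<open>K \<noteq> {}\<close>]) auto
      finally have "(\<integral>x. inverse (real (Suc n)) * indicator K x \<partial>lborel) \<le> 0"
        using iB iK by (subst (asm) Bochner_Integration.integral_add) auto
      moreover have "(\<integral>x. inverse (real (Suc n)) * indicator K x \<partial>lborel) = inverse (real (Suc n)) * measure lborel K"
        using fK by (simp add: emeasure_eq_ennreal_measure)
      moreover have "inverse (real (Suc n)) * measure lborel K > 0" using K(3) by simp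
      ultimately show False by linarith
    qed
    moreover have "?A \<in> sets lborel" unfolding sets_lborel by (rule Am)
    ultimately have "?A \<in> null_sets lborel" by (rule null_setsI)
    from AE_not_in[OF this] show ?thesis by (simp only: mem_Collect_eq)
  qed
  obtain D :: "complex set" where D: "countable D" "\<And>X. open X \<Longrightarrow> X \<noteq> {} \<Longrightarrow> \<exists>d\<in>D. d \<in> X"
    using countable_dense_setE by blast
  have "AE x in lborel. \<forall>c\<in>{c\<in>D. cmod c \<le> 1}. \<forall>n. \<not> (norm x \<le> real n \<and> Re (c * F x) \<ge> B x + inverse (real (Suc n)))"
    by (subst AE_ball_countable) (use D(1) * in \<open>auto simp: AE_all_countable\<close>)
  thus ?thesis
  proof (rule AE_mp, intro AE_I2 impI)
    fix x assume x: "\<forall>c\<in>{c\<in>D. cmod c \<le> 1}. \<forall>n. \<not> (norm x \<le> real n \<and> Re (c * F x) \<ge> B x + inverse (real (Suc n)))"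
    show "cmod (F x) \<le> B x"
    proof (rule ccontr)
      assume "\<not> cmod (F x) \<le> B x"
      hence lt: "B x < cmod (F x)" and pos: "cmod (F x) > 0" using B(2)[of x] by auto
      \<comment> \<open>\<open>t\<close> lies strictly between \<open>B x / cmod (F x)\<close> and
        1. The unimodular factor that turns \<open>F x\<close> into its modulus, scaled by
        \<open>t\<close>, is then an interior point of the disc where the real part still exceeds
        \<open>B x\<close>, so nearby points of the dense set work too.\<close>
      define t where "t = (B x / cmod (F x) + 1) / 2"
      have t: "B x / cmod (F x) < t" "0 \<le> t" "t < 1" using lt pos B(2)[of x] by (auto simp: t_def field_simps)
      let ?X = "{c. Re (c * F x) > B x} \<inter> ball 0 1"
      have "of_real t * cnj (F x) / of_real (cmod (F x)) \<in> ?X"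
      proof -
        have e: "of_real t * cnj (F x) / of_real (cmod (F x)) * F x = of_real (t * cmod (F x))"
          using pos complex_norm_square[of "F x"] by (simp add: field_simps power2_eq_square)
        have "Re (of_real t * cnj (F x) / of_real (cmod (F x)) * F x) > B x"
          unfolding e using t(1) pos by (simp add: field_simps)
        moreover have "cmod (of_real t * cnj (F x) / of_real (cmod (F x))) = t"
          using t pos by (simp add: norm_mult norm_divide)
        ultimately show ?thesis using t(3) by (simp only: Int_iff mem_Collect_eq mem_ball_0 simp_thms)
      qed
      moreover have "open ?X"
        by (intro open_Int open_Collect_less continuous_intros) auto
      ultimately obtain d where "d \<in> D" "d \<in> ?X" using D(2)[of ?X] by blast
      hence d: "d \<in> D" "Re (d * F x) > B x" "cmod d < 1" by simp_all
      obtain n0 where n0: "inverse (real (Suc n0)) < Re (d * F x) - B x" using reals_Archimedean d(2) by (metis diff_gt_0_iff_gt)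
      obtain n1 :: nat where n1: "norm x \<le> real n1" using real_arch_simple by blast
      define n where "n = max n0 n1"
      have "inverse (real (Suc n)) \<le> inverse (real (Suc n0))" unfolding n_def by (intro le_imp_inverse_le) auto
      moreover have "norm x \<le> real n" using n1 by (simp add: n_def)
      moreover have "\<not> (norm x \<le> real n \<and> Re (d * F x) \<ge> B x + inverse (real (Suc n)))"
        using x d(1) less_imp_le[OF d(3)] by blast
      ultimately show False using n0 by linarith
    qed
  qed
qed

text \<open>The previous bound with \<open>B = 0\<close> for the difference; the integrals split
  because test functions are bounded with compact support.\<close>

lemma AE_eq_by_duality:
  fixes F G :: "'a::euclidean_space \<Rightarrow> complex"
  assumes F: "F \<in> borel_measurable borel" "\<And>K. compact K \<Longrightarrow> set_integrable lborel K F"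
    and G: "G \<in> borel_measurable borel" "\<And>K. compact K \<Longrightarrow> set_integrable lborel K G"
    and eq: "\<And>\<phi>. test_fun \<phi> \<Longrightarrow> (\<integral>x. F x * \<phi> x \<partial>lborel) = (\<integral>x. G x * \<phi> x \<partial>lborel)"
  shows "AE x in lborel. F x = G x"
proof -
  note [measurable] = F(1) G(1)
  have i: "integrable lborel (\<lambda>x. H x * \<phi> x)"
    if H: "H \<in> borel_measurable borel" "\<And>K. compact K \<Longrightarrow> set_integrable lborel K H" and \<phi>: "test_fun \<phi>"
    for H \<phi> :: "'a \<Rightarrow> complex"
  proof -
    note [measurable] = H(1) schwartz_measurable[OF test_schwartz[OF \<phi>]]
    obtain C where C: "\<And>x. cmod (\<phi> x) \<le> C" "C \<ge> 0" using schwartz_bounded[OF test_schwartz[OF \<phi>]] by metis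
    show ?thesis
    proof (rule Bochner_Integration.integrable_bound)
      show "integrable lborel (\<lambda>x. C * cmod (indicator (supp \<phi>) x *\<^sub>R H x))"
        using \<phi> by (intro integrable_mult_right indicator_scaleR_integrable H) (simp add: test_fun_def)
      show "AE x in lborel. norm (H x * \<phi> x) \<le> norm (C * cmod (indicator (supp \<phi>) x *\<^sub>R H x))"
        using C(2) outside_supp[of _ \<phi>] mult_left_mono[OF C(1) norm_ge_zero]
        by (intro AE_I2) (auto simp: norm_mult indicator_def mult.commute[of C])
    qed measurable
  qed
  have "AE x in lborel. cmod (F x - G x) \<le> 0"
  proof (rule AE_le_by_duality)
    show "set_integrable lborel K (\<lambda>x. F x - G x)" if "compact K" for K
      using F(2)[OF that] G(2)[OF that] by (rule set_integral_diff(1))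
    show "cmod (\<integral>x. (F x - G x) * \<phi> x \<partial>lborel) \<le> (\<integral>x. 0 * cmod (\<phi> x) \<partial>lborel)" if \<phi>: "test_fun \<phi>" for \<phi>
      using i[OF F \<phi>] i[OF G \<phi>] eq[OF \<phi>] by (simp add: left_diff_distrib)
  qed auto
  thus ?thesis by (rule AE_mp) auto
qed

section \<open>Lebesgue spaces and Young's inequality\<close>

lemma ennreal_ge_1_cases:
  assumes "1 \<le> (p::ennreal)"
  obtains "p = \<infinity>" | p' where "p' \<ge> 1" "p = ennreal p'"
  using assms by (cases p) (auto simp: ennreal_le_iff2 ennreal_1[symmetric] simp del: ennreal_1)

lemma in_Lp_measurable: "in_Lp p F \<Longrightarrow> F \<in> borel_measurable borel"
  by (simp add: in_Lp_def)

lemma in_Lp_top_iff: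
  "in_Lp \<infinity> F \<longleftrightarrow> F \<in> borel_measurable borel \<and> (\<exists>C\<ge>0. AE x in lborel. cmod (F x) \<le> C)"
proof (intro iffI conjI)
  assume *: "in_Lp \<infinity> F"
  thus "F \<in> borel_measurable borel" by (rule in_Lp_measurable)
  have fin: "esssup lborel (\<lambda>x. ennreal (cmod (F x))) < \<infinity>" using * by (simp add: in_Lp_def)
  have "AE x in lborel. cmod (F x) \<le> enn2real (esssup lborel (\<lambda>x. ennreal (cmod (F x))))"
    using esssup_AE[of "\<lambda>x. ennreal (cmod (F x))" lborel]
  proof eventually_elim
    case (elim x)
    from enn2real_mono[OF elim] fin show ?case by simp
  qed
  thus "\<exists>C\<ge>0. AE x in lborel. cmod (F x) \<le> C" using enn2real_nonneg by blast
next
  assume *: "F \<in> borel_measurable borel \<and> (\<exists>C\<ge>0. AE x in lborel. cmod (F x) \<le> C)"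
  then obtain C where C: "C \<ge> 0" "AE x in lborel. cmod (F x) \<le> C" by blast
  have [measurable]: "F \<in> borel_measurable borel" using * by simp
  have "esssup lborel (\<lambda>x. ennreal (cmod (F x))) \<le> ennreal C"
    by (rule esssup_I) (use C in \<open>auto elim!: eventually_mono intro!: ennreal_leI\<close>)
  thus "in_Lp \<infinity> F" by (auto simp: in_Lp_def le_less_trans)
qed

lemma in_Lp_finite_iff:
  assumes "p \<ge> 1"
  shows "in_Lp (ennreal p) F \<longleftrightarrow> F \<in> borel_measurable borel \<and> integrable lborel (\<lambda>x. cmod (F x) powr p)"
  using assms by (auto simp: in_Lp_def integrable_iff_bounded)

lemma in_Lp_mono:
  fixes F G :: "'a::euclidean_space \<Rightarrow> complex"
  assumes p: "1 \<le> p" and "in_Lp p F" "G \<in> borel_measurable borel" "0 \<le> C"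
    and le: "AE x in lborel. cmod (G x) \<le> C * cmod (F x)"
  shows "in_Lp p G"
proof -
  note [measurable] = in_Lp_measurable[OF assms(2)] assms(3)
  from p show ?thesis
  proof (cases rule: ennreal_ge_1_cases)
    case 1
    then obtain D where D: "D \<ge> 0" "AE x in lborel. cmod (F x) \<le> D" using assms(2) in_Lp_top_iff by blast
    have "AE x in lborel. cmod (G x) \<le> C * D"
      using le D(2) by eventually_elim (use assms(4) in \<open>meson mult_left_mono order_trans\<close>)
    thus ?thesis unfolding 1 in_Lp_top_iff using assms(3,4) D(1) by (intro conjI exI[of _ "C * D"]) auto
  next
    case (2 p')
    have i: "integrable lborel (\<lambda>x. C powr p' * cmod (F x) powr p')"
      using assms(2) 2 by (intro integrable_mult_right) (simp add: in_Lp_finite_iff)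
    have "integrable lborel (\<lambda>x. cmod (G x) powr p')"
    proof (rule Bochner_Integration.integrable_bound[OF i])
      show "AE x in lborel. norm (cmod (G x) powr p') \<le> norm (C powr p' * cmod (F x) powr p')"
        using le
      proof eventually_elim
        case (elim x)
        have "cmod (G x) powr p' \<le> (C * cmod (F x)) powr p'" using 2 elim by (intro powr_mono2) auto
        thus ?case using assms(4) by (simp add: powr_mult)
      qed
    qed measurable
    thus ?thesis using 2 assms(3) by (simp add: in_Lp_finite_iff)
  qed
qed

lemma in_Lp_cong:
  assumes "1 \<le> p" "in_Lp p F" "G \<in> borel_measurable borel" "AE x in lborel. F x = G x"
  shows "in_Lp p G"
  by (rule in_Lp_mono[OF assms(1-3), of 1]) (use assms(4) in \<open>auto elim: eventually_mono\<close>)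

lemma in_Lp_add:
  fixes F G :: "'a::euclidean_space \<Rightarrow> complex"
  assumes p: "1 \<le> p" and F: "in_Lp p F" and G: "in_Lp p G"
  shows "in_Lp p (\<lambda>x. of_real (cmod (F x) + cmod (G x)))"
proof -
  note [measurable] = in_Lp_measurable[OF F] in_Lp_measurable[OF G]
  from p show ?thesis
  proof (cases rule: ennreal_ge_1_cases)
    case 1
    then obtain C D where D: "C \<ge> 0" "AE x in lborel. cmod (F x) \<le> C" "D \<ge> 0" "AE x in lborel. cmod (G x) \<le> D"
      using F G in_Lp_top_iff by blast
    have "AE x in lborel. cmod (of_real (cmod (F x) + cmod (G x))) \<le> C + D"
      using D(2,4) by eventually_elim (simp del: of_real_add)
    thus ?thesis unfolding 1 in_Lp_top_iff using D(1,3) by (intro conjI exI[of _ "C + D"]) auto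
  next
    case (2 p')
    have i: "integrable lborel (\<lambda>x. 2 powr p' * (cmod (F x) powr p' + cmod (G x) powr p'))"
      using F G 2 by (intro integrable_mult_right Bochner_Integration.integrable_add) (simp_all add: in_Lp_finite_iff)
    have "integrable lborel (\<lambda>x. cmod (of_real (cmod (F x) + cmod (G x))) powr p')"
    proof (rule Bochner_Integration.integrable_bound[OF i])
      show "AE x in lborel. norm (cmod (of_real (cmod (F x) + cmod (G x))) powr p') \<le>
          norm (2 powr p' * (cmod (F x) powr p' + cmod (G x) powr p'))"
      proof (intro AE_I2)
        fix x
        let ?m = "max (cmod (F x)) (cmod (G x))"
        have "(cmod (F x) + cmod (G x)) powr p' \<le> (2 * ?m) powr p'" using 2 by (intro powr_mono2) auto
        also have "\<dots> = 2 powr p' * ?m powr p'" by (simp add: powr_mult le_max_iff_disj)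
        also have "\<dots> \<le> 2 powr p' * (cmod (F x) powr p' + cmod (G x) powr p')"
          by (intro mult_left_mono) (auto simp: max_def)
        finally show "norm (cmod (of_real (cmod (F x) + cmod (G x))) powr p') \<le>
          norm (2 powr p' * (cmod (F x) powr p' + cmod (G x) powr p'))" by (simp del: of_real_add)
      qed
    qed measurable
    thus ?thesis using 2 by (simp add: in_Lp_finite_iff)
  qed
qed

text \<open>Values above 1 are dominated by their \<open>p\<close>-th power and the others by 1, so
  a constant plus an integrable function dominates \<open>F\<close>. This treats all exponents
  alike, including infinity.\<close>

lemma in_Lp_split:
  fixes F :: "'a::euclidean_space \<Rightarrow> complex"
  assumes p: "1 \<le> p" and F: "in_Lp p F"
  obtains C a where "C \<ge> 0" "integrable lborel a" "\<And>x. a x \<ge> 0" "AE x in lborel. cmod (F x) \<le> C + a x"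
proof -
  from p show ?thesis
  proof (cases rule: ennreal_ge_1_cases)
    case 1
    then obtain C where "C \<ge> 0" "AE x in lborel. cmod (F x) \<le> C" using F in_Lp_top_iff by blast
    thus ?thesis using that[of C "\<lambda>_. 0"] by simp
  next
    case (2 p')
    have "cmod (F x) \<le> 1 + cmod (F x) powr p'" for x
    proof (cases "cmod (F x) \<le> 1")
      case False
      hence "cmod (F x) powr 1 \<le> cmod (F x) powr p'" using 2 by (intro powr_mono) auto
      thus ?thesis by simp
    qed (simp add: add_increasing2)
    thus ?thesis using that[of 1 "\<lambda>x. cmod (F x) powr p'"] F 2 by (simp add: in_Lp_finite_iff)
  qed
qed

text \<open>The decaying majorant is bounded by 1 and integrable, hence in every
  \<open>L\<^sup>p\<close>.\<close>

lemma in_Lp_decay: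
  fixes F :: "'a::euclidean_space \<Rightarrow> complex"
  assumes p: "1 \<le> p" and [measurable]: "F \<in> borel_measurable borel"
    and C: "0 \<le> C" "AE x in lborel. cmod (F x) \<le> C * inverse ((1 + norm x) ^ (2 * DIM('a)))"
  shows "in_Lp p F"
proof -
  let ?d = "\<lambda>x::'a. inverse ((1 + norm x) ^ (2 * DIM('a)))"
  have d: "0 < ?d x" "?d x \<le> 1" for x
  proof -
    have "1 \<le> (1 + norm x) ^ (2 * DIM('a))" by (intro one_le_power) simp
    from le_imp_inverse_le[OF this] show "?d x \<le> 1" by simp
    show "0 < ?d x" by (simp add: add_pos_nonneg)
  qed
  have dn: "cmod (complex_of_real (?d x)) = ?d x" for x
    using d(1)[of x] by (simp only: norm_of_real abs_of_pos)
  have "in_Lp p (\<lambda>x. complex_of_real (?d x))"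
    using p
  proof (cases rule: ennreal_ge_1_cases)
    case 1
    have "AE x in lborel. cmod (complex_of_real (?d x)) \<le> 1" unfolding dn by (intro AE_I2 d(2))
    thus ?thesis unfolding 1 in_Lp_top_iff by (intro conjI exI[of _ 1]) auto
  next
    case (2 p')
    have "integrable lborel (\<lambda>x. cmod (complex_of_real (?d x)) powr p')"
    proof (rule Bochner_Integration.integrable_bound[OF integrable_decay[OF order_refl]])
      show "AE x in lborel. norm (cmod (complex_of_real (?d x)) powr p') \<le> norm (?d x)"
      proof (intro AE_I2)
        fix x
        have "?d x powr p' \<le> ?d x powr 1" using d[of x] 2 by (intro powr_mono') auto
        thus "norm (cmod (complex_of_real (?d x)) powr p') \<le> norm (?d x)"
          unfolding dn using d(1)[of x] by (simp only: powr_one real_norm_def abs_of_nonneg powr_ge_zero less_imp_le)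
      qed
    qed measurable
    thus ?thesis using 2 by (simp add: in_Lp_finite_iff)
  qed
  thus ?thesis
    by (rule in_Lp_mono[OF p _ _ C(1)]) (use C(2) in \<open>simp_all only: dn assms\<close>)
qed

section \<open>Young's inequality for convolutions\<close>

lemma two_powr_le:
  fixes x y :: real
  assumes "0 \<le> x" "0 \<le> y" "0 \<le> \<theta>" "\<theta> \<le> 1"
  shows "x powr \<theta> * y powr (1 - \<theta>) \<le> x + y"
proof -
  have "x powr \<theta> * y powr (1 - \<theta>) \<le> (x + y) powr \<theta> * (x + y) powr (1 - \<theta>)"
    using assms by (intro mult_mono powr_mono2) auto
  also have "\<dots> = (x + y) powr 1" by (subst powr_add[symmetric]) simp
  finally show ?thesis using assms by simp
qed

text \<open>A crude substitute for the weighted inequality between geometric and arithmetic means: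
  every base is enlarged to the full sum, and the exponents add up to 1.\<close>

lemma three_powr_le:
  fixes x y z :: real
  assumes "0 \<le> x" "0 \<le> y" "0 \<le> z" "0 \<le> a" "0 \<le> b" "0 \<le> c" "a + b + c = 1"
  shows "x powr a * y powr b * z powr c \<le> x + y + z"
proof -
  have "x powr a * y powr b * z powr c \<le> (x + y + z) powr a * (x + y + z) powr b * (x + y + z) powr c"
    using assms by (intro mult_mono powr_mono2) auto
  also have "\<dots> = (x + y + z) powr 1" using assms(7) by (simp add: powr_add[symmetric])
  finally show ?thesis using assms by simp
qed

text \<open>The pointwise inequality behind Young's inequality; \<open>l\<close> is chosen later so that the first term
  integrates to at most \<open>1\<close>.\<close>

lemma young_pointwise:
  fixes a b :: real
  assumes "0 \<le> a" "0 \<le> b" "0 < l" "1 \<le> p" "1 \<le> q" "1 \<le> r" "1 / p + 1 / q = 1 / r + 1"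
  shows "a * b \<le> l powr (- (1 / r)) * (l * (a powr p * b powr q) + a powr p + b powr q)"
proof (cases "a = 0 \<or> b = 0")
  case False
  hence ab: "a > 0" "b > 0" using assms by auto
  have le: "1 / p \<le> 1" "1 / q \<le> 1" using assms by auto
  \<comment> \<open>The exponents \<open>1 / r\<close>, \<open>1 / p - 1 / r\<close> and
    \<open>1 / q - 1 / r\<close> are nonnegative and sum to 1 by the relation between
    \<open>p\<close>, \<open>q\<close> and \<open>r\<close>.\<close>
  have "a * b = l powr (- (1 / r)) * ((l * (a powr p * b powr q)) powr (1 / r) *
      (a powr p) powr (1 / p - 1 / r) * (b powr q) powr (1 / q - 1 / r))"
  proof -
    have 1: "(l * (a powr p * b powr q)) powr (1 / r) = l powr (1 / r) * (a powr (p / r) * b powr (q / r))"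
      using ab assms by (simp add: powr_mult powr_powr)
    have 2: "(a powr p) powr (1 / p - 1 / r) = a powr (1 - p / r)"
      using assms by (simp add: powr_powr right_diff_distrib)
    have 3: "(b powr q) powr (1 / q - 1 / r) = b powr (1 - q / r)"
      using assms by (simp add: powr_powr right_diff_distrib)
    have 4: "l powr (- (1 / r)) * l powr (1 / r) = 1" using assms by (simp add: powr_add[symmetric])
    have 5: "a powr (p / r) * a powr (1 - p / r) = a" "b powr (q / r) * b powr (1 - q / r) = b"
      using ab by (simp_all add: powr_add[symmetric])
    have "l powr (- (1 / r)) * (l powr (1 / r) * (a powr (p / r) * b powr (q / r)) * a powr (1 - p / r) * b powr (1 - q / r)) =
        (l powr (- (1 / r)) * l powr (1 / r)) * (a powr (p / r) * a powr (1 - p / r)) * (b powr (q / r) * b powr (1 - q / r))"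
      by (simp only: mult_ac)
    thus ?thesis unfolding 1 2 3 4 5 by simp
  qed
  also have "\<dots> \<le> l powr (- (1 / r)) * (l * (a powr p * b powr q) + a powr p + b powr q)"
    using assms(3,6,7) le by (intro mult_left_mono three_powr_le) auto
  finally show ?thesis .
next
  case True
  thus ?thesis using assms by auto
qed

lemma nn_integral_reflect:
  fixes f :: "'a::euclidean_space \<Rightarrow> ennreal"
  assumes "f \<in> borel_measurable borel"
  shows "(\<integral>\<^sup>+\<zeta>. f (\<xi> - \<zeta>) \<partial>lborel) = (\<integral>\<^sup>+\<zeta>. f \<zeta> \<partial>lborel)"
  using nn_integral_affine[OF assms, of "-1" \<xi>] by simp

lemma nn_integral_translate:
  fixes f :: "'a::euclidean_space \<Rightarrow> ennreal"
  assumes "f \<in> borel_measurable borel"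
  shows "(\<integral>\<^sup>+\<xi>. f (\<xi> - \<zeta>) \<partial>lborel) = (\<integral>\<^sup>+\<xi>. f \<xi> \<partial>lborel)"
  using nn_integral_affine[OF assms, of 1 "- \<zeta>"] by (simp add: add.commute)

text \<open>With values in \<open>ennreal\<close> the integral always exists, absolute convergence
  of the convolution is finiteness, and Tonelli applies without side conditions.\<close>

definition abs_conv :: "('a::euclidean_space \<Rightarrow> complex) \<Rightarrow> ('a \<Rightarrow> complex) \<Rightarrow> 'a \<Rightarrow> ennreal" where
  "abs_conv F G \<xi> = (\<integral>\<^sup>+\<zeta>. ennreal (cmod (F (\<xi> - \<zeta>)) * cmod (G \<zeta>)) \<partial>lborel)"

definition conv :: "('a::euclidean_space \<Rightarrow> complex) \<Rightarrow> ('a \<Rightarrow> complex) \<Rightarrow> 'a \<Rightarrow> complex" where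
  "conv F G \<xi> = (\<integral>\<zeta>. F (\<xi> - \<zeta>) * G \<zeta> \<partial>lborel)"

lemma abs_conv_measurable [measurable]:
  assumes [measurable]: "F \<in> borel_measurable borel" "G \<in> borel_measurable borel"
  shows "abs_conv F G \<in> borel_measurable borel"
  unfolding abs_conv_def by measurable

lemma conv_measurable [measurable]:
  assumes [measurable]: "F \<in> borel_measurable borel" "G \<in> borel_measurable borel"
  shows "conv F G \<in> borel_measurable borel"
  unfolding conv_def by measurable

text \<open>Integrating the pointwise inequality in \<open>\<zeta>\<close> with
  \<open>l = 1 / x'\<close>, where \<open>x'\<close> exceeds the convolution \<open>X \<xi>\<close>
  of the powers, bounds \<open>abs_conv F G \<xi>\<close> by \<open>x' powr (1 / r)\<close> times a
  constant. Its \<open>r\<close>-th power is then controlled by \<open>x'\<close>, which is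
  integrable because \<open>X\<close> is, by Tonelli.\<close>

lemma young_finite:
  fixes F G :: "'a::euclidean_space \<Rightarrow> complex"
  assumes pqr: "1 \<le> p" "1 \<le> q" "1 \<le> r" "1 / p + 1 / q = 1 / r + 1"
    and [measurable]: "F \<in> borel_measurable borel" "G \<in> borel_measurable borel"
    and F: "integrable lborel (\<lambda>x. cmod (F x) powr p)" and G: "integrable lborel (\<lambda>x. cmod (G x) powr q)"
  obtains H where "integrable lborel H" "AE \<xi> in lborel. abs_conv F G \<xi> < \<infinity> \<and> enn2real (abs_conv F G \<xi>) powr r \<le> H \<xi>"
proof -
  define X where "X \<xi> = (\<integral>\<^sup>+\<zeta>. ennreal (cmod (F (\<xi> - \<zeta>)) powr p * cmod (G \<zeta>) powr q) \<partial>lborel)" for \<xi>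
  have [measurable]: "X \<in> borel_measurable borel" unfolding X_def by measurable
  define Y where "Y = (\<integral>x. cmod (F x) powr p \<partial>lborel)"
  define Z where "Z = (\<integral>x. cmod (G x) powr q \<partial>lborel)"
  have YZ: "Y \<ge> 0" "Z \<ge> 0" by (auto simp: Y_def Z_def)
  have Y: "(\<integral>\<^sup>+x. ennreal (cmod (F x) powr p) \<partial>lborel) = ennreal Y"
    unfolding Y_def by (rule nn_integral_eq_integral[OF F]) simp
  have Z: "(\<integral>\<^sup>+x. ennreal (cmod (G x) powr q) \<partial>lborel) = ennreal Z"
    unfolding Z_def by (rule nn_integral_eq_integral[OF G]) simp
  have "(\<integral>\<^sup>+\<xi>. X \<xi> \<partial>lborel) = (\<integral>\<^sup>+\<zeta>. \<integral>\<^sup>+\<xi>. ennreal (cmod (F (\<xi> - \<zeta>)) powr p * cmod (G \<zeta>) powr q) \<partial>lborel \<partial>lborel)"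
    unfolding X_def by (rule lborel_pair.Fubini') measurable
  also have "\<dots> = (\<integral>\<^sup>+\<zeta>. ennreal Y * ennreal (cmod (G \<zeta>) powr q) \<partial>lborel)"
    by (simp add: ennreal_mult nn_integral_multc nn_integral_translate[of "\<lambda>x. ennreal (cmod (F x) powr p)"] Y)
  also have "\<dots> = ennreal Y * ennreal Z" by (simp add: nn_integral_cmult Z)
  finally have IX: "(\<integral>\<^sup>+\<xi>. X \<xi> \<partial>lborel) < \<infinity>" by (simp add: ennreal_mult_less_top)
  hence AX: "AE \<xi> in lborel. X \<xi> < \<infinity>" using nn_integral_PInf_AE[of X lborel] by (auto simp: less_top)
  \<comment> \<open>\<open>X \<xi>\<close> may vanish; adding a positive integrable function makes
    \<open>l\<close> well defined without losing integrability.\<close>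
  let ?d = "\<lambda>x::'a. inverse ((1 + norm x) ^ (2 * DIM('a)))"
  have d: "?d x > 0" for x by (simp add: add_pos_nonneg)
  let ?x = "\<lambda>\<xi>. enn2real (X \<xi>)"
  let ?H = "\<lambda>\<xi>. (?x \<xi> + ?d \<xi>) * (1 + Y + Z) powr r"
  have "integrable lborel ?x"
  proof (rule integrableI_nonneg)
    have "(\<integral>\<^sup>+\<xi>. ennreal (?x \<xi>) \<partial>lborel) \<le> (\<integral>\<^sup>+\<xi>. X \<xi> \<partial>lborel)"
      by (rule nn_integral_mono) (simp add: ennreal_enn2real_if)
    thus "(\<integral>\<^sup>+\<xi>. ennreal (?x \<xi>) \<partial>lborel) < \<infinity>" using IX by (rule le_less_trans)
  qed auto
  hence "integrable lborel ?H"
    by (intro integrable_mult_left Bochner_Integration.integrable_add integrable_decay) auto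
  moreover have "AE \<xi> in lborel. abs_conv F G \<xi> < \<infinity> \<and> enn2real (abs_conv F G \<xi>) powr r \<le> ?H \<xi>"
    using AX
  proof eventually_elim
    case (elim \<xi>)
    define x' where "x' = ?x \<xi> + ?d \<xi>"
    have x': "x' > 0" using d[of \<xi>] enn2real_nonneg[of "X \<xi>"] unfolding x'_def by linarith
    define l where "l = 1 / x'"
    have l: "l > 0" using x' by (simp add: l_def)
    have Xe: "X \<xi> = ennreal (?x \<xi>)" using elim by simp
    have "abs_conv F G \<xi> \<le> (\<integral>\<^sup>+\<zeta>. ennreal (l powr (- (1 / r))) * (ennreal l * ennreal (cmod (F (\<xi> - \<zeta>)) powr p * cmod (G \<zeta>) powr q) +
        ennreal (cmod (F (\<xi> - \<zeta>)) powr p) + ennreal (cmod (G \<zeta>) powr q)) \<partial>lborel)"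
      unfolding abs_conv_def
    proof (rule nn_integral_mono)
      fix \<zeta>
      show "ennreal (cmod (F (\<xi> - \<zeta>)) * cmod (G \<zeta>)) \<le> ennreal (l powr (- (1 / r))) *
         (ennreal l * ennreal (cmod (F (\<xi> - \<zeta>)) powr p * cmod (G \<zeta>) powr q) +
        ennreal (cmod (F (\<xi> - \<zeta>)) powr p) + ennreal (cmod (G \<zeta>) powr q))"
        using ennreal_leI[OF young_pointwise[OF norm_ge_zero norm_ge_zero l pqr, of "F (\<xi> - \<zeta>)" "G \<zeta>"]] l
        by (simp add: ennreal_mult[symmetric] ennreal_plus[symmetric] del: ennreal_plus)
    qed
    also have "\<dots> = ennreal (l powr (- (1 / r))) * (ennreal l * X \<xi> + ennreal Y + ennreal Z)"
      by (simp add: nn_integral_cmult nn_integral_add Y Z X_def[symmetric]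
          nn_integral_reflect[of "\<lambda>x. ennreal (cmod (F x) powr p)"])
    also have "\<dots> = ennreal (l powr (- (1 / r)) * (l * ?x \<xi> + Y + Z))"
      using l YZ enn2real_nonneg[of "X \<xi>"]
      by (subst Xe) (simp add: ennreal_mult[symmetric] ennreal_plus[symmetric] del: ennreal_plus ennreal_enn2real)
    also have "\<dots> \<le> ennreal (x' powr (1 / r) * (1 + Y + Z))"
    proof (intro ennreal_leI mult_mono add_mono order_refl)
      show "l powr (- (1 / r)) \<le> x' powr (1 / r)" using x' by (simp add: l_def powr_divide powr_minus field_simps)
      show "l * ?x \<xi> \<le> 1" using x' d[of \<xi>] by (simp add: l_def x'_def field_simps)
    qed (use l YZ in auto)
    finally have le: "abs_conv F G \<xi> \<le> ennreal (x' powr (1 / r) * (1 + Y + Z))" .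
    hence "enn2real (abs_conv F G \<xi>) \<le> x' powr (1 / r) * (1 + Y + Z)"
      using enn2real_mono[OF le] YZ by simp
    hence "enn2real (abs_conv F G \<xi>) powr r \<le> (x' powr (1 / r) * (1 + Y + Z)) powr r"
      using pqr by (intro powr_mono2) auto
    also have "\<dots> = ?H \<xi>"
      unfolding x'_def[symmetric] using x' YZ pqr by (simp add: powr_mult powr_powr)
    finally show ?case using le by (auto simp: le_less_trans)
  qed
  ultimately show ?thesis using that by blast
qed

text \<open>If one exponent is infinite, the other is 1. For finite conjugate exponents,
  \<open>a * b \<le> a powr p' + b powr q'\<close> takes the place of Hoelder's inequality.\<close>

lemma young_bounded:
  fixes F G :: "'a::euclidean_space \<Rightarrow> complex"
  assumes pq: "1 \<le> p" "1 \<le> q" "1 / p + 1 / q = 1" and F: "in_Lp p F" and G: "in_Lp q G"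
  obtains C where "\<And>\<xi>. abs_conv F G \<xi> \<le> ennreal C"
proof -
  note [measurable] = in_Lp_measurable[OF F] in_Lp_measurable[OF G]
  have one: "x = ennreal 1" if "1 \<le> x" "1 / x = 1" for x
    using that(1)
  proof (cases rule: ennreal_ge_1_cases)
    case (2 x')
    hence "ennreal (1 / x') = ennreal 1" using that(2) by (simp add: divide_ennreal[of 1, simplified])
    hence "1 / x' = 1" using 2 by (subst (asm) ennreal_inj) auto
    thus ?thesis using 2 by simp
  qed (use that in simp)
  from pq(1) show ?thesis
  proof (cases rule: ennreal_ge_1_cases)
    case 1
    hence "q = ennreal 1" using pq one by simp
    hence iG: "integrable lborel (\<lambda>x. cmod (G x))" using G in_Lp_finite_iff[of 1 G] by (simp add: powr_one_gt_zero_iff)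
    obtain C where C: "C \<ge> 0" "AE x in lborel. cmod (F x) \<le> C" using F 1 in_Lp_top_iff by blast
    have "abs_conv F G \<xi> \<le> ennreal (C * (\<integral>\<zeta>. cmod (G \<zeta>) \<partial>lborel))" for \<xi>
    proof -
      have "AE \<zeta> in lborel. cmod (F (\<xi> + (-1) *\<^sub>R \<zeta>)) \<le> C" by (rule AE_affine[OF _ C(2)]) simp
      hence "AE \<zeta> in lborel. ennreal (cmod (F (\<xi> - \<zeta>)) * cmod (G \<zeta>)) \<le> ennreal C * ennreal (cmod (G \<zeta>))"
        by eventually_elim (use C(1) in \<open>auto simp: ennreal_mult[symmetric] intro!: ennreal_leI mult_right_mono\<close>)
      hence "abs_conv F G \<xi> \<le> (\<integral>\<^sup>+\<zeta>. ennreal C * ennreal (cmod (G \<zeta>)) \<partial>lborel)"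
        unfolding abs_conv_def by (rule nn_integral_mono_AE)
      also have "\<dots> = ennreal (C * (\<integral>\<zeta>. cmod (G \<zeta>) \<partial>lborel))"
        using C(1) by (simp add: nn_integral_cmult nn_integral_eq_integral[OF iG] ennreal_mult)
      finally show ?thesis .
    qed
    thus ?thesis by (rule that)
  next
    case p: (2 p')
    from pq(2) show ?thesis
    proof (cases rule: ennreal_ge_1_cases)
      case 1
      hence "p = ennreal 1" using pq one by simp
      hence iF: "integrable lborel (\<lambda>x. cmod (F x))" using F in_Lp_finite_iff[of 1 F] by (simp add: powr_one_gt_zero_iff)
      obtain C where C: "C \<ge> 0" "AE x in lborel. cmod (G x) \<le> C" using G 1 in_Lp_top_iff by blast
      have "abs_conv F G \<xi> \<le> ennreal (C * (\<integral>\<zeta>. cmod (F \<zeta>) \<partial>lborel))" for \<xi>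
      proof -
        have "AE \<zeta> in lborel. ennreal (cmod (F (\<xi> - \<zeta>)) * cmod (G \<zeta>)) \<le> ennreal C * ennreal (cmod (F (\<xi> - \<zeta>)))"
          using C(2) by eventually_elim (use C(1) in \<open>auto simp: ennreal_mult[symmetric] mult.commute[of C] intro!: ennreal_leI mult_left_mono\<close>)
        hence "abs_conv F G \<xi> \<le> (\<integral>\<^sup>+\<zeta>. ennreal C * ennreal (cmod (F (\<xi> - \<zeta>))) \<partial>lborel)"
          unfolding abs_conv_def by (rule nn_integral_mono_AE)
        also have "\<dots> = ennreal (C * (\<integral>\<zeta>. cmod (F \<zeta>) \<partial>lborel))"
          using C(1) by (simp add: nn_integral_cmult nn_integral_reflect[of "\<lambda>x. ennreal (cmod (F x))"]
              nn_integral_eq_integral[OF iF] ennreal_mult)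
        finally show ?thesis .
      qed
      thus ?thesis by (rule that)
    next
      case q: (2 q')
      have s: "1 / p' + 1 / q' = 1"
      proof -
        have "ennreal (1 / p' + 1 / q') = ennreal 1"
          using pq(3) p q by (subst ennreal_plus) (auto simp: divide_ennreal[of 1, simplified])
        thus ?thesis using p q by (subst (asm) ennreal_inj) auto
      qed
      have iF: "integrable lborel (\<lambda>x. cmod (F x) powr p')" and iG: "integrable lborel (\<lambda>x. cmod (G x) powr q')"
        using F G p q by (simp_all add: in_Lp_finite_iff)
      let ?C = "(\<integral>\<zeta>. cmod (F \<zeta>) powr p' \<partial>lborel) + (\<integral>\<zeta>. cmod (G \<zeta>) powr q' \<partial>lborel)"
      have "abs_conv F G \<xi> \<le> ennreal ?C" for \<xi>
      proof -
        have "a * b \<le> a powr p' + b powr q'" if "a \<ge> 0" "b \<ge> 0" for a b :: real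
        proof -
          have "1 - 1 / p' = 1 / q'" using s by simp
          hence "(a powr p') powr (1 / p') * (b powr q') powr (1 / q') \<le> a powr p' + b powr q'"
            using two_powr_le[of "a powr p'" "b powr q'" "1 / p'"] p by simp
          thus ?thesis using that p q by (simp add: powr_powr)
        qed
        hence "abs_conv F G \<xi> \<le> (\<integral>\<^sup>+\<zeta>. ennreal (cmod (F (\<xi> - \<zeta>)) powr p') + ennreal (cmod (G \<zeta>) powr q') \<partial>lborel)"
          unfolding abs_conv_def
          by (intro nn_integral_mono) (simp add: ennreal_plus[symmetric] ennreal_leI del: ennreal_plus)
        also have "\<dots> = ennreal ?C"
          by (simp add: nn_integral_add nn_integral_reflect[of "\<lambda>x. ennreal (cmod (F x) powr p')"]
              nn_integral_eq_integral[OF iF] nn_integral_eq_integral[OF iG])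
        finally show ?thesis .
      qed
      thus ?thesis by (rule that)
    qed
  qed
qed

theorem young:
  fixes F G :: "'a::euclidean_space \<Rightarrow> complex"
  assumes pqr: "1 \<le> p" "1 \<le> q" "1 \<le> r" "1 / p + 1 / q = 1 / r + 1"
    and F: "in_Lp p F" and G: "in_Lp q G"
  shows "AE \<xi> in lborel. abs_conv F G \<xi> < \<infinity>" "in_Lp r (\<lambda>\<xi>. of_real (enn2real (abs_conv F G \<xi>)))"
proof -
  note [measurable] = in_Lp_measurable[OF F] in_Lp_measurable[OF G]
  have "(AE \<xi> in lborel. abs_conv F G \<xi> < \<infinity>) \<and> in_Lp r (\<lambda>\<xi>. of_real (enn2real (abs_conv F G \<xi>)))"
    using pqr(3)
  proof (cases rule: ennreal_ge_1_cases)
    case 1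
    hence "1 / p + 1 / q = 1" using pqr by simp
    then obtain C where C: "\<And>\<xi>. abs_conv F G \<xi> \<le> ennreal C" using young_bounded[OF pqr(1,2) _ F G] by blast
    have "AE \<xi> in lborel. cmod (of_real (enn2real (abs_conv F G \<xi>))) \<le> max C 0"
    proof (intro AE_I2)
      fix \<xi>
      have "enn2real (abs_conv F G \<xi>) \<le> enn2real (ennreal C)" by (rule enn2real_mono[OF C]) simp
      thus "cmod (of_real (enn2real (abs_conv F G \<xi>))) \<le> max C 0" by (cases "C \<ge> 0") (auto simp: ennreal_neg)
    qed
    hence "in_Lp r (\<lambda>\<xi>. of_real (enn2real (abs_conv F G \<xi>)))"
      unfolding 1 in_Lp_top_iff by (intro conjI exI[of _ "max C 0"]) auto
    moreover have "abs_conv F G \<xi> < \<infinity>" for \<xi> using C[of \<xi>] by (auto simp: le_less_trans)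
    ultimately show ?thesis by simp
  next
    case r: (2 r')
    have ipq: "1 / x \<le> 1" if "1 \<le> x" for x :: ennreal
      using that
    proof (cases rule: ennreal_ge_1_cases)
      case (2 x')
      thus ?thesis by (simp add: divide_ennreal[of 1, simplified] ennreal_le_1)
    qed simp
    \<comment> \<open>An infinite exponent would leave \<open>1 / r + 1 = 1 / y \<le> 1\<close>,
      which is impossible for finite \<open>r\<close>.\<close>
    have fin: "x \<noteq> \<infinity>" if "1 / x + 1 / y = 1 / r + 1" "1 \<le> y" for x y
    proof
      assume "x = \<infinity>"
      hence "1 / r + 1 = 1 / y" using that by simp
      also have "\<dots> \<le> 0 + 1" using ipq[OF that(2)] by simp
      finally have le: "1 / r + 1 \<le> 1" by simp
      have "1 / r + 1 = ennreal (1 / r' + 1)"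
        using r by (subst ennreal_plus) (auto simp: divide_ennreal[of 1, simplified])
      hence "ennreal (1 / r' + 1) \<le> ennreal 1" using le by simp
      hence "1 / r' + 1 \<le> 1" by (subst (asm) ennreal_le_iff) auto
      thus False using r by simp
    qed
    obtain p' where p: "p' \<ge> 1" "p = ennreal p'" using pqr fin[OF pqr(4,2)] by (auto elim: ennreal_ge_1_cases)
    obtain q' where q: "q' \<ge> 1" "q = ennreal q'"
      using pqr fin[of q p] by (auto elim: ennreal_ge_1_cases simp: add.commute)
    have s: "1 / p' + 1 / q' = 1 / r' + 1"
    proof -
      have "ennreal (1 / p' + 1 / q') = ennreal (1 / r' + 1)"
        using pqr(4) p q r by (subst (1 2) ennreal_plus) (auto simp: divide_ennreal[of 1, simplified])
      thus ?thesis using p q r by (subst (asm) ennreal_inj) auto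
    qed
    have iF: "integrable lborel (\<lambda>x. cmod (F x) powr p')" and iG: "integrable lborel (\<lambda>x. cmod (G x) powr q')"
      using F G p q by (simp_all add: in_Lp_finite_iff)
    obtain H where H: "integrable lborel H"
      "AE \<xi> in lborel. abs_conv F G \<xi> < \<infinity> \<and> enn2real (abs_conv F G \<xi>) powr r' \<le> H \<xi>"
      by (rule young_finite[OF p(1) q(1) r(1) s _ _ iF iG]) measurable
    have "AE \<xi> in lborel. norm (cmod (of_real (enn2real (abs_conv F G \<xi>))) powr r') \<le> norm (H \<xi>)"
      using H(2) by eventually_elim (use enn2real_nonneg in auto)
    hence "integrable lborel (\<lambda>\<xi>. cmod (of_real (enn2real (abs_conv F G \<xi>))) powr r')"
      by (rule Bochner_Integration.integrable_bound[OF H(1), rotated]) measurable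
    thus ?thesis using H(2) r by (auto simp: in_Lp_finite_iff elim!: eventually_mono)
  qed
  thus "AE \<xi> in lborel. abs_conv F G \<xi> < \<infinity>" "in_Lp r (\<lambda>\<xi>. of_real (enn2real (abs_conv F G \<xi>)))" by auto
qed

lemma abs_conv_integrable:
  assumes "F \<in> borel_measurable borel" "G \<in> borel_measurable borel" "abs_conv F G \<xi> < \<infinity>"
  shows "integrable lborel (\<lambda>\<zeta>. F (\<xi> - \<zeta>) * G \<zeta>)"
proof (rule integrableI_bounded)
  note [measurable] = assms(1,2)
  show "(\<lambda>\<zeta>. F (\<xi> - \<zeta>) * G \<zeta>) \<in> borel_measurable lborel" by measurable
  show "(\<integral>\<^sup>+\<zeta>. ennreal (norm (F (\<xi> - \<zeta>) * G \<zeta>)) \<partial>lborel) < \<infinity>"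
    using assms(3) by (simp add: abs_conv_def norm_mult)
qed

lemma conv_le_abs_conv: "cmod (conv F G \<xi>) \<le> enn2real (abs_conv F G \<xi>)"
proof (cases "integrable lborel (\<lambda>\<zeta>. F (\<xi> - \<zeta>) * G \<zeta>)")
  case True
  have "cmod (conv F G \<xi>) \<le> (\<integral>\<zeta>. cmod (F (\<xi> - \<zeta>) * G \<zeta>) \<partial>lborel)"
    unfolding conv_def by (rule integral_norm_bound)
  also have "\<dots> = enn2real (abs_conv F G \<xi>)"
    unfolding abs_conv_def norm_mult[symmetric]
    by (rule integral_eq_nn_integral) (use borel_measurable_integrable[OF True] in auto)
  finally show ?thesis .
qed (simp add: conv_def not_integrable_integral_eq)

text \<open>The form in which Young's inequality is used below: a pointwise inequality between
  kernels transfers the estimate from \<open>a\<close>, \<open>b\<close> to \<open>A\<close>,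
  \<open>B\<close>. The multiplier \<open>W\<close> may vanish on large sets, such as the complement
  of a cone, so finiteness is asserted only where it does not.\<close>

theorem weighted_young:
  fixes a b A B W :: "'a::euclidean_space \<Rightarrow> complex"
  assumes pqr: "1 \<le> p" "1 \<le> q" "1 \<le> r" "1 / p + 1 / q = 1 / r + 1"
    and ab: "in_Lp p a" "in_Lp q b"
    and m [measurable]: "A \<in> borel_measurable borel" "B \<in> borel_measurable borel" "W \<in> borel_measurable borel"
    and C: "0 \<le> C" "\<And>\<xi> \<zeta>. cmod (W \<xi>) * (cmod (A (\<xi> - \<zeta>)) * cmod (B \<zeta>)) \<le> C * (cmod (a (\<xi> - \<zeta>)) * cmod (b \<zeta>))"
  shows "AE \<xi> in lborel. W \<xi> \<noteq> 0 \<longrightarrow> abs_conv A B \<xi> < \<infinity>"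
    and "in_Lp r (\<lambda>\<xi>. W \<xi> * of_real (enn2real (abs_conv A B \<xi>)))"
    and "in_Lp r (\<lambda>\<xi>. W \<xi> * conv A B \<xi>)"
proof -
  note [measurable] = in_Lp_measurable[OF ab(1)] in_Lp_measurable[OF ab(2)]
  have le: "ennreal (cmod (W \<xi>)) * abs_conv A B \<xi> \<le> ennreal C * abs_conv a b \<xi>" for \<xi>
    unfolding abs_conv_def using C
    by (subst nn_integral_cmult[symmetric], measurable)+
       (intro nn_integral_mono, simp add: ennreal_mult[symmetric] ennreal_leI)
  show fin: "AE \<xi> in lborel. W \<xi> \<noteq> 0 \<longrightarrow> abs_conv A B \<xi> < \<infinity>"
    using young(1)[OF pqr ab]
  proof eventually_elim
    case (elim \<xi>)
    hence "ennreal C * abs_conv a b \<xi> < \<infinity>" by (simp add: ennreal_mult_less_top)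
    hence "ennreal (cmod (W \<xi>)) * abs_conv A B \<xi> < \<infinity>" using le[of \<xi>] by (rule le_less_trans[rotated])
    thus ?case by (auto simp: ennreal_mult_less_top)
  qed
  show *: "in_Lp r (\<lambda>\<xi>. W \<xi> * of_real (enn2real (abs_conv A B \<xi>)))"
  proof (rule in_Lp_mono[OF pqr(3) young(2)[OF pqr ab] _ C(1)])
    show "AE \<xi> in lborel. cmod (W \<xi> * of_real (enn2real (abs_conv A B \<xi>))) \<le>
        C * cmod (of_real (enn2real (abs_conv a b \<xi>)))"
      using young(1)[OF pqr ab]
    proof eventually_elim
      case (elim \<xi>)
      have "enn2real (ennreal (cmod (W \<xi>)) * abs_conv A B \<xi>) \<le> enn2real (ennreal C * abs_conv a b \<xi>)"
        by (rule enn2real_mono[OF le]) (use elim in \<open>simp add: ennreal_mult_less_top\<close>)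
      thus ?case using C(1) by (simp add: enn2real_mult norm_mult)
    qed
  qed measurable
  show "in_Lp r (\<lambda>\<xi>. W \<xi> * conv A B \<xi>)"
    by (rule in_Lp_mono[OF pqr(3) *, of _ 1])
       (auto simp: norm_mult intro!: mult_left_mono conv_le_abs_conv)
qed

section \<open>The weights\<close>

text \<open>The Japanese bracket to the power \<open>\<alpha>\<close>, kept real so that it can
  stand in inequalities; \<open>weight\<close> is its complex embedding.\<close>

definition jb :: "real \<Rightarrow> 'a::euclidean_space \<Rightarrow> real" where
  "jb \<alpha> \<xi> = (1 + (norm \<xi>)\<^sup>2) powr (\<alpha> / 2)"

lemma weight_jb: "weight \<alpha> \<xi> = of_real (jb \<alpha> \<xi>)"
  by (simp add: weight_def jb_def)

lemma jb_base: "1 \<le> 1 + (norm \<xi>)\<^sup>2"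
  by simp

lemma jb_pos: "0 < jb \<alpha> \<xi>"
proof -
  have "0 < 1 + (norm \<xi>)\<^sup>2" by (simp add: add_pos_nonneg)
  hence "1 + (norm \<xi>)\<^sup>2 \<noteq> 0" by linarith
  thus ?thesis unfolding jb_def powr_gt_zero .
qed

lemma jb_nonneg: "0 \<le> jb \<alpha> \<xi>"
  by (rule less_imp_le[OF jb_pos])

lemma cmod_weight: "cmod (weight \<alpha> \<xi>) = jb \<alpha> \<xi>"
  using jb_nonneg[of \<alpha> \<xi>] by (simp add: weight_jb)

lemma weight_nonzero: "weight \<alpha> \<xi> \<noteq> 0"
  using jb_pos[of \<alpha> \<xi>] by (simp add: weight_jb)

lemma jb_add: "jb (\<alpha> + \<beta>) \<xi> = jb \<alpha> \<xi> * jb \<beta> \<xi>"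
  by (simp add: jb_def powr_add[symmetric] add_divide_distrib)

lemma jb_0: "jb 0 \<xi> = 1"
  using jb_base[of \<xi>] by (simp add: jb_def add_nonneg_eq_0_iff)

lemma jb_minus: "jb \<alpha> \<xi> * jb (- \<alpha>) \<xi> = 1"
  using jb_add[of \<alpha> "- \<alpha>" \<xi>] by (simp add: jb_0)

lemma jb_mono: "\<alpha> \<le> \<beta> \<Longrightarrow> jb \<alpha> \<xi> \<le> jb \<beta> \<xi>"
  unfolding jb_def by (intro powr_mono) auto

lemma jb_measurable [measurable]: "jb \<alpha> \<in> borel_measurable borel"
  unfolding jb_def by measurable

lemma weight_measurable [measurable]: "weight \<alpha> \<in> borel_measurable borel"
  unfolding weight_def by measurable

lemma jb_le_power:
  assumes "\<alpha> \<le> real k" shows "jb \<alpha> \<xi> \<le> (1 + norm \<xi>) ^ k"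
proof -
  have "jb \<alpha> \<xi> \<le> jb (real k) \<xi>" by (rule jb_mono[OF assms])
  also have "\<dots> \<le> ((1 + norm \<xi>)\<^sup>2) powr (real k / 2)"
    unfolding jb_def by (intro powr_mono2) (auto simp: power2_eq_square algebra_simps)
  also have "\<dots> = (1 + norm \<xi>) powr real k"
    by (simp add: powr_powr add_pos_nonneg flip: powr_numeral)
  also have "\<dots> = (1 + norm \<xi>) ^ k" by (rule powr_realpow) (simp add: add_pos_nonneg)
  finally show ?thesis .
qed

lemma power_le_jb: "(1 + norm \<xi>) ^ k \<le> 2 ^ k * jb (real k) \<xi>"
proof -
  have p: "0 < 1 + norm \<xi>" by (simp add: add_pos_nonneg)
  have "(1 + norm \<xi>)\<^sup>2 \<le> 2\<^sup>2 * (1 + (norm \<xi>)\<^sup>2)"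
  proof -
    have "(1 + x)\<^sup>2 \<le> 2\<^sup>2 * (1 + x\<^sup>2)" for x :: real
    proof -
      have "0 \<le> (1 - x)\<^sup>2 + (2 * x\<^sup>2 + 2)" by (intro add_nonneg_nonneg) auto
      also have "\<dots> = 2\<^sup>2 * (1 + x\<^sup>2) - (1 + x)\<^sup>2" by (simp add: power2_eq_square algebra_simps)
      finally show ?thesis by (simp only: diff_ge_0_iff_ge)
    qed
    thus ?thesis .
  qed
  hence "((1 + norm \<xi>)\<^sup>2) powr (real k / 2) \<le> (2\<^sup>2 * (1 + (norm \<xi>)\<^sup>2)) powr (real k / 2)"
    by (intro powr_mono2) auto
  also have "\<dots> = (2\<^sup>2) powr (real k / 2) * jb (real k) \<xi>" unfolding jb_def by (rule powr_mult)
  also have "((1 + norm \<xi>)\<^sup>2) powr (real k / 2) = (1 + norm \<xi>) ^ k"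
    using p by (simp add: powr_powr powr_realpow flip: powr_numeral)
  also have "(2\<^sup>2) powr (real k / 2) = (2::real) ^ k"
  proof -
    have "(2::real)\<^sup>2 = 2 powr 2" by (simp add: powr_numeral)
    hence "((2::real)\<^sup>2) powr (real k / 2) = 2 powr (2 * (real k / 2))" by (simp only: powr_powr)
    thus ?thesis by (simp add: powr_realpow)
  qed
  finally show ?thesis .
qed

lemma peetre_base: "1 + (norm (u + v :: 'a::euclidean_space))\<^sup>2 \<le> 2 * ((1 + (norm u)\<^sup>2) * (1 + (norm v)\<^sup>2))"
proof -
  have "(norm (u + v))\<^sup>2 \<le> (norm u + norm v)\<^sup>2" by (intro power_mono norm_triangle_ineq) auto
  also have "\<dots> \<le> 2 * (norm u)\<^sup>2 + 2 * (norm v)\<^sup>2"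
    using sum_squares_bound[of "norm u" "norm v"] by (simp add: power2_eq_square algebra_simps)
  finally have "1 + (norm (u + v))\<^sup>2 \<le> 2 * (1 + (norm u)\<^sup>2 + (norm v)\<^sup>2)" by simp
  also have "\<dots> \<le> 2 * ((1 + (norm u)\<^sup>2) * (1 + (norm v)\<^sup>2))" by (simp add: algebra_simps)
  finally show ?thesis .
qed

lemma peetre_nonneg:
  assumes "\<alpha> \<ge> 0" shows "jb \<alpha> (u + v) \<le> 2 powr \<alpha> * jb \<alpha> u * jb \<alpha> v"
proof -
  have "jb \<alpha> (u + v) \<le> (2 * ((1 + (norm u)\<^sup>2) * (1 + (norm v)\<^sup>2))) powr (\<alpha> / 2)"
    unfolding jb_def using assms by (intro powr_mono2 peetre_base) auto
  also have "\<dots> = 2 powr (\<alpha> / 2) * (jb \<alpha> u * jb \<alpha> v)" by (simp add: powr_mult jb_def)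
  also have "\<dots> \<le> 2 powr \<alpha> * (jb \<alpha> u * jb \<alpha> v)"
    using assms by (intro mult_right_mono powr_mono mult_nonneg_nonneg jb_nonneg) auto
  finally show ?thesis by (simp add: mult.assoc)
qed

text \<open>A negative exponent is reduced to its absolute value by exchanging the two points and
  multiplying by \<open>jb \<alpha> \<xi> * jb \<alpha> \<zeta>\<close>.\<close>

lemma peetre: "jb \<alpha> \<xi> \<le> 2 powr \<bar>\<alpha>\<bar> * jb \<bar>\<alpha>\<bar> (\<xi> - \<zeta>) * jb \<alpha> \<zeta>"
proof (cases "\<alpha> \<ge> 0")
  case True
  thus ?thesis using peetre_nonneg[OF True, of "\<xi> - \<zeta>" \<zeta>] by simp
next
  case False
  hence "jb (- \<alpha>) \<zeta> \<le> 2 powr (- \<alpha>) * jb (- \<alpha>) (\<zeta> - \<xi>) * jb (- \<alpha>) \<xi>"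
    using peetre_nonneg[of "- \<alpha>" "\<zeta> - \<xi>" \<xi>] by simp
  hence "jb (- \<alpha>) \<zeta> * (jb \<alpha> \<xi> * jb \<alpha> \<zeta>) \<le> 2 powr (- \<alpha>) * jb (- \<alpha>) (\<zeta> - \<xi>) * jb (- \<alpha>) \<xi> * (jb \<alpha> \<xi> * jb \<alpha> \<zeta>)"
    by (intro mult_right_mono mult_nonneg_nonneg jb_nonneg)
  also have "\<dots> = 2 powr (- \<alpha>) * jb (- \<alpha>) (\<zeta> - \<xi>) * jb \<alpha> \<zeta> * (jb \<alpha> \<xi> * jb (- \<alpha>) \<xi>)" by (simp add: mult_ac)
  also have "jb (- \<alpha>) \<zeta> * (jb \<alpha> \<xi> * jb \<alpha> \<zeta>) = jb \<alpha> \<xi> * (jb \<alpha> \<zeta> * jb (- \<alpha>) \<zeta>)" by (simp add: mult_ac)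
  also have "jb (- \<alpha>) (\<zeta> - \<xi>) = jb \<bar>\<alpha>\<bar> (\<xi> - \<zeta>)" using False by (simp add: jb_def norm_minus_commute)
  finally show ?thesis using False by (simp add: jb_minus)
qed

section \<open>Distributions whose Fourier transform is a function\<close>

text \<open>The weighted function is at most a constant plus an integrable function. Decay of order
  \<open>l\<close> compensates the weight, and the further \<open>2 * DIM('a)\<close> make the
  constant integrable. Admitting every measurable \<open>\<phi>\<close> with this decay covers
  inverse transforms of Schwartz functions as well as indicators of compact sets.\<close>

lemma H_pairing:
  fixes F :: "'a::euclidean_space \<Rightarrow> complex"
  assumes p: "1 \<le> p" and m: "F \<in> borel_measurable borel" and F: "in_Lp p (\<lambda>\<xi>. weight \<alpha> \<xi> * F \<xi>)"
  shows "\<exists>C k. C \<ge> 0 \<and> (\<forall>\<phi> D. \<phi> \<in> borel_measurable borel \<longrightarrow>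
     (\<forall>\<xi>. (1 + norm \<xi>) ^ k * cmod (\<phi> \<xi>) \<le> D) \<longrightarrow>
     integrable lborel (\<lambda>\<xi>. F \<xi> * \<phi> \<xi>) \<and> (\<integral>\<xi>. cmod (F \<xi> * \<phi> \<xi>) \<partial>lborel) \<le> C * D)"
proof -
  obtain C a where C: "C \<ge> 0" "integrable lborel a" "\<And>x. a x \<ge> 0" "AE \<xi> in lborel. cmod (weight \<alpha> \<xi> * F \<xi>) \<le> C + a \<xi>"
    using in_Lp_split[OF p F] by blast
  obtain l :: nat where l: "- \<alpha> \<le> real l" using real_arch_simple by blast
  let ?d = "\<lambda>\<xi>::'a. inverse ((1 + norm \<xi>) ^ (2 * DIM('a)))"
  let ?w = "\<lambda>\<xi>. C * ?d \<xi> + a \<xi>"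
  have iw: "integrable lborel ?w" by (intro Bochner_Integration.integrable_add integrable_mult_right integrable_decay C) auto
  have w0: "?w \<xi> \<ge> 0" for \<xi> using C(1,3) by (simp add: add_nonneg_nonneg)
  show ?thesis
  proof (intro exI[of _ "\<integral>\<xi>. ?w \<xi> \<partial>lborel"] exI[of _ "l + 2 * DIM('a)"] conjI[of "0 \<le> _"] allI impI)
    show "0 \<le> (\<integral>\<xi>. ?w \<xi> \<partial>lborel)" by (rule integral_nonneg_AE) (use w0 in auto)
    fix \<phi> :: "'a \<Rightarrow> complex" and D
    assume \<phi>: "\<phi> \<in> borel_measurable borel" and *: "\<forall>\<xi>. (1 + norm \<xi>) ^ (l + 2 * DIM('a)) * cmod (\<phi> \<xi>) \<le> D"
    note \<phi> = \<phi> *[rule_format]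
    note [measurable] = m \<phi>(1)
    have "cmod (\<phi> 0) \<le> D" using \<phi>(2)[of 0] by simp
    hence D: "D \<ge> 0" by (rule order_trans[OF norm_ge_zero])
    have le: "AE \<xi> in lborel. cmod (F \<xi> * \<phi> \<xi>) \<le> D * ?w \<xi>"
      using C(4)
    proof eventually_elim
      case (elim \<xi>)
      have p0: "0 < 1 + norm \<xi>" by (simp add: add_pos_nonneg)
      have d1: "?d \<xi> \<le> 1"
        using le_imp_inverse_le[of 1 "(1 + norm \<xi>) ^ (2 * DIM('a))"] one_le_power[of "1 + norm \<xi>"] by simp
      have d0: "0 \<le> ?d \<xi>" using p0 by simp
      have "jb (- \<alpha>) \<xi> * cmod (\<phi> \<xi>) \<le> (1 + norm \<xi>) ^ l * cmod (\<phi> \<xi>)"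
        by (intro mult_right_mono jb_le_power l) auto
      also have "\<dots> = (1 + norm \<xi>) ^ (l + 2 * DIM('a)) * cmod (\<phi> \<xi>) * ?d \<xi>"
        using p0 by (simp add: power_add field_simps)
      also have "\<dots> \<le> D * ?d \<xi>" by (intro mult_right_mono \<phi>(2) d0)
      finally have 1: "jb (- \<alpha>) \<xi> * cmod (\<phi> \<xi>) \<le> D * ?d \<xi>" .
      have "cmod (F \<xi> * \<phi> \<xi>) = (jb \<alpha> \<xi> * jb (- \<alpha>) \<xi>) * cmod (F \<xi>) * cmod (\<phi> \<xi>)"
        by (simp add: jb_minus norm_mult)
      also have "\<dots> = cmod (weight \<alpha> \<xi> * F \<xi>) * (jb (- \<alpha>) \<xi> * cmod (\<phi> \<xi>))"
        by (simp add: norm_mult cmod_weight mult_ac)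
      also have "\<dots> \<le> (C + a \<xi>) * (D * ?d \<xi>)"
        by (rule mult_mono[OF elim 1]) (use C(1) C(3)[of \<xi>] in \<open>auto intro!: mult_nonneg_nonneg jb_nonneg\<close>)
      also have "\<dots> = D * (C * ?d \<xi> + a \<xi> * ?d \<xi>)" by (simp add: algebra_simps)
      also have "\<dots> \<le> D * ?w \<xi>" using D d1 C(3)[of \<xi>] by (intro mult_left_mono add_left_mono) (auto intro: mult_left_le)
      finally show ?case .
    qed
    have i: "integrable lborel (\<lambda>\<xi>. D * ?w \<xi>)" by (rule integrable_mult_right[OF iw])
    have "AE \<xi> in lborel. norm (F \<xi> * \<phi> \<xi>) \<le> norm (D * ?w \<xi>)"
      using le by eventually_elim (unfold real_norm_def, rule order_trans[OF _ abs_ge_self])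
    hence iF: "integrable lborel (\<lambda>\<xi>. F \<xi> * \<phi> \<xi>)"
      by (rule Bochner_Integration.integrable_bound[OF i, rotated]) measurable
    have "(\<integral>\<xi>. cmod (F \<xi> * \<phi> \<xi>) \<partial>lborel) \<le> (\<integral>\<xi>. D * ?w \<xi> \<partial>lborel)"
      by (rule integral_mono_AE[OF integrable_norm[OF iF] i le])
    also have "\<dots> = (\<integral>\<xi>. ?w \<xi> \<partial>lborel) * D" by (simp only: integral_mult_right_zero mult.commute)
    finally show "integrable lborel (\<lambda>\<xi>. F \<xi> * \<phi> \<xi>) \<and> (\<integral>\<xi>. cmod (F \<xi> * \<phi> \<xi>) \<partial>lborel) \<le> (\<integral>\<xi>. ?w \<xi> \<partial>lborel) * D"
      using iF by blast
  qed
qed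

lemma H_schwartz_integrable:
  assumes "1 \<le> p" "F \<in> borel_measurable borel" "in_Lp p (\<lambda>\<xi>. weight \<alpha> \<xi> * F \<xi>)" "schwartz_fun \<phi>"
  shows "integrable lborel (\<lambda>\<xi>. F \<xi> * \<phi> \<xi>)"
proof -
  obtain C k where Ck: "C \<ge> 0" "\<forall>\<phi> D. \<phi> \<in> borel_measurable borel \<longrightarrow>
     (\<forall>\<xi>. (1 + norm \<xi>) ^ k * cmod (\<phi> \<xi>) \<le> D) \<longrightarrow>
     integrable lborel (\<lambda>\<xi>. F \<xi> * \<phi> \<xi>) \<and> (\<integral>\<xi>. cmod (F \<xi> * \<phi> \<xi>) \<partial>lborel) \<le> C * D"
    using H_pairing[OF assms(1-3)] by blast
  obtain D where D: "schwartz_bound k \<phi> D" using assms(4) schwartz_fun_iff by blast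
  have "(1 + norm \<xi>) ^ k * cmod (\<phi> \<xi>) \<le> D" for \<xi> using schwartz_boundD[OF D, of "[]" \<xi>] by simp
  thus ?thesis using Ck(2) schwartz_measurable[OF assms(4)] by blast
qed

lemma H_locally_integrable:
  fixes F :: "'a::euclidean_space \<Rightarrow> complex"
  assumes "1 \<le> p" "F \<in> borel_measurable borel" "in_Lp p (\<lambda>\<xi>. weight \<alpha> \<xi> * F \<xi>)" "compact K"
  shows "set_integrable lborel K F"
proof -
  obtain C k where Ck: "C \<ge> 0" "\<forall>\<phi> D. \<phi> \<in> borel_measurable borel \<longrightarrow>
     (\<forall>\<xi>. (1 + norm \<xi>) ^ k * cmod (\<phi> \<xi>) \<le> D) \<longrightarrow>
     integrable lborel (\<lambda>\<xi>. F \<xi> * \<phi> \<xi>) \<and> (\<integral>\<xi>. cmod (F \<xi> * \<phi> \<xi>) \<partial>lborel) \<le> C * D"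
    using H_pairing[OF assms(1-3)] by blast
  obtain R where R: "R > 0" "\<And>x. x \<in> K \<Longrightarrow> norm x \<le> R" using compact_imp_bounded[OF assms(4)] bounded_pos by metis
  have [measurable]: "K \<in> sets borel" by (rule borel_compact[OF assms(4)])
  have m: "(\<lambda>\<xi>. complex_of_real (indicator K \<xi>)) \<in> borel_measurable borel" by measurable
  have "(1 + norm \<xi>) ^ k * cmod (of_real (indicator K \<xi>)) \<le> (1 + R) ^ k" for \<xi>
    using R by (cases "\<xi> \<in> K") (auto intro!: power_mono)
  hence "integrable lborel (\<lambda>\<xi>. F \<xi> * of_real (indicator K \<xi>))" using Ck(2) m by blast
  thus ?thesis by (simp add: set_integrable_def scaleR_conv_of_real mult.commute)
qed

lemma ifourier_linear:
  assumes "schwartz_fun \<phi>" "schwartz_fun \<psi>"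
  shows "ifourier (\<lambda>x. a * \<phi> x + b * \<psi> x) \<xi> = a * ifourier \<phi> \<xi> + b * ifourier \<psi> \<xi>"
  using fourier_linear[OF schwartz_integrable[OF assms(1)] schwartz_integrable[OF assms(2)], of a b "- \<xi>"]
  by (simp add: ifourier_def algebra_simps add_divide_distrib)

text \<open>Pairing \<open>K\<close> with inverse transforms defines a tempered distribution, since
  the decay of an inverse transform is controlled by Schwartz bounds; inversion then identifies its
  transform with \<open>K\<close>. Products are constructed from their transforms in this
  way.\<close>

lemma H_exists:
  fixes K :: "'a::euclidean_space \<Rightarrow> complex"
  assumes r: "1 \<le> r" and m: "K \<in> borel_measurable borel" and K: "in_Lp r (\<lambda>\<xi>. weight \<alpha> \<xi> * K \<xi>)"
  obtains h where "tempered_distribution h" "has_fourier_fun h K"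
proof -
  define T where "T \<psi> = (\<integral>\<xi>. K \<xi> * ifourier \<psi> \<xi> \<partial>lborel)" for \<psi>
  have i: "integrable lborel (\<lambda>\<xi>. K \<xi> * ifourier \<psi> \<xi>)" if "schwartz_fun \<psi>" for \<psi>
    by (rule H_schwartz_integrable[OF r m K schwartz_ifourier[OF that]])
  obtain C k where Ck: "C \<ge> 0" "\<forall>\<phi> D. \<phi> \<in> borel_measurable borel \<longrightarrow>
     (\<forall>\<xi>. (1 + norm \<xi>) ^ k * cmod (\<phi> \<xi>) \<le> D) \<longrightarrow>
     integrable lborel (\<lambda>\<xi>. K \<xi> * \<phi> \<xi>) \<and> (\<integral>\<xi>. cmod (K \<xi> * \<phi> \<xi>) \<partial>lborel) \<le> C * D"
    using H_pairing[OF r m K] by blast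
  obtain E where E: "E \<ge> 0" "\<And>\<phi> B (\<xi>::'a). schwartz_fun \<phi> \<Longrightarrow> schwartz_bound (k + 2 * DIM('a)) \<phi> B \<Longrightarrow>
     (1 + norm \<xi>) ^ k * cmod (fourier \<phi> \<xi>) \<le> E * B" using fourier_decay[of k] by metis
  let ?c = "1 / (2 * pi) ^ DIM('a)"
  have T: "tempered_distribution T"
  proof (rule temperedI)
    fix \<phi> \<psi> :: "'a \<Rightarrow> complex" and a b assume \<phi>: "schwartz_fun \<phi>" "schwartz_fun \<psi>"
    have "T (\<lambda>x. a * \<phi> x + b * \<psi> x) = (\<integral>\<xi>. a * (K \<xi> * ifourier \<phi> \<xi>) + b * (K \<xi> * ifourier \<psi> \<xi>) \<partial>lborel)"
      unfolding T_def ifourier_linear[OF \<phi>] by (simp add: algebra_simps)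
    also have "\<dots> = (\<integral>\<xi>. a * (K \<xi> * ifourier \<phi> \<xi>) \<partial>lborel) + (\<integral>\<xi>. b * (K \<xi> * ifourier \<psi> \<xi>) \<partial>lborel)"
      by (intro Bochner_Integration.integral_add integrable_mult_right i \<phi>)
    finally show "T (\<lambda>x. a * \<phi> x + b * \<psi> x) = a * T \<phi> + b * T \<psi>"
      unfolding T_def by (simp only: integral_mult_right_zero)
  next
    fix \<phi> :: "'a \<Rightarrow> complex" and B assume \<phi>: "schwartz_fun \<phi>" "schwartz_bound (k + 2 * DIM('a)) \<phi> B"
    have "(1 + norm \<xi>) ^ k * cmod (ifourier \<phi> \<xi>) \<le> ?c * (E * B)" for \<xi>
    proof -
      have "(1 + norm \<xi>) ^ k * cmod (ifourier \<phi> \<xi>) = ?c * ((1 + norm (- \<xi>)) ^ k * cmod (fourier \<phi> (- \<xi>)))"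
        by (simp add: ifourier_def norm_mult norm_divide norm_power)
      also have "\<dots> \<le> ?c * (E * B)" by (intro mult_left_mono E(2) \<phi>) auto
      finally show ?thesis .
    qed
    from conjunct2[OF Ck(2)[rule_format, OF schwartz_measurable[OF schwartz_ifourier[OF \<phi>(1)]] this]]
    have "cmod (T \<phi>) \<le> C * (?c * (E * B))"
      unfolding T_def by (rule order_trans[OF integral_norm_bound])
    thus "cmod (T \<phi>) \<le> (C * ?c * E) * B" by (simp add: mult_ac)
  qed
  have "distr_is_fun (fourier_distr T) K"
    unfolding distr_is_fun_def fourier_distr_def T_def
    using m H_locally_integrable[OF r m K] by (auto simp: ifourier_fourier test_schwartz)
  hence "has_fourier_fun T K" unfolding has_fourier_fun_def distr_eq_def using T by blast
  thus ?thesis using that T by blast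
qed

lemma distr_is_fun_measurable: "distr_is_fun u F \<Longrightarrow> F \<in> borel_measurable borel"
  by (simp add: distr_is_fun_def)

lemma has_fourier_fun_measurable: "has_fourier_fun f F \<Longrightarrow> F \<in> borel_measurable borel"
  by (auto simp: has_fourier_fun_def distr_is_fun_def)

text \<open>By definition the representing function is tested only on test functions. Truncations of
  \<open>\<rho>\<close>, which do not exceed it in modulus, extend the formula by dominated
  convergence.\<close>

lemma tempered_fourier_schwartz:
  fixes F :: "'a::euclidean_space \<Rightarrow> complex"
  assumes T: "tempered_distribution T" "distr_is_fun (fourier_distr T) F"
    and p: "1 \<le> p" "in_Lp p (\<lambda>\<xi>. weight \<alpha> \<xi> * F \<xi>)" and \<rho>: "schwartz_fun \<rho>"
  shows "T (fourier \<rho>) = (\<integral>\<xi>. F \<xi> * \<rho> \<xi> \<partial>lborel)"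
proof -
  have m: "F \<in> borel_measurable borel" by (rule distr_is_fun_measurable[OF T(2)])
  note [measurable] = m schwartz_measurable[OF \<rho>]
  obtain \<rho>s where \<rho>s: "\<And>j::nat. test_fun (\<rho>s j)" "\<And>j x. cmod (\<rho>s j x) \<le> cmod (\<rho> x)"
    "\<And>x. (\<lambda>j. \<rho>s j x) \<longlonglongrightarrow> \<rho> x"
    "\<And>N. \<exists>B. \<forall>j. schwartz_bound N (\<lambda>x. \<rho> x - \<rho>s j x) (B / (real j + 1))"
    using schwartz_approx[OF \<rho>] by blast
  note [measurable] = schwartz_measurable[OF test_schwartz[OF \<rho>s(1)]]
  have "(\<lambda>j. T (fourier (\<rho>s j))) \<longlonglongrightarrow> T (fourier \<rho>)"
    by (rule tempered_tendsto[OF T(1) schwartz_fourier[OF \<rho>] schwartz_fourier[OF test_schwartz[OF \<rho>s(1)]]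
          fourier_tendsto[OF \<rho> test_schwartz[OF \<rho>s(1)] \<rho>s(4)]])
  moreover have "T (fourier (\<rho>s j)) = (\<integral>\<xi>. F \<xi> * \<rho>s j \<xi> \<partial>lborel)" for j
    using T(2) \<rho>s(1) by (simp add: distr_is_fun_def fourier_distr_def)
  moreover have "(\<lambda>j. \<integral>\<xi>. F \<xi> * \<rho>s j \<xi> \<partial>lborel) \<longlonglongrightarrow> (\<integral>\<xi>. F \<xi> * \<rho> \<xi> \<partial>lborel)"
  proof (rule integral_dominated_convergence[where w = "\<lambda>\<xi>. cmod (F \<xi> * \<rho> \<xi>)"])
    show "integrable lborel (\<lambda>\<xi>. cmod (F \<xi> * \<rho> \<xi>))"
      by (rule integrable_norm[OF H_schwartz_integrable[OF p(1) m p(2) \<rho>]])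
    show "AE \<xi> in lborel. (\<lambda>j. F \<xi> * \<rho>s j \<xi>) \<longlonglongrightarrow> F \<xi> * \<rho> \<xi>" by (intro AE_I2 tendsto_intros \<rho>s(3))
    show "AE \<xi> in lborel. cmod (F \<xi> * \<rho>s j \<xi>) \<le> cmod (F \<xi> * \<rho> \<xi>)" for j
      unfolding norm_mult by (intro AE_I2 mult_left_mono \<rho>s(2)) auto
  qed measurable
  ultimately show ?thesis by (simp add: LIMSEQ_unique)
qed

text \<open>Transforms of test functions are only Schwartz functions, so the two tempered extensions
  have to be identified there by density before duality can compare \<open>F\<close> and
  \<open>F'\<close>.\<close>

lemma has_fourier_fun_unique:
  fixes F :: "'a::euclidean_space \<Rightarrow> complex"
  assumes "has_fourier_fun f F" "has_fourier_fun f F'"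
  shows "AE \<xi> in lborel. F \<xi> = F' \<xi>"
proof -
  obtain T T' where T: "tempered_distribution T" "distr_eq f T" "distr_is_fun (fourier_distr T) F"
    and T': "tempered_distribution T'" "distr_eq f T'" "distr_is_fun (fourier_distr T') F'"
    using assms unfolding has_fourier_fun_def by blast
  have "T \<phi> = T' \<phi>" if "schwartz_fun \<phi>" for \<phi>
    by (rule tempered_eqI[OF T(1) T'(1) _ that]) (use T(2) T'(2) in \<open>simp add: distr_eq_def\<close>)
  hence "T (fourier \<phi>) = T' (fourier \<phi>)" if "test_fun \<phi>" for \<phi>
    using schwartz_fourier[OF test_schwartz[OF that]] by blast
  thus ?thesis
    by (intro AE_eq_by_duality) (use T(3) T'(3) in \<open>auto simp: distr_is_fun_def fourier_distr_def\<close>)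
qed

text \<open>Injectivity of the Fourier transform: a test function is the transform of a Schwartz
  function \<open>\<rho>\<close>, and the two extensions agree on the transforms of test functions
  that approximate \<open>\<rho>\<close>.\<close>

lemma has_fourier_fun_distr_eq:
  fixes F :: "'a::euclidean_space \<Rightarrow> complex"
  assumes "has_fourier_fun f F" "has_fourier_fun g G" "AE \<xi> in lborel. F \<xi> = G \<xi>"
  shows "distr_eq f g"
proof -
  obtain T T' where T: "tempered_distribution T" "distr_eq f T" "distr_is_fun (fourier_distr T) F"
    and T': "tempered_distribution T'" "distr_eq g T'" "distr_is_fun (fourier_distr T') G"
    using assms unfolding has_fourier_fun_def by blast
  have [measurable]: "F \<in> borel_measurable borel" "G \<in> borel_measurable borel"
    using T(3) T'(3) by (simp_all add: distr_is_fun_def)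
  have test: "T (fourier \<phi>) = T' (fourier \<phi>)" if "test_fun \<phi>" for \<phi>
  proof -
    note [measurable] = schwartz_measurable[OF test_schwartz[OF that]]
    have "(\<integral>\<xi>. F \<xi> * \<phi> \<xi> \<partial>lborel) = (\<integral>\<xi>. G \<xi> * \<phi> \<xi> \<partial>lborel)"
      by (intro integral_cong_AE) (use assms(3) in \<open>auto elim: eventually_mono\<close>)
    thus ?thesis using T(3) T'(3) that by (simp add: distr_is_fun_def fourier_distr_def)
  qed
  have "T \<psi> = T' \<psi>" if "test_fun \<psi>" for \<psi>
  proof -
    define \<rho> where "\<rho> = ifourier \<psi>"
    have \<rho>: "schwartz_fun \<rho>" "fourier \<rho> = \<psi>"
      using that by (simp_all add: \<rho>_def schwartz_ifourier fourier_ifourier test_schwartz)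
    obtain \<rho>s where \<rho>s: "\<And>j::nat. test_fun (\<rho>s j)"
      "\<And>N. \<exists>B. \<forall>j. schwartz_bound N (\<lambda>x. \<rho> x - \<rho>s j x) (B / (real j + 1))"
      using schwartz_approx[OF \<rho>(1)] by metis
    have "(\<lambda>j. U (fourier (\<rho>s j))) \<longlonglongrightarrow> U \<psi>" if "tempered_distribution U" for U
      unfolding \<rho>(2)[symmetric]
      by (rule tempered_tendsto[OF that schwartz_fourier[OF \<rho>(1)] schwartz_fourier[OF test_schwartz[OF \<rho>s(1)]]
          fourier_tendsto[OF \<rho>(1) test_schwartz[OF \<rho>s(1)] \<rho>s(2)]])
    from this[OF T(1)] this[OF T'(1)] show ?thesis unfolding test[OF \<rho>s(1)] by (rule LIMSEQ_unique)
  qed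
  thus ?thesis using T(2) T'(2) by (simp add: distr_eq_def)
qed

lemma has_fourier_fun_cong:
  fixes F :: "'a::euclidean_space \<Rightarrow> complex"
  assumes "has_fourier_fun f F" "AE \<xi> in lborel. F \<xi> = G \<xi>" "G \<in> borel_measurable borel"
  shows "has_fourier_fun f G"
proof -
  obtain T where T: "tempered_distribution T" "distr_eq f T" "distr_is_fun (fourier_distr T) F"
    using assms unfolding has_fourier_fun_def by blast
  have [measurable]: "F \<in> borel_measurable borel" "G \<in> borel_measurable borel"
    using T(3) assms(3) by (simp_all add: distr_is_fun_def)
  have "distr_is_fun (fourier_distr T) G"
    unfolding distr_is_fun_def
  proof (intro conjI allI impI)
    show "G \<in> borel_measurable lborel" by simp
    fix K :: "'a set" assume K: "compact K"
    have [measurable]: "K \<in> sets borel" by (rule borel_compact[OF K])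
    have "set_integrable lborel K F" using T(3) K by (simp add: distr_is_fun_def)
    thus "set_integrable lborel K G"
      unfolding set_integrable_def
      by (subst (asm) integrable_cong_AE[of _ _ "\<lambda>x. indicator K x *\<^sub>R G x"])
         (use assms(2) in \<open>auto elim: eventually_mono\<close>)
  next
    fix \<phi> :: "'a \<Rightarrow> complex" assume \<phi>: "test_fun \<phi>"
    note [measurable] = schwartz_measurable[OF test_schwartz[OF \<phi>]]
    have "(\<integral>\<xi>. F \<xi> * \<phi> \<xi> \<partial>lborel) = (\<integral>\<xi>. G \<xi> * \<phi> \<xi> \<partial>lborel)"
      by (intro integral_cong_AE) (use assms(2) in \<open>auto elim: eventually_mono\<close>)
    thus "fourier_distr T \<phi> = (\<integral>\<xi>. G \<xi> * \<phi> \<xi> \<partial>lborel)"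
      using T(3) \<phi> by (simp add: distr_is_fun_def)
  qed
  thus ?thesis unfolding has_fourier_fun_def using T by blast
qed

lemma has_fourier_fun_transfer:
  "has_fourier_fun f F \<Longrightarrow> (\<And>\<phi>. test_fun \<phi> \<Longrightarrow> g \<phi> = f \<phi>) \<Longrightarrow> has_fourier_fun g F"
  unfolding has_fourier_fun_def distr_eq_def by metis

section \<open>Multiplication by test functions\<close>

lemma modulated_fourier:
  "fourier (\<lambda>x. exp (\<i> * complex_of_real (x \<bullet> \<zeta>)) * \<eta> x) \<xi> = fourier \<eta> (\<xi> - \<zeta>)"
proof -
  have "- \<i> * complex_of_real (x \<bullet> \<xi>) + \<i> * complex_of_real (x \<bullet> \<zeta>) = - \<i> * complex_of_real (x \<bullet> (\<xi> - \<zeta>))" for x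
    by (simp add: inner_diff_right right_diff_distrib)
  hence "exp (- \<i> * complex_of_real (x \<bullet> \<xi>)) * (exp (\<i> * complex_of_real (x \<bullet> \<zeta>)) * \<eta> x) =
      exp (- \<i> * complex_of_real (x \<bullet> (\<xi> - \<zeta>))) * \<eta> x" for x
    by (simp only: mult.assoc[symmetric] exp_add[symmetric])
  thus ?thesis unfolding fourier_def by (simp only:)
qed

text \<open>Modulating \<open>\<eta>\<close> translates its transform, so the multiplication formula
  yields the convolution theorem for Schwartz functions.\<close>

lemma ifourier_mult:
  fixes \<eta> \<phi> :: "'a::euclidean_space \<Rightarrow> complex"
  assumes "schwartz_fun \<eta>" "schwartz_fun \<phi>"
  shows "ifourier (\<lambda>x. \<eta> x * fourier \<phi> x) \<zeta> =
     of_real (1 / (2 * pi) ^ DIM('a)) * (\<integral>\<xi>. \<phi> \<xi> * fourier \<eta> (\<xi> - \<zeta>) \<partial>lborel)"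
proof -
  let ?g = "\<lambda>x. exp (\<i> * complex_of_real (x \<bullet> \<zeta>)) * \<eta> x"
  have [measurable]: "\<eta> \<in> borel_measurable borel" by (rule schwartz_measurable[OF assms(1)])
  have "integrable lborel ?g"
    by (rule Bochner_Integration.integrable_bound[OF schwartz_integrable[OF assms(1)]])
       (auto simp: norm_mult cmod_exp_i)
  from fourier_multiplication[OF schwartz_integrable[OF assms(2)] this]
  have "(\<integral>x. fourier \<phi> x * ?g x \<partial>lborel) = (\<integral>\<xi>. \<phi> \<xi> * fourier \<eta> (\<xi> - \<zeta>) \<partial>lborel)"
    unfolding modulated_fourier .
  thus ?thesis unfolding ifourier_def fourier_def[of _ "- \<zeta>"] by (simp add: mult_ac)
qed

lemma weight_schwartz_in_L1:
  assumes "schwartz_fun \<phi>" shows "in_Lp 1 (\<lambda>\<xi>. weight \<alpha> \<xi> * \<phi> \<xi>)"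
proof -
  note [measurable] = schwartz_measurable[OF assms]
  obtain k :: nat where k: "\<alpha> \<le> real k" using real_arch_simple by blast
  have "integrable lborel (\<lambda>\<xi>. weight \<alpha> \<xi> * \<phi> \<xi>)"
    by (rule Bochner_Integration.integrable_bound[OF schwartz_weight_integrable[OF assms, of k]])
       (auto simp: norm_mult cmod_weight intro!: AE_I2 mult_right_mono jb_le_power k)
  hence "integrable lborel (\<lambda>\<xi>. cmod (weight \<alpha> \<xi> * \<phi> \<xi>) powr 1)" by simp
  thus ?thesis using in_Lp_finite_iff[of 1 "\<lambda>\<xi>. weight \<alpha> \<xi> * \<phi> \<xi>"] by simp
qed

text \<open>Young with exponents 1, \<open>p\<close>, \<open>p\<close>: Peetre's inequality puts a
  weight of order \<open>\<bar>\<alpha>\<bar>\<close> on the Schwartz factor, which stays integrable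
  under any weight.\<close>

lemma H_conv_schwartz:
  fixes F \<phi> :: "'a::euclidean_space \<Rightarrow> complex"
  assumes p: "1 \<le> p" and m: "F \<in> borel_measurable borel" and F: "in_Lp p (\<lambda>\<xi>. weight \<alpha> \<xi> * F \<xi>)"
    and \<phi>: "schwartz_fun \<phi>"
  shows "AE \<xi> in lborel. abs_conv \<phi> F \<xi> < \<infinity>"
    and "in_Lp p (\<lambda>\<xi>. weight \<alpha> \<xi> * of_real (enn2real (abs_conv \<phi> F \<xi>)))"
    and "in_Lp p (\<lambda>\<xi>. weight \<alpha> \<xi> * conv \<phi> F \<xi>)"
proof -
  have e: "1 / 1 + 1 / p = 1 / p + (1::ennreal)" by (simp add: add.commute divide_ennreal[of 1 1, simplified])
  have le: "cmod (weight \<alpha> \<xi>) * (cmod (\<phi> (\<xi> - \<zeta>)) * cmod (F \<zeta>)) \<le>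
     2 powr \<bar>\<alpha>\<bar> * (cmod (weight \<bar>\<alpha>\<bar> (\<xi> - \<zeta>) * \<phi> (\<xi> - \<zeta>)) * cmod (weight \<alpha> \<zeta> * F \<zeta>))" for \<xi> \<zeta>
    using mult_right_mono[OF peetre[of \<alpha> \<xi> \<zeta>], of "cmod (\<phi> (\<xi> - \<zeta>)) * cmod (F \<zeta>)"]
    by (simp add: norm_mult cmod_weight mult_ac)
  note * = weighted_young[OF order_refl p p e weight_schwartz_in_L1[OF \<phi>, of "\<bar>\<alpha>\<bar>"] F schwartz_measurable[OF \<phi>] m
      weight_measurable powr_ge_zero le]
  show "AE \<xi> in lborel. abs_conv \<phi> F \<xi> < \<infinity>" using *(1) weight_nonzero by (auto elim: eventually_mono)
  show "in_Lp p (\<lambda>\<xi>. weight \<alpha> \<xi> * of_real (enn2real (abs_conv \<phi> F \<xi>)))" by (rule *(2))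
  show "in_Lp p (\<lambda>\<xi>. weight \<alpha> \<xi> * conv \<phi> F \<xi>)" by (rule *(3))
qed

lemma in_Lp_cmult:
  assumes "1 \<le> p" "in_Lp p F" shows "in_Lp p (\<lambda>x. c * F x)"
proof -
  note [measurable] = in_Lp_measurable[OF assms(2)]
  show ?thesis by (rule in_Lp_mono[OF assms, of _ "cmod c"]) (auto simp: norm_mult)
qed

abbreviation cft :: "'a::euclidean_space itself \<Rightarrow> complex" where
  "cft (TYPE('a)) \<equiv> complex_of_real (1 / (2 * pi) ^ DIM('a))"

text \<open>Tested on \<open>\<phi>\<close>, the left side is \<open>f\<close> applied to
  \<open>\<eta>\<close> times \<open>fourier \<phi>\<close>, which is the transform of a convolution
  with \<open>fourier \<eta>\<close>; Fubini moves this convolution from \<open>\<phi>\<close> to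
  \<open>F\<close>.\<close>

theorem has_fourier_fun_mult:
  fixes F \<eta> :: "'a::euclidean_space \<Rightarrow> complex"
  assumes f: "has_fourier_fun f F" and p: "1 \<le> p" and F: "in_Lp p (\<lambda>\<xi>. weight \<alpha> \<xi> * F \<xi>)"
    and \<eta>: "test_fun \<eta>"
  shows "has_fourier_fun (mult_distr \<eta> f) (\<lambda>\<xi>. cft TYPE('a) * conv (fourier \<eta>) F \<xi>)"
    and "in_Lp p (\<lambda>\<xi>. weight \<alpha> \<xi> * (cft TYPE('a) * conv (fourier \<eta>) F \<xi>))"
proof -
  let ?c = "cft TYPE('a)"
  have m: "F \<in> borel_measurable borel" by (rule has_fourier_fun_measurable[OF f])
  have s\<eta>: "schwartz_fun (fourier \<eta>)" by (rule schwartz_fourier[OF test_schwartz[OF \<eta>]])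
  note [measurable] = m schwartz_measurable[OF s\<eta>]
  note * = H_conv_schwartz[OF p m F s\<eta>]
  show L: "in_Lp p (\<lambda>\<xi>. weight \<alpha> \<xi> * (?c * conv (fourier \<eta>) F \<xi>))"
    using in_Lp_cmult[OF p *(3), of ?c] by (simp add: mult.left_commute)
  have mK: "(\<lambda>\<xi>. ?c * conv (fourier \<eta>) F \<xi>) \<in> borel_measurable borel" by measurable
  obtain T where T: "tempered_distribution T" "distr_eq f T" "distr_is_fun (fourier_distr T) F"
    using f unfolding has_fourier_fun_def by blast
  have "distr_is_fun (fourier_distr (mult_distr \<eta> T)) (\<lambda>\<xi>. ?c * conv (fourier \<eta>) F \<xi>)"
    unfolding distr_is_fun_def
  proof (intro conjI allI impI)
    show "(\<lambda>\<xi>. ?c * conv (fourier \<eta>) F \<xi>) \<in> borel_measurable lborel" using mK by simp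
    show "set_integrable lborel K (\<lambda>\<xi>. ?c * conv (fourier \<eta>) F \<xi>)" if "compact K" for K
      by (rule H_locally_integrable[OF p mK L that])
    fix \<phi> :: "'a \<Rightarrow> complex" assume \<phi>: "test_fun \<phi>"
    have s\<phi>: "schwartz_fun \<phi>" by (rule test_schwartz[OF \<phi>])
    note [measurable] = schwartz_measurable[OF s\<phi>]
    let ?\<psi> = "\<lambda>x. \<eta> x * fourier \<phi> x"
    have s: "schwartz_fun ?\<psi>" by (rule schwartz_test_mult[OF \<eta> schwartz_fourier[OF s\<phi>]])
    \<comment> \<open>Absolute integrability follows by pairing \<open>\<phi>\<close> with the
      convolution of the moduli, which lies in the same weighted space as \<open>F\<close>.\<close>
    have i: "integrable (lborel \<Otimes>\<^sub>M lborel) (\<lambda>(\<xi>, \<zeta>). \<phi> \<xi> * (fourier \<eta> (\<xi> - \<zeta>) * F \<zeta>))"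
    proof (rule integrable_pairI)
      let ?E = "\<lambda>\<xi>. enn2real (abs_conv (fourier \<eta>) F \<xi>)"
      have "(\<integral>\<^sup>+\<xi>. \<integral>\<^sup>+\<zeta>. ennreal (cmod (\<phi> \<xi> * (fourier \<eta> (\<xi> - \<zeta>) * F \<zeta>))) \<partial>lborel \<partial>lborel) =
          (\<integral>\<^sup>+\<xi>. ennreal (cmod (\<phi> \<xi>)) * abs_conv (fourier \<eta>) F \<xi> \<partial>lborel)"
        unfolding abs_conv_def norm_mult by (simp add: ennreal_mult nn_integral_cmult)
      also have "\<dots> = (\<integral>\<^sup>+\<xi>. ennreal (cmod (of_real (?E \<xi>) * \<phi> \<xi>)) \<partial>lborel)"
        by (intro nn_integral_cong_AE, use *(1) in eventually_elim) (simp add: norm_mult ennreal_mult mult.commute)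
      also have "\<dots> < \<infinity>"
        by (rule nn_integral_less_top, rule H_schwartz_integrable[OF p _ *(2) s\<phi>]) measurable
      finally show "(\<integral>\<^sup>+\<xi>. \<integral>\<^sup>+\<zeta>. ennreal (cmod (\<phi> \<xi> * (fourier \<eta> (\<xi> - \<zeta>) * F \<zeta>))) \<partial>lborel \<partial>lborel) < \<infinity>" .
    qed measurable
    have "fourier_distr (mult_distr \<eta> T) \<phi> = T (fourier (ifourier ?\<psi>))"
      unfolding fourier_distr_def mult_distr_def by (simp add: fourier_ifourier[OF s])
    also have "\<dots> = (\<integral>\<zeta>. F \<zeta> * ifourier ?\<psi> \<zeta> \<partial>lborel)"
      by (rule tempered_fourier_schwartz[OF T(1,3) p F schwartz_ifourier[OF s]])
    also have "\<dots> = (\<integral>\<zeta>. ?c * (\<integral>\<xi>. \<phi> \<xi> * (fourier \<eta> (\<xi> - \<zeta>) * F \<zeta>) \<partial>lborel) \<partial>lborel)"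
    proof (intro Bochner_Integration.integral_cong refl)
      fix \<zeta>
      have "(\<integral>\<xi>. \<phi> \<xi> * (fourier \<eta> (\<xi> - \<zeta>) * F \<zeta>) \<partial>lborel) = (\<integral>\<xi>. \<phi> \<xi> * fourier \<eta> (\<xi> - \<zeta>) \<partial>lborel) * F \<zeta>"
        by (simp only: mult.assoc[symmetric] integral_mult_left_zero)
      thus "F \<zeta> * ifourier ?\<psi> \<zeta> = ?c * (\<integral>\<xi>. \<phi> \<xi> * (fourier \<eta> (\<xi> - \<zeta>) * F \<zeta>) \<partial>lborel)"
        unfolding ifourier_mult[OF test_schwartz[OF \<eta>] s\<phi>] by simp
    qed
    also have "\<dots> = ?c * (\<integral>\<zeta>. (\<integral>\<xi>. \<phi> \<xi> * (fourier \<eta> (\<xi> - \<zeta>) * F \<zeta>) \<partial>lborel) \<partial>lborel)"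
      by (rule integral_mult_right_zero)
    also have "\<dots> = ?c * (\<integral>\<xi>. (\<integral>\<zeta>. \<phi> \<xi> * (fourier \<eta> (\<xi> - \<zeta>) * F \<zeta>) \<partial>lborel) \<partial>lborel)"
      by (subst lborel_pair.Fubini_integral[OF i]) (rule refl)
    also have "\<dots> = (\<integral>\<xi>. ?c * conv (fourier \<eta>) F \<xi> * \<phi> \<xi> \<partial>lborel)"
    proof (subst integral_mult_right_zero[symmetric], intro Bochner_Integration.integral_cong refl)
      fix \<xi>
      show "?c * (\<integral>\<zeta>. \<phi> \<xi> * (fourier \<eta> (\<xi> - \<zeta>) * F \<zeta>) \<partial>lborel) = ?c * conv (fourier \<eta>) F \<xi> * \<phi> \<xi>"
        unfolding conv_def integral_mult_right_zero by (simp only: mult_ac)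
    qed
    finally show "fourier_distr (mult_distr \<eta> T) \<phi> = (\<integral>\<xi>. ?c * conv (fourier \<eta>) F \<xi> * \<phi> \<xi> \<partial>lborel)" .
  qed
  moreover have "distr_eq (mult_distr \<eta> f) (mult_distr \<eta> T)"
    using T(2) test_mult(1)[OF \<eta> test_smooth] by (simp add: distr_eq_def mult_distr_def)
  ultimately show "has_fourier_fun (mult_distr \<eta> f) (\<lambda>\<xi>. ?c * conv (fourier \<eta>) F \<xi>)"
    unfolding has_fourier_fun_def using tempered_mult_distr[OF T(1) \<eta>] by blast
qed

lemma in_H_mult:
  fixes \<eta> :: "'a::euclidean_space \<Rightarrow> complex"
  assumes "1 \<le> p" "in_H \<alpha> p f" "test_fun \<eta>" shows "in_H \<alpha> p (mult_distr \<eta> f)"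
  using assms has_fourier_fun_mult[OF _ assms(1) _ assms(3)] unfolding in_H_def by blast

text \<open>On the support of \<open>\<eta>\<close> the distribution sees derivatives up to a fixed
  order \<open>N\<close> only. For \<open>fourier \<phi>\<close> these are bounded by a weighted
  \<open>L\<^sup>1\<close> norm of \<open>\<phi>\<close>, which gives the second claim.\<close>

lemma tempered_localized:
  fixes \<eta> :: "'a::euclidean_space \<Rightarrow> complex"
  assumes "distribution f" "test_fun \<eta>"
  shows "tempered_distribution (mult_distr \<eta> f)"
    and "\<exists>C N. C \<ge> 0 \<and> (\<forall>\<phi>. schwartz_fun \<phi> \<longrightarrow>
       cmod (mult_distr \<eta> f (fourier \<phi>)) \<le> C * (\<integral>x. (1 + norm x) ^ N * cmod (\<phi> x) \<partial>lborel))"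
proof -
  obtain C N where CN: "C \<ge> 0" "\<And>\<phi> B. test_fun \<phi> \<Longrightarrow> supp \<phi> \<subseteq> supp \<eta> \<Longrightarrow>
     (\<And>bs x. set bs \<subseteq> Basis \<Longrightarrow> length bs \<le> N \<Longrightarrow> cmod (pderivs bs \<phi> x) \<le> B) \<Longrightarrow> cmod (f \<phi>) \<le> C * B"
    using distribution_bound[OF assms(1), of "supp \<eta>"] assms(2) unfolding test_fun_def by blast
  have bd: "cmod (mult_distr \<eta> f \<phi>) \<le> C * B"
    if \<phi>: "smooth_fun_on UNIV \<phi>" "schwartz_bound N (\<lambda>x. \<eta> x * \<phi> x) B" for \<phi> B
    unfolding mult_distr_def
  proof (rule CN(2)[OF test_mult[OF assms(2) \<phi>(1)]])
    fix bs :: "'a list" and x assume bs: "set bs \<subseteq> Basis" "length bs \<le> N"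
    have "1 * cmod (pderivs bs (\<lambda>x. \<eta> x * \<phi> x) x) \<le> (1 + norm x) ^ N * cmod (pderivs bs (\<lambda>x. \<eta> x * \<phi> x) x)"
      by (intro mult_right_mono one_le_power) auto
    thus "cmod (pderivs bs (\<lambda>x. \<eta> x * \<phi> x) x) \<le> B" using schwartz_boundD[OF \<phi>(2) bs, of x] by simp
  qed
  obtain D where D: "D \<ge> 0" "\<And>\<phi> B. smooth_fun_on UNIV \<phi> \<Longrightarrow> schwartz_bound N \<phi> B \<Longrightarrow>
    schwartz_bound N (\<lambda>x. \<eta> x * \<phi> x) (D * B)" using schwartz_bound_test_mult[OF assms(2)] by blast
  show "tempered_distribution (mult_distr \<eta> f)"
  proof (rule temperedI)
    fix \<phi> \<psi> :: "'a \<Rightarrow> complex" and a b assume \<phi>: "schwartz_fun \<phi>" "schwartz_fun \<psi>"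
    have "(\<lambda>x. \<eta> x * (a * \<phi> x + b * \<psi> x)) = (\<lambda>x. a * (\<eta> x * \<phi> x) + b * (\<eta> x * \<psi> x))"
      by (simp add: algebra_simps)
    moreover have "test_fun (\<lambda>x. \<eta> x * \<phi> x)" "test_fun (\<lambda>x. \<eta> x * \<psi> x)"
      using test_mult(1)[OF assms(2) schwartz_smooth] \<phi> by blast+
    ultimately show "mult_distr \<eta> f (\<lambda>x. a * \<phi> x + b * \<psi> x) = a * mult_distr \<eta> f \<phi> + b * mult_distr \<eta> f \<psi>"
      using assms(1) by (simp add: mult_distr_def distribution_def linear_functional_on_def)
  next
    fix \<phi> :: "'a \<Rightarrow> complex" and B assume \<phi>: "schwartz_fun \<phi>" "schwartz_bound N \<phi> B"
    show "cmod (mult_distr \<eta> f \<phi>) \<le> (C * D) * B"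
      using bd[OF schwartz_smooth[OF \<phi>(1)] D(2)[OF schwartz_smooth[OF \<phi>(1)] \<phi>(2)]] by (simp add: mult.assoc)
  qed
  obtain E where E: "schwartz_bound N \<eta> E" using test_schwartz[OF assms(2)] schwartz_fun_iff by blast
  have "cmod (mult_distr \<eta> f (fourier \<phi>)) \<le> C * 2 ^ N * E * (\<integral>x. (1 + norm x) ^ N * cmod (\<phi> x) \<partial>lborel)"
    if \<phi>: "schwartz_fun \<phi>" for \<phi>
  proof -
    let ?I = "\<integral>x. (1 + norm x) ^ N * cmod (\<phi> x) \<partial>lborel"
    \<comment> \<open>The roles in the product estimate are exchanged: \<open>fourier \<phi>\<close>
      is the multiplier with bounded derivatives, so only \<open>?I\<close> depends on
      \<open>\<phi>\<close>, and the Schwartz bound of \<open>\<eta>\<close> goes into the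
      constant.\<close>
    have "schwartz_bound N (\<lambda>x. fourier \<phi> x * \<eta> x) (2 ^ N * (?I * E))"
    proof (rule schwartz_bound_mult[where k = 0])
      fix bs :: "'a list" and x assume bs: "set bs \<subseteq> Basis" "length bs \<le> N"
      have "cmod (pderivs bs (fourier \<phi>) x) \<le> (\<integral>x. (1 + norm x) ^ length bs * cmod (\<phi> x) \<partial>lborel)"
        by (rule pderivs_fourier_le[OF \<phi> bs(1)])
      also have "\<dots> \<le> ?I"
        by (intro integral_mono schwartz_weight_integrable \<phi> mult_right_mono power_increasing bs(2)) auto
      finally show "cmod (pderivs bs (fourier \<phi>) x) \<le> ?I * (1 + norm x) ^ 0" by simp
    qed (use E in \<open>auto intro: smooth_fourier \<phi> test_smooth assms(2)\<close>)
    hence "schwartz_bound N (\<lambda>x. \<eta> x * fourier \<phi> x) (2 ^ N * (?I * E))" by (simp add: mult.commute)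
    from bd[OF smooth_fourier[OF \<phi>] this] show ?thesis by (simp add: mult_ac)
  qed
  moreover have "0 \<le> C * 2 ^ N * E" using CN(1) schwartz_bound_nonneg[OF E] by simp
  ultimately show "\<exists>C N. C \<ge> 0 \<and> (\<forall>\<phi>. schwartz_fun \<phi> \<longrightarrow>
       cmod (mult_distr \<eta> f (fourier \<phi>)) \<le> C * (\<integral>x. (1 + norm x) ^ N * cmod (\<phi> x) \<partial>lborel))" by blast
qed

text \<open>A weighted \<open>L\<^sup>1\<close> bound on a functional is dual to a pointwise bound
  on its density. The extension \<open>T\<close> and the localized distribution itself agree on
  transforms of test functions by density.\<close>

lemma localized_fourier_growth:
  fixes F :: "'a::euclidean_space \<Rightarrow> complex"
  assumes "distribution f" "test_fun \<eta>" "has_fourier_fun (mult_distr \<eta> f) F"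
  obtains C N where "C \<ge> 0" "AE \<xi> in lborel. cmod (F \<xi>) \<le> C * (1 + norm \<xi>) ^ N"
proof -
  obtain T where T: "tempered_distribution T" "distr_eq (mult_distr \<eta> f) T" "distr_is_fun (fourier_distr T) F"
    using assms(3) unfolding has_fourier_fun_def by blast
  obtain C N where CN: "C \<ge> 0" "\<And>\<phi>. schwartz_fun \<phi> \<Longrightarrow>
       cmod (mult_distr \<eta> f (fourier \<phi>)) \<le> C * (\<integral>x. (1 + norm x) ^ N * cmod (\<phi> x) \<partial>lborel)"
    using tempered_localized(2)[OF assms(1,2)] by blast
  have "AE \<xi> in lborel. cmod (F \<xi>) \<le> C * (1 + norm \<xi>) ^ N"
  proof (rule AE_le_by_duality)
    show "F \<in> borel_measurable borel" "\<And>K. compact K \<Longrightarrow> set_integrable lborel K F"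
      using T(3) by (simp_all add: distr_is_fun_def)
    show "continuous_on UNIV (\<lambda>\<xi>::'a. C * (1 + norm \<xi>) ^ N)" by (intro continuous_intros)
    show "0 \<le> C * (1 + norm \<xi>) ^ N" for \<xi> using CN(1) by simp
    fix \<phi> :: "'a \<Rightarrow> complex" assume \<phi>: "test_fun \<phi>"
    have "(\<integral>x. F x * \<phi> x \<partial>lborel) = T (fourier \<phi>)"
      using T(3) \<phi> by (simp add: distr_is_fun_def fourier_distr_def)
    also have "\<dots> = mult_distr \<eta> f (fourier \<phi>)"
      by (rule tempered_eqI[OF T(1) tempered_localized(1)[OF assms(1,2)] _ schwartz_fourier[OF test_schwartz[OF \<phi>]]])
         (use T(2) in \<open>simp add: distr_eq_def\<close>)
    finally show "cmod (\<integral>x. F x * \<phi> x \<partial>lborel) \<le> (\<integral>x. C * (1 + norm x) ^ N * cmod (\<phi> x) \<partial>lborel)"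
      using CN(2)[OF test_schwartz[OF \<phi>]] by (simp add: mult.assoc)
  qed
  thus ?thesis using that CN(1) by blast
qed

section \<open>Products\<close>

lemma AE_reflect:
  assumes "AE x in lborel. P x" shows "AE \<zeta> in lborel. P (\<xi> - \<zeta> :: 'a::euclidean_space)"
  using AE_affine[OF _ assms, of "-1" \<xi>] by simp

lemma conv_cong_AE:
  fixes F G F' G' :: "'a::euclidean_space \<Rightarrow> complex"
  assumes [measurable]: "F \<in> borel_measurable borel" "F' \<in> borel_measurable borel"
    "G \<in> borel_measurable borel" "G' \<in> borel_measurable borel"
    and "AE x in lborel. F x = F' x" "AE x in lborel. G x = G' x"
  shows "conv F G = conv F' G'" "abs_conv F G = abs_conv F' G'"
proof -
  have *: "AE \<zeta> in lborel. F (\<xi> - \<zeta>) = F' (\<xi> - \<zeta>) \<and> G \<zeta> = G' \<zeta>" for \<xi>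
    using AE_reflect[OF assms(5), of \<xi>] assms(6) by eventually_elim simp
  show "conv F G = conv F' G'"
    unfolding conv_def
  proof (intro ext integral_cong_AE)
    fix \<xi>
    show "AE \<zeta> in lborel. F (\<xi> - \<zeta>) * G \<zeta> = F' (\<xi> - \<zeta>) * G' \<zeta>"
      using *[of \<xi>] by eventually_elim simp
  qed measurable
  show "abs_conv F G = abs_conv F' G'"
    unfolding abs_conv_def
  proof (intro ext nn_integral_cong_AE)
    fix \<xi>
    show "AE \<zeta> in lborel. ennreal (cmod (F (\<xi> - \<zeta>)) * cmod (G \<zeta>)) = ennreal (cmod (F' (\<xi> - \<zeta>)) * cmod (G' \<zeta>))"
      using *[of \<xi>] by eventually_elim simp
  qed
qed

lemma conv_commute:
  fixes F G :: "'a::euclidean_space \<Rightarrow> complex"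
  assumes [measurable]: "F \<in> borel_measurable borel" "G \<in> borel_measurable borel"
  shows "conv F G = conv G F"
proof
  fix \<xi>
  have "(\<lambda>\<zeta>. F (\<xi> - \<zeta>) * G \<zeta>) \<in> borel_measurable borel" by measurable
  from lborel_integral_affine[OF this, of "-1" \<xi>] show "conv F G \<xi> = conv G F \<xi>"
    by (simp add: conv_def mult.commute)
qed

lemma conv_cmult_left: "conv (\<lambda>\<xi>. c * F \<xi>) G \<xi> = c * conv F G \<xi>"
  unfolding conv_def mult.assoc by (rule integral_mult_right_zero)

lemma conv_cmult_right: "conv F (\<lambda>\<xi>. c * G \<xi>) \<xi> = c * conv F G \<xi>"
  unfolding conv_def mult.left_commute[of _ c] by (rule integral_mult_right_zero)

text \<open>By Tonelli the hypothesis is the absolute integrability of the double integrand, so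
  Fubini applies.\<close>

lemma conv_assoc:
  fixes A F G :: "'a::euclidean_space \<Rightarrow> complex"
  assumes [measurable]: "A \<in> borel_measurable borel" "F \<in> borel_measurable borel" "G \<in> borel_measurable borel"
    and fin: "(\<integral>\<^sup>+\<zeta>. ennreal (cmod (A (\<xi> - \<zeta>))) * abs_conv F G \<zeta> \<partial>lborel) < \<infinity>"
  shows "conv A (conv F G) \<xi> = conv (conv A F) G \<xi>"
proof -
  let ?H = "\<lambda>\<zeta> \<eta>. A (\<xi> - \<zeta>) * (F (\<zeta> - \<eta>) * G \<eta>)"
  have i: "integrable (lborel \<Otimes>\<^sub>M lborel) (case_prod ?H)"
  proof (rule integrable_pairI)
    have "(\<integral>\<^sup>+\<zeta>. \<integral>\<^sup>+\<eta>. ennreal (cmod (?H \<zeta> \<eta>)) \<partial>lborel \<partial>lborel) =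
        (\<integral>\<^sup>+\<zeta>. ennreal (cmod (A (\<xi> - \<zeta>))) * abs_conv F G \<zeta> \<partial>lborel)"
      unfolding abs_conv_def norm_mult by (simp add: ennreal_mult nn_integral_cmult)
    thus "(\<integral>\<^sup>+\<zeta>. \<integral>\<^sup>+\<eta>. ennreal (cmod (?H \<zeta> \<eta>)) \<partial>lborel \<partial>lborel) < \<infinity>" using fin by simp
  qed measurable
  have "conv A (conv F G) \<xi> = (\<integral>\<zeta>. (\<integral>\<eta>. ?H \<zeta> \<eta> \<partial>lborel) \<partial>lborel)"
    unfolding conv_def by (simp only: integral_mult_right_zero)
  also have "\<dots> = (\<integral>\<eta>. (\<integral>\<zeta>. ?H \<zeta> \<eta> \<partial>lborel) \<partial>lborel)"
    by (rule lborel_pair.Fubini_integral[OF i, symmetric])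
  also have "\<dots> = (\<integral>\<eta>. conv A F (\<xi> - \<eta>) * G \<eta> \<partial>lborel)"
  proof (intro Bochner_Integration.integral_cong refl)
    fix \<eta>
    have m: "(\<lambda>\<zeta>. A (\<xi> - \<zeta>) * F (\<zeta> - \<eta>)) \<in> borel_measurable borel" by measurable
    have "(\<integral>\<zeta>. ?H \<zeta> \<eta> \<partial>lborel) = (\<integral>\<zeta>. A (\<xi> - \<zeta>) * F (\<zeta> - \<eta>) \<partial>lborel) * G \<eta>"
      by (simp only: mult.assoc[symmetric] integral_mult_left_zero)
    also have "(\<integral>\<zeta>. A (\<xi> - \<zeta>) * F (\<zeta> - \<eta>) \<partial>lborel) = conv A F (\<xi> - \<eta>)"
      using lborel_integral_affine[OF m, of 1 \<eta>] by (simp add: conv_def diff_diff_eq)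
    finally show "(\<integral>\<zeta>. ?H \<zeta> \<eta> \<partial>lborel) = conv A F (\<xi> - \<eta>) * G \<eta>" .
  qed
  finally show ?thesis by (simp only: conv_def[of "conv A F"])
qed

text \<open>Peetre at the smaller exponent. As \<open>\<alpha> + \<beta> \<ge> 0\<close>, its
  absolute value is at most the larger exponent, so the extra weight is absorbed by the other
  factor.\<close>

lemma min_kernel:
  fixes \<xi> \<zeta> :: "'a::euclidean_space"
  assumes "\<alpha> + \<beta> \<ge> 0"
  shows "jb (min \<alpha> \<beta>) \<xi> \<le> 2 powr (\<bar>\<alpha>\<bar> + \<bar>\<beta>\<bar>) * (jb \<alpha> (\<xi> - \<zeta>) * jb \<beta> \<zeta>)"
proof (cases "\<alpha> \<le> \<beta>")
  case True
  have "jb \<alpha> \<xi> \<le> 2 powr \<bar>\<alpha>\<bar> * jb \<bar>\<alpha>\<bar> (\<xi> - (\<xi> - \<zeta>)) * jb \<alpha> (\<xi> - \<zeta>)" by (rule peetre)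
  also have "\<dots> \<le> 2 powr (\<bar>\<alpha>\<bar> + \<bar>\<beta>\<bar>) * jb \<beta> \<zeta> * jb \<alpha> (\<xi> - \<zeta>)"
  proof (intro mult_right_mono mult_mono powr_mono)
    show "jb \<bar>\<alpha>\<bar> (\<xi> - (\<xi> - \<zeta>)) \<le> jb \<beta> \<zeta>" using True assms jb_mono[of "\<bar>\<alpha>\<bar>" \<beta> \<zeta>] by simp
  qed (auto simp: jb_nonneg)
  finally show ?thesis using True by (simp add: min_def mult_ac)
next
  case False
  have "jb \<beta> \<xi> \<le> 2 powr \<bar>\<beta>\<bar> * jb \<bar>\<beta>\<bar> (\<xi> - \<zeta>) * jb \<beta> \<zeta>" by (rule peetre)
  also have "\<dots> \<le> 2 powr (\<bar>\<alpha>\<bar> + \<bar>\<beta>\<bar>) * jb \<alpha> (\<xi> - \<zeta>) * jb \<beta> \<zeta>"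
    by (intro mult_right_mono mult_mono powr_mono jb_mono) (use False assms in \<open>auto simp: jb_nonneg\<close>)
  finally show ?thesis using False by (simp add: min_def mult_ac)
qed

lemma young_min:
  fixes F G :: "'a::euclidean_space \<Rightarrow> complex"
  assumes pqr: "1 \<le> p" "1 \<le> q" "1 \<le> r" "1 / p + 1 / q = 1 / r + 1" and s: "\<alpha> + \<beta> \<ge> 0"
    and m: "F \<in> borel_measurable borel" "G \<in> borel_measurable borel"
    and F: "in_Lp p (\<lambda>\<xi>. weight \<alpha> \<xi> * F \<xi>)" and G: "in_Lp q (\<lambda>\<xi>. weight \<beta> \<xi> * G \<xi>)"
  shows "AE \<xi> in lborel. abs_conv F G \<xi> < \<infinity>"
    and "in_Lp r (\<lambda>\<xi>. weight (min \<alpha> \<beta>) \<xi> * of_real (enn2real (abs_conv F G \<xi>)))"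
    and "in_Lp r (\<lambda>\<xi>. weight (min \<alpha> \<beta>) \<xi> * conv F G \<xi>)"
proof -
  have le: "cmod (weight (min \<alpha> \<beta>) \<xi>) * (cmod (F (\<xi> - \<zeta>)) * cmod (G \<zeta>)) \<le>
     2 powr (\<bar>\<alpha>\<bar> + \<bar>\<beta>\<bar>) * (cmod (weight \<alpha> (\<xi> - \<zeta>) * F (\<xi> - \<zeta>)) * cmod (weight \<beta> \<zeta> * G \<zeta>))" for \<xi> \<zeta>
    using mult_right_mono[OF min_kernel[OF s, of \<xi> \<zeta>], of "cmod (F (\<xi> - \<zeta>)) * cmod (G \<zeta>)"]
    by (simp add: norm_mult cmod_weight mult_ac)
  note * = weighted_young[OF pqr F G m weight_measurable powr_ge_zero le]
  show "AE \<xi> in lborel. abs_conv F G \<xi> < \<infinity>" using *(1) weight_nonzero by (auto elim: eventually_mono)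
  show "in_Lp r (\<lambda>\<xi>. weight (min \<alpha> \<beta>) \<xi> * of_real (enn2real (abs_conv F G \<xi>)))" by (rule *(2))
  show "in_Lp r (\<lambda>\<xi>. weight (min \<alpha> \<beta>) \<xi> * conv F G \<xi>)" by (rule *(3))
qed

lemma is_product_conv:
  fixes f g h :: "('a::euclidean_space \<Rightarrow> complex) \<Rightarrow> complex"
  shows "is_product f g h \<longleftrightarrow> distribution h \<and>
     (\<exists>F G. has_fourier_fun f F \<and> has_fourier_fun g G \<and>
        (AE \<xi> in lborel. integrable lborel (\<lambda>\<zeta>. F (\<xi> - \<zeta>) * G \<zeta>)) \<and>
        has_fourier_fun h (\<lambda>\<xi>. cft TYPE('a) * conv F G \<xi>))"
  unfolding is_product_def conv_def ..

lemma product_exists: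
  fixes F G :: "'a::euclidean_space \<Rightarrow> complex"
  assumes pqr: "1 \<le> p" "1 \<le> q" "1 \<le> r" "1 / p + 1 / q = 1 / r + 1" and s: "\<alpha> + \<beta> \<ge> 0"
    and f: "has_fourier_fun f F" "in_Lp p (\<lambda>\<xi>. weight \<alpha> \<xi> * F \<xi>)"
    and g: "has_fourier_fun g G" "in_Lp q (\<lambda>\<xi>. weight \<beta> \<xi> * G \<xi>)"
  obtains h where "is_product f g h" "in_H (min \<alpha> \<beta>) r h"
proof -
  let ?K = "\<lambda>\<xi>. cft TYPE('a) * conv F G \<xi>"
  have m [measurable]: "F \<in> borel_measurable borel" "G \<in> borel_measurable borel"
    using f(1) g(1) by (auto intro: has_fourier_fun_measurable)
  note * = young_min[OF pqr s m f(2) g(2)]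
  have L: "in_Lp r (\<lambda>\<xi>. weight (min \<alpha> \<beta>) \<xi> * ?K \<xi>)"
    using in_Lp_cmult[OF pqr(3) *(3), of "cft TYPE('a)"] by (simp add: mult.left_commute)
  have mK: "?K \<in> borel_measurable borel" by measurable
  obtain h where h: "tempered_distribution h" "has_fourier_fun h ?K"
    using H_exists[OF pqr(3) mK L] by blast
  have "AE \<xi> in lborel. integrable lborel (\<lambda>\<zeta>. F (\<xi> - \<zeta>) * G \<zeta>)"
    using *(1) by eventually_elim (rule abs_conv_integrable[OF m])
  hence "is_product f g h"
    unfolding is_product_conv using tempered_imp_distribution[OF h(1)] f(1) g(1) h(2) by blast
  moreover have "in_H (min \<alpha> \<beta>) r h" unfolding in_H_def using h(2) L by blast
  ultimately show ?thesis by (rule that)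
qed

text \<open>The representatives in \<open>is_product\<close> are existential; as transforms are
  unique up to null sets and convolutions do not see null sets, any other choice gives the same
  function.\<close>

lemma product_fourier:
  fixes F G :: "'a::euclidean_space \<Rightarrow> complex"
  assumes "is_product f g k" "has_fourier_fun f F" "has_fourier_fun g G"
  shows "has_fourier_fun k (\<lambda>\<xi>. cft TYPE('a) * conv F G \<xi>)"
proof -
  obtain F' G' where FG: "has_fourier_fun f F'" "has_fourier_fun g G'"
    "has_fourier_fun k (\<lambda>\<xi>. cft TYPE('a) * conv F' G' \<xi>)"
    using assms(1) unfolding is_product_conv by blast
  have "conv F' G' = conv F G"
    by (rule conv_cong_AE(1)[OF has_fourier_fun_measurable[OF FG(1)] has_fourier_fun_measurable[OF assms(2)]
          has_fourier_fun_measurable[OF FG(2)] has_fourier_fun_measurable[OF assms(3)]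
          has_fourier_fun_unique[OF FG(1) assms(2)] has_fourier_fun_unique[OF FG(2) assms(3)]])
  thus ?thesis using FG(3) by simp
qed

lemma product_unique:
  assumes "is_product f g h" "is_product f g h'" shows "distr_eq h' h"
proof -
  obtain F G where FG: "has_fourier_fun f F" "has_fourier_fun g G"
    using assms(1) unfolding is_product_def by blast
  show ?thesis
    by (rule has_fourier_fun_distr_eq[OF product_fourier[OF assms(2) FG] product_fourier[OF assms(1) FG]]) simp
qed

text \<open>Multiplying the product by \<open>\<eta>\<close> convolves its transform with
  \<open>fourier \<eta>\<close>; by associativity this convolution can be applied to
  \<open>F\<close> alone.\<close>

lemma product_mult_left:
  fixes F G \<eta> :: "'a::euclidean_space \<Rightarrow> complex"
  assumes pqr: "1 \<le> p" "1 \<le> q" "1 \<le> r" "1 / p + 1 / q = 1 / r + 1" and s: "\<alpha> + \<beta> \<ge> 0"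
    and m: "F \<in> borel_measurable borel" "G \<in> borel_measurable borel"
    and F: "in_Lp p (\<lambda>\<xi>. weight \<alpha> \<xi> * F \<xi>)" and G: "in_Lp q (\<lambda>\<xi>. weight \<beta> \<xi> * G \<xi>)"
    and k: "has_fourier_fun k (\<lambda>\<xi>. cft TYPE('a) * conv F G \<xi>)" and \<eta>: "test_fun \<eta>"
  shows "has_fourier_fun (mult_distr \<eta> k) (\<lambda>\<xi>. cft TYPE('a) * conv (\<lambda>\<xi>. cft TYPE('a) * conv (fourier \<eta>) F \<xi>) G \<xi>)"
proof -
  let ?c = "cft TYPE('a)"
  have s\<eta>: "schwartz_fun (fourier \<eta>)" by (rule schwartz_fourier[OF test_schwartz[OF \<eta>]])
  note [measurable] = m schwartz_measurable[OF s\<eta>]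
  note * = young_min[OF pqr s m F G]
  have L: "in_Lp r (\<lambda>\<xi>. weight (min \<alpha> \<beta>) \<xi> * (?c * conv F G \<xi>))"
    using in_Lp_cmult[OF pqr(3) *(3), of ?c] by (simp add: mult.left_commute)
  \<comment> \<open>The convolution of the moduli lies in a weighted space itself, so its
    convolution with \<open>fourier \<eta>\<close> is finite almost everywhere, which is the
    hypothesis of \<open>conv_assoc\<close>.\<close>
  let ?E = "\<lambda>\<xi>. complex_of_real (enn2real (abs_conv F G \<xi>))"
  have mE: "?E \<in> borel_measurable borel" by measurable
  have "AE \<xi> in lborel. ?c * conv (fourier \<eta>) (\<lambda>\<xi>. ?c * conv F G \<xi>) \<xi> =
      ?c * conv (\<lambda>\<xi>. ?c * conv (fourier \<eta>) F \<xi>) G \<xi>"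
    using H_conv_schwartz(1)[OF pqr(3) mE *(2) s\<eta>]
  proof eventually_elim
    case (elim \<xi>)
    have "(\<integral>\<^sup>+\<zeta>. ennreal (cmod (fourier \<eta> (\<xi> - \<zeta>))) * abs_conv F G \<zeta> \<partial>lborel) = abs_conv (fourier \<eta>) ?E \<xi>"
      unfolding abs_conv_def[of "fourier \<eta>"]
      by (intro nn_integral_cong_AE, use *(1) in eventually_elim) (simp add: ennreal_mult)
    hence "conv (fourier \<eta>) (conv F G) \<xi> = conv (conv (fourier \<eta>) F) G \<xi>"
      using elim by (intro conv_assoc m schwartz_measurable s\<eta>) simp
    thus ?case by (simp only: conv_cmult_left conv_cmult_right)
  qed
  thus ?thesis
    by (rule has_fourier_fun_cong[OF has_fourier_fun_mult(1)[OF k pqr(3) L \<eta>]]) measurable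
qed

text \<open>Each factor receives its cutoff by \<open>product_mult_left\<close>, the second one
  after commuting the convolution and exchanging \<open>p\<close> with \<open>q\<close>. Allowing
  any representatives \<open>A\<close> and \<open>B\<close> makes room for those with pointwise
  decay.\<close>

lemma product_mult:
  fixes A B \<eta>\<^sub>1 \<eta>\<^sub>2 :: "'a::euclidean_space \<Rightarrow> complex"
  assumes pqr: "1 \<le> p" "1 \<le> q" "1 \<le> r" "1 / p + 1 / q = 1 / r + 1" and s: "\<alpha> + \<beta> \<ge> 0"
    and f: "in_H \<alpha> p f" and g: "in_H \<beta> q g" and k: "is_product f g k"
    and \<eta>: "test_fun \<eta>\<^sub>1" "test_fun \<eta>\<^sub>2"
    and A: "has_fourier_fun (mult_distr \<eta>\<^sub>1 f) A" and B: "has_fourier_fun (mult_distr \<eta>\<^sub>2 g) B"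
  shows "has_fourier_fun (mult_distr (\<lambda>x. \<eta>\<^sub>1 x * \<eta>\<^sub>2 x) k) (\<lambda>\<xi>. cft TYPE('a) * conv A B \<xi>)"
proof -
  let ?c = "cft TYPE('a)"
  obtain F G where F: "has_fourier_fun f F" "in_Lp p (\<lambda>\<xi>. weight \<alpha> \<xi> * F \<xi>)"
    and G: "has_fourier_fun g G" "in_Lp q (\<lambda>\<xi>. weight \<beta> \<xi> * G \<xi>)"
    using f g unfolding in_H_def by blast
  define A' where "A' \<xi> = ?c * conv (fourier \<eta>\<^sub>1) F \<xi>" for \<xi>
  define B' where "B' \<xi> = ?c * conv (fourier \<eta>\<^sub>2) G \<xi>" for \<xi>
  have A': "has_fourier_fun (mult_distr \<eta>\<^sub>1 f) A'" "in_Lp p (\<lambda>\<xi>. weight \<alpha> \<xi> * A' \<xi>)"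
    unfolding A'_def by (rule has_fourier_fun_mult[OF F(1) pqr(1) F(2) \<eta>(1)])+
  have B': "has_fourier_fun (mult_distr \<eta>\<^sub>2 g) B'"
    unfolding B'_def by (rule has_fourier_fun_mult[OF G(1) pqr(2) G(2) \<eta>(2)])
  note m = has_fourier_fun_measurable[OF F(1)] has_fourier_fun_measurable[OF G(1)]
    has_fourier_fun_measurable[OF A'(1)] has_fourier_fun_measurable[OF B'(1)]
    has_fourier_fun_measurable[OF A] has_fourier_fun_measurable[OF B]
  have "has_fourier_fun (mult_distr \<eta>\<^sub>1 k) (\<lambda>\<xi>. ?c * conv A' G \<xi>)"
    using product_mult_left[OF pqr s m(1,2) F(2) G(2) product_fourier[OF k F(1) G(1)] \<eta>(1)]
    unfolding A'_def .
  hence 1: "has_fourier_fun (mult_distr \<eta>\<^sub>1 k) (\<lambda>\<xi>. ?c * conv G A' \<xi>)"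
    unfolding conv_commute[OF m(3,2)] .
  have qpr: "1 / q + 1 / p = 1 / r + 1" and s': "\<beta> + \<alpha> \<ge> 0" using pqr(4) s by (simp_all add: add.commute)
  have "has_fourier_fun (mult_distr \<eta>\<^sub>2 (mult_distr \<eta>\<^sub>1 k)) (\<lambda>\<xi>. ?c * conv B' A' \<xi>)"
    using product_mult_left[OF pqr(2,1,3) qpr s' m(2,3) G(2) A'(2) 1 \<eta>(2)] unfolding B'_def .
  moreover have "mult_distr \<eta>\<^sub>2 (mult_distr \<eta>\<^sub>1 k) = mult_distr (\<lambda>x. \<eta>\<^sub>1 x * \<eta>\<^sub>2 x) k"
    by (simp add: mult_distr_def mult.assoc)
  moreover have "conv B' A' = conv A B"
    unfolding conv_commute[OF m(4,3)]
    by (rule conv_cong_AE(1)[OF m(3,5,4,6) has_fourier_fun_unique[OF A'(1) A] has_fourier_fun_unique[OF B'(1) B]])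
  ultimately show ?thesis by simp
qed

section \<open>Localization\<close>

lemma mult_distr_cutoff:
  assumes "\<And>x. \<kappa> x \<noteq> 0 \<Longrightarrow> \<theta> x = 1" shows "mult_distr \<kappa> (mult_distr \<theta> f) = mult_distr \<kappa> f"
proof -
  have "\<theta> x * (\<kappa> x * \<phi> x) = \<kappa> x * \<phi> x" for x and \<phi> :: "'a \<Rightarrow> complex" using assms[of x] by (cases "\<kappa> x = 0") auto
  thus ?thesis unfolding mult_distr_def by (simp only:)
qed

lemma nonzero_in_supp: "\<phi> x \<noteq> 0 \<Longrightarrow> x \<in> supp \<phi>"
  using outside_supp by blast

text \<open>Near \<open>x\<^sub>0\<close> the given cutoff \<open>\<eta>\<close> has no zeros, so
  \<open>\<kappa>\<close> is \<open>\<eta>\<close> times the test function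
  \<open>\<kappa> / \<eta>\<close>, and multiplication by test functions preserves the space. Hence
  one good cutoff makes every sufficiently concentrated one good.\<close>

lemma locally_in_H_cutoff:
  fixes x\<^sub>0 :: "'a::euclidean_space"
  assumes "locally_in_H \<alpha> p x\<^sub>0 g" "1 \<le> p"
  obtains e where "e > 0" "\<And>\<kappa>. test_fun \<kappa> \<Longrightarrow> supp \<kappa> \<subseteq> ball x\<^sub>0 e \<Longrightarrow> in_H \<alpha> p (mult_distr \<kappa> g)"
proof -
  obtain \<eta> where \<eta>: "test_fun \<eta>" "\<eta> x\<^sub>0 \<noteq> 0" "in_H \<alpha> p (mult_distr \<eta> g)"
    using assms(1) unfolding locally_in_H_def by blast
  let ?U = "{x. \<eta> x \<noteq> 0}"
  have cont: "continuous_on UNIV \<eta>" by (rule smooth_continuous[OF test_smooth[OF \<eta>(1)]])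
  have U: "open ?U" by (intro open_Collect_neq cont continuous_on_const)
  then obtain e where e: "e > 0" "ball x\<^sub>0 e \<subseteq> ?U" using \<eta>(2) open_contains_ball by blast
  show ?thesis
  proof (rule that[OF e(1)])
    fix \<kappa> assume \<kappa>: "test_fun \<kappa>" "supp \<kappa> \<subseteq> ball x\<^sub>0 e"
    let ?\<psi> = "\<lambda>x. \<kappa> x * inverse (\<eta> x)"
    have cs: "compact (supp \<kappa>)" using \<kappa>(1) by (simp add: test_fun_def)
    \<comment> \<open>Two open sets cover the space: on the first \<open>\<eta>\<close> is
      invertible, and on the complement of \<open>supp \<kappa>\<close> the quotient is 0. The zeros
      of \<open>\<eta>\<close> lie in the second.\<close>
    have "smooth_fun_on UNIV ?\<psi>"
    proof (rule smooth_local)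
      fix x
      show "\<exists>V. open V \<and> x \<in> V \<and> smooth_fun_on V ?\<psi>"
      proof (cases "x \<in> supp \<kappa>")
        case True
        have "smooth_fun_on ?U ?\<psi>"
          by (rule smooth_mult[OF U smooth_subset[OF test_smooth[OF \<kappa>(1)] subset_UNIV]
                smooth_inverse[OF U smooth_subset[OF test_smooth[OF \<eta>(1)] subset_UNIV]]]) simp
        thus ?thesis using U True \<kappa>(2) e(2) by blast
      next
        case False
        have o: "open (- supp \<kappa>)" using compact_imp_closed[OF cs] by (simp add: open_closed)
        have "smooth_fun_on (- supp \<kappa>) ?\<psi>"
          by (rule smooth_cong_open[OF o _ smooth_const[OF o, of 0]]) (simp add: outside_supp)
        thus ?thesis using o False by blast
      qed
    qed
    moreover have "compact (supp ?\<psi>)"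
      by (rule supp_compactI(2)[OF cs]) (simp add: outside_supp)
    ultimately have "test_fun ?\<psi>" by (simp add: test_fun_def)
    hence "in_H \<alpha> p (mult_distr ?\<psi> (mult_distr \<eta> g))" by (rule in_H_mult[OF assms(2) \<eta>(3)])
    moreover have "mult_distr ?\<psi> (mult_distr \<eta> g) = mult_distr \<kappa> g"
    proof -
      have "\<eta> x * (\<kappa> x * inverse (\<eta> x) * \<phi> x) = \<kappa> x * \<phi> x" for x and \<phi> :: "'a \<Rightarrow> complex"
      proof (cases "\<kappa> x = 0")
        case False
        hence "\<eta> x \<noteq> 0" using nonzero_in_supp[of \<kappa> x] \<kappa>(2) e(2) by blast
        thus ?thesis by simp
      qed simp
      thus ?thesis unfolding mult_distr_def by (simp only:)
    qed
    ultimately show "in_H \<alpha> p (mult_distr \<kappa> g)" by simp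
  qed
qed

lemma small_cutoff:
  fixes x\<^sub>0 :: "'a::euclidean_space"
  assumes "e > 0"
  obtains \<kappa> where "cutoff_near x\<^sub>0 \<kappa>" "supp \<kappa> \<subseteq> ball x\<^sub>0 e"
proof -
  have r: "e / 3 > 0" using assms by simp
  obtain \<kappa> where \<kappa>: "test_fun \<kappa>" "\<And>x. x \<in> cball x\<^sub>0 (e / 3) \<Longrightarrow> \<kappa> x = 1"
    "\<And>x. x \<notin> ball x\<^sub>0 (2 * (e / 3)) \<Longrightarrow> \<kappa> x = 0" "supp \<kappa> \<subseteq> cball x\<^sub>0 (2 * (e / 3))" "\<And>x. cmod (\<kappa> x) \<le> 1"
    by (rule exists_cutoff[OF r, of x\<^sub>0], rule that)
  have "\<forall>\<^sub>F x in nhds x\<^sub>0. \<kappa> x = 1"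
    unfolding eventually_nhds_metric
    by (intro exI[of _ "e / 3"]) (use \<kappa>(2) r in \<open>auto simp: dist_commute\<close>)
  moreover have "cball x\<^sub>0 (2 * (e / 3)) \<subseteq> ball x\<^sub>0 e" using assms by auto
  ultimately show ?thesis using that[of \<kappa>] \<kappa>(1,4) by (auto simp: cutoff_near_def)
qed

lemma cutoff_nearD:
  assumes "cutoff_near x\<^sub>0 \<theta>"
  shows "test_fun \<theta>" "\<theta> x\<^sub>0 = 1" "\<exists>e>0. \<forall>x\<in>ball x\<^sub>0 e. \<theta> x = 1"
  using assms unfolding cutoff_near_def eventually_nhds_metric
  by (auto simp: dist_commute)

text \<open>For \<open>\<kappa>\<close> supported where all four cutoffs equal 1, the square of
  \<open>\<kappa>\<close> times either product has the transform determined by the localizations of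
  \<open>f\<close> and \<open>g\<close> by \<open>\<kappa>\<close>; so the products agree where
  \<open>\<kappa>\<close> is 1.\<close>

lemma product_local:
  fixes x\<^sub>0 :: "'a::euclidean_space"
  assumes pqr: "1 \<le> p" "1 \<le> q" "1 \<le> r" "1 / p + 1 / q = 1 / r + 1" and s: "\<alpha> + \<beta> \<ge> 0"
    and c: "cutoff_near x\<^sub>0 \<theta>" "cutoff_near x\<^sub>0 \<psi>" "cutoff_near x\<^sub>0 \<theta>'" "cutoff_near x\<^sub>0 \<psi>'"
    and H: "in_H \<alpha> p (mult_distr \<theta> f)" "in_H \<beta> q (mult_distr \<psi> g)"
      "in_H \<alpha> p (mult_distr \<theta>' f)" "in_H \<beta> q (mult_distr \<psi>' g)"
    and k: "is_product (mult_distr \<theta> f) (mult_distr \<psi> g) k"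
      "is_product (mult_distr \<theta>' f) (mult_distr \<psi>' g) k'"
  shows "distr_eq_near x\<^sub>0 k k'"
proof -
  obtain e1 e2 e3 e4 where e: "e1 > 0" "\<forall>x\<in>ball x\<^sub>0 e1. \<theta> x = 1" "e2 > 0" "\<forall>x\<in>ball x\<^sub>0 e2. \<psi> x = 1"
    "e3 > 0" "\<forall>x\<in>ball x\<^sub>0 e3. \<theta>' x = 1" "e4 > 0" "\<forall>x\<in>ball x\<^sub>0 e4. \<psi>' x = 1"
    using c[THEN cutoff_nearD(3)] by blast
  define d where "d = min (min e1 e2) (min e3 e4)"
  have d: "d > 0" using e by (simp add: d_def)
  obtain \<kappa> where \<kappa>: "cutoff_near x\<^sub>0 \<kappa>" "supp \<kappa> \<subseteq> ball x\<^sub>0 d" using small_cutoff[OF d] by blast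
  have t: "test_fun \<kappa>" by (rule cutoff_nearD(1)[OF \<kappa>(1)])
  have one: "\<theta> x = 1 \<and> \<psi> x = 1 \<and> \<theta>' x = 1 \<and> \<psi>' x = 1" if "\<kappa> x \<noteq> 0" for x
    using nonzero_in_supp[of \<kappa> x, OF that] \<kappa>(2) e by (auto simp: d_def)
  have mf: "mult_distr \<kappa> (mult_distr \<theta> f) = mult_distr \<kappa> f" "mult_distr \<kappa> (mult_distr \<theta>' f) = mult_distr \<kappa> f"
    "mult_distr \<kappa> (mult_distr \<psi> g) = mult_distr \<kappa> g" "mult_distr \<kappa> (mult_distr \<psi>' g) = mult_distr \<kappa> g"
    using one by (auto intro!: mult_distr_cutoff)
  obtain A where A: "has_fourier_fun (mult_distr \<kappa> f) A"
    using in_H_mult[OF pqr(1) H(1) t] unfolding mf in_H_def by blast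
  obtain B where B: "has_fourier_fun (mult_distr \<kappa> g) B"
    using in_H_mult[OF pqr(2) H(2) t] unfolding mf in_H_def by blast
  have "distr_eq (mult_distr (\<lambda>x. \<kappa> x * \<kappa> x) k) (mult_distr (\<lambda>x. \<kappa> x * \<kappa> x) k')"
    by (rule has_fourier_fun_distr_eq[OF product_mult[OF pqr s H(1,2) k(1) t t A[folded mf(1)] B[folded mf(3)]]
          product_mult[OF pqr s H(3,4) k(2) t t A[folded mf(2)] B[folded mf(4)]]]) simp
  hence eq: "k (\<lambda>x. \<kappa> x * \<kappa> x * \<phi> x) = k' (\<lambda>x. \<kappa> x * \<kappa> x * \<phi> x)" if "test_fun \<phi>" for \<phi>
    using that by (simp add: distr_eq_def mult_distr_def)
  obtain e' where e': "e' > 0" "\<forall>x\<in>ball x\<^sub>0 e'. \<kappa> x = 1" using cutoff_nearD(3)[OF \<kappa>(1)] by blast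
  show ?thesis
    unfolding distr_eq_near_def
  proof (intro exI[of _ "ball x\<^sub>0 e'"] conjI allI impI)
    fix \<phi> assume \<phi>: "test_fun \<phi> \<and> supp \<phi> \<subseteq> ball x\<^sub>0 e'"
    have e: "\<kappa> x * \<kappa> x * \<phi> x = \<phi> x" for x
      using nonzero_in_supp[of \<phi> x] \<phi> e'(2) by (cases "\<phi> x = 0") auto
    show "k \<phi> = k' \<phi>" using eq[OF conjunct1[OF \<phi>]] unfolding e .
  qed (use e' in auto)
qed

lemma near_product_exists:
  fixes x\<^sub>0 :: "'a::euclidean_space"
  assumes pqr: "1 \<le> p" "1 \<le> q" "1 \<le> r" "1 / p + 1 / q = 1 / r + 1" and s: "\<alpha> + \<beta> \<ge> 0"
    and f: "locally_in_H \<alpha> p x\<^sub>0 f" and g: "locally_in_H \<beta> q x\<^sub>0 g"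
  shows "\<exists>h. is_product_near \<alpha> p \<beta> q x\<^sub>0 f g h"
proof -
  have ex: "\<exists>k. is_product u v k" if "in_H \<alpha> p u" "in_H \<beta> q v" for u v :: "('a \<Rightarrow> complex) \<Rightarrow> complex"
    using that product_exists[OF pqr s] unfolding in_H_def by metis
  obtain e1 where e1: "e1 > 0" "\<And>\<kappa>. test_fun \<kappa> \<Longrightarrow> supp \<kappa> \<subseteq> ball x\<^sub>0 e1 \<Longrightarrow> in_H \<alpha> p (mult_distr \<kappa> f)"
    using locally_in_H_cutoff[OF f pqr(1)] by blast
  obtain e2 where e2: "e2 > 0" "\<And>\<kappa>. test_fun \<kappa> \<Longrightarrow> supp \<kappa> \<subseteq> ball x\<^sub>0 e2 \<Longrightarrow> in_H \<beta> q (mult_distr \<kappa> g)"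
    using locally_in_H_cutoff[OF g pqr(2)] by blast
  obtain \<theta> where \<theta>: "cutoff_near x\<^sub>0 \<theta>" "supp \<theta> \<subseteq> ball x\<^sub>0 e1" using small_cutoff[OF e1(1)] by blast
  obtain \<psi> where \<psi>: "cutoff_near x\<^sub>0 \<psi>" "supp \<psi> \<subseteq> ball x\<^sub>0 e2" using small_cutoff[OF e2(1)] by blast
  have Hf: "in_H \<alpha> p (mult_distr \<theta> f)" by (rule e1(2)[OF cutoff_nearD(1)[OF \<theta>(1)] \<theta>(2)])
  have Hg: "in_H \<beta> q (mult_distr \<psi> g)" by (rule e2(2)[OF cutoff_nearD(1)[OF \<psi>(1)] \<psi>(2)])
  obtain h where h: "is_product (mult_distr \<theta> f) (mult_distr \<psi> g) h" using ex[OF Hf Hg] by blast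
  have "is_product_near \<alpha> p \<beta> q x\<^sub>0 f g h"
    unfolding is_product_near_def
  proof (intro conjI allI impI)
    show "distribution h" using h by (simp add: is_product_def)
    show "\<exists>\<theta> \<psi>. cutoff_near x\<^sub>0 \<theta> \<and> cutoff_near x\<^sub>0 \<psi> \<and> in_H \<alpha> p (mult_distr \<theta> f) \<and> in_H \<beta> q (mult_distr \<psi> g)"
      using \<theta>(1) \<psi>(1) Hf Hg by blast
    fix \<theta>' \<psi>'
    assume *: "cutoff_near x\<^sub>0 \<theta>' \<and> cutoff_near x\<^sub>0 \<psi>' \<and> in_H \<alpha> p (mult_distr \<theta>' f) \<and> in_H \<beta> q (mult_distr \<psi>' g)"
    then obtain k where k: "is_product (mult_distr \<theta>' f) (mult_distr \<psi>' g) k" using ex by blast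
    have "distr_eq_near x\<^sub>0 h k"
      by (rule product_local[OF pqr s \<theta>(1) \<psi>(1) _ _ Hf Hg _ _ h k]) (use * in blast)+
    thus "\<exists>k. is_product (mult_distr \<theta>' f) (mult_distr \<psi>' g) k \<and> distr_eq_near x\<^sub>0 h k" using k by blast
  qed
  thus ?thesis by blast
qed

text \<open>On a small ball both cutoffs are 1 and \<open>h\<close> equals their product
  \<open>k\<close>, so the transform of a localization of \<open>h\<close> comes from localizations
  of \<open>f\<close> and \<open>g\<close> in which the original cutoffs no longer appear.\<close>

lemma near_product_fourier:
  fixes x\<^sub>0 :: "'a::euclidean_space"
  assumes pqr: "1 \<le> p" "1 \<le> q" "1 \<le> r" "1 / p + 1 / q = 1 / r + 1" and s: "\<alpha> + \<beta> \<ge> 0"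
    and h: "is_product_near \<alpha> p \<beta> q x\<^sub>0 f g h"
  obtains e where "e > 0" "\<And>\<eta>\<^sub>1 \<eta>\<^sub>2 A B. test_fun \<eta>\<^sub>1 \<Longrightarrow> test_fun \<eta>\<^sub>2 \<Longrightarrow> supp \<eta>\<^sub>1 \<subseteq> ball x\<^sub>0 e \<Longrightarrow> supp \<eta>\<^sub>2 \<subseteq> ball x\<^sub>0 e \<Longrightarrow>
    has_fourier_fun (mult_distr \<eta>\<^sub>1 f) A \<Longrightarrow> has_fourier_fun (mult_distr \<eta>\<^sub>2 g) B \<Longrightarrow>
    has_fourier_fun (mult_distr (\<lambda>x. \<eta>\<^sub>1 x * \<eta>\<^sub>2 x) h) (\<lambda>\<xi>. cft TYPE('a) * conv A B \<xi>)"
proof -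
  obtain \<theta> \<psi> where c: "cutoff_near x\<^sub>0 \<theta>" "cutoff_near x\<^sub>0 \<psi>"
    and H: "in_H \<alpha> p (mult_distr \<theta> f)" "in_H \<beta> q (mult_distr \<psi> g)"
    using h unfolding is_product_near_def by blast
  then obtain k where k: "is_product (mult_distr \<theta> f) (mult_distr \<psi> g) k" "distr_eq_near x\<^sub>0 h k"
    using h unfolding is_product_near_def by blast
  obtain U where U: "open U" "x\<^sub>0 \<in> U" "\<And>\<phi>. test_fun \<phi> \<Longrightarrow> supp \<phi> \<subseteq> U \<Longrightarrow> h \<phi> = k \<phi>"
    using k(2) unfolding distr_eq_near_def by blast
  obtain e0 where e0: "e0 > 0" "ball x\<^sub>0 e0 \<subseteq> U" using U(1,2) open_contains_ball by blast
  obtain e1 e2 where e: "e1 > 0" "\<forall>x\<in>ball x\<^sub>0 e1. \<theta> x = 1" "e2 > 0" "\<forall>x\<in>ball x\<^sub>0 e2. \<psi> x = 1"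
    using c[THEN cutoff_nearD(3)] by blast
  define d where "d = min e0 (min e1 e2)"
  have dU: "ball x\<^sub>0 d \<subseteq> U" using e0(2) subset_ball[of d e0 x\<^sub>0] by (simp add: d_def)
  show ?thesis
  proof (rule that[of d])
    show "d > 0" using e0 e by (simp add: d_def)
    fix \<eta>\<^sub>1 \<eta>\<^sub>2 A B
    assume \<eta>: "test_fun \<eta>\<^sub>1" "test_fun \<eta>\<^sub>2" "supp \<eta>\<^sub>1 \<subseteq> ball x\<^sub>0 d" "supp \<eta>\<^sub>2 \<subseteq> ball x\<^sub>0 d"
      and A: "has_fourier_fun (mult_distr \<eta>\<^sub>1 f) A" and B: "has_fourier_fun (mult_distr \<eta>\<^sub>2 g) B"
    have "mult_distr \<eta>\<^sub>1 (mult_distr \<theta> f) = mult_distr \<eta>\<^sub>1 f"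
      by (rule mult_distr_cutoff) (use nonzero_in_supp[of \<eta>\<^sub>1] \<eta>(3) e in \<open>force simp: d_def\<close>)
    moreover have "mult_distr \<eta>\<^sub>2 (mult_distr \<psi> g) = mult_distr \<eta>\<^sub>2 g"
      by (rule mult_distr_cutoff) (use nonzero_in_supp[of \<eta>\<^sub>2] \<eta>(4) e in \<open>force simp: d_def\<close>)
    ultimately have "has_fourier_fun (mult_distr (\<lambda>x. \<eta>\<^sub>1 x * \<eta>\<^sub>2 x) k) (\<lambda>\<xi>. cft TYPE('a) * conv A B \<xi>)"
      using A B by (intro product_mult[OF pqr s H k(1) \<eta>(1,2)]) simp_all
    thus "has_fourier_fun (mult_distr (\<lambda>x. \<eta>\<^sub>1 x * \<eta>\<^sub>2 x) h) (\<lambda>\<xi>. cft TYPE('a) * conv A B \<xi>)"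
    proof (rule has_fourier_fun_transfer)
      fix \<phi> :: "'a \<Rightarrow> complex" assume \<phi>: "test_fun \<phi>"
      have e: "(\<lambda>x. \<eta>\<^sub>1 x * \<eta>\<^sub>2 x * \<phi> x) = (\<lambda>x. \<eta>\<^sub>1 x * (\<eta>\<^sub>2 x * \<phi> x))" by (simp add: mult.assoc)
      have sm: "smooth_fun_on UNIV (\<lambda>x. \<eta>\<^sub>2 x * \<phi> x)"
        by (rule test_smooth[OF test_mult(1)[OF \<eta>(2) test_smooth[OF \<phi>]]])
      have "supp (\<lambda>x. \<eta>\<^sub>1 x * (\<eta>\<^sub>2 x * \<phi> x)) \<subseteq> U"
        using test_mult(2)[OF \<eta>(1) sm] \<eta>(3) dU by blast
      thus "mult_distr (\<lambda>x. \<eta>\<^sub>1 x * \<eta>\<^sub>2 x) h \<phi> = mult_distr (\<lambda>x. \<eta>\<^sub>1 x * \<eta>\<^sub>2 x) k \<phi>"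
        unfolding mult_distr_def e using U(3)[OF test_mult(1)[OF \<eta>(1) sm]] by blast
    qed
  qed
qed

section \<open>Cones\<close>

text \<open>For a unit vector \<open>e\<close> and \<open>0 \<le> c < 1\<close> this is the open
  circular cone about \<open>e\<close> whose half-angle has cosine \<open>c\<close>. Increasing
  \<open>c\<close> narrows it, and the origin never belongs to it.\<close>

definition cone_around :: "real \<Rightarrow> 'a::euclidean_space \<Rightarrow> 'a set" where
  "cone_around c e = {\<xi>. c * norm \<xi> < \<xi> \<bullet> e}"

lemma open_cone_around: "open (cone_around c e)"
  unfolding cone_around_def by (intro open_Collect_less continuous_intros)

lemma cone_around_antimono: "c \<le> c' \<Longrightarrow> cone_around c' e \<subseteq> cone_around c e"
  unfolding cone_around_def using mult_right_mono[of c c' "norm _"] by (fastforce intro: le_less_trans)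

text \<open>Subtracting the two cone conditions gives \<open>c' * norm \<xi> - c * norm \<zeta>
  \<le> norm (\<xi> - \<zeta>)\<close>; eliminating \<open>norm \<zeta>\<close> by the triangle
  inequality leaves the positive multiple \<open>c' - c\<close> of
  \<open>norm \<xi>\<close>.\<close>

lemma cone_separation:
  fixes e :: "'a::euclidean_space"
  assumes "norm e = 1" "0 \<le> c" "c < c'" "c \<le> 1"
  obtains L where "L \<ge> 1" "\<And>\<xi> \<zeta>. \<xi> \<in> cone_around c' e \<Longrightarrow> \<zeta> \<notin> cone_around c e \<Longrightarrow>
    norm \<xi> \<le> L * norm (\<xi> - \<zeta>) \<and> norm \<zeta> \<le> L * norm (\<xi> - \<zeta>)"
\<comment> \<open>\<open>2 / (c' - c)\<close> bounds \<open>norm \<xi>\<close>, and the summand 1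
  pays for the triangle inequality that bounds \<open>norm \<zeta>\<close>.\<close>
proof (rule that[of "1 + 2 / (c' - c)"])
  show "1 \<le> 1 + 2 / (c' - c)" using assms by simp
  fix \<xi> \<zeta> :: 'a assume *: "\<xi> \<in> cone_around c' e" "\<zeta> \<notin> cone_around c e"
  let ?n = "norm (\<xi> - \<zeta>)"
  have "c' * norm \<xi> - c * norm \<zeta> \<le> \<xi> \<bullet> e - \<zeta> \<bullet> e" using * by (auto simp: cone_around_def)
  also have "\<dots> = (\<xi> - \<zeta>) \<bullet> e" by (simp add: inner_diff_left)
  also have "\<dots> \<le> ?n" using norm_cauchy_schwarz[of "\<xi> - \<zeta>" e] assms(1) by simp
  finally have 1: "c' * norm \<xi> - c * norm \<zeta> \<le> ?n" .
  have tri: "norm \<zeta> \<le> norm \<xi> + ?n" using norm_triangle_ineq4[of \<xi> "\<xi> - \<zeta>"] by simp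
  hence "c * norm \<zeta> \<le> c * (norm \<xi> + ?n)" using assms by (intro mult_left_mono)
  moreover have "c * ?n \<le> 1 * ?n" using assms by (intro mult_right_mono) auto
  ultimately have "(c' - c) * norm \<xi> \<le> 2 * ?n" using 1 by (simp add: algebra_simps)
  hence 2: "norm \<xi> \<le> 2 / (c' - c) * ?n" using assms by (simp add: field_simps)
  show "norm \<xi> \<le> (1 + 2 / (c' - c)) * ?n \<and> norm \<zeta> \<le> (1 + 2 / (c' - c)) * ?n"
    using 2 tri norm_ge_zero[of "\<xi> - \<zeta>"] unfolding distrib_right by linarith
qed

lemma open_conic_contains:
  fixes \<xi>\<^sub>0 :: "'a::euclidean_space"
  assumes "open \<Gamma>" "\<xi>\<^sub>0 \<in> \<Gamma>" "\<xi>\<^sub>0 \<noteq> 0" "\<And>\<zeta> t. \<zeta> \<in> \<Gamma> \<Longrightarrow> t > 0 \<Longrightarrow> t *\<^sub>R \<zeta> \<in> \<Gamma>"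
  obtains c where "0 \<le> c" "c < 1" "cone_around c (sgn \<xi>\<^sub>0) \<subseteq> \<Gamma>"
proof -
  let ?e = "sgn \<xi>\<^sub>0"
  have e1: "norm ?e = 1" using assms(3) by (simp add: norm_sgn)
  have "?e \<in> \<Gamma>" unfolding sgn_div_norm using assms by (intro assms(4)) auto
  then obtain d where d: "d > 0" "ball ?e d \<subseteq> \<Gamma>" using assms(1) open_contains_ball by blast
  \<comment> \<open>For unit vectors, \<open>norm (v - e) < d\<close> means
    \<open>v \<bullet> e > 1 - d\<^sup>2 / 2\<close>; the maximum keeps \<open>c\<close>
    nonnegative.\<close>
  define c where "c = max 0 (1 - d\<^sup>2 / 2)"
  show ?thesis
  proof (rule that[of c])
    show "0 \<le> c" "c < 1" using d by (auto simp: c_def)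
    show "cone_around c ?e \<subseteq> \<Gamma>"
    proof
      fix \<xi> assume \<xi>: "\<xi> \<in> cone_around c ?e"
      hence n: "norm \<xi> > 0" by (auto simp: cone_around_def)
      let ?v = "inverse (norm \<xi>) *\<^sub>R \<xi>"
      have v1: "norm ?v = 1" using n by simp
      have "c < ?v \<bullet> ?e" using \<xi> n by (simp add: cone_around_def field_simps)
      hence "1 - d\<^sup>2 / 2 < ?v \<bullet> ?e" by (simp add: c_def)
      moreover have "(norm (?v - ?e))\<^sup>2 = (norm ?v)\<^sup>2 + (norm ?e)\<^sup>2 - 2 * (?v \<bullet> ?e)"
        by (simp only: power2_norm_eq_inner inner_diff_left inner_diff_right inner_commute)
      ultimately have "(norm (?v - ?e))\<^sup>2 < d\<^sup>2" unfolding v1 e1 by simp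
      hence "norm (?v - ?e) < d" using d(1) by (simp add: power_less_imp_less_base)
      hence "?v \<in> \<Gamma>" using d(2) by (auto simp: dist_norm norm_minus_commute)
      from assms(4)[OF this n] show "\<xi> \<in> \<Gamma>" using n by simp
    qed
  qed
qed

lemma jb_scale:
  assumes "norm \<xi> \<le> L * norm \<eta>" "L \<ge> 1" "s \<ge> 0" shows "jb s \<xi> \<le> L powr s * jb s \<eta>"
proof -
  have "(norm \<xi>)\<^sup>2 \<le> (L * norm \<eta>)\<^sup>2" using assms by (intro power_mono) auto
  moreover have "1 \<le> L\<^sup>2" using assms by (simp add: one_le_power)
  ultimately have "1 + (norm \<xi>)\<^sup>2 \<le> L\<^sup>2 * (1 + (norm \<eta>)\<^sup>2)" by (simp add: power_mult_distrib distrib_left)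
  hence "jb s \<xi> \<le> (L\<^sup>2 * (1 + (norm \<eta>)\<^sup>2)) powr (s / 2)" unfolding jb_def using assms by (intro powr_mono2) auto
  also have "\<dots> = (L\<^sup>2) powr (s / 2) * jb s \<eta>" unfolding jb_def by (rule powr_mult)
  also have "(L\<^sup>2) powr (s / 2) = L powr s"
  proof -
    have "L\<^sup>2 = L powr 2" using assms by (simp add: powr_numeral)
    hence "(L\<^sup>2) powr (s / 2) = L powr (2 * (s / 2))" by (simp only: powr_powr)
    thus ?thesis by simp
  qed
  finally show ?thesis .
qed

text \<open>\<open>jb \<beta> \<zeta>\<close> is at least
  \<open>jb (- \<bar>\<beta>\<bar>) \<zeta>\<close>, and the loss is recovered from a weight at
  \<open>\<eta>\<close>, which dominates \<open>\<zeta>\<close>. It serves to insert a weight of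
  either sign when the other factor has decay to spare.\<close>

lemma one_le_jb:
  assumes "norm \<zeta> \<le> L * norm \<eta>" "L \<ge> 1" shows "1 \<le> L powr \<bar>\<beta>\<bar> * jb \<bar>\<beta>\<bar> \<eta> * jb \<beta> \<zeta>"
proof -
  have "1 = jb \<bar>\<beta>\<bar> \<zeta> * jb (- \<bar>\<beta>\<bar>) \<zeta>" by (simp add: jb_minus)
  also have "\<dots> \<le> L powr \<bar>\<beta>\<bar> * jb \<bar>\<beta>\<bar> \<eta> * jb \<beta> \<zeta>"
    by (intro mult_mono jb_scale jb_mono assms mult_nonneg_nonneg jb_nonneg) (use assms in auto)
  finally show ?thesis .
qed

lemma jb_compare:
  assumes "norm \<zeta> \<le> L * norm \<eta>" "norm \<eta> \<le> L * norm \<zeta>" "L \<ge> 1"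
  shows "jb \<alpha> \<zeta> \<le> L powr \<bar>\<alpha>\<bar> * jb \<alpha> \<eta>"
proof (cases "\<alpha> \<ge> 0")
  case True
  thus ?thesis using jb_scale[OF assms(1,3) True] by simp
next
  case False
  hence "jb (- \<alpha>) \<eta> \<le> L powr \<bar>\<alpha>\<bar> * jb (- \<alpha>) \<zeta>" using jb_scale[OF assms(2,3), of "- \<alpha>"] by simp
  hence "jb (- \<alpha>) \<eta> * (jb \<alpha> \<zeta> * jb \<alpha> \<eta>) \<le> L powr \<bar>\<alpha>\<bar> * jb (- \<alpha>) \<zeta> * (jb \<alpha> \<zeta> * jb \<alpha> \<eta>)"
    by (intro mult_right_mono mult_nonneg_nonneg jb_nonneg)
  also have "\<dots> = L powr \<bar>\<alpha>\<bar> * jb \<alpha> \<eta> * (jb \<alpha> \<zeta> * jb (- \<alpha>) \<zeta>)" by (simp add: mult_ac)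
  also have "jb (- \<alpha>) \<eta> * (jb \<alpha> \<zeta> * jb \<alpha> \<eta>) = jb \<alpha> \<zeta> * (jb \<alpha> \<eta> * jb (- \<alpha>) \<eta>)" by (simp add: mult_ac)
  finally show ?thesis by (simp add: jb_minus)
qed

section \<open>Rapid decay in cones\<close>

definition rapid_on :: "'a::euclidean_space set \<Rightarrow> ('a \<Rightarrow> complex) \<Rightarrow> bool" where
  "rapid_on S F \<longleftrightarrow> (\<forall>M. \<exists>D\<ge>0. \<forall>\<xi>\<in>S. (1 + norm \<xi>) ^ M * cmod (F \<xi>) \<le> D)"

lemma rapid_on_subset: "rapid_on S F \<Longrightarrow> T \<subseteq> S \<Longrightarrow> rapid_on T F"
  unfolding rapid_on_def by blast

text \<open>For \<open>\<xi>\<close> in the narrower cone and \<open>\<zeta>\<close> in the wider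
  one, \<open>F\<close> decays at \<open>\<zeta>\<close>, and moving the weight from
  \<open>\<xi>\<close> to \<open>\<zeta>\<close> costs powers of
  \<open>1 + norm (\<xi> - \<zeta>)\<close>. For other \<open>\<zeta>\<close>,
  \<open>norm (\<xi> - \<zeta>)\<close> dominates both norms and so pays for weight and growth.
  Either cost is absorbed by \<open>\<phi>\<close>. The bound holds at every point of the cone,
  since the growth bound is only used under the integral.\<close>

lemma conv_rapid:
  fixes F \<phi> :: "'a::euclidean_space \<Rightarrow> complex"
  assumes \<phi>: "schwartz_fun \<phi>" and m: "F \<in> borel_measurable borel"
    and C: "C \<ge> 0" "AE \<zeta> in lborel. cmod (F \<zeta>) \<le> C * (1 + norm \<zeta>) ^ N"
    and F: "rapid_on (cone_around c e) F" and e: "norm e = 1" "0 \<le> c" "c < c'" "c \<le> 1"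
  shows "rapid_on (cone_around c' e) (conv \<phi> F)"
  unfolding rapid_on_def
proof
  fix M
  note [measurable] = m schwartz_measurable[OF \<phi>]
  obtain L where L: "L \<ge> 1" "\<And>\<xi> \<zeta>. \<xi> \<in> cone_around c' e \<Longrightarrow> \<zeta> \<notin> cone_around c e \<Longrightarrow>
    norm \<xi> \<le> L * norm (\<xi> - \<zeta>) \<and> norm \<zeta> \<le> L * norm (\<xi> - \<zeta>)"
    using cone_separation[OF e] by blast
  obtain D where D: "D \<ge> 0" "\<And>\<zeta>. \<zeta> \<in> cone_around c e \<Longrightarrow> (1 + norm \<zeta>) ^ M * cmod (F \<zeta>) \<le> D"
    using F unfolding rapid_on_def by blast
  \<comment> \<open>\<open>D\<close> serves the first case; in the second, the powers of
    \<open>L\<close> come from the weight of order \<open>M\<close> and the growth of order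
    \<open>N\<close>.\<close>
  define E where "E = D + L ^ M * (C * L ^ N)"
  have E: "E \<ge> 0" "D \<le> E" "L ^ M * (C * L ^ N) \<le> E" using D C L by (auto simp: E_def)
  define g where "g x = (1 + norm x) ^ (M + N) * cmod (\<phi> x)" for x
  have ig: "integrable lborel g" unfolding g_def by (rule schwartz_weight_integrable[OF \<phi>])
  have g0: "g x \<ge> 0" for x by (simp add: g_def)
  have "(1 + norm \<xi>) ^ M * cmod (conv \<phi> F \<xi>) \<le> E * (\<integral>x. g x \<partial>lborel)" if \<xi>: "\<xi> \<in> cone_around c' e" for \<xi>
  proof -
    have "AE \<zeta> in lborel. ennreal ((1 + norm \<xi>) ^ M) * ennreal (cmod (\<phi> (\<xi> - \<zeta>)) * cmod (F \<zeta>)) \<le> ennreal E * ennreal (g (\<xi> - \<zeta>))"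
      using C(2)
    proof eventually_elim
      case (elim \<zeta>)
      have p: "0 \<le> 1 + norm (\<xi> - \<zeta>)" "1 \<le> 1 + norm (\<xi> - \<zeta>)" by auto
      have "(1 + norm \<xi>) ^ M * cmod (F \<zeta>) \<le> E * (1 + norm (\<xi> - \<zeta>)) ^ (M + N)"
      proof (cases "\<zeta> \<in> cone_around c e")
        case True
        have "1 + z \<le> (1 + x) * (1 + y)" if "z \<le> y + x" "0 \<le> x * y" for x y z :: real
          using that by (simp add: distrib_left distrib_right)
        from this[OF norm_triangle_sub]
        have "1 + norm \<xi> \<le> (1 + norm (\<xi> - \<zeta>)) * (1 + norm \<zeta>)" by simp
        hence "(1 + norm \<xi>) ^ M \<le> (1 + norm (\<xi> - \<zeta>)) ^ M * (1 + norm \<zeta>) ^ M"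
          unfolding power_mult_distrib[symmetric] by (intro power_mono) auto
        hence "(1 + norm \<xi>) ^ M * cmod (F \<zeta>) \<le> (1 + norm (\<xi> - \<zeta>)) ^ M * (1 + norm \<zeta>) ^ M * cmod (F \<zeta>)"
          by (intro mult_right_mono) auto
        also have "\<dots> = (1 + norm (\<xi> - \<zeta>)) ^ M * ((1 + norm \<zeta>) ^ M * cmod (F \<zeta>))" by (simp only: mult.assoc)
        also have "\<dots> \<le> (1 + norm (\<xi> - \<zeta>)) ^ (M + N) * E"
          by (intro mult_mono power_increasing order_trans[OF D(2)[OF True] E(2)] p) auto
        finally show ?thesis by (simp only: mult.commute)
      next
        case False
        have n: "norm \<xi> \<le> L * norm (\<xi> - \<zeta>)" "norm \<zeta> \<le> L * norm (\<xi> - \<zeta>)" using L(2)[OF \<xi> False] by auto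
        have l: "1 + norm \<xi> \<le> L * (1 + norm (\<xi> - \<zeta>))" "1 + norm \<zeta> \<le> L * (1 + norm (\<xi> - \<zeta>))"
          using n L(1) by (auto simp: distrib_left)
        have "(1 + norm \<xi>) ^ M * cmod (F \<zeta>) \<le> (L * (1 + norm (\<xi> - \<zeta>))) ^ M * (C * (L * (1 + norm (\<xi> - \<zeta>))) ^ N)"
          using L(1) C(1) p
          by (intro mult_mono power_mono l order_trans[OF elim] mult_nonneg_nonneg zero_le_power) auto
        also have "\<dots> = L ^ M * (C * L ^ N) * (1 + norm (\<xi> - \<zeta>)) ^ (M + N)"
          by (simp only: power_mult_distrib power_add mult_ac)
        also have "\<dots> \<le> E * (1 + norm (\<xi> - \<zeta>)) ^ (M + N)"
          by (intro mult_right_mono E(3) zero_le_power p)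
        finally show ?thesis .
      qed
      from mult_right_mono[OF this norm_ge_zero[of "\<phi> (\<xi> - \<zeta>)"]]
      have "(1 + norm \<xi>) ^ M * (cmod (\<phi> (\<xi> - \<zeta>)) * cmod (F \<zeta>)) \<le> E * g (\<xi> - \<zeta>)"
        unfolding g_def by (simp only: mult_ac)
      thus ?case using E(1) g0[of "\<xi> - \<zeta>"]
        by (simp only: ennreal_mult[symmetric] norm_ge_zero mult_nonneg_nonneg zero_le_power add_nonneg_nonneg zero_le_one ennreal_leI)
    qed
    hence "(\<integral>\<^sup>+\<zeta>. ennreal ((1 + norm \<xi>) ^ M) * ennreal (cmod (\<phi> (\<xi> - \<zeta>)) * cmod (F \<zeta>)) \<partial>lborel) \<le>
        (\<integral>\<^sup>+\<zeta>. ennreal E * ennreal (g (\<xi> - \<zeta>)) \<partial>lborel)" by (rule nn_integral_mono_AE)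
    moreover have [measurable]: "g \<in> borel_measurable borel" unfolding g_def by measurable
    moreover have "(\<integral>\<^sup>+\<zeta>. ennreal E * ennreal (g (\<xi> - \<zeta>)) \<partial>lborel) = ennreal (E * (\<integral>x. g x \<partial>lborel))"
      using E(1) by (simp add: nn_integral_cmult nn_integral_reflect[of "\<lambda>x. ennreal (g x)"]
          nn_integral_eq_integral[OF ig] g0 ennreal_mult)
    ultimately have le: "ennreal ((1 + norm \<xi>) ^ M) * abs_conv \<phi> F \<xi> \<le> ennreal (E * (\<integral>x. g x \<partial>lborel))"
      by (simp add: nn_integral_cmult abs_conv_def)
    have "(1 + norm \<xi>) ^ M * cmod (conv \<phi> F \<xi>) \<le> (1 + norm \<xi>) ^ M * enn2real (abs_conv \<phi> F \<xi>)"
      by (intro mult_left_mono conv_le_abs_conv) auto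
    also have "\<dots> = enn2real (ennreal ((1 + norm \<xi>) ^ M) * abs_conv \<phi> F \<xi>)"
      by (simp add: enn2real_mult)
    also have "\<dots> \<le> enn2real (ennreal (E * (\<integral>x. g x \<partial>lborel)))"
      by (rule enn2real_mono[OF le]) simp
    also have "\<dots> = E * (\<integral>x. g x \<partial>lborel)" using E(1) g0 by (simp add: integral_nonneg_AE)
    finally show ?thesis .
  qed
  moreover have "0 \<le> E * (\<integral>x. g x \<partial>lborel)" using E(1) g0 by (simp add: integral_nonneg_AE)
  ultimately show "\<exists>D\<ge>0. \<forall>\<xi>\<in>cone_around c' e. (1 + norm \<xi>) ^ M * cmod (conv \<phi> F \<xi>) \<le> D" by blast
qed

text \<open>The cutoff of the wavefront condition need not bring \<open>f\<close> into the weighted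
  space. Its product with a small cutoff \<open>\<kappa>\<close> serves both purposes: it is
  concentrated near \<open>x\<^sub>0\<close>, and its transform, a convolution, still decays in a
  narrower cone.\<close>

lemma not_WF_localize:
  fixes x\<^sub>0 \<xi>\<^sub>0 :: "'a::euclidean_space"
  assumes f: "distribution f" "\<xi>\<^sub>0 \<notin> WF_at x\<^sub>0 f" "locally_in_H \<alpha> p x\<^sub>0 f" and \<xi>\<^sub>0: "\<xi>\<^sub>0 \<noteq> 0"
    and p: "1 \<le> p" and d: "d > 0"
  obtains \<eta> A c where "test_fun \<eta>" "\<eta> x\<^sub>0 \<noteq> 0" "supp \<eta> \<subseteq> ball x\<^sub>0 d" "0 \<le> c" "c < 1"
    "has_fourier_fun (mult_distr \<eta> f) A" "in_Lp p (\<lambda>\<xi>. weight \<alpha> \<xi> * A \<xi>)" "rapid_on (cone_around c (sgn \<xi>\<^sub>0)) A"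
proof -
  let ?e = "sgn \<xi>\<^sub>0"
  have e1: "norm ?e = 1" using \<xi>\<^sub>0 by (simp add: norm_sgn)
  obtain \<eta> F \<Gamma> where \<eta>: "test_fun \<eta>" "\<eta> x\<^sub>0 \<noteq> 0" and F: "has_fourier_fun (mult_distr \<eta> f) F"
    and \<Gamma>: "open \<Gamma>" "\<xi>\<^sub>0 \<in> \<Gamma>" "\<And>\<zeta> t. \<zeta> \<in> \<Gamma> \<Longrightarrow> t > 0 \<Longrightarrow> t *\<^sub>R \<zeta> \<in> \<Gamma>"
    and dec: "\<And>N::nat. \<exists>C. \<forall>\<zeta>\<in>\<Gamma>. cmod (F \<zeta>) \<le> C / (1 + norm \<zeta>) ^ N"
    using f(2) \<xi>\<^sub>0 unfolding WF_at_def WF_def by blast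
  obtain c where c: "0 \<le> c" "c < 1" "cone_around c ?e \<subseteq> \<Gamma>"
    using open_conic_contains[OF \<Gamma>(1,2) \<xi>\<^sub>0 \<Gamma>(3)] by blast
  have rF: "rapid_on (cone_around c ?e) F"
    unfolding rapid_on_def
  proof
    fix M
    obtain C where C: "\<forall>\<zeta>\<in>\<Gamma>. cmod (F \<zeta>) \<le> C / (1 + norm \<zeta>) ^ M" using dec by blast
    have "(1 + norm \<zeta>) ^ M * cmod (F \<zeta>) \<le> max C 0" if "\<zeta> \<in> cone_around c ?e" for \<zeta>
    proof -
      have "0 < (1 + norm \<zeta>) ^ M" by (simp add: add_pos_nonneg)
      moreover have "cmod (F \<zeta>) \<le> C / (1 + norm \<zeta>) ^ M" using that c(3) C by blast
      ultimately have "(1 + norm \<zeta>) ^ M * cmod (F \<zeta>) \<le> C" by (simp add: field_simps)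
      thus ?thesis by simp
    qed
    thus "\<exists>D\<ge>0. \<forall>\<xi>\<in>cone_around c ?e. (1 + norm \<xi>) ^ M * cmod (F \<xi>) \<le> D" by (intro exI[of _ "max C 0"]) auto
  qed
  obtain C N where growth: "C \<ge> 0" "AE \<xi> in lborel. cmod (F \<xi>) \<le> C * (1 + norm \<xi>) ^ N"
    using localized_fourier_growth[OF f(1) \<eta>(1) F] by blast
  have mF [measurable]: "F \<in> borel_measurable borel" by (rule has_fourier_fun_measurable[OF F])
  \<comment> \<open>Polynomial growth puts the localized distribution into a space with exponent
    infinity and order \<open>- real N\<close>, so the theorem on multiplication by test functions
    applies to it and \<open>\<kappa>\<close>.\<close>
  have Linf: "in_Lp \<infinity> (\<lambda>\<xi>. weight (- real N) \<xi> * F \<xi>)"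
    unfolding in_Lp_top_iff
  proof (intro conjI exI[of _ "C * 2 ^ N"])
    show "AE \<xi> in lborel. cmod (weight (- real N) \<xi> * F \<xi>) \<le> C * 2 ^ N"
      using growth(2)
    proof eventually_elim
      case (elim \<xi>)
      have "cmod (weight (- real N) \<xi> * F \<xi>) = jb (- real N) \<xi> * cmod (F \<xi>)" by (simp add: norm_mult cmod_weight)
      also have "\<dots> \<le> jb (- real N) \<xi> * (C * (2 ^ N * jb (real N) \<xi>))"
        using growth(1) by (intro mult_left_mono jb_nonneg order_trans[OF elim] power_le_jb)
      also have "\<dots> = C * 2 ^ N * (jb (real N) \<xi> * jb (- real N) \<xi>)" by (simp only: mult_ac)
      finally show ?case by (simp only: jb_minus mult_1_right)
    qed
  qed (use growth(1) in auto)
  obtain d' where d': "d' > 0" "\<And>\<kappa>. test_fun \<kappa> \<Longrightarrow> supp \<kappa> \<subseteq> ball x\<^sub>0 d' \<Longrightarrow> in_H \<alpha> p (mult_distr \<kappa> f)"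
    using locally_in_H_cutoff[OF f(3) p] by blast
  define d1 where "d1 = min d d'"
  have d1: "d1 > 0" "ball x\<^sub>0 d1 \<subseteq> ball x\<^sub>0 d" "ball x\<^sub>0 d1 \<subseteq> ball x\<^sub>0 d'"
    using d d' by (auto simp: d1_def)
  obtain \<kappa> where \<kappa>: "cutoff_near x\<^sub>0 \<kappa>" "supp \<kappa> \<subseteq> ball x\<^sub>0 d1" using small_cutoff[OF d1(1)] by blast
  have t: "test_fun \<kappa>" "\<kappa> x\<^sub>0 = 1" using cutoff_nearD[OF \<kappa>(1)] by auto
  let ?\<eta> = "\<lambda>x. \<kappa> x * \<eta> x"
  have t\<eta>: "test_fun ?\<eta>" "supp ?\<eta> \<subseteq> ball x\<^sub>0 d1"
    using test_mult[OF t(1) test_smooth[OF \<eta>(1)]] \<kappa>(2) by auto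
  obtain A where A: "has_fourier_fun (mult_distr ?\<eta> f) A" "in_Lp p (\<lambda>\<xi>. weight \<alpha> \<xi> * A \<xi>)"
    using d'(2)[OF t\<eta>(1)] t\<eta>(2) d1(3) unfolding in_H_def by blast
  define A1 where "A1 \<xi> = cft TYPE('a) * conv (fourier \<kappa>) F \<xi>" for \<xi>
  have "has_fourier_fun (mult_distr \<kappa> (mult_distr \<eta> f)) A1"
    unfolding A1_def by (rule has_fourier_fun_mult(1)[OF F _ Linf t(1)]) simp
  moreover have "mult_distr \<kappa> (mult_distr \<eta> f) = mult_distr ?\<eta> f"
    unfolding mult_distr_def by (simp only: mult_ac)
  ultimately have A1: "has_fourier_fun (mult_distr ?\<eta> f) A1" by simp
  have mA [measurable]: "A \<in> borel_measurable borel" "A1 \<in> borel_measurable borel"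
    by (rule has_fourier_fun_measurable[OF A(1)] has_fourier_fun_measurable[OF A1])+
  define c' where "c' = (1 + c) / 2"
  have c': "c < c'" "c' < 1" "0 \<le> c'" using c by (auto simp: c'_def)
  let ?G = "cone_around c' ?e"
  have [measurable]: "?G \<in> sets borel" by (rule borel_open[OF open_cone_around])
  have "rapid_on ?G (conv (fourier \<kappa>) F)"
    by (rule conv_rapid[OF schwartz_fourier[OF test_schwartz[OF t(1)]] mF growth rF e1 c(1) c'(1)]) (use c in simp)
  hence rA1: "rapid_on ?G A1"
    unfolding rapid_on_def
  proof (intro allI)
    fix M
    assume "\<forall>M. \<exists>D\<ge>0. \<forall>\<xi>\<in>?G. (1 + norm \<xi>) ^ M * cmod (conv (fourier \<kappa>) F \<xi>) \<le> D"
    then obtain D where D: "D \<ge> 0" "\<forall>\<xi>\<in>?G. (1 + norm \<xi>) ^ M * cmod (conv (fourier \<kappa>) F \<xi>) \<le> D" by blast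
    have "(1 + norm \<xi>) ^ M * cmod (A1 \<xi>) \<le> cmod (cft TYPE('a)) * D" if "\<xi> \<in> ?G" for \<xi>
    proof -
      have "(1 + norm \<xi>) ^ M * cmod (A1 \<xi>) = cmod (cft TYPE('a)) * ((1 + norm \<xi>) ^ M * cmod (conv (fourier \<kappa>) F \<xi>))"
        by (simp only: A1_def norm_mult mult_ac)
      also have "\<dots> \<le> cmod (cft TYPE('a)) * D" using D(2) that by (intro mult_left_mono) auto
      finally show ?thesis .
    qed
    thus "\<exists>D\<ge>0. \<forall>\<xi>\<in>?G. (1 + norm \<xi>) ^ M * cmod (A1 \<xi>) \<le> D"
      using D(1) by (intro exI[of _ "cmod (cft TYPE('a)) * D"] conjI mult_nonneg_nonneg ballI) auto
  qed
  \<comment> \<open>\<open>A\<close> is known to lie in the weighted space and \<open>A1\<close> to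
    decay pointwise in the cone; they agree almost everywhere, so the splice has both
    properties.\<close>
  define A2 where "A2 \<xi> = (if \<xi> \<in> ?G then A1 \<xi> else A \<xi>)" for \<xi>
  have mA2 [measurable]: "A2 \<in> borel_measurable borel" unfolding A2_def by measurable
  have ae: "AE \<xi> in lborel. A \<xi> = A2 \<xi>"
    using has_fourier_fun_unique[OF A(1) A1] by eventually_elim (simp add: A2_def)
  show ?thesis
  proof (rule that[of ?\<eta> c' A2])
    show "test_fun ?\<eta>" "supp ?\<eta> \<subseteq> ball x\<^sub>0 d" using t\<eta> d1 by auto
    show "\<kappa> x\<^sub>0 * \<eta> x\<^sub>0 \<noteq> 0" using t \<eta> by simp
    show "0 \<le> c'" "c' < 1" by (rule c'(3) c'(2))+
    show "has_fourier_fun (mult_distr ?\<eta> f) A2" by (rule has_fourier_fun_cong[OF A(1) ae mA2])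
    show "in_Lp p (\<lambda>\<xi>. weight \<alpha> \<xi> * A2 \<xi>)"
      by (rule in_Lp_cong[OF p A(2)]) (measurable, use ae in eventually_elim, simp)
    show "rapid_on ?G A2" using rA1 unfolding rapid_on_def A2_def by simp
  qed
qed

text \<open>In the cone the decay of \<open>A\<close> beats the weight of order \<open>M\<close> and
  still leaves an \<open>L\<^sup>p\<close> function. Adding it to the weighted \<open>A\<close>
  gives a single majorant, so one application of Young's inequality covers all positions of the two
  frequencies.\<close>

lemma rapid_majorant:
  fixes A :: "'a::euclidean_space \<Rightarrow> complex"
  assumes p: "1 \<le> p" and [measurable]: "A \<in> borel_measurable borel" and A: "in_Lp p (\<lambda>\<xi>. weight \<alpha> \<xi> * A \<xi>)"
    and r: "rapid_on (cone_around c e) A"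
  obtains a where "in_Lp p a" "\<And>\<xi>. jb \<alpha> \<xi> * cmod (A \<xi>) \<le> cmod (a \<xi>)"
    "\<And>\<xi>. \<xi> \<in> cone_around c e \<Longrightarrow> jb M \<xi> * cmod (A \<xi>) \<le> cmod (a \<xi>)"
proof -
  let ?G = "cone_around c e"
  have [measurable]: "?G \<in> sets borel" by (rule borel_open[OF open_cone_around])
  define A' where "A' \<xi> = (if \<xi> \<in> ?G then weight M \<xi> * A \<xi> else 0)" for \<xi>
  obtain m :: nat where m: "M \<le> real m" using real_arch_simple by blast
  obtain D where D: "D \<ge> 0" "\<And>\<xi>. \<xi> \<in> ?G \<Longrightarrow> (1 + norm \<xi>) ^ (m + 2 * DIM('a)) * cmod (A \<xi>) \<le> D"
    using r unfolding rapid_on_def by blast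
  have "cmod (A' \<xi>) \<le> D * inverse ((1 + norm \<xi>) ^ (2 * DIM('a)))" for \<xi>
  proof (cases "\<xi> \<in> ?G")
    case True
    have p: "0 < (1 + norm \<xi>) ^ (2 * DIM('a))" by (simp add: add_pos_nonneg)
    have "cmod (A' \<xi>) * (1 + norm \<xi>) ^ (2 * DIM('a)) = jb M \<xi> * ((1 + norm \<xi>) ^ (2 * DIM('a)) * cmod (A \<xi>))"
      using True by (simp add: A'_def norm_mult cmod_weight)
    also have "\<dots> \<le> (1 + norm \<xi>) ^ m * ((1 + norm \<xi>) ^ (2 * DIM('a)) * cmod (A \<xi>))"
      by (intro mult_right_mono jb_le_power m) auto
    also have "\<dots> \<le> D" using D(2)[OF True] by (simp only: power_add mult.assoc)
    finally show ?thesis using p by (simp only: divide_inverse[symmetric] pos_le_divide_eq)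
  qed (use D(1) in \<open>simp add: A'_def\<close>)
  moreover have "A' \<in> borel_measurable borel" unfolding A'_def by measurable
  ultimately have "in_Lp p A'" by (intro in_Lp_decay[OF p _ D(1)]) auto
  from in_Lp_add[OF p A this] show ?thesis
  proof (rule that)
    fix \<xi>
    have "cmod (of_real (cmod (weight \<alpha> \<xi> * A \<xi>) + cmod (A' \<xi>))) = jb \<alpha> \<xi> * cmod (A \<xi>) + cmod (A' \<xi>)"
      by (simp add: norm_mult cmod_weight jb_nonneg add_nonneg_nonneg del: of_real_add of_real_mult)
    note * = this
    show "jb \<alpha> \<xi> * cmod (A \<xi>) \<le> cmod (of_real (cmod (weight \<alpha> \<xi> * A \<xi>) + cmod (A' \<xi>)))"
      unfolding * by simp
    show "jb M \<xi> * cmod (A \<xi>) \<le> cmod (of_real (cmod (weight \<alpha> \<xi> * A \<xi>) + cmod (A' \<xi>)))" if "\<xi> \<in> ?G"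
      unfolding * using that by (simp add: A'_def norm_mult cmod_weight jb_nonneg)
  qed
qed

section \<open>Kernel estimates in cones\<close>

lemma kernel_mono:
  fixes u v x y X Y k K w :: real
  assumes "w \<le> k * (u * v)" "u * x \<le> X" "v * y \<le> Y" "0 \<le> k" "k \<le> K" "0 \<le> u" "0 \<le> v" "0 \<le> x" "0 \<le> y"
  shows "w * (x * y) \<le> K * (X * Y)"
proof -
  have "w * (x * y) \<le> k * (u * v) * (x * y)" using assms by (intro mult_right_mono) auto
  also have "\<dots> = k * ((u * x) * (v * y))" by (simp add: mult_ac)
  also have "\<dots> \<le> K * (X * Y)"
  proof (rule mult_mono[OF assms(5)])
    have ux: "0 \<le> u * x" "0 \<le> v * y" using assms by auto
    show "(u * x) * (v * y) \<le> X * Y" using assms(2,3) ux by (intro mult_mono) auto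
    show "0 \<le> u * x * (v * y)" using ux by simp
    show "0 \<le> K" using assms by linarith
  qed
  finally show ?thesis .
qed

text \<open>In the application \<open>G\<close> is a cone, and the hypothesis on \<open>L\<close> expresses that \<open>\<xi>\<close> lies in a
  strictly smaller one.\<close>

lemma kernel_both:
  fixes \<xi> \<zeta> :: "'a::euclidean_space"
  assumes s: "\<alpha> + \<beta> \<ge> 0" "\<sigma> \<le> \<alpha> + \<beta>" and L: "L \<ge> 1" "\<And>\<eta>. \<eta> \<notin> G \<Longrightarrow> norm \<xi> \<le> L * norm (\<xi> - \<eta>) \<and> norm \<eta> \<le> L * norm (\<xi> - \<eta>)"
    and M: "M = \<alpha> + \<beta> + \<bar>\<alpha>\<bar> + \<bar>\<beta>\<bar>"
    and x: "0 \<le> x" "jb \<alpha> (\<xi> - \<zeta>) * x \<le> X" "\<xi> - \<zeta> \<in> G \<Longrightarrow> jb M (\<xi> - \<zeta>) * x \<le> X"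
    and y: "0 \<le> y" "jb \<beta> \<zeta> * y \<le> Y" "\<zeta> \<in> G \<Longrightarrow> jb M \<zeta> * y \<le> Y"
  shows "jb \<sigma> \<xi> * (x * y) \<le> (2 powr M + L powr M) * (X * Y)"
proof -
  let ?\<eta> = "\<xi> - \<zeta>" and ?s = "\<alpha> + \<beta>"
  \<comment> \<open>\<open>M\<close> is large enough for one decaying factor to carry the whole
    weight of order \<open>?s\<close> and to compensate the possibly negative order of the other
    factor, at the cost of \<open>\<bar>\<alpha>\<bar>\<close> or
    \<open>\<bar>\<beta>\<bar>\<close>.\<close>
  have M0: "?s \<le> M" "0 \<le> M" using M s by auto
  have "jb ?s \<xi> * (x * y) \<le> (2 powr M + L powr M) * (X * Y)"
  proof (cases "?\<eta> \<in> G"; cases "\<zeta> \<in> G")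
    assume in_G: "?\<eta> \<in> G" "\<zeta> \<in> G"
    have "jb ?s \<xi> \<le> 2 powr ?s * jb ?s ?\<eta> * jb ?s \<zeta>" using peetre_nonneg[OF s(1), of ?\<eta> \<zeta>] by simp
    also have "\<dots> \<le> 2 powr M * jb M ?\<eta> * jb M \<zeta>"
      using M0 by (intro mult_mono powr_mono jb_mono mult_nonneg_nonneg jb_nonneg) auto
    finally have "jb ?s \<xi> \<le> 2 powr M * (jb M ?\<eta> * jb M \<zeta>)" by (simp only: mult.assoc)
    thus ?thesis by (rule kernel_mono[OF _ x(3)[OF in_G(1)] y(3)[OF in_G(2)]]) (use x y in \<open>auto simp: jb_nonneg\<close>)
  next
    assume in_G: "?\<eta> \<in> G" "\<zeta> \<notin> G"
    note l = L(2)[OF in_G(2)]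
    \<comment> \<open>The factor 1 is estimated by \<open>one_le_jb\<close>, which inserts
      \<open>jb \<beta> \<zeta>\<close> at the price of
      \<open>jb \<bar>\<beta>\<bar> ?\<eta>\<close>.\<close>
    have "jb ?s \<xi> * 1 \<le> (L powr ?s * jb ?s ?\<eta>) * (L powr \<bar>\<beta>\<bar> * jb \<bar>\<beta>\<bar> ?\<eta> * jb \<beta> \<zeta>)"
      using l by (intro mult_mono jb_scale one_le_jb L s mult_nonneg_nonneg jb_nonneg) auto
    also have "\<dots> = L powr (?s + \<bar>\<beta>\<bar>) * (jb (?s + \<bar>\<beta>\<bar>) ?\<eta> * jb \<beta> \<zeta>)"
      by (simp only: powr_add jb_add mult_ac)
    also have "\<dots> \<le> L powr M * (jb M ?\<eta> * jb \<beta> \<zeta>)"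
      using M L(1) by (intro mult_mono powr_mono jb_mono mult_nonneg_nonneg jb_nonneg) auto
    finally have "jb ?s \<xi> \<le> L powr M * (jb M ?\<eta> * jb \<beta> \<zeta>)" by simp
    thus ?thesis by (rule kernel_mono[OF _ x(3)[OF in_G(1)] y(2)]) (use x y in \<open>auto simp: jb_nonneg\<close>)
  next
    assume in_G: "?\<eta> \<notin> G" "\<zeta> \<in> G"
    have l: "norm \<xi> \<le> L * norm \<zeta>" "norm ?\<eta> \<le> L * norm \<zeta>" using L(2)[OF in_G(1)] by simp_all
    have "jb ?s \<xi> * 1 \<le> (L powr ?s * jb ?s \<zeta>) * (L powr \<bar>\<alpha>\<bar> * jb \<bar>\<alpha>\<bar> \<zeta> * jb \<alpha> ?\<eta>)"
      using l by (intro mult_mono jb_scale one_le_jb L s mult_nonneg_nonneg jb_nonneg) auto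
    also have "\<dots> = L powr (?s + \<bar>\<alpha>\<bar>) * (jb \<alpha> ?\<eta> * jb (?s + \<bar>\<alpha>\<bar>) \<zeta>)"
      by (simp only: powr_add jb_add mult_ac)
    also have "\<dots> \<le> L powr M * (jb \<alpha> ?\<eta> * jb M \<zeta>)"
      using M L(1) by (intro mult_mono powr_mono jb_mono mult_nonneg_nonneg jb_nonneg) auto
    finally have "jb ?s \<xi> \<le> L powr M * (jb \<alpha> ?\<eta> * jb M \<zeta>)" by simp
    thus ?thesis by (rule kernel_mono[OF _ x(2) y(3)[OF in_G(2)]]) (use x y in \<open>auto simp: jb_nonneg\<close>)
  next
    \<comment> \<open>Here \<open>?\<eta>\<close> and \<open>\<zeta>\<close> are comparable, so the
      weight of order \<open>?s\<close> at \<open>\<zeta>\<close> can be divided into order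
      \<open>\<alpha>\<close> at \<open>?\<eta>\<close> and order \<open>\<beta>\<close> at
      \<open>\<zeta>\<close>, whatever their signs.\<close>
    assume in_G: "?\<eta> \<notin> G" "\<zeta> \<notin> G"
    have l: "norm \<xi> \<le> L * norm \<zeta>" "norm ?\<eta> \<le> L * norm \<zeta>" "norm \<zeta> \<le> L * norm ?\<eta>"
      using L(2)[OF in_G(1)] L(2)[OF in_G(2)] by simp_all
    have "jb ?s \<xi> \<le> L powr ?s * jb ?s \<zeta>" by (rule jb_scale[OF l(1) L(1) s(1)])
    also have "\<dots> = L powr ?s * (jb \<alpha> \<zeta> * jb \<beta> \<zeta>)" by (simp only: jb_add)
    also have "\<dots> \<le> L powr ?s * (L powr \<bar>\<alpha>\<bar> * jb \<alpha> ?\<eta> * jb \<beta> \<zeta>)"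
      by (intro mult_left_mono mult_right_mono jb_compare l L jb_nonneg) auto
    also have "\<dots> = L powr (?s + \<bar>\<alpha>\<bar>) * (jb \<alpha> ?\<eta> * jb \<beta> \<zeta>)" by (simp only: powr_add mult_ac)
    also have "\<dots> \<le> L powr M * (jb \<alpha> ?\<eta> * jb \<beta> \<zeta>)"
      using M L(1) by (intro mult_right_mono powr_mono mult_nonneg_nonneg jb_nonneg) auto
    finally have "jb ?s \<xi> \<le> L powr M * (jb \<alpha> ?\<eta> * jb \<beta> \<zeta>)" .
    thus ?thesis by (rule kernel_mono[OF _ x(2) y(2)]) (use x y in \<open>auto simp: jb_nonneg\<close>)
  qed
  moreover have "jb \<sigma> \<xi> * (x * y) \<le> jb ?s \<xi> * (x * y)"
    using x y by (intro mult_right_mono jb_mono s) auto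
  ultimately show ?thesis by linarith
qed

text \<open>Off the cone the only information is that \<open>\<zeta>\<close> dominates
  \<open>\<xi>\<close> and \<open>\<xi> - \<zeta>\<close>. The weight of order
  \<open>\<sigma>\<close> moves from \<open>\<xi>\<close> to \<open>\<zeta>\<close>, where order
  \<open>\<beta>\<close> is available; the rest, of order \<open>min 0 \<alpha>\<close>, is bounded
  by \<open>jb \<alpha> (\<xi> - \<zeta>)\<close>, through the one-sided comparison if
  \<open>\<alpha>\<close> is negative and trivially otherwise.\<close>

lemma kernel_one:
  fixes \<xi> \<zeta> :: "'a::euclidean_space"
  assumes s: "\<alpha> + \<beta> \<ge> 0" "\<beta> \<ge> 0" and \<sigma>: "\<sigma> = \<beta> + min 0 \<alpha>"
    and L: "L \<ge> 1" "\<And>\<eta>. \<eta> \<notin> G \<Longrightarrow> norm \<xi> \<le> L * norm (\<xi> - \<eta>) \<and> norm \<eta> \<le> L * norm (\<xi> - \<eta>)"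
    and M: "M = \<beta> + \<bar>\<alpha>\<bar>"
    and x: "0 \<le> x" "jb \<alpha> (\<xi> - \<zeta>) * x \<le> X" "\<xi> - \<zeta> \<in> G \<Longrightarrow> jb M (\<xi> - \<zeta>) * x \<le> X"
    and y: "0 \<le> y" "jb \<beta> \<zeta> * y \<le> Y"
  shows "jb \<sigma> \<xi> * (x * y) \<le> (2 powr M + L powr M) * (X * Y)"
proof -
  let ?\<eta> = "\<xi> - \<zeta>"
  \<comment> \<open>\<open>0 \<le> \<sigma>\<close> combines both sign conditions: it is
    \<open>\<beta> \<ge> 0\<close> if \<open>\<alpha> \<ge> 0\<close>, and
    \<open>\<alpha> + \<beta> \<ge> 0\<close> otherwise.\<close>
  have \<sigma>0: "0 \<le> \<sigma>" "\<sigma> \<le> \<beta>" "\<sigma> \<le> M" using \<sigma> s M by auto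
  show ?thesis
  proof (cases "?\<eta> \<in> G")
    case True
    have "jb \<sigma> \<xi> \<le> 2 powr \<sigma> * jb \<sigma> ?\<eta> * jb \<sigma> \<zeta>" using peetre_nonneg[OF \<sigma>0(1), of ?\<eta> \<zeta>] by simp
    also have "\<dots> \<le> 2 powr M * jb M ?\<eta> * jb \<beta> \<zeta>"
      using \<sigma>0 by (intro mult_mono powr_mono jb_mono mult_nonneg_nonneg jb_nonneg) auto
    finally have "jb \<sigma> \<xi> \<le> 2 powr M * (jb M ?\<eta> * jb \<beta> \<zeta>)" by (simp only: mult.assoc)
    thus ?thesis by (rule kernel_mono[OF _ x(3)[OF True] y(2)]) (use x y in \<open>auto simp: jb_nonneg\<close>)
  next
    case False
    have l: "norm \<xi> \<le> L * norm \<zeta>" "norm ?\<eta> \<le> L * norm \<zeta>" using L(2)[OF False] by simp_all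
    have m: "jb (min 0 \<alpha>) \<zeta> \<le> L powr \<bar>\<alpha>\<bar> * jb \<alpha> ?\<eta>"
    proof (cases "\<alpha> \<ge> 0")
      case True
      have "1 * 1 \<le> L powr \<bar>\<alpha>\<bar> * jb \<alpha> ?\<eta>"
      proof (rule mult_mono)
        show "1 \<le> L powr \<bar>\<alpha>\<bar>" using L(1) by (intro ge_one_powr_ge_zero) auto
        show "1 \<le> jb \<alpha> ?\<eta>" using jb_mono[OF True, of ?\<eta>] by (simp add: jb_0)
      qed auto
      thus ?thesis using True by (simp add: min_def jb_0)
    next
      case False
      have "1 \<le> L powr \<bar>\<alpha>\<bar> * jb \<bar>\<alpha>\<bar> \<zeta> * jb \<alpha> ?\<eta>" by (rule one_le_jb[OF l(2) L(1)])
      hence "jb \<alpha> \<zeta> * 1 \<le> jb \<alpha> \<zeta> * (L powr \<bar>\<alpha>\<bar> * jb \<bar>\<alpha>\<bar> \<zeta> * jb \<alpha> ?\<eta>)" by (intro mult_left_mono jb_nonneg)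
      also have "\<dots> = L powr \<bar>\<alpha>\<bar> * jb \<alpha> ?\<eta> * (jb \<alpha> \<zeta> * jb (- \<alpha>) \<zeta>)" using False by (simp add: mult_ac)
      finally show ?thesis using False by (simp add: jb_minus min_def)
    qed
    have "jb \<sigma> \<xi> \<le> L powr \<sigma> * jb \<sigma> \<zeta>" by (rule jb_scale[OF l(1) L(1) \<sigma>0(1)])
    also have "\<dots> = L powr \<sigma> * (jb \<beta> \<zeta> * jb (min 0 \<alpha>) \<zeta>)" by (simp only: \<sigma> jb_add)
    also have "\<dots> \<le> L powr \<sigma> * (jb \<beta> \<zeta> * (L powr \<bar>\<alpha>\<bar> * jb \<alpha> ?\<eta>))"
      by (intro mult_left_mono m jb_nonneg) auto
    also have "\<dots> = L powr (\<sigma> + \<bar>\<alpha>\<bar>) * (jb \<alpha> ?\<eta> * jb \<beta> \<zeta>)" by (simp only: powr_add mult_ac)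
    also have "\<dots> \<le> L powr M * (jb \<alpha> ?\<eta> * jb \<beta> \<zeta>)"
      using M L(1) \<sigma>0 by (intro mult_right_mono powr_mono mult_nonneg_nonneg jb_nonneg) auto
    finally have "jb \<sigma> \<xi> \<le> L powr M * (jb \<alpha> ?\<eta> * jb \<beta> \<zeta>)" .
    thus ?thesis by (rule kernel_mono[OF _ x(2) y(2)]) (use x y in \<open>auto simp: jb_nonneg\<close>)
  qed
qed

text \<open>The conic cutoff \<open>u\<close> is part of the multiplier in
  \<open>weighted_young\<close> and vanishes off the cone, so the kernel bound is asked for only
  when \<open>\<xi>\<close> lies in the cone.\<close>

lemma microlocallyI:
  fixes x\<^sub>0 \<xi>\<^sub>0 :: "'a::euclidean_space"
  assumes pqr: "1 \<le> p" "1 \<le> q" "1 \<le> r" "1 / p + 1 / q = 1 / r + 1"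
    and \<xi>\<^sub>0: "\<xi>\<^sub>0 \<noteq> 0" and c: "0 \<le> c" "c < 1" and ab: "in_Lp p a" "in_Lp q b"
    and m [measurable]: "A \<in> borel_measurable borel" "B \<in> borel_measurable borel"
    and \<eta>: "test_fun \<eta>" "\<eta> x\<^sub>0 \<noteq> 0"
    and F: "has_fourier_fun (mult_distr \<eta> h) (\<lambda>\<xi>. cft TYPE('a) * conv A B \<xi>)"
    and K: "0 \<le> K" "\<And>\<xi> \<zeta>. \<xi> \<in> cone_around c (sgn \<xi>\<^sub>0) \<Longrightarrow>
      jb s \<xi> * (cmod (A (\<xi> - \<zeta>)) * cmod (B \<zeta>)) \<le> K * (cmod (a (\<xi> - \<zeta>)) * cmod (b \<zeta>))"
  shows "microlocally_in_H s r x\<^sub>0 \<xi>\<^sub>0 h"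
proof -
  let ?e = "sgn \<xi>\<^sub>0"
  have e1: "norm ?e = 1" using \<xi>\<^sub>0 by (simp add: norm_sgn)
  obtain u where u: "smooth_fun_on (- {0}) u" "\<And>\<xi> t. t > 0 \<Longrightarrow> u (t *\<^sub>R \<xi>) = u \<xi>" "u ?e \<noteq> 0"
    "\<And>\<xi>. u \<xi> \<noteq> 0 \<Longrightarrow> \<xi> \<bullet> ?e > c * norm \<xi>" "\<And>\<xi>. cmod (u \<xi>) \<le> 1"
    by (rule exists_conic_cutoff[OF e1 c], rule that)
  \<comment> \<open>Smoothness off the origin gives measurability only there; the value at the
    origin, which lies in no cone, extends it to the whole space.\<close>
  have "u 0 = 0" using u(4)[of 0] by auto
  hence "u = (\<lambda>\<xi>. indicator (- {0}) \<xi> *\<^sub>R u \<xi>)" by (auto simp: indicator_def fun_eq_iff)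
  moreover have "(\<lambda>\<xi>. indicator (- {0}) \<xi> *\<^sub>R u \<xi>) \<in> borel_measurable borel"
    by (rule borel_measurable_continuous_on_indicator[OF _ smooth_continuous[OF u(1)]]) simp
  ultimately have [measurable]: "u \<in> borel_measurable borel" by metis
  have le: "cmod (weight s \<xi> * u \<xi>) * (cmod (A (\<xi> - \<zeta>)) * cmod (B \<zeta>)) \<le> K * (cmod (a (\<xi> - \<zeta>)) * cmod (b \<zeta>))" for \<xi> \<zeta>
  proof (cases "u \<xi> = 0")
    case False
    hence \<xi>: "\<xi> \<in> cone_around c ?e" using u(4) by (simp add: cone_around_def)
    have "cmod (weight s \<xi> * u \<xi>) \<le> jb s \<xi>"
      using mult_left_mono[OF u(5)[of \<xi>] jb_nonneg[of s \<xi>]] by (simp add: norm_mult cmod_weight)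
    hence "cmod (weight s \<xi> * u \<xi>) * (cmod (A (\<xi> - \<zeta>)) * cmod (B \<zeta>)) \<le> jb s \<xi> * (cmod (A (\<xi> - \<zeta>)) * cmod (B \<zeta>))"
      by (intro mult_right_mono) auto
    also have "\<dots> \<le> K * (cmod (a (\<xi> - \<zeta>)) * cmod (b \<zeta>))" by (rule K(2)[OF \<xi>])
    finally show ?thesis .
  qed (use K(1) in simp)
  have "in_Lp r (\<lambda>\<xi>. weight s \<xi> * u \<xi> * conv A B \<xi>)"
    by (rule weighted_young(3)[OF pqr ab m _ K(1) le]) measurable
  hence "in_Lp r (\<lambda>\<xi>. cft TYPE('a) * (weight s \<xi> * u \<xi> * conv A B \<xi>))" by (rule in_Lp_cmult[OF pqr(3)])
  hence L: "in_Lp r (\<lambda>\<xi>. weight s \<xi> * u \<xi> * (cft TYPE('a) * conv A B \<xi>))" by (simp only: mult_ac)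
  have "u \<xi>\<^sub>0 = u ?e" unfolding sgn_div_norm using \<xi>\<^sub>0 by (subst u(2)) auto
  hence "u \<xi>\<^sub>0 \<noteq> 0" using u(3) by simp
  thus ?thesis unfolding microlocally_in_H_def using \<eta> u(1,2) F L by blast
qed

section \<open>The product theorem\<close>

lemma microlocal_both:
  fixes x\<^sub>0 \<xi>\<^sub>0 :: "'a::euclidean_space"
  assumes pqr: "1 \<le> p" "1 \<le> q" "1 \<le> r" "1 / p + 1 / q = 1 / r + 1" and s: "\<alpha> + \<beta> \<ge> 0" "\<sigma> \<le> \<alpha> + \<beta>"
    and \<xi>\<^sub>0: "\<xi>\<^sub>0 \<noteq> 0"
    and f: "distribution f" "\<xi>\<^sub>0 \<notin> WF_at x\<^sub>0 f" "locally_in_H \<alpha> p x\<^sub>0 f"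
    and g: "distribution g" "\<xi>\<^sub>0 \<notin> WF_at x\<^sub>0 g" "locally_in_H \<beta> q x\<^sub>0 g"
    and h: "is_product_near \<alpha> p \<beta> q x\<^sub>0 f g h"
  shows "microlocally_in_H \<sigma> r x\<^sub>0 \<xi>\<^sub>0 h"
proof -
  let ?e = "sgn \<xi>\<^sub>0"
  have e1: "norm ?e = 1" using \<xi>\<^sub>0 by (simp add: norm_sgn)
  obtain d where d: "d > 0" and prod: "\<And>\<eta>\<^sub>1 \<eta>\<^sub>2 A B. test_fun \<eta>\<^sub>1 \<Longrightarrow> test_fun \<eta>\<^sub>2 \<Longrightarrow> supp \<eta>\<^sub>1 \<subseteq> ball x\<^sub>0 d \<Longrightarrow> supp \<eta>\<^sub>2 \<subseteq> ball x\<^sub>0 d \<Longrightarrow>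
    has_fourier_fun (mult_distr \<eta>\<^sub>1 f) A \<Longrightarrow> has_fourier_fun (mult_distr \<eta>\<^sub>2 g) B \<Longrightarrow>
    has_fourier_fun (mult_distr (\<lambda>x. \<eta>\<^sub>1 x * \<eta>\<^sub>2 x) h) (\<lambda>\<xi>. cft TYPE('a) * conv A B \<xi>)"
    by (rule near_product_fourier[OF pqr s(1) h], rule that)
  obtain \<eta>\<^sub>1 A c1 where A: "test_fun \<eta>\<^sub>1" "\<eta>\<^sub>1 x\<^sub>0 \<noteq> 0" "supp \<eta>\<^sub>1 \<subseteq> ball x\<^sub>0 d" "0 \<le> c1" "c1 < 1"
    "has_fourier_fun (mult_distr \<eta>\<^sub>1 f) A" "in_Lp p (\<lambda>\<xi>. weight \<alpha> \<xi> * A \<xi>)" "rapid_on (cone_around c1 ?e) A"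
    by (rule not_WF_localize[OF f \<xi>\<^sub>0 pqr(1) d], rule that)
  obtain \<eta>\<^sub>2 B c2 where B: "test_fun \<eta>\<^sub>2" "\<eta>\<^sub>2 x\<^sub>0 \<noteq> 0" "supp \<eta>\<^sub>2 \<subseteq> ball x\<^sub>0 d" "0 \<le> c2" "c2 < 1"
    "has_fourier_fun (mult_distr \<eta>\<^sub>2 g) B" "in_Lp q (\<lambda>\<xi>. weight \<beta> \<xi> * B \<xi>)" "rapid_on (cone_around c2 ?e) B"
    by (rule not_WF_localize[OF g \<xi>\<^sub>0 pqr(2) d], rule that)
  \<comment> \<open>The narrower of the two cones, on which both transforms decay.\<close>
  define c where "c = max c1 c2"
  have c: "0 \<le> c" "c < 1" using A(4,5) B(4,5) by (auto simp: c_def)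
  have rA: "rapid_on (cone_around c ?e) A" by (rule rapid_on_subset[OF A(8) cone_around_antimono]) (simp add: c_def)
  have rB: "rapid_on (cone_around c ?e) B" by (rule rapid_on_subset[OF B(8) cone_around_antimono]) (simp add: c_def)
  \<comment> \<open>Strictly between \<open>c\<close> and 1: the new cone still contains the
    direction of \<open>\<xi>\<^sub>0\<close> and is separated from the complement of the old
    one.\<close>
  define c' where "c' = (1 + c) / 2"
  have c': "c < c'" "c' < 1" "0 \<le> c'" using c by (auto simp: c'_def)
  obtain L where L: "L \<ge> 1" "\<And>\<xi> \<zeta>. \<xi> \<in> cone_around c' ?e \<Longrightarrow> \<zeta> \<notin> cone_around c ?e \<Longrightarrow>
    norm \<xi> \<le> L * norm (\<xi> - \<zeta>) \<and> norm \<zeta> \<le> L * norm (\<xi> - \<zeta>)"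
    using cone_separation[OF e1 c(1) c'(1) less_imp_le[OF c(2)]] by blast
  define M where "M = \<alpha> + \<beta> + \<bar>\<alpha>\<bar> + \<bar>\<beta>\<bar>"
  note mA = has_fourier_fun_measurable[OF A(6)] and mB = has_fourier_fun_measurable[OF B(6)]
  obtain a where a: "in_Lp p a" "\<And>\<xi>. jb \<alpha> \<xi> * cmod (A \<xi>) \<le> cmod (a \<xi>)"
    "\<And>\<xi>. \<xi> \<in> cone_around c ?e \<Longrightarrow> jb M \<xi> * cmod (A \<xi>) \<le> cmod (a \<xi>)"
    by (rule rapid_majorant[OF pqr(1) mA A(7) rA, of M], rule that)
  obtain b where b: "in_Lp q b" "\<And>\<xi>. jb \<beta> \<xi> * cmod (B \<xi>) \<le> cmod (b \<xi>)"
    "\<And>\<xi>. \<xi> \<in> cone_around c ?e \<Longrightarrow> jb M \<xi> * cmod (B \<xi>) \<le> cmod (b \<xi>)"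
    by (rule rapid_majorant[OF pqr(2) mB B(7) rB, of M], rule that)
  show ?thesis
  proof (rule microlocallyI[OF pqr \<xi>\<^sub>0 c'(3,2) a(1) b(1) mA mB _ _ prod[OF A(1) B(1) A(3) B(3) A(6) B(6)]])
    show "test_fun (\<lambda>x. \<eta>\<^sub>1 x * \<eta>\<^sub>2 x)" by (rule test_mult(1)[OF A(1) test_smooth[OF B(1)]])
    show "\<eta>\<^sub>1 x\<^sub>0 * \<eta>\<^sub>2 x\<^sub>0 \<noteq> 0" using A(2) B(2) by simp
    show "0 \<le> 2 powr M + L powr M" by simp
    fix \<xi> \<zeta> assume \<xi>: "\<xi> \<in> cone_around c' ?e"
    show "jb \<sigma> \<xi> * (cmod (A (\<xi> - \<zeta>)) * cmod (B \<zeta>)) \<le> (2 powr M + L powr M) * (cmod (a (\<xi> - \<zeta>)) * cmod (b \<zeta>))"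
      by (rule kernel_both[OF s L(1) L(2)[OF \<xi>] M_def norm_ge_zero a(2,3) norm_ge_zero b(2,3)])
  qed
qed

text \<open>\<open>g\<close> is localized by an ordinary small cutoff \<open>\<kappa>\<close>, and
  its transform enters only through the weighted \<open>L\<^sup>q\<close> bound, so no majorant with
  extra decay is built for it.\<close>

lemma microlocal_one:
  fixes x\<^sub>0 \<xi>\<^sub>0 :: "'a::euclidean_space"
  assumes pqr: "1 \<le> p" "1 \<le> q" "1 \<le> r" "1 / p + 1 / q = 1 / r + 1" and s: "\<alpha> + \<beta> \<ge> 0" "\<beta> \<ge> 0"
    and \<xi>\<^sub>0: "\<xi>\<^sub>0 \<noteq> 0"
    and f: "distribution f" "\<xi>\<^sub>0 \<notin> WF_at x\<^sub>0 f" "locally_in_H \<alpha> p x\<^sub>0 f"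
    and g: "locally_in_H \<beta> q x\<^sub>0 g"
    and h: "is_product_near \<alpha> p \<beta> q x\<^sub>0 f g h"
  shows "microlocally_in_H (\<beta> + min 0 \<alpha>) r x\<^sub>0 \<xi>\<^sub>0 h"
proof -
  let ?e = "sgn \<xi>\<^sub>0"
  have e1: "norm ?e = 1" using \<xi>\<^sub>0 by (simp add: norm_sgn)
  obtain d where d: "d > 0" and prod: "\<And>\<eta>\<^sub>1 \<eta>\<^sub>2 A B. test_fun \<eta>\<^sub>1 \<Longrightarrow> test_fun \<eta>\<^sub>2 \<Longrightarrow> supp \<eta>\<^sub>1 \<subseteq> ball x\<^sub>0 d \<Longrightarrow> supp \<eta>\<^sub>2 \<subseteq> ball x\<^sub>0 d \<Longrightarrow>
    has_fourier_fun (mult_distr \<eta>\<^sub>1 f) A \<Longrightarrow> has_fourier_fun (mult_distr \<eta>\<^sub>2 g) B \<Longrightarrow>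
    has_fourier_fun (mult_distr (\<lambda>x. \<eta>\<^sub>1 x * \<eta>\<^sub>2 x) h) (\<lambda>\<xi>. cft TYPE('a) * conv A B \<xi>)"
    by (rule near_product_fourier[OF pqr s(1) h], rule that)
  obtain \<eta>\<^sub>1 A c where A: "test_fun \<eta>\<^sub>1" "\<eta>\<^sub>1 x\<^sub>0 \<noteq> 0" "supp \<eta>\<^sub>1 \<subseteq> ball x\<^sub>0 d" "0 \<le> c" "c < 1"
    "has_fourier_fun (mult_distr \<eta>\<^sub>1 f) A" "in_Lp p (\<lambda>\<xi>. weight \<alpha> \<xi> * A \<xi>)" "rapid_on (cone_around c ?e) A"
    by (rule not_WF_localize[OF f \<xi>\<^sub>0 pqr(1) d], rule that)
  obtain d' where d': "d' > 0" "\<And>\<kappa>. test_fun \<kappa> \<Longrightarrow> supp \<kappa> \<subseteq> ball x\<^sub>0 d' \<Longrightarrow> in_H \<beta> q (mult_distr \<kappa> g)"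
    using locally_in_H_cutoff[OF g pqr(2)] by blast
  have "min d d' > 0" using d d' by simp
  then obtain \<kappa> where \<kappa>: "cutoff_near x\<^sub>0 \<kappa>" "supp \<kappa> \<subseteq> ball x\<^sub>0 (min d d')" using small_cutoff by blast
  have t: "test_fun \<kappa>" "\<kappa> x\<^sub>0 = 1" using cutoff_nearD[OF \<kappa>(1)] by auto
  have supp: "supp \<kappa> \<subseteq> ball x\<^sub>0 d" "supp \<kappa> \<subseteq> ball x\<^sub>0 d'"
    using \<kappa>(2) subset_ball[of "min d d'" d x\<^sub>0] subset_ball[of "min d d'" d' x\<^sub>0] by auto
  obtain B where B: "has_fourier_fun (mult_distr \<kappa> g) B" "in_Lp q (\<lambda>\<xi>. weight \<beta> \<xi> * B \<xi>)"
    using d'(2)[OF t(1) supp(2)] unfolding in_H_def by blast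
  define c' where "c' = (1 + c) / 2"
  have c': "c < c'" "c' < 1" "0 \<le> c'" using A(4,5) by (auto simp: c'_def)
  obtain L where L: "L \<ge> 1" "\<And>\<xi> \<zeta>. \<xi> \<in> cone_around c' ?e \<Longrightarrow> \<zeta> \<notin> cone_around c ?e \<Longrightarrow>
    norm \<xi> \<le> L * norm (\<xi> - \<zeta>) \<and> norm \<zeta> \<le> L * norm (\<xi> - \<zeta>)"
    using cone_separation[OF e1 A(4) c'(1) less_imp_le[OF A(5)]] by blast
  define M where "M = \<beta> + \<bar>\<alpha>\<bar>"
  note mA = has_fourier_fun_measurable[OF A(6)] and mB = has_fourier_fun_measurable[OF B(1)]
  obtain a where a: "in_Lp p a" "\<And>\<xi>. jb \<alpha> \<xi> * cmod (A \<xi>) \<le> cmod (a \<xi>)"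
    "\<And>\<xi>. \<xi> \<in> cone_around c ?e \<Longrightarrow> jb M \<xi> * cmod (A \<xi>) \<le> cmod (a \<xi>)"
    by (rule rapid_majorant[OF pqr(1) mA A(7,8), of M], rule that)
  show ?thesis
  proof (rule microlocallyI[OF pqr \<xi>\<^sub>0 c'(3,2) a(1) B(2) mA mB _ _ prod[OF A(1) t(1) A(3) supp(1) A(6) B(1)]])
    show "test_fun (\<lambda>x. \<eta>\<^sub>1 x * \<kappa> x)" by (rule test_mult(1)[OF A(1) test_smooth[OF t(1)]])
    show "\<eta>\<^sub>1 x\<^sub>0 * \<kappa> x\<^sub>0 \<noteq> 0" using A(2) t(2) by simp
    show "0 \<le> 2 powr M + L powr M" by simp
    fix \<xi> \<zeta> assume \<xi>: "\<xi> \<in> cone_around c' ?e"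
    have "jb \<beta> \<zeta> * cmod (B \<zeta>) \<le> cmod (weight \<beta> \<zeta> * B \<zeta>)" by (simp add: norm_mult cmod_weight)
    note w = this
    show "jb (\<beta> + min 0 \<alpha>) \<xi> * (cmod (A (\<xi> - \<zeta>)) * cmod (B \<zeta>)) \<le>
        (2 powr M + L powr M) * (cmod (a (\<xi> - \<zeta>)) * cmod (weight \<beta> \<zeta> * B \<zeta>))"
      by (rule kernel_one[OF s refl L(1) L(2)[OF \<xi>] M_def norm_ge_zero a(2,3) norm_ge_zero w])
  qed
qed

theorem theorem4p8:
  fixes f g :: "(real ^ 'n \<Rightarrow> complex) \<Rightarrow> complex"
    and \<alpha>\<^sub>f \<alpha>\<^sub>g :: real
    and p q r :: ennreal
    and x\<^sub>0 \<xi>\<^sub>0 :: "real ^ 'n"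
  assumes "distribution f" and "distribution g"
    and "\<alpha>\<^sub>f + \<alpha>\<^sub>g \<ge> 0"
    and "1 \<le> p" and "1 \<le> q" and "1 \<le> r"
    and "1 / p + 1 / q = 1 / r + 1"
    and "\<xi>\<^sub>0 \<noteq> 0"
  shows "(in_H \<alpha>\<^sub>f p f \<and> in_H \<alpha>\<^sub>g q g \<longrightarrow>
           (\<exists>h. is_product f g h \<and> (\<forall>h'. is_product f g h' \<longrightarrow> distr_eq h' h) \<and>
                in_H (min \<alpha>\<^sub>f \<alpha>\<^sub>g) r h))
       \<and> (\<xi>\<^sub>0 \<notin> WF_at x\<^sub>0 f \<union> WF_at x\<^sub>0 g \<and>
           locally_in_H \<alpha>\<^sub>f p x\<^sub>0 f \<and> locally_in_H \<alpha>\<^sub>g q x\<^sub>0 g \<longrightarrow>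
           (\<exists>h. is_product_near \<alpha>\<^sub>f p \<alpha>\<^sub>g q x\<^sub>0 f g h) \<and>
           (\<forall>h. is_product_near \<alpha>\<^sub>f p \<alpha>\<^sub>g q x\<^sub>0 f g h \<longrightarrow>
                microlocally_in_H (\<alpha>\<^sub>f + \<alpha>\<^sub>g + Min {\<alpha>\<^sub>f, \<alpha>\<^sub>g, 0}) r x\<^sub>0 \<xi>\<^sub>0 h))
       \<and> (\<xi>\<^sub>0 \<notin> WF_at x\<^sub>0 f \<and> \<alpha>\<^sub>g \<ge> 0 \<and>
           locally_in_H \<alpha>\<^sub>f p x\<^sub>0 f \<and> locally_in_H \<alpha>\<^sub>g q x\<^sub>0 g \<longrightarrow>
           (\<exists>h. is_product_near \<alpha>\<^sub>f p \<alpha>\<^sub>g q x\<^sub>0 f g h) \<and>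
           (\<forall>h. is_product_near \<alpha>\<^sub>f p \<alpha>\<^sub>g q x\<^sub>0 f g h \<longrightarrow>
                microlocally_in_H (\<alpha>\<^sub>g + min 0 \<alpha>\<^sub>f) r x\<^sub>0 \<xi>\<^sub>0 h))"
proof (intro conjI impI allI)
  note pqr = assms(4-7)
  show "\<exists>h. is_product f g h \<and> (\<forall>h'. is_product f g h' \<longrightarrow> distr_eq h' h) \<and> in_H (min \<alpha>\<^sub>f \<alpha>\<^sub>g) r h"
    if H: "in_H \<alpha>\<^sub>f p f \<and> in_H \<alpha>\<^sub>g q g"
  proof -
    obtain F G where "has_fourier_fun f F" "in_Lp p (\<lambda>\<xi>. weight \<alpha>\<^sub>f \<xi> * F \<xi>)"
      "has_fourier_fun g G" "in_Lp q (\<lambda>\<xi>. weight \<alpha>\<^sub>g \<xi> * G \<xi>)"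
      using H unfolding in_H_def by blast
    then obtain h where h: "is_product f g h" "in_H (min \<alpha>\<^sub>f \<alpha>\<^sub>g) r h"
      using product_exists[OF pqr assms(3)] by blast
    thus ?thesis using product_unique[OF h(1)] by blast
  qed
  show "\<exists>h. is_product_near \<alpha>\<^sub>f p \<alpha>\<^sub>g q x\<^sub>0 f g h"
    if "\<xi>\<^sub>0 \<notin> WF_at x\<^sub>0 f \<union> WF_at x\<^sub>0 g \<and> locally_in_H \<alpha>\<^sub>f p x\<^sub>0 f \<and> locally_in_H \<alpha>\<^sub>g q x\<^sub>0 g"
    using near_product_exists[OF pqr assms(3)] that by blast
  show "\<exists>h. is_product_near \<alpha>\<^sub>f p \<alpha>\<^sub>g q x\<^sub>0 f g h"
    if "\<xi>\<^sub>0 \<notin> WF_at x\<^sub>0 f \<and> \<alpha>\<^sub>g \<ge> 0 \<and> locally_in_H \<alpha>\<^sub>f p x\<^sub>0 f \<and> locally_in_H \<alpha>\<^sub>g q x\<^sub>0 g"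
    using near_product_exists[OF pqr assms(3)] that by blast
  fix h assume h: "is_product_near \<alpha>\<^sub>f p \<alpha>\<^sub>g q x\<^sub>0 f g h"
  \<comment> \<open>The minimum is at most 0, so the exponent is at most
    \<open>\<alpha>\<^sub>f + \<alpha>\<^sub>g\<close>, as \<open>microlocal_both\<close>
    requires.\<close>
  show "microlocally_in_H (\<alpha>\<^sub>f + \<alpha>\<^sub>g + Min {\<alpha>\<^sub>f, \<alpha>\<^sub>g, 0}) r x\<^sub>0 \<xi>\<^sub>0 h"
    if "\<xi>\<^sub>0 \<notin> WF_at x\<^sub>0 f \<union> WF_at x\<^sub>0 g \<and> locally_in_H \<alpha>\<^sub>f p x\<^sub>0 f \<and> locally_in_H \<alpha>\<^sub>g q x\<^sub>0 g"
    by (rule microlocal_both[OF pqr assms(3) _ assms(8,1) _ _ assms(2) _ _ h]) (use that in auto)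
  show "microlocally_in_H (\<alpha>\<^sub>g + min 0 \<alpha>\<^sub>f) r x\<^sub>0 \<xi>\<^sub>0 h"
    if "\<xi>\<^sub>0 \<notin> WF_at x\<^sub>0 f \<and> \<alpha>\<^sub>g \<ge> 0 \<and> locally_in_H \<alpha>\<^sub>f p x\<^sub>0 f \<and> locally_in_H \<alpha>\<^sub>g q x\<^sub>0 g"
    by (rule microlocal_one[OF pqr assms(3) _ assms(8,1) _ _ _ h]) (use that in auto)
qed

end
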